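(* Let $X$ be an irreducible affine variety over $\mathbb{C}$. If $\mathrm{Aut}(X)\simeq\mathrm{Aut}(\mathrm{SL}_2/T)$ as ind-groups, then $X\simeq \mathrm{SL}_2/T$ as a variety. If $\mathrm{Aut}(X)\simeq\mathrm{Aut}(\mathrm{SL}_2/N)$ as ind-groups, then $X\simeq\mathrm{SL}_2/N$ as a variety.
   Context: The base field is $\mathbb{C}$ and $\mathrm{SL}_2=\mathrm{SL}_2(\mathbb{C})$. $T\subset\mathrm{SL}_2$ is the standard (diagonal) subtorus and $N\subset \mathrm{SL}_2$ is the normalizer of $T$; $\mathrm{SL}_2/T$ and $\mathrm{SL}_2/N$ are affine surfaces. An ind-variety is a set $V$ with an ascending filtration $V_0\subset V_1\subset\cdots$, $V=\bigcup_k V_k$, where each $V_k$ is an affine algebraic variety and $V_k$ is Zariski-closed in $V_{k+1}$. A morphism $V\to W$ of ind-varieties is a map such that for each $k$ there is $m$ with $V_k$ mapped into $W_m$ and $V_k\to W_m$ a morphism of varieties. An ind-group is an ind-variety with a group structure such that $(g,h)\mapsto gh^{-1}$ is a morphism; an isomorphism of ind-groups is a group isomorphism that is an isomorphism of ind-varieties. For an affine variety $X$, $\mathrm{Aut}(X)$ carries its standard ind-group structure (filter by the degrees, with respect to a fixed finite generating set of $\mathcal{O}(X)$, of $\varphi^*$ and $(\varphi^{-1})^*$ on the generators); for every algebraic group $G$, regular $G$-actions on $X$ correspond to ind-group homomorphisms $G\to\mathrm{Aut}(X)$. *)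

theory Defs
  imports "HOL-Analysis.Determinants" "HOL-Algebra.Bij" "HOL-Algebra.Left_Coset"
    "HOL-Algebra.Group_Action"
begin

section \<open>Affine varieties\<close>

text \<open>
  A variety is a set of points together with its algebra of complex-valued regular functions.
  Functions are represented by their extensional representatives, as in \<^const>\<open>Bij\<close>, so that
  functions agreeing on all points are equal.
\<close>

record 'a variety =
  points :: "'a set"
  regular :: "('a \<Rightarrow> complex) set"

text \<open>
  \<open>poly_le A S k f\<close>: on \<open>A\<close>, the function \<open>f\<close> is a linear combination of products of at most \<open>k\<close>
  functions from \<open>S\<close>, i.e. some polynomial of degree at most \<open>k\<close> in elements of \<open>S\<close> represents it.
\<close>

inductive poly_le :: "'a set \<Rightarrow> ('a \<Rightarrow> complex) set \<Rightarrow> nat \<Rightarrow> ('a \<Rightarrow> complex) \<Rightarrow> bool"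
  for A :: "'a set" and S :: "('a \<Rightarrow> complex) set"
  where
    const: "poly_le A S k (\<lambda>x\<in>A. c)"
  | gen: "f \<in> S \<Longrightarrow> poly_le A S (Suc k) (restrict f A)"
  | add: "poly_le A S k f \<Longrightarrow> poly_le A S k g \<Longrightarrow> poly_le A S k (\<lambda>x\<in>A. f x + g x)"
  | mult: "poly_le A S j f \<Longrightarrow> poly_le A S k g \<Longrightarrow> poly_le A S (j + k) (\<lambda>x\<in>A. f x * g x)"

definition polys_le :: "'a set \<Rightarrow> ('a \<Rightarrow> complex) set \<Rightarrow> nat \<Rightarrow> ('a \<Rightarrow> complex) set"
  where "polys_le A S k = {f. poly_le A S k f}"

definition generated_algebra :: "'a set \<Rightarrow> ('a \<Rightarrow> complex) set \<Rightarrow> ('a \<Rightarrow> complex) set"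
  where "generated_algebra A S = (\<Union>k. polys_le A S k)"

definition affine_space :: "nat \<Rightarrow> (nat \<Rightarrow> complex) variety"
  where "affine_space n =
    \<lparr>points = {..<n} \<rightarrow>\<^sub>E UNIV,
     regular = generated_algebra ({..<n} \<rightarrow>\<^sub>E UNIV) ((\<lambda>i x. x i) ` {..<n})\<rparr>"

definition zariski_closed :: "'a variety \<Rightarrow> 'a set \<Rightarrow> bool"
  where "zariski_closed X Z \<longleftrightarrow> (\<exists>F \<subseteq> regular X. Z = {x \<in> points X. \<forall>f\<in>F. f x = 0})"

text \<open>
  The structure on \<open>P\<close> pulled back along \<open>e\<close>. If \<open>e\<close> is injective on \<open>P\<close> with closed image, this
  is the (reduced) closed subvariety structure of \<open>e ` P\<close>, transported to \<open>P\<close>.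
\<close>

definition embedded_variety :: "'a set \<Rightarrow> ('a \<Rightarrow> 'b) \<Rightarrow> 'b variety \<Rightarrow> 'a variety"
  where "embedded_variety P e Y = \<lparr>points = P, regular = (\<lambda>p. compose P p e) ` regular Y\<rparr>"

definition affine_variety :: "'a variety \<Rightarrow> bool"
  where "affine_variety X \<longleftrightarrow>
    (\<exists>n e. inj_on e (points X) \<and> zariski_closed (affine_space n) (e ` points X) \<and>
      X = embedded_variety (points X) e (affine_space n))"

definition irreducible_variety :: "'a variety \<Rightarrow> bool"
  where "irreducible_variety X \<longleftrightarrow> points X \<noteq> {} \<and>
    (\<forall>A B. zariski_closed X A \<and> zariski_closed X B \<and> A \<union> B = points X \<longrightarrow>
      A = points X \<or> B = points X)"

definition variety_morphism :: "('a \<Rightarrow> 'b) \<Rightarrow> 'a variety \<Rightarrow> 'b variety \<Rightarrow> bool"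
  where "variety_morphism \<phi> X Y \<longleftrightarrow> \<phi> \<in> points X \<rightarrow> points Y \<and>
    (\<forall>f\<in>regular Y. compose (points X) f \<phi> \<in> regular X)"

definition variety_iso :: "('a \<Rightarrow> 'b) \<Rightarrow> 'a variety \<Rightarrow> 'b variety \<Rightarrow> bool"
  where "variety_iso \<phi> X Y \<longleftrightarrow> bij_betw \<phi> (points X) (points Y) \<and>
    variety_morphism \<phi> X Y \<and> variety_morphism (inv_into (points X) \<phi>) Y X"

definition variety_isomorphic :: "'a variety \<Rightarrow> 'b variety \<Rightarrow> bool"
  where "variety_isomorphic X Y \<longleftrightarrow> (\<exists>\<phi>. variety_iso \<phi> X Y)"

definition generating_set :: "'a variety \<Rightarrow> ('a \<Rightarrow> complex) set \<Rightarrow> bool"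
  where "generating_set X S \<longleftrightarrow>
    finite S \<and> S \<subseteq> regular X \<and> regular X = generated_algebra (points X) S"


section \<open>Ind-groups\<close>

text \<open>
  The filtration \<open>level\<close> carries the ind-variety structure. As for \<^const>\<open>iso\<close> on monoids,
  the axioms (levels affine and successively closed, group operations morphisms) play no role
  in what an isomorphism is.
\<close>

record 'a ind_group = "'a monoid" +
  level :: "nat \<Rightarrow> 'a variety"

definition ind_points :: "(nat \<Rightarrow> 'a variety) \<Rightarrow> 'a set"
  where "ind_points V = (\<Union>k. points (V k))"

definition ind_morphism :: "('a \<Rightarrow> 'b) \<Rightarrow> (nat \<Rightarrow> 'a variety) \<Rightarrow> (nat \<Rightarrow> 'b variety) \<Rightarrow> bool"
  where "ind_morphism \<phi> V W \<longleftrightarrow> (\<forall>k. \<exists>m. variety_morphism \<phi> (V k) (W m))"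

definition ind_iso :: "('a \<Rightarrow> 'b) \<Rightarrow> (nat \<Rightarrow> 'a variety) \<Rightarrow> (nat \<Rightarrow> 'b variety) \<Rightarrow> bool"
  where "ind_iso \<phi> V W \<longleftrightarrow> bij_betw \<phi> (ind_points V) (ind_points W) \<and>
    ind_morphism \<phi> V W \<and> ind_morphism (inv_into (ind_points V) \<phi>) W V"

definition ind_group_isomorphic :: "'a ind_group \<Rightarrow> 'b ind_group \<Rightarrow> bool"
  where "ind_group_isomorphic G H \<longleftrightarrow> (\<exists>\<phi>. \<phi> \<in> iso G H \<and> ind_iso \<phi> (level G) (level H))"


section \<open>The automorphism group of an affine variety\<close>

definition automorphisms :: "'a variety \<Rightarrow> ('a \<Rightarrow> 'a) set"
  where "automorphisms X = {\<phi> \<in> Bij (points X). variety_iso \<phi> X X}"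

definition linear_functional :: "'a set \<Rightarrow> ('a \<Rightarrow> complex) set \<Rightarrow> (('a \<Rightarrow> complex) \<Rightarrow> complex) \<Rightarrow> bool"
  where "linear_functional A V l \<longleftrightarrow>
    (\<forall>f\<in>V. \<forall>g\<in>V. l (\<lambda>x\<in>A. f x + g x) = l f + l g) \<and>
    (\<forall>f\<in>V. \<forall>c. l (\<lambda>x\<in>A. c * f x) = c * l f)"

text \<open>
  For a finite-dimensional space \<open>V\<close> of functions on \<open>A\<close> and a finite \<open>I\<close>, the affine space of
  \<open>I\<close>-tuples in \<open>V\<close>.
\<close>

definition tuple_variety ::
    "'i set \<Rightarrow> 'a set \<Rightarrow> ('a \<Rightarrow> complex) set \<Rightarrow> ('i \<Rightarrow> 'a \<Rightarrow> complex) variety"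
  where "tuple_variety I A V =
    \<lparr>points = I \<rightarrow>\<^sub>E V,
     regular = generated_algebra (I \<rightarrow>\<^sub>E V) {(\<lambda>v. l (v i)) | i l. i \<in> I \<and> linear_functional A V l}\<rparr>"

text \<open>
  \<open>aut_coords X S \<phi>\<close> is the tuple of all \<open>\<phi>\<^sup>*f\<close> (index \<open>(True, f)\<close>) and \<open>(\<phi>\<^sup>-\<^sup>1)\<^sup>*f\<close>
  (index \<open>(False, f)\<close>) for \<open>f \<in> S\<close>. Level \<open>k\<close> of the filtration consists of those \<open>\<phi>\<close> all of whose
  coordinates have degree at most \<open>k\<close>, with its structure as a closed subvariety of the affine
  space of such tuples.
\<close>

definition aut_coords ::
    "'a variety \<Rightarrow> ('a \<Rightarrow> complex) set \<Rightarrow> ('a \<Rightarrow> 'a) \<Rightarrow> bool \<times> ('a \<Rightarrow> complex) \<Rightarrow> 'a \<Rightarrow> complex"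
  where "aut_coords X S \<phi> = (\<lambda>(b, f) \<in> UNIV \<times> S.
    compose (points X) f (if b then \<phi> else inv_into (points X) \<phi>))"

definition aut_level :: "'a variety \<Rightarrow> ('a \<Rightarrow> complex) set \<Rightarrow> nat \<Rightarrow> ('a \<Rightarrow> 'a) variety"
  where "aut_level X S k =
    (let V = polys_le (points X) S k; I = UNIV \<times> S
     in embedded_variety {\<phi> \<in> automorphisms X. aut_coords X S \<phi> \<in> I \<rightarrow>\<^sub>E V}
          (aut_coords X S) (tuple_variety I (points X) V))"

definition aut_ind_group :: "'a variety \<Rightarrow> ('a \<Rightarrow> complex) set \<Rightarrow> ('a \<Rightarrow> 'a) ind_group"
  where "aut_ind_group X S =
    \<lparr>carrier = automorphisms X,
     mult = mult (BijGroup (points X)),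
     one = one (BijGroup (points X)),
     level = aut_level X S\<rparr>"


section \<open>The homogeneous spaces of SL2\<close>

definition SL2 :: "(complex^2^2) monoid"
  where "SL2 = \<lparr>carrier = {A. det A = 1}, mult = (**), one = mat 1\<rparr>"

definition SL2_variety :: "(complex^2^2) variety"
  where "SL2_variety =
    \<lparr>points = carrier SL2,
     regular = generated_algebra (carrier SL2) {(\<lambda>A. A $ i $ j) | i j. True}\<rparr>"

definition torus :: "(complex^2^2) set"
  where "torus = {A \<in> carrier SL2. \<forall>i j. i \<noteq> j \<longrightarrow> A $ i $ j = 0}"

text \<open>
  The regular functions on the space of left cosets are those whose pullback to the group is regular;
  for reductive \<open>H\<close>, such as the torus and its normalizer, the quotient is affine with this
  coordinate ring.
\<close>

definition SL2_quotient :: "(complex^2^2) set \<Rightarrow> (complex^2^2) set variety"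
  where "SL2_quotient H =
    \<lparr>points = lcosets\<^bsub>SL2\<^esub> H,
     regular = {f \<in> extensional (lcosets\<^bsub>SL2\<^esub> H).
       (\<lambda>g\<in>carrier SL2. f (g <#\<^bsub>SL2\<^esub> H)) \<in> regular SL2_variety}\<rparr>"

abbreviation SL2_mod_T :: "(complex^2^2) set variety"
  where "SL2_mod_T \<equiv> SL2_quotient torus"

abbreviation SL2_mod_N :: "(complex^2^2) set variety"
  where "SL2_mod_N \<equiv> SL2_quotient (normalizer SL2 torus)"

end

theory Submission
  imports Defs "HOL-Computational_Algebra.Polynomial" "HOL-Analysis.Complex_Transcendental"
begin

text \<open>
  Write \<open>Q\<close> for the homogeneous space. An isomorphism of ind-groups carries the action of the group on \<open>Q\<close>
  to a rational action on \<open>X\<close>. If \<open>f\<close> is a function on \<open>X\<close> of highest weight \<open>n\<close>, then \<open>x \<mapsto> upper (s * f x) x\<close>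
  is a one-parameter group of automorphisms of \<open>X\<close>; on \<open>Q\<close> it becomes one that commutes with the unipotent
  group and has weight \<open>n + 2\<close> under the torus, and \<open>Q\<close> has at most one such group up to a constant.
  Hence highest weight functions on \<open>X\<close> of a given weight are unique up to scalars, so the coordinate
  ring of \<open>X\<close> is multiplicity free.

  Multiplicity freeness forces \<open>X\<close> to have a dense orbit of a point \<open>p\<close> that is fixed by a maximal
  unipotent group or by the torus. In the first case \<open>X\<close> is a cone, whose scalings are automorphisms that
  commute with the action and need not square to the identity; on \<open>Q\<close> every automorphism commuting with the action squares to
  the identity. In the second case the orbit is all of \<open>X\<close>, which is the quotient by the torus or by its
  normalizer; the two are told apart by whether a nontrivial automorphism commutes with the action.
\<close>


section \<open>Two by two matrices and polynomial functions of their entries\<close>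

text \<open>\<open>X\<close> is not known to be normal or even to have a two-dimensional orbit, so
  its geometry has to come out of its ring. If \<open>f\<close> is a highest weight function of
  weight \<open>n > 0\<close> and \<open>g\<close> its derivative along \<open>lower\<close>, then
  \<open>upper s\<close> fixes \<open>f\<close> and moves \<open>g\<close> to
  \<open>g + n s f\<close>. By multiplicity freeness all unipotent invariants are algebraic over
  \<open>f\<close>, so after inverting \<open>f\<close> every function is algebraic over
  \<open>f\<close> and \<open>g\<close>. A tangent direction of an orbit that kills \<open>f\<close>
  and \<open>g\<close> therefore kills every function, and a three-dimensional Lie algebra always
  has one; its generator is nilpotent or semisimple, which gives the two kinds of stabilizer. In the
  semisimple case the functions on \<open>X\<close> could still form a proper subring of those on
  the orbit. The conductor of that subring is nonzero and stable under the Lie algebra, and on a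
  homogeneous space such an ideal contains 1; an explicit computation with the derivation along
  \<open>lower\<close> carries this out. In the nilpotent case scaling acts on each isotypic
  component of the ring by a scalar, which is why it extends from the orbit to
  \<open>X\<close>.\<close>

definition mat2 :: "complex \<Rightarrow> complex \<Rightarrow> complex \<Rightarrow> complex \<Rightarrow> complex^2^2"
  where "mat2 a b c d = vector [vector [a, b], vector [c, d]]"

lemma mat2_nth [simp]:
  "mat2 a b c d $ 1 $ 1 = a" "mat2 a b c d $ 1 $ 2 = b"
  "mat2 a b c d $ 2 $ 1 = c" "mat2 a b c d $ 2 $ 2 = d"
  by (simp_all add: mat2_def)

lemma mat2_eq_iff: "A = mat2 a b c d \<longleftrightarrow> A $ 1 $ 1 = a \<and> A $ 1 $ 2 = b \<and> A $ 2 $ 1 = c \<and> A $ 2 $ 2 = d"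
  by (auto simp: vec_eq_iff forall_2)

lemma mat2_inject [simp]:
  "mat2 a b c d = mat2 a' b' c' d' \<longleftrightarrow> a = a' \<and> b = b' \<and> c = c' \<and> d = d'"
  by (simp add: mat2_eq_iff)

lemma mat2_cases: obtains a b c d where "A = mat2 a b c d"
  by (metis mat2_eq_iff)

lemma mat2_mult [simp]:
  "mat2 a b c d ** mat2 a' b' c' d' = mat2 (a*a' + b*c') (a*b' + b*d') (c*a' + d*c') (c*b' + d*d')"
  by (simp add: mat2_eq_iff matrix_matrix_mult_def sum_2)

lemma det_mat2 [simp]: "det (mat2 a b c d) = a*d - b*c"
  by (simp add: det_2)

lemma mat_1_eq_mat2: "mat 1 = mat2 1 0 0 1"
  by (simp add: mat2_eq_iff mat_def)

definition adj2 :: "complex^2^2 \<Rightarrow> complex^2^2"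
  where "adj2 A = mat2 (A$2$2) (- A$1$2) (- A$2$1) (A$1$1)"

lemma adj2_mat2 [simp]: "adj2 (mat2 a b c d) = mat2 d (-b) (-c) a"
  by (simp add: adj2_def)

lemma det_adj2 [simp]: "det (adj2 A) = det A"
  by (cases A rule: mat2_cases) (simp add: mult.commute)

lemma adj2_mult: "det A = 1 \<Longrightarrow> adj2 A ** A = mat 1" "det A = 1 \<Longrightarrow> A ** adj2 A = mat 1"
  by (cases A rule: mat2_cases; simp add: mat_1_eq_mat2 algebra_simps)+

abbreviation upper :: "complex \<Rightarrow> complex^2^2" where "upper s \<equiv> mat2 1 s 0 1"
abbreviation lower :: "complex \<Rightarrow> complex^2^2" where "lower r \<equiv> mat2 1 0 r 1"
abbreviation diag2 :: "complex \<Rightarrow> complex^2^2" where "diag2 l \<equiv> mat2 l 0 0 (inverse l)"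
abbreviation weyl :: "complex^2^2" where "weyl \<equiv> mat2 0 1 (-1) 0"

section \<open>Polynomial functions of matrix entries and their values along curves\<close>

inductive_set mpoly :: "(complex^2^2 \<Rightarrow> complex) set" where
  const: "(\<lambda>A. c) \<in> mpoly"
| entry: "(\<lambda>A. A $ i $ j) \<in> mpoly"
| add: "F \<in> mpoly \<Longrightarrow> G \<in> mpoly \<Longrightarrow> (\<lambda>A. F A + G A) \<in> mpoly"
| mult: "F \<in> mpoly \<Longrightarrow> G \<in> mpoly \<Longrightarrow> (\<lambda>A. F A * G A) \<in> mpoly"

lemma mpoly_uminus: "F \<in> mpoly \<Longrightarrow> (\<lambda>A. - F A) \<in> mpoly"
  using mpoly.mult[OF mpoly.const[of "-1"]] by simp

lemma mpoly_diff: "F \<in> mpoly \<Longrightarrow> G \<in> mpoly \<Longrightarrow> (\<lambda>A. F A - G A) \<in> mpoly"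
  using mpoly.add[OF _ mpoly_uminus, of F G] by simp

lemma mpoly_power: "F \<in> mpoly \<Longrightarrow> (\<lambda>A. F A ^ n) \<in> mpoly"
  by (induction n) (auto intro: mpoly.intros)

lemma mpoly_sum: "(\<And>i. i \<in> I \<Longrightarrow> F i \<in> mpoly) \<Longrightarrow> (\<lambda>A. \<Sum>i\<in>I. F i A) \<in> mpoly"
  by (induction I rule: infinite_finite_induct) (auto intro: mpoly.intros)

lemma mpoly_poly: "F \<in> mpoly \<Longrightarrow> (\<lambda>A. poly p (F A)) \<in> mpoly"
  by (induction p) (auto intro: mpoly.intros)

lemmas mpoly_intros = mpoly.intros mpoly_uminus mpoly_diff mpoly_power mpoly_poly

lemma mpoly_compose_entries:
  assumes "F \<in> mpoly" and "\<And>i j. (\<lambda>A. \<gamma> A $ i $ j) \<in> mpoly"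
  shows "(\<lambda>A. F (\<gamma> A)) \<in> mpoly"
  using assms(1) by induction (auto intro: mpoly.intros assms(2))

lemma mpoly_mult_left: "F \<in> mpoly \<Longrightarrow> (\<lambda>A. F (B ** A)) \<in> mpoly"
  by (rule mpoly_compose_entries) (auto simp: matrix_matrix_mult_def intro!: mpoly_sum mpoly_intros)

lemma mpoly_mult_right: "F \<in> mpoly \<Longrightarrow> (\<lambda>A. F (A ** B)) \<in> mpoly"
  by (rule mpoly_compose_entries) (auto simp: matrix_matrix_mult_def intro!: mpoly_sum mpoly_intros)

lemma mpoly_adj2: "F \<in> mpoly \<Longrightarrow> (\<lambda>A. F (adj2 A)) \<in> mpoly"
proof (rule mpoly_compose_entries)
  fix i j :: 2
  show "(\<lambda>A. adj2 A $ i $ j) \<in> mpoly"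
    using exhaust_2[of i] exhaust_2[of j] by (auto simp: adj2_def intro!: mpoly_intros)
qed

lemma mpoly_curve:
  assumes "F \<in> mpoly" and "\<And>i j. \<exists>p. \<forall>z. \<gamma> z $ i $ j = poly p z"
  obtains p where "\<And>z. F (\<gamma> z) = poly p z"
proof -
  have "\<exists>p. \<forall>z. F (\<gamma> z) = poly p z"
    using assms(1)
  proof induction
    case (const c) then show ?case by (intro exI[of _ "[:c:]"]) simp
  next
    case (entry i j) then show ?case by (rule assms(2))
  next
    case (add F G) then show ?case by (metis poly_add)
  next
    case (mult F G) then show ?case by (metis poly_mult)
  qed
  then show ?thesis using that by blast
qed

lemma mat2_curve:
  assumes "\<And>z. \<gamma> z = mat2 (poly a z) (poly b z) (poly c z) (poly d z)"
  shows "\<exists>p. \<forall>z. \<gamma> z $ i $ j = poly p z"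
  using exhaust_2[of i] exhaust_2[of j] by (auto simp: assms)

lemma mpoly_upper: assumes "F \<in> mpoly" obtains p where "\<And>z. F (upper z) = poly p z"
  using mpoly_curve[OF assms mat2_curve[of upper 1 "[:0,1:]" 0 1]] by auto

lemma mpoly_lower: assumes "F \<in> mpoly" obtains p where "\<And>z. F (lower z) = poly p z"
  using mpoly_curve[OF assms mat2_curve[of lower 1 0 "[:0,1:]" 1]] by auto

text \<open>For nonzero \<open>z\<close> the matrix \<open>mat2 0 (-1) 1 z\<close> is the product of
  \<open>upper (- 1/z)\<close>, \<open>diag2 (1/z)\<close> and \<open>lower (1/z)\<close>. Unlike
  these factors it has a limit as \<open>z\<close> tends to 0, so it completes the curve
  \<open>lower\<close> at infinity and turns the behaviour there into a polynomial identity.\<close>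

lemma mpoly_weyl_curve: assumes "F \<in> mpoly" obtains p where "\<And>z. F (mat2 0 (-1) 1 z) = poly p z"
  using mpoly_curve[OF assms mat2_curve[of "mat2 0 (-1) 1" 0 "[:-1:]" 1 "[:0,1:]"]] by auto

lemma mpoly_diag:
  assumes "F \<in> mpoly"
  obtains N p where "\<And>l. l \<noteq> 0 \<Longrightarrow> l ^ N * F (diag2 l) = poly p l"
proof -
  have "\<exists>N p. \<forall>l. l \<noteq> 0 \<longrightarrow> l ^ N * F (diag2 l) = poly p l"
    using assms
  proof induction
    case (const c) then show ?case by (intro exI[of _ 0] exI[of _ "[:c:]"]) simp
  next
    case (entry i j)
    show ?case
      using exhaust_2[of i] exhaust_2[of j]
      by (intro exI[of _ 1] exI[of _ "if i = j then if i = 1 then [:0,0,1:] else 1 else 0"])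
        (auto simp: power2_eq_square)
  next
    case (add F G)
    then obtain N M p q where *: "\<forall>l. l \<noteq> 0 \<longrightarrow> l ^ N * F (diag2 l) = poly p l"
      "\<forall>l. l \<noteq> 0 \<longrightarrow> l ^ M * G (diag2 l) = poly q l" by blast
    have "l ^ (N+M) * (F (diag2 l) + G (diag2 l)) = poly (monom 1 M * p + monom 1 N * q) l" if "l \<noteq> 0" for l
      using * that by (simp add: poly_monom power_add distrib_left mult_ac )
    then show ?case by blast
  next
    case (mult F G)
    then obtain N M p q where *: "\<forall>l. l \<noteq> 0 \<longrightarrow> l ^ N * F (diag2 l) = poly p l"
      "\<forall>l. l \<noteq> 0 \<longrightarrow> l ^ M * G (diag2 l) = poly q l" by blast
    have "l ^ (N+M) * (F (diag2 l) * G (diag2 l)) = poly (p * q) l" if "l \<noteq> 0" for l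
    proof -
      have "l ^ (N+M) * (F (diag2 l) * G (diag2 l)) = (l ^ N * F (diag2 l)) * (l ^ M * G (diag2 l))"
        by (simp add: power_add mult_ac)
      then show ?thesis using * that by simp
    qed
    then show ?case by blast
  qed
  then show ?thesis using that by blast
qed

text \<open>\<open>D\<close> is the gradient of \<open>F\<close> at the identity. Testing it on
  curves makes the chain rule part of the definition, so sums and products follow from
  differentiation in one variable.\<close>

definition tangent_map :: "(complex^2^2 \<Rightarrow> complex) \<Rightarrow> complex^2^2 \<Rightarrow> bool"
  where "tangent_map F D \<longleftrightarrow> (\<forall>\<gamma> V. \<gamma> 0 = mat 1 \<longrightarrow>
    (\<forall>i j. ((\<lambda>z. \<gamma> z $ i $ j) has_field_derivative V $ i $ j) (at 0)) \<longrightarrow>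
    ((\<lambda>z. F (\<gamma> z)) has_field_derivative (\<Sum>i\<in>UNIV. \<Sum>j\<in>UNIV. D $ i $ j * V $ i $ j)) (at 0))"

lemma tangent_mapD:
  assumes "tangent_map F D" and "\<gamma> 0 = mat 1"
    and "\<And>i j. ((\<lambda>z. \<gamma> z $ i $ j) has_field_derivative V $ i $ j) (at 0)"
  shows "((\<lambda>z. F (\<gamma> z)) has_field_derivative (\<Sum>i\<in>UNIV. \<Sum>j\<in>UNIV. D $ i $ j * V $ i $ j)) (at 0)"
  using assms unfolding tangent_map_def by blast

lemma mpoly_tangent:
  assumes "F \<in> mpoly" shows "\<exists>D. tangent_map F D"
  using assms
proof induction
  case (const c) then show ?case by (intro exI[of _ 0]) (auto simp: tangent_map_def)
next
  case (entry i j)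
  let ?D = "mat2 (if i=1\<and>j=1 then 1 else 0) (if i=1\<and>j=2 then 1 else 0)
     (if i=2\<and>j=1 then 1 else 0) (if i=2\<and>j=2 then 1 else 0)"
  have "(\<Sum>i'\<in>UNIV. \<Sum>j'\<in>UNIV. ?D $ i' $ j' * V $ i' $ j') = V $ i $ j" for V :: "complex^2^2"
    using exhaust_2[of i] exhaust_2[of j] by (auto simp: sum_2)
  then have "tangent_map (\<lambda>A. A $ i $ j) ?D" unfolding tangent_map_def by simp
  then show ?case by blast
next
  case (add F G)
  then obtain D E where D: "tangent_map F D" and E: "tangent_map G E" by blast
  have "tangent_map (\<lambda>A. F A + G A) (D + E)"
    unfolding tangent_map_def
    by (intro allI impI, rule DERIV_cong[OF DERIV_add[OF tangent_mapD[OF D] tangent_mapD[OF E]]])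
      (auto simp: sum_2 algebra_simps)
  then show ?case by blast
next
  case (mult F G)
  then obtain D E where D: "tangent_map F D" and E: "tangent_map G E" by blast
  have "tangent_map (\<lambda>A. F A * G A) (\<chi> i j. D $ i $ j * G (mat 1) + E $ i $ j * F (mat 1))"
    unfolding tangent_map_def
    by (intro allI impI, rule DERIV_cong[OF DERIV_mult[OF tangent_mapD[OF D] tangent_mapD[OF E]]])
      (auto simp: sum_2 algebra_simps)
  then show ?case by blast
qed

text \<open>Only exponents at least \<open>m\<close> occur on the left and only exponents at most 0
  on the right. Multiplying by \<open>d\<close> to the degree of \<open>q\<close> turns this into a
  clash of degrees with \<open>reflect_poly q\<close>. The lemma serves to exclude highest weights
  of the wrong sign.\<close>

lemma poly_inverse_decay_zero:
  fixes p q :: "complex poly"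
  assumes "\<And>d. d \<noteq> 0 \<Longrightarrow> d ^ m * poly p d = poly q (inverse d)" and "m > 0"
  shows "q = 0"
proof (rule ccontr)
  assume q: "q \<noteq> 0"
  define D where "D = degree q"
  have "poly (monom 1 (m + D) * p) d = poly (reflect_poly q) d" if "d \<noteq> 0" for d
  proof -
    have "poly (reflect_poly q) d = d ^ D * poly q (inverse d)"
      using that by (simp add: poly_reflect_poly_nz D_def)
    also have "\<dots> = d ^ D * (d ^ m * poly p d)" using assms(1)[OF that] by simp
    finally show ?thesis by (simp add: poly_monom power_add mult_ac)
  qed
  then have "poly (monom 1 (m + D) * p - reflect_poly q) d = 0" if "d \<noteq> 0" for d
    using that by simp
  then have "infinite {d. poly (monom 1 (m + D) * p - reflect_poly q) d = 0}"
    using infinite_super[of "UNIV - {0}" "{d. poly (monom 1 (m + D) * p - reflect_poly q) d = 0}"]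
    by (auto simp: infinite_UNIV_char_0)
  then have eq: "monom 1 (m + D) * p = reflect_poly q"
    using poly_roots_finite by (metis right_minus_eq)
  moreover have "p \<noteq> 0" using eq q by auto
  ultimately have "degree (reflect_poly q) = m + D + degree p"
    by (metis degree_monom_eq degree_mult_eq monom_eq_0_iff one_neq_zero)
  then show False using degree_reflect_poly_le[of q] assms(2) by (simp add: D_def)
qed

text \<open>This stands in for the linear independence of characters: an identity valid for all
  nonzero \<open>l\<close> is an identity of polynomials. It extracts weight components and
  coefficients of unipotent expansions.\<close>

lemma sum_powers_unique:
  fixes c c' :: "nat \<Rightarrow> complex"
  assumes "\<And>l. l \<noteq> 0 \<Longrightarrow> (\<Sum>i\<le>n. l ^ i * c i) = (\<Sum>i\<le>n. l ^ i * c' i)" and "i \<le> n"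
  shows "c i = c' i"
proof -
  define p where "p = (\<Sum>i\<le>n. monom (c i - c' i) i)"
  have "poly p l = 0" if "l \<noteq> 0" for l
    using assms(1)[OF that] by (simp add: p_def poly_sum poly_monom algebra_simps sum_subtractf)
  then have "infinite {l. poly p l = 0}"
    using infinite_super[of "UNIV - {0}" "{l. poly p l = 0}"] by (auto simp: infinite_UNIV_char_0)
  then have "p = 0" using poly_roots_finite by blast
  moreover have "coeff p i = c i - c' i"
    using assms(2) by (simp add: p_def coeff_sum)
  ultimately show ?thesis by simp
qed

section \<open>Algebras of functions with a rational action of the special linear group\<close>

text \<open>Elements of the tensor product of \<open>mpoly\<close> with \<open>R\<close>, viewed as
  functions of a matrix and a point.\<close>

inductive_set tensor_functions :: "('a \<Rightarrow> complex) set \<Rightarrow> (complex^2^2 \<Rightarrow> 'a \<Rightarrow> complex) set"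
  for R :: "('a \<Rightarrow> complex) set" where
  base: "F \<in> mpoly \<Longrightarrow> f \<in> R \<Longrightarrow> (\<lambda>g x. F g * f x) \<in> tensor_functions R"
| add: "h \<in> tensor_functions R \<Longrightarrow> k \<in> tensor_functions R \<Longrightarrow> (\<lambda>g x. h g x + k g x) \<in> tensor_functions R"

text \<open>Membership in \<open>R\<close> depends only on the values on \<open>P\<close>, so sums
  and products can be formed without restricting to extensional representatives. The assumption
  \<open>rational\<close> is the coaction: it says that the action map is a morphism without
  mentioning a product variety.\<close>

locale sl2_variety =
  fixes P :: "'a set" and R :: "('a \<Rightarrow> complex) set" and act :: "complex^2^2 \<Rightarrow> 'a \<Rightarrow> 'a"
  assumes R_cong: "f \<in> R \<Longrightarrow> (\<And>x. x \<in> P \<Longrightarrow> f' x = f x) \<Longrightarrow> f' \<in> R"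
    and R_const: "(\<lambda>x. c) \<in> R"
    and R_add: "f \<in> R \<Longrightarrow> f' \<in> R \<Longrightarrow> (\<lambda>x. f x + f' x) \<in> R"
    and R_mult: "f \<in> R \<Longrightarrow> f' \<in> R \<Longrightarrow> (\<lambda>x. f x * f' x) \<in> R"
    and act_closed: "det g = 1 \<Longrightarrow> x \<in> P \<Longrightarrow> act g x \<in> P"
    and act_act: "det g = 1 \<Longrightarrow> det h = 1 \<Longrightarrow> x \<in> P \<Longrightarrow> act g (act h x) = act (g ** h) x"
    and act_1: "x \<in> P \<Longrightarrow> act (mat 1) x = x"
    and separated: "x \<in> P \<Longrightarrow> y \<in> P \<Longrightarrow> (\<And>f. f \<in> R \<Longrightarrow> f x = f y) \<Longrightarrow> x = y"
    and rational: "f \<in> R \<Longrightarrow> \<exists>h\<in>tensor_functions R. \<forall>g x. det g = 1 \<longrightarrow> x \<in> P \<longrightarrow> f (act g x) = h g x"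
begin

lemma R_uminus: "f \<in> R \<Longrightarrow> (\<lambda>x. - f x) \<in> R"
  using R_mult[OF R_const[of "-1"]] by simp

lemma R_diff: "f \<in> R \<Longrightarrow> g \<in> R \<Longrightarrow> (\<lambda>x. f x - g x) \<in> R"
  using R_add[OF _ R_uminus, of f g] by simp

lemma R_power: "f \<in> R \<Longrightarrow> (\<lambda>x. f x ^ n) \<in> R"
  by (induction n) (auto intro: R_const R_mult)

lemma R_sum: "(\<And>i. i \<in> I \<Longrightarrow> f i \<in> R) \<Longrightarrow> (\<lambda>x. \<Sum>i\<in>I. f i x) \<in> R"
  by (induction I rule: infinite_finite_induct) (auto intro: R_const R_add)

lemmas R_intros = R_const R_add R_mult R_uminus R_diff R_power R_sum

lemma act_upper_lower_closed [simp]: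
  "x \<in> P \<Longrightarrow> act (upper s) x \<in> P" "x \<in> P \<Longrightarrow> act (lower s) x \<in> P"
  "x \<in> P \<Longrightarrow> l \<noteq> 0 \<Longrightarrow> act (diag2 l) x \<in> P" "x \<in> P \<Longrightarrow> act weyl x \<in> P"
  by (auto intro!: act_closed)

lemma act_mat2 [simp]: "a*d - b*c = 1 \<Longrightarrow> a'*d' - b'*c' = 1 \<Longrightarrow> x \<in> P \<Longrightarrow>
  act (mat2 a b c d) (act (mat2 a' b' c' d') x) = act (mat2 a b c d ** mat2 a' b' c' d') x"
  by (rule act_act) auto

lemma act_diag_upper: "x \<in> P \<Longrightarrow> l \<noteq> 0 \<Longrightarrow>
  act (diag2 l) (act (upper s) x) = act (upper (l\<^sup>2 * s)) (act (diag2 l) x)"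
  by (simp add: power2_eq_square field_simps)

lemma act_mat2_one [simp]: "x \<in> P \<Longrightarrow> act (mat2 1 0 0 1) x = x"
  using act_1 by (simp add: mat_1_eq_mat2)

lemma R_act:
  assumes "f \<in> R" "det g = 1" shows "(\<lambda>x. f (act g x)) \<in> R"
proof -
  obtain h where h: "h \<in> tensor_functions R" "\<And>x. x \<in> P \<Longrightarrow> f (act g x) = h g x"
    using rational[OF assms(1)] assms(2) by blast
  from h(1) have "h g \<in> R"
    by induction (auto intro: R_intros)
  then show ?thesis by (rule R_cong) (rule h(2))
qed

text \<open>The coefficients beyond \<open>n\<close> are made to vanish identically so that two
  expansions can be added after padding both to length \<open>max n m\<close>.\<close>

lemma tensor_curve:
  assumes "h \<in> tensor_functions R" and "\<And>F. F \<in> mpoly \<Longrightarrow> \<exists>p. \<forall>z. F (\<gamma> z) = poly p z"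
  shows "\<exists>n a. (\<forall>i. a i \<in> R) \<and> (\<forall>i>n. \<forall>x. a i x = 0) \<and> (\<forall>z. \<forall>x. h (\<gamma> z) x = (\<Sum>i\<le>n. z ^ i * a i x))"
  using assms(1)
proof induction
  case (base F f)
  then obtain p where p: "\<And>z. F (\<gamma> z) = poly p z" using assms(2) by blast
  show ?case
  proof (rule exI[of _ "degree p"], rule exI[of _ "\<lambda>i x. coeff p i * f x"], intro conjI allI impI)
    show "(\<lambda>x. coeff p i * f x) \<in> R" for i by (intro R_intros base)
    show "coeff p i * f x = 0" if "degree p < i" for i x using that by (simp add: coeff_eq_0)
    show "F (\<gamma> z) * f x = (\<Sum>i\<le>degree p. z ^ i * (coeff p i * f x))" for z x
      by (simp only: p poly_altdef sum_distrib_right mult.assoc mult.left_commute)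
  qed
next
  case (add h k)
  from add.IH(1) obtain n a where a0: "\<forall>i. a i \<in> R" "\<forall>i>n. \<forall>x. a i x = 0"
    "\<forall>z x. h (\<gamma> z) x = (\<Sum>i\<le>n. z ^ i * a i x)" by blast
  from add.IH(2) obtain m b where b0: "\<forall>i. b i \<in> R" "\<forall>i>m. \<forall>x. b i x = 0"
    "\<forall>z x. k (\<gamma> z) x = (\<Sum>i\<le>m. z ^ i * b i x)" by blast
  note a = a0[rule_format] and b = b0[rule_format]
  have 1: "(\<Sum>i\<le>n. z ^ i * a i x) = (\<Sum>i\<le>max n m. z ^ i * a i x)" for z x
    by (rule sum.mono_neutral_left) (auto simp: a(2))
  have 2: "(\<Sum>i\<le>m. z ^ i * b i x) = (\<Sum>i\<le>max n m. z ^ i * b i x)" for z x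
    by (rule sum.mono_neutral_left) (auto simp: b(2))
  show ?case
    by (rule exI[of _ "max n m"], rule exI[of _ "\<lambda>i x. a i x + b i x"])
      (auto simp: a(2,3) b(2,3) 1 2 sum.distrib distrib_left intro: R_add a(1) b(1))
qed

text \<open>Negative powers of \<open>l\<close> are cleared by the factor \<open>l ^ N\<close>.
  Stating this for all large \<open>N\<close> lets two summands share one exponent.\<close>

lemma tensor_diag:
  assumes "h \<in> tensor_functions R"
  shows "\<exists>N0. \<forall>N\<ge>N0. \<exists>n a. (\<forall>i. a i \<in> R) \<and> (\<forall>i>n. \<forall>x. a i x = 0) \<and>
    (\<forall>l x. l \<noteq> 0 \<longrightarrow> l ^ N * h (diag2 l) x = (\<Sum>i\<le>n. l ^ i * a i x))"
  using assms
proof induction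
  case (base F f)
  obtain N0 p where p: "\<And>l. l \<noteq> 0 \<Longrightarrow> l ^ N0 * F (diag2 l) = poly p l" using mpoly_diag[OF base(1)] by blast
  show ?case
  proof (rule exI[of _ N0], intro allI impI)
    fix N assume N: "N \<ge> N0"
    define q where "q = monom 1 (N - N0) * p"
    have q: "l ^ N * F (diag2 l) = poly q l" if "l \<noteq> 0" for l
    proof -
      have "l ^ N * F (diag2 l) = l ^ (N - N0) * (l ^ N0 * F (diag2 l))"
        using N by (simp add: power_add[symmetric] mult.assoc[symmetric])
      then show ?thesis using p[OF that] by (simp add: q_def poly_monom)
    qed
    have "l ^ N * (F (diag2 l) * f x) = (\<Sum>i\<le>degree q. l ^ i * (coeff q i * f x))" if "l \<noteq> 0" for l x
      by (simp only: mult.assoc[symmetric] q[OF that] poly_altdef sum_distrib_right) (simp only: mult_ac)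
    then show "\<exists>n a. (\<forall>i. a i \<in> R) \<and> (\<forall>i>n. \<forall>x. a i x = 0) \<and>
      (\<forall>l x. l \<noteq> 0 \<longrightarrow> l ^ N * (F (diag2 l) * f x) = (\<Sum>i\<le>n. l ^ i * a i x))"
      by (intro exI[of _ "degree q"] exI[of _ "\<lambda>i x. coeff q i * f x"])
        (auto simp: coeff_eq_0 intro: R_mult R_const base)
  qed
next
  case (add h k)
  from add.IH(1) obtain N1 where N1: "\<forall>N\<ge>N1. \<exists>n a. (\<forall>i. a i \<in> R) \<and> (\<forall>i>n. \<forall>x. a i x = 0) \<and>
    (\<forall>l x. l \<noteq> 0 \<longrightarrow> l ^ N * h (diag2 l) x = (\<Sum>i\<le>n. l ^ i * a i x))" by blast
  from add.IH(2) obtain N2 where N2: "\<forall>N\<ge>N2. \<exists>n a. (\<forall>i. a i \<in> R) \<and> (\<forall>i>n. \<forall>x. a i x = 0) \<and>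
    (\<forall>l x. l \<noteq> 0 \<longrightarrow> l ^ N * k (diag2 l) x = (\<Sum>i\<le>n. l ^ i * a i x))" by blast
  show ?case
  proof (rule exI[of _ "max N1 N2"], intro allI impI)
    fix N assume "N \<ge> max N1 N2"
    then have "N \<ge> N1" "N \<ge> N2" by auto
    from N1[rule_format, OF this(1)] obtain n a where a0: "\<forall>i. a i \<in> R" "\<forall>i>n. \<forall>x. a i x = 0"
      "\<forall>l x. l \<noteq> 0 \<longrightarrow> l ^ N * h (diag2 l) x = (\<Sum>i\<le>n. l ^ i * a i x)" by blast
    from N2[rule_format, OF \<open>N \<ge> N2\<close>] obtain m b where b0: "\<forall>i. b i \<in> R" "\<forall>i>m. \<forall>x. b i x = 0"
      "\<forall>l x. l \<noteq> 0 \<longrightarrow> l ^ N * k (diag2 l) x = (\<Sum>i\<le>m. l ^ i * b i x)" by blast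
    note a = a0[rule_format] and b = b0[rule_format]
    have 1: "(\<Sum>i\<le>n. z ^ i * a i x) = (\<Sum>i\<le>max n m. z ^ i * a i x)" for z x
      by (rule sum.mono_neutral_left) (auto simp: a(2))
    have 2: "(\<Sum>i\<le>m. z ^ i * b i x) = (\<Sum>i\<le>max n m. z ^ i * b i x)" for z x
      by (rule sum.mono_neutral_left) (auto simp: b(2))
    show "\<exists>n a. (\<forall>i. a i \<in> R) \<and> (\<forall>i>n. \<forall>x. a i x = 0) \<and>
      (\<forall>l x. l \<noteq> 0 \<longrightarrow> l ^ N * (h (diag2 l) x + k (diag2 l) x) = (\<Sum>i\<le>n. l ^ i * a i x))"
      by (rule exI[of _ "max n m"], rule exI[of _ "\<lambda>i x. a i x + b i x"])
        (auto simp: a(2,3) b(2,3) 1 2 sum.distrib distrib_left intro: R_add a(1) b(1))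
  qed
qed

lemma act_curve:
  assumes "f \<in> R" and "\<And>z. det (\<gamma> z) = 1" and "\<And>F. F \<in> mpoly \<Longrightarrow> \<exists>p. \<forall>z. F (\<gamma> z) = poly p z"
  obtains n a where "\<And>i. a i \<in> R" "\<And>i x. i > n \<Longrightarrow> a i x = 0"
    "\<And>z x. x \<in> P \<Longrightarrow> f (act (\<gamma> z) x) = (\<Sum>i\<le>n. z ^ i * a i x)"
proof -
  obtain h where h: "h \<in> tensor_functions R" "\<And>g x. det g = 1 \<Longrightarrow> x \<in> P \<Longrightarrow> f (act g x) = h g x"
    using rational[OF assms(1)] by blast
  obtain n a where "\<And>i. a i \<in> R" "\<And>i x. i > n \<Longrightarrow> a i x = 0" "\<And>z x. h (\<gamma> z) x = (\<Sum>i\<le>n. z ^ i * a i x)"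
    using tensor_curve[of h \<gamma>, OF h(1) assms(3)] by blast
  then show ?thesis using h(2)[of "\<gamma> z" for z, OF assms(2)] that[of a n] by simp
qed

section \<open>Weights, unipotent expansions and highest weight functions\<close>

definition vanishes :: "('a \<Rightarrow> complex) \<Rightarrow> bool" where "vanishes f \<longleftrightarrow> (\<forall>x\<in>P. f x = 0)"

definition upper_invariant :: "('a \<Rightarrow> complex) \<Rightarrow> bool"
  where "upper_invariant f \<longleftrightarrow> (\<forall>s. \<forall>x\<in>P. f (act (upper s) x) = f x)"

text \<open>Torus weight \<open>i - N\<close>, phrased without negative exponents.\<close>

definition weight :: "nat \<Rightarrow> nat \<Rightarrow> ('a \<Rightarrow> complex) \<Rightarrow> bool"
  where "weight N i f \<longleftrightarrow> (\<forall>l. l \<noteq> 0 \<longrightarrow> (\<forall>x\<in>P. l ^ N * f (act (diag2 l) x) = l ^ i * f x))"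

text \<open>For \<open>i\<close> up to \<open>n\<close>, \<open>a i\<close> is the
  \<open>i\<close>-th divided power of the locally nilpotent derivation belonging to
  \<open>upper\<close>, applied to \<open>f\<close>.\<close>

definition upper_expansion :: "('a \<Rightarrow> complex) \<Rightarrow> nat \<Rightarrow> (nat \<Rightarrow> 'a \<Rightarrow> complex) \<Rightarrow> bool"
  where "upper_expansion f n a \<longleftrightarrow> (\<forall>i. a i \<in> R) \<and>
    (\<forall>s. \<forall>x\<in>P. f (act (upper s) x) = (\<Sum>i\<le>n. s ^ i * a i x))"

text \<open>Functions are moved by composition with the action and not with its inverse, so a
  function of highest weight \<open>n\<close> has torus weight \<open>-n\<close> in this
  convention.\<close>

definition highest_weight :: "nat \<Rightarrow> ('a \<Rightarrow> complex) \<Rightarrow> bool"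
  where "highest_weight n f \<longleftrightarrow> f \<in> R \<and> upper_invariant f \<and> weight n 0 f"

lemma upper_expansion_exists:
  assumes "f \<in> R" obtains n a where "upper_expansion f n a"
proof (rule act_curve[OF assms, of upper])
  show "F \<in> mpoly \<Longrightarrow> \<exists>p. \<forall>z. F (upper z) = poly p z" for F
    by (metis mpoly_upper)
qed (use that in \<open>auto simp: upper_expansion_def\<close>)

lemma upper_expansion_at_0:
  assumes "upper_expansion f n a" "x \<in> P" shows "a 0 x = f x"
proof -
  have "f (act (upper 0) x) = (\<Sum>i\<le>n. 0 ^ i * a i x)" using assms unfolding upper_expansion_def by blast
  also have "\<dots> = (\<Sum>i\<le>n. if i = 0 then a i x else 0)" by (rule sum.cong) auto
  also have "\<dots> = a 0 x" by simp
  finally show ?thesis using assms(2) by simp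
qed

text \<open>Moving by \<open>upper t\<close> and then by \<open>upper s\<close> is moving by
  \<open>upper (t + s)\<close>. Both descriptions are polynomials in \<open>s\<close>, and their
  coefficients of \<open>s ^ n\<close> are the leading coefficient at the moved point and at
  \<open>x\<close>.\<close>

lemma leading_upper_invariant:
  assumes "upper_expansion f n a" shows "upper_invariant (a n)"
  unfolding upper_invariant_def
proof (intro allI ballI)
  fix t x assume x: "x \<in> P"
  define p where "p = (\<Sum>i\<le>n. monom (a i (act (upper t) x)) i)"
  define q where "q = (\<Sum>i\<le>n. smult (a i x) ([:t, 1:] ^ i))"
  have "poly p s = poly q s" for s
  proof -
    have "poly p s = f (act (upper s) (act (upper t) x))"
      using assms x by (simp add: p_def poly_sum poly_monom upper_expansion_def mult.commute del: act_mat2)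
    also have "\<dots> = f (act (upper (t + s)) x)" using x by simp
    also have "\<dots> = poly q s"
      using assms x by (simp add: q_def poly_sum upper_expansion_def mult.commute)
    finally show ?thesis .
  qed
  then have "p = q" by (simp add: poly_eq_poly_eq_iff[symmetric] fun_eq_iff)
  then have "coeff p n = coeff q n" by simp
  moreover have "coeff p n = a n (act (upper t) x)" by (simp add: p_def coeff_sum)
  moreover have "coeff ([:t, 1:] ^ i) n = (if i = n then 1 else 0)" if "i \<le> n" for i
  proof (cases "i = n")
    case True
    have "lead_coeff ([:t, 1:] ^ n) = 1" by (simp add: lead_coeff_power)
    then show ?thesis using True by (simp add: degree_power_eq)
  next
    case False
    then show ?thesis using that by (intro coeff_eq_0[THEN trans]) (auto simp: degree_power_eq)
  qed
  then have "(\<Sum>i\<le>n. a i x * coeff ([:t, 1:] ^ i) n) = (\<Sum>i\<le>n. if i = n then a i x else 0)"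
    by (intro sum.cong) auto
  then have "coeff q n = a n x" by (simp add: q_def coeff_sum)
  ultimately show "a n (act (upper t) x) = a n x" by simp
qed

lemma upper_expansion_drop:
  assumes "upper_expansion f (Suc n) a" "vanishes (a (Suc n))" shows "upper_expansion f n a"
  using assms by (auto simp: upper_expansion_def vanishes_def)

lemma leading_upper_expansion:
  assumes "f \<in> R" "\<not> vanishes f"
  obtains n a where "upper_expansion f n a" "\<not> vanishes (a n)"
proof -
  obtain n a where "upper_expansion f n a" by (rule upper_expansion_exists[OF assms(1)])
  then have "\<exists>n. upper_expansion f n a \<and> \<not> vanishes (a n)"
  proof (induction n)
    case 0
    then show ?case using assms(2) upper_expansion_at_0[OF 0] by (intro exI[of _ 0]) (auto simp: vanishes_def)
  next
    case (Suc n)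
    then show ?case using upper_expansion_drop by blast
  qed
  then show ?thesis using that by blast
qed

text \<open>Conjugation by \<open>diag2 l\<close> multiplies the parameter of \<open>upper\<close>
  by the square of \<open>l\<close>, so each step along the expansion shifts the torus weight by
  2.\<close>

lemma weight_upper_expansion:
  assumes "upper_expansion f n a" "weight N i f" "j \<le> n"
  shows "weight (N + 2 * j) i (a j)"
  unfolding weight_def
proof (intro allI impI ballI)
  fix l :: complex and x assume l: "l \<noteq> 0" and x: "x \<in> P"
  have "(\<Sum>j\<le>n. s ^ j * (l ^ (N + 2 * j) * a j (act (diag2 l) x))) = (\<Sum>j\<le>n. s ^ j * (l ^ i * a j x))" for s
  proof -
    have "(\<Sum>j\<le>n. s ^ j * (l ^ (N + 2 * j) * a j (act (diag2 l) x)))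
      = l ^ N * (\<Sum>j\<le>n. (l\<^sup>2 * s) ^ j * a j (act (diag2 l) x))"
      by (simp add: sum_distrib_left power_add power_mult_distrib power_mult[symmetric] mult_ac)
    also have "\<dots> = l ^ N * f (act (upper (l\<^sup>2 * s)) (act (diag2 l) x))"
      using assms(1) x l unfolding upper_expansion_def by (metis act_upper_lower_closed(3))
    also have "act (upper (l\<^sup>2 * s)) (act (diag2 l) x) = act (diag2 l) (act (upper s) x)"
      by (rule act_diag_upper[OF x l, symmetric])
    also have "l ^ N * f \<dots> = l ^ i * f (act (upper s) x)"
      using assms(2) x l unfolding weight_def by (metis act_upper_lower_closed(1))
    also have "\<dots> = (\<Sum>j\<le>n. s ^ j * (l ^ i * a j x))"
      using assms(1) x by (simp add: upper_expansion_def sum_distrib_left mult_ac)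
    finally show ?thesis .
  qed
  from sum_powers_unique[OF this assms(3)]
  show "l ^ (N + 2 * j) * a j (act (diag2 l) x) = l ^ i * a j x" .
qed

text \<open>The components are the coefficients of the powers of \<open>l\<close>. Acting by
  \<open>diag2 m\<close> before \<open>diag2 l\<close> shows that each of them is a weight function,
  and \<open>l = 1\<close> gives the sum.\<close>

lemma weight_decomposition:
  assumes "f \<in> R"
  obtains N n a where "\<And>i. a i \<in> R" "\<And>i. weight N i (a i)"
    "\<And>l x. l \<noteq> 0 \<Longrightarrow> x \<in> P \<Longrightarrow> l ^ N * f (act (diag2 l) x) = (\<Sum>i\<le>n. l ^ i * a i x)"
    "\<And>i x. i > n \<Longrightarrow> a i x = 0" "\<And>x. x \<in> P \<Longrightarrow> f x = (\<Sum>i\<le>n. a i x)"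
proof -
  obtain h where h: "h \<in> tensor_functions R" "\<And>g x. det g = 1 \<Longrightarrow> x \<in> P \<Longrightarrow> f (act g x) = h g x"
    using rational[OF assms(1)] by blast
  obtain N n a where a: "\<And>i. a i \<in> R" "\<And>i x. i > n \<Longrightarrow> a i x = 0"
    "\<And>l x. l \<noteq> 0 \<Longrightarrow> l ^ N * h (diag2 l) x = (\<Sum>i\<le>n. l ^ i * a i x)"
    using tensor_diag[OF h(1)] by blast
  have f: "l ^ N * f (act (diag2 l) x) = (\<Sum>i\<le>n. l ^ i * a i x)" if "l \<noteq> 0" "x \<in> P" for l x
    using h(2)[of "diag2 l" x] a(3)[OF that(1), of x] that by simp
  have "weight N i (a i)" for i
    unfolding weight_def
  proof (intro allI impI ballI)
    fix m :: complex and x assume m: "m \<noteq> 0" and x: "x \<in> P"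
    show "m ^ N * a i (act (diag2 m) x) = m ^ i * a i x"
    proof (cases "i \<le> n")
      case True
      have "(\<Sum>i\<le>n. l ^ i * (m ^ N * a i (act (diag2 m) x))) = (\<Sum>i\<le>n. l ^ i * (m ^ i * a i x))" if l: "l \<noteq> 0" for l
      proof -
        have "(\<Sum>i\<le>n. l ^ i * (m ^ N * a i (act (diag2 m) x))) = m ^ N * (\<Sum>i\<le>n. l ^ i * a i (act (diag2 m) x))"
          by (simp add: sum_distrib_left mult_ac)
        also have "\<dots> = m ^ N * (l ^ N * f (act (diag2 l) (act (diag2 m) x)))"
          using f[OF l, of "act (diag2 m) x"] x m by simp
        also have "\<dots> = (l * m) ^ N * f (act (diag2 (l * m)) x)"
          using x l m by (simp add: power_mult_distrib mult_ac)
        also have "\<dots> = (\<Sum>i\<le>n. (l * m) ^ i * a i x)" using f[of "l * m" x] x l m by simp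
        finally show ?thesis by (simp add: power_mult_distrib mult_ac)
      qed
      from sum_powers_unique[OF this True] show ?thesis .
    qed (simp add: a(2))
  qed
  moreover have "f x = (\<Sum>i\<le>n. a i x)" if "x \<in> P" for x
    using f[of 1 x] that by simp
  ultimately show ?thesis using that[OF a(1) _ f a(2)] by blast
qed

lemma weight_component_upper_invariant:
  assumes "upper_invariant f" "\<And>i x. i > n \<Longrightarrow> a i x = 0"
    "\<And>l x. l \<noteq> 0 \<Longrightarrow> x \<in> P \<Longrightarrow> l ^ N * f (act (diag2 l) x) = (\<Sum>i\<le>n. l ^ i * a i x)"
  shows "upper_invariant (a i)"
  unfolding upper_invariant_def
proof (intro allI ballI)
  fix s x assume x: "x \<in> P"
  show "a i (act (upper s) x) = a i x"
  proof (cases "i \<le> n")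
    case True
    have "(\<Sum>i\<le>n. l ^ i * a i (act (upper s) x)) = (\<Sum>i\<le>n. l ^ i * a i x)" if l: "l \<noteq> 0" for l
    proof -
      have "act (diag2 l) (act (upper s) x) = act (upper (l\<^sup>2 * s)) (act (diag2 l) x)"
        using x l by (rule act_diag_upper)
      then have "f (act (diag2 l) (act (upper s) x)) = f (act (diag2 l) x)"
        using assms(1) x l unfolding upper_invariant_def by (metis act_upper_lower_closed(3))
      then show ?thesis using assms(3)[OF l, of x] assms(3)[OF l, of "act (upper s) x"] x
        by (simp del: act_mat2)
    qed
    from sum_powers_unique[OF this True] show ?thesis .
  qed (simp add: assms(2))
qed

text \<open>Dominance of highest weights. Along \<open>lower z\<close> and along
  \<open>mat2 0 (-1) 1 z\<close> the function is polynomial, and invariance and weight relate the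
  two polynomials at inverse arguments. A weight of the wrong sign would force the first one to
  vanish, although its value at 0 is \<open>f x\<close>.\<close>

lemma highest_weight_nonneg:
  assumes f: "f \<in> R" "upper_invariant f" "weight N i f" "\<not> vanishes f"
  shows "i \<le> N \<and> highest_weight (N - i) f"
proof -
  have "i \<le> N"
  proof (rule ccontr)
    assume "\<not> i \<le> N"
    obtain x where x: "x \<in> P" "f x \<noteq> 0" using f(4) by (auto simp: vanishes_def)
    obtain n a where a: "\<And>z x. x \<in> P \<Longrightarrow> f (act (lower z) x) = (\<Sum>i\<le>n. z ^ i * a i x)"
    proof (rule act_curve[OF f(1), of lower])
      show "F \<in> mpoly \<Longrightarrow> \<exists>p. \<forall>z. F (lower z) = poly p z" for F by (metis mpoly_lower)
    qed auto
    obtain m b where b: "\<And>z x. x \<in> P \<Longrightarrow> f (act (mat2 0 (-1) 1 z) x) = (\<Sum>i\<le>m. z ^ i * b i x)"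
    proof (rule act_curve[OF f(1), of "mat2 0 (-1) 1"])
      show "F \<in> mpoly \<Longrightarrow> \<exists>p. \<forall>z. F (mat2 0 (-1) 1 z) = poly p z" for F by (metis mpoly_weyl_curve)
    qed auto
    define q where "q = (\<Sum>i\<le>n. monom (a i x) i)"
    define p where "p = (\<Sum>i\<le>m. monom (b i x) i)"
    have q: "f (act (lower z) x) = poly q z" for z
      using x by (simp add: q_def poly_sum poly_monom a mult.commute)
    have p: "f (act (mat2 0 (-1) 1 z) x) = poly p z" for z
      using x by (simp add: p_def poly_sum poly_monom b mult.commute)
    have "d ^ (i - N) * poly p d = poly q (inverse d)" if d: "d \<noteq> 0" for d
    proof -
      have "act (mat2 0 (-1) 1 d) x = act (upper (- inverse d)) (act (diag2 (inverse d)) (act (lower (inverse d)) x))"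
        using x d by (simp add: field_simps)
      then have "poly p d = f (act (diag2 (inverse d)) (act (lower (inverse d)) x))"
        using p f(2) x d unfolding upper_invariant_def
        by (metis act_upper_lower_closed(2,3) nonzero_imp_inverse_nonzero)
      then have "inverse d ^ N * poly p d = inverse d ^ i * f (act (lower (inverse d)) x)"
        using f(3) x d unfolding weight_def
        by (metis act_upper_lower_closed(2) nonzero_imp_inverse_nonzero)
      then have "inverse d ^ N * poly p d = inverse d ^ N * inverse d ^ (i - N) * poly q (inverse d)"
        using \<open>\<not> i \<le> N\<close> by (simp add: q power_add[symmetric])
      then show ?thesis using d by (simp add: field_simps)
    qed
    then have "q = 0" using poly_inverse_decay_zero[of "i - N" p q] \<open>\<not> i \<le> N\<close> by simp
    then show False using q[of 0] x by simp
  qed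
  moreover have "weight (N - i) 0 f"
    unfolding weight_def
  proof (intro allI impI ballI)
    fix l :: complex and x assume l: "l \<noteq> 0" and x: "x \<in> P"
    have "l ^ i * (l ^ (N - i) * f (act (diag2 l) x)) = l ^ i * f x"
      using f(3) l x \<open>i \<le> N\<close> by (simp add: weight_def power_add[symmetric] mult.assoc[symmetric])
    then show "l ^ (N - i) * f (act (diag2 l) x) = l ^ 0 * f x" using l by simp
  qed
  ultimately show ?thesis using f by (simp add: highest_weight_def)
qed

lemma weight_weyl:
  assumes "weight N i f" shows "weight i N (\<lambda>x. f (act weyl x))"
  unfolding weight_def
proof (intro allI impI ballI)
  fix l :: complex and x assume l: "l \<noteq> 0" and x: "x \<in> P"
  define y where "y = act weyl (act (diag2 l) x)"
  have y: "y \<in> P" "act (diag2 l) y = act weyl x" using x l by (simp_all add: y_def act_closed)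
  have "l ^ N * f (act (diag2 l) y) = l ^ i * f y" using assms l y unfolding weight_def by blast
  then have "l ^ i * f y = l ^ N * f (act weyl x)" by (simp only: y(2))
  then show "l ^ i * f (act weyl (act (diag2 l) x)) = l ^ N * f (act weyl x)" by (simp only: y_def)
qed

text \<open>A function moved by the torus has a component of nonzero weight. The Weyl element
  exchanges the two signs, and passing to the leading coefficient of the unipotent expansion can
  only raise the highest weight.\<close>

lemma positive_highest_weight_exists:
  assumes "f \<in> R" "l \<noteq> 0" "x \<in> P" "f (act (diag2 l) x) \<noteq> f x"
  obtains n h where "n > 0" "highest_weight n h" "\<not> vanishes h"
proof -
  obtain N n a where a: "\<And>i. a i \<in> R" "\<And>i. weight N i (a i)"
    "\<And>l x. l \<noteq> 0 \<Longrightarrow> x \<in> P \<Longrightarrow> l ^ N * f (act (diag2 l) x) = (\<Sum>i\<le>n. l ^ i * a i x)"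
    "\<And>i x. i > n \<Longrightarrow> a i x = 0" "\<And>x. x \<in> P \<Longrightarrow> f x = (\<Sum>i\<le>n. a i x)"
    by (rule weight_decomposition[OF assms(1)]) blast
  have "\<exists>i. i \<noteq> N \<and> \<not> vanishes (a i)"
  proof (rule ccontr)
    assume "\<not> ?thesis"
    then have *: "\<And>i. i \<noteq> N \<Longrightarrow> a i x = 0" using assms(3) by (auto simp: vanishes_def)
    have "l ^ N * f (act (diag2 l) x) = (\<Sum>i\<le>n. l ^ N * a i x)"
      unfolding a(3)[OF assms(2,3)] by (rule sum.cong[OF refl]) (metis * mult_zero_right)
    also have "\<dots> = l ^ N * f x" using a(5)[OF assms(3)] by (simp add: sum_distrib_left)
    finally show False using assms by simp
  qed
  then obtain i where i: "i \<noteq> N" "\<not> vanishes (a i)" by blast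
  have "\<exists>M j b. b \<in> R \<and> weight M j b \<and> \<not> vanishes b \<and> j < M"
  proof (cases "i < N")
    case True then show ?thesis by (intro exI[of _ N] exI[of _ i] exI[of _ "a i"] conjI a i)
  next
    case False
    have "\<not> vanishes (\<lambda>x. a i (act weyl x))"
    proof
      assume v: "vanishes (\<lambda>x. a i (act weyl x))"
      have "a i x = 0" if "x \<in> P" for x
      proof -
        have x': "act (mat2 0 (-1) 1 0) x \<in> P" using that by (simp add: act_closed)
        have "act weyl (act (mat2 0 (-1) 1 0) x) = x" using that by simp
        then show ?thesis using v x' unfolding vanishes_def by (metis (no_types))
      qed
      then show False using i(2) by (auto simp: vanishes_def)
    qed
    moreover have "(\<lambda>x. a i (act weyl x)) \<in> R" by (rule R_act[OF a(1)]) simp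
    ultimately show ?thesis using weight_weyl[OF a(2)[of i]] False i(1) by (meson linorder_neqE_nat)
  qed
  then obtain M j b where b: "b \<in> R" "weight M j b" "\<not> vanishes b" "j < M" by blast
  obtain k c where c: "upper_expansion b k c" "\<not> vanishes (c k)" by (rule leading_upper_expansion[OF b(1,3)])
  have "c k \<in> R" using c(1) by (simp add: upper_expansion_def)
  then have "highest_weight (M + 2 * k - j) (c k)"
    using highest_weight_nonneg[OF _ leading_upper_invariant[OF c(1)] weight_upper_expansion[OF c(1) b(2)]] c(2) by blast
  then show ?thesis using that[of "M + 2 * k - j" "c k"] b(4) c(2) by simp
qed

text \<open>For a set \<open>Z\<close> of pairs stable under the group, the functions with
  \<open>a x = r * a y\<close> on \<open>Z\<close> form a stable subspace, which contains a highest
  weight function as soon as it is nonzero. With \<open>r = 0\<close> on a diagonal this concerns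
  functions vanishing on an orbit; with \<open>r = -1\<close> it isolates functions that change sign
  under a symmetry of the orbit.\<close>

lemma highest_weight_with_relation:
  assumes a: "a \<in> R" "\<not> vanishes a"
    and Z: "\<And>x y. (x, y) \<in> Z \<Longrightarrow> x \<in> P \<and> y \<in> P" "\<And>g x y. (x, y) \<in> Z \<Longrightarrow> det g = 1 \<Longrightarrow> (act g x, act g y) \<in> Z"
      "\<And>x y. (x, y) \<in> Z \<Longrightarrow> a x = r * a y"
  obtains n h where "highest_weight n h" "\<not> vanishes h" "\<And>x y. (x, y) \<in> Z \<Longrightarrow> h x = r * h y"
proof -
  obtain N d b where b: "\<And>i. b i \<in> R" "\<And>i. weight N i (b i)"
    "\<And>l x. l \<noteq> 0 \<Longrightarrow> x \<in> P \<Longrightarrow> l ^ N * a (act (diag2 l) x) = (\<Sum>i\<le>d. l ^ i * b i x)"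
    "\<And>i x. i > d \<Longrightarrow> b i x = 0" "\<And>x. x \<in> P \<Longrightarrow> a x = (\<Sum>i\<le>d. b i x)"
    by (rule weight_decomposition[OF a(1)]) blast
  obtain x where x: "x \<in> P" "a x \<noteq> 0" using a(2) by (auto simp: vanishes_def)
  then have "\<exists>i\<le>d. b i x \<noteq> 0" using b(5)[OF x(1)] by (metis atMost_iff sum.neutral)
  then obtain i where i: "i \<le> d" "\<not> vanishes (b i)" using x(1) by (auto simp: vanishes_def)
  obtain k c where c: "upper_expansion (b i) k c" "\<not> vanishes (c k)"
    by (rule leading_upper_expansion[OF b(1) i(2)])
  have cR: "c k \<in> R" using c(1) by (simp add: upper_expansion_def)
  have "highest_weight (N + 2 * k - i) (c k)"
    using highest_weight_nonneg[OF cR leading_upper_invariant[OF c(1)] weight_upper_expansion[OF c(1) b(2)]] c(2) by blast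
  moreover have bz: "b i x = r * b i y" if xy: "(x, y) \<in> Z" for x y
  proof -
    have "(\<Sum>i\<le>d. l ^ i * b i x) = (\<Sum>i\<le>d. l ^ i * (r * b i y))" if l: "l \<noteq> 0" for l
    proof -
      have "(act (diag2 l) x, act (diag2 l) y) \<in> Z" using Z(2)[OF xy] l by simp
      from Z(3)[OF this] have "l ^ N * a (act (diag2 l) x) = r * (l ^ N * a (act (diag2 l) y))" by simp
      then have "(\<Sum>i\<le>d. l ^ i * b i x) = r * (\<Sum>i\<le>d. l ^ i * b i y)" using b(3)[OF l] Z(1)[OF xy] by simp
      then show ?thesis by (simp add: sum_distrib_left mult.left_commute)
    qed
    from sum_powers_unique[OF this i(1)] show ?thesis .
  qed
  moreover have "c k x = r * c k y" if xy: "(x, y) \<in> Z" for x y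
  proof -
    have "(\<Sum>j\<le>k. s ^ j * c j x) = (\<Sum>j\<le>k. s ^ j * (r * c j y))" for s
    proof -
      have "b i (act (upper s) x) = (\<Sum>j\<le>k. s ^ j * c j x)" "b i (act (upper s) y) = (\<Sum>j\<le>k. s ^ j * c j y)"
        using c(1) Z(1)[OF xy] unfolding upper_expansion_def by blast+
      moreover have "b i (act (upper s) x) = r * b i (act (upper s) y)" using bz[OF Z(2)[OF xy]] by simp
      ultimately show ?thesis by (simp add: sum_distrib_left mult.left_commute)
    qed
    from sum_powers_unique[OF this, of k] show ?thesis by simp
  qed
  ultimately show ?thesis using that c(2) by blast
qed

end

section \<open>A point with large stabilizer\<close>

locale multiplicity_free_sl2_variety = sl2_variety +
  assumes domain: "f \<in> R \<Longrightarrow> f' \<in> R \<Longrightarrow> (\<And>x. x \<in> P \<Longrightarrow> f x * f' x = 0) \<Longrightarrow> vanishes f \<or> vanishes f'"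
    and multiplicity_free: "highest_weight n f \<Longrightarrow> highest_weight n f' \<Longrightarrow> \<not> vanishes f \<Longrightarrow>
      \<exists>c. \<forall>x\<in>P. f' x = c * f x"
    and torus_nontrivial: "\<exists>f\<in>R. \<exists>l x. l \<noteq> 0 \<and> x \<in> P \<and> f (act (diag2 l) x) \<noteq> f x"
begin

section \<open>Zero sets of highest weight functions\<close>

lemma nonvanishing_power:
  assumes "f \<in> R" "\<not> vanishes f" shows "\<not> vanishes (\<lambda>x. f x ^ k)"
  using assms by (auto simp: vanishes_def)

lemma highest_weight_power:
  assumes "highest_weight n f" shows "highest_weight (n * k) (\<lambda>x. f x ^ k)"
proof -
  have "l ^ (n * k) * f (act (diag2 l) x) ^ k = f x ^ k" if "l \<noteq> 0" "x \<in> P" for l x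
  proof -
    have "l ^ (n * k) * f (act (diag2 l) x) ^ k = (l ^ n * f (act (diag2 l) x)) ^ k"
      by (simp only: power_mult power_mult_distrib)
    then show ?thesis using assms that by (simp add: highest_weight_def weight_def)
  qed
  then show ?thesis
    using assms by (auto simp: highest_weight_def upper_invariant_def weight_def intro: R_power)
qed

text \<open>The powers \<open>f ^ m\<close> and \<open>h ^ n\<close> share the highest weight
  \<open>n * m\<close>, so multiplicity freeness makes them proportional. In particular all nonzero
  highest weight functions of positive weight have the same zeros.\<close>

lemma highest_weight_proportional:
  assumes "highest_weight n f" "\<not> vanishes f" "highest_weight m h" "\<not> vanishes h"
  obtains c where "c \<noteq> 0" "\<And>x. x \<in> P \<Longrightarrow> h x ^ n = c * f x ^ m"
proof -
  have 1: "highest_weight (n * m) (\<lambda>x. f x ^ m)" "highest_weight (n * m) (\<lambda>x. h x ^ n)"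
    using highest_weight_power[OF assms(1)] highest_weight_power[OF assms(3), of n] by (simp_all add: mult.commute)
  have 2: "\<not> vanishes (\<lambda>x. f x ^ m)" "\<not> vanishes (\<lambda>x. h x ^ n)"
    using assms nonvanishing_power by (auto simp: highest_weight_def)
  obtain c where c: "\<forall>x\<in>P. h x ^ n = c * f x ^ m" using multiplicity_free[OF 1 2(1)] by blast
  moreover have "c \<noteq> 0" using c 2(2) by (auto simp: vanishes_def)
  ultimately show ?thesis using that by blast
qed

lemma highest_weight_nonzero:
  assumes "highest_weight n f" "n > 0" "p \<in> P" "f p \<noteq> 0" "highest_weight m h" "\<not> vanishes h"
  shows "h p \<noteq> 0"
proof -
  have "\<not> vanishes f" using assms by (auto simp: vanishes_def)
  then obtain c where "c \<noteq> 0" "\<And>x. x \<in> P \<Longrightarrow> h x ^ n = c * f x ^ m"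
    using highest_weight_proportional[OF assms(1) _ assms(5,6)] by blast
  then have "h p ^ n \<noteq> 0" using assms by simp
  then show ?thesis using assms(2) by (auto simp: power_0_left)
qed

text \<open>The functions vanishing on the orbit of \<open>p\<close> are stable under the group. A
  nonzero one would produce a highest weight function among them, which cannot vanish at
  \<open>p\<close> because it has no zeros where \<open>f\<close> has none. Thus the orbit of
  \<open>p\<close> is dense.\<close>

lemma orbit_restriction_injective:
  assumes f: "highest_weight n f" "n > 0" "p \<in> P" "f p \<noteq> 0"
    and a: "a \<in> R" "\<And>g. det g = 1 \<Longrightarrow> a (act g p) = 0"
  shows "vanishes a"
proof (rule ccontr)
  assume nv: "\<not> vanishes a"
  obtain m h where h: "highest_weight m h" "\<not> vanishes h"
    "h p = 0"
  proof (rule highest_weight_with_relation[OF a(1) nv, of "{(act g p, act g p) |g. det g = 1}" 0])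
    show "x \<in> P \<and> y \<in> P" if "(x, y) \<in> {(act g p, act g p) |g. det g = 1}" for x y
      using that f(3) by (auto intro: act_closed)
    show "(act h x, act h y) \<in> {(act g p, act g p) |g. det g = 1}"
      if xy: "(x, y) \<in> {(act g p, act g p) |g. det g = 1}" "det h = 1" for h x y
    proof -
      obtain g where g: "det g = 1" "x = act g p" "y = act g p" using xy(1) by auto
      then have "act h x = act (h ** g) p" "act h y = act (h ** g) p" "det (h ** g) = 1"
        using f(3) xy(2) by (auto simp: act_act det_mul)
      then show ?thesis by auto
    qed
    show "a x = 0 * a y" if "(x, y) \<in> {(act g p, act g p) |g. det g = 1}" for x y
      using that a(2) by auto
    fix n h assume h: "highest_weight n h" "\<not> vanishes h"
      "\<And>x y. (x, y) \<in> {(act g p, act g p) |g. det g = 1} \<Longrightarrow> h x = 0 * h y"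
    have "(p, p) \<in> {(act g p, act g p) |g. det g = 1}"
      using f(3) by (auto intro!: exI[of _ "mat 1"] simp: act_1)
    then show thesis using that[OF h(1,2)] h(3) by auto
  qed
  then show False using highest_weight_nonzero[OF f] by blast
qed

text \<open>The function \<open>e 1\<close> is the derivative of \<open>f\<close> along
  \<open>lower\<close>. That \<open>upper\<close> translates it by a multiple of \<open>f\<close> is
  the integrated form of the bracket relation between the raising and lowering operators on a
  highest weight vector.\<close>

lemma lower_derivative:
  assumes f: "highest_weight n f"
  obtains d e where "\<And>i. e i \<in> R"
    "\<And>z x. x \<in> P \<Longrightarrow> f (act (lower z) x) = poly (\<Sum>i\<le>d. monom (e i x) i) z"
    "\<And>s x. x \<in> P \<Longrightarrow> e 1 (act (upper s) x) = e 1 x + of_nat n * s * f x"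
    "\<And>x. coeff (\<Sum>i\<le>d. monom (e i x) i) 1 = e 1 x"
proof -
  have "f \<in> R" using f by (simp add: highest_weight_def)
  obtain d e where e: "\<And>i. e i \<in> R" "\<And>i x. i > d \<Longrightarrow> e i x = 0"
    "\<And>z x. x \<in> P \<Longrightarrow> f (act (lower z) x) = (\<Sum>i\<le>d. z ^ i * e i x)"
  proof (rule act_curve[OF \<open>f \<in> R\<close>, of lower])
    show "F \<in> mpoly \<Longrightarrow> \<exists>p. \<forall>z. F (lower z) = poly p z" for F by (metis mpoly_lower)
  qed auto
  define q where "q = (\<lambda>x. \<Sum>i\<le>d. monom (e i x) i)"
  have q: "f (act (lower z) x) = poly (q x) z" if "x \<in> P" for z x
    using e(3)[OF that] by (simp add: q_def poly_sum poly_monom mult.commute)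
  have q1: "coeff (q x) 1 = e 1 x" for x
    by (cases "1 \<le> d") (auto simp: q_def coeff_sum e(2))
  have der: "(poly (q x) has_field_derivative e 1 x) (at 0)" for x
    by (rule DERIV_cong[OF poly_DERIV]) (simp add: poly_0_coeff_0 coeff_pderiv q1[unfolded One_nat_def])
  have "e 1 (act (upper s) x) = e 1 x + of_nat n * s * f x" if x: "x \<in> P" for s x
  proof (rule DERIV_unique[OF der])
    let ?rhs = "\<lambda>r. (1 + r * s) ^ n * poly (q x) (r / (1 + r * s))"
    have eq: "poly (q (act (upper s) x)) r = ?rhs r" if r: "1 + r * s \<noteq> 0" for r
    proof -
      let ?l = "inverse (1 + r * s)"
      \<comment> \<open>Factorization in the open cell, valid where \<open>1 + r * s\<close> is
        nonzero; this suffices because only derivatives at \<open>r = 0\<close> are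
        compared.\<close>
      have "act (lower r) (act (upper s) x) = act (upper (s * ?l)) (act (diag2 ?l) (act (lower (r / (1 + r * s))) x))"
      proof -
        define l u where "l = ?l" and "u = 1 + r * s"
        have lu: "l * u = 1" "inverse l = u" "u = 1 + r * s" using r by (simp_all add: l_def u_def)
        have "lower r ** upper s = upper (s * l) ** (mat2 l 0 0 u ** lower (r * l))"
          using lu(1,3) by (simp, intro conjI; algebra)
        then have "lower r ** upper s = upper (s * l) ** (diag2 l ** lower (r * l))"
          by (simp only: lu(2))
        moreover have "r / (1 + r * s) = r * l" by (simp add: l_def divide_inverse)
        moreover have "l \<noteq> 0" using r by (simp add: l_def)
        moreover have "act (upper (s * l)) (act (diag2 l ** lower (r * l)) x) = act (upper (s * l) ** (diag2 l ** lower (r * l))) x"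
          "act (diag2 l) (act (lower (r * l)) x) = act (diag2 l ** lower (r * l)) x"
          "act (lower r) (act (upper s) x) = act (lower r ** upper s) x"
          by (rule act_act; use \<open>l \<noteq> 0\<close> x in \<open>simp add: det_mul del: mat2_mult\<close>)+
        ultimately show ?thesis by (simp only: l_def[symmetric])
      qed
      moreover have "f (act (upper (s * ?l)) (act (diag2 ?l) (act (lower (r / (1 + r * s))) x)))
        = f (act (diag2 ?l) (act (lower (r / (1 + r * s))) x))"
        using f x r unfolding highest_weight_def upper_invariant_def
        by (metis act_upper_lower_closed(2,3) nonzero_imp_inverse_nonzero)
      moreover have "?l ^ n * f (act (diag2 ?l) (act (lower (r / (1 + r * s))) x)) = f (act (lower (r / (1 + r * s))) x)"
        using f x r unfolding highest_weight_def weight_def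
        by (metis act_upper_lower_closed(2) nonzero_imp_inverse_nonzero power_0 mult_1)
      ultimately have "?l ^ n * poly (q (act (upper s) x)) r = poly (q x) (r / (1 + r * s))"
        using q[OF act_upper_lower_closed(1)[OF x], of r s] q[OF x] by (simp del: act_mat2)
      then show ?thesis using r by (simp add: field_simps)
    qed
    have rhs: "(?rhs has_field_derivative e 1 x + of_nat n * s * f x) (at 0)"
    proof -
      have "((\<lambda>r. poly (q x) (r / (1 + r * s))) has_field_derivative e 1 x * 1) (at 0)"
        by (rule DERIV_chain2[where f = "poly (q x)"]) (use der in \<open>auto intro!: derivative_eq_intros\<close>)
      moreover have "((\<lambda>r. (1 + r * s) ^ n) has_field_derivative of_nat n * s) (at 0)"
        by (auto intro!: derivative_eq_intros)
      ultimately have "(?rhs has_field_derivative of_nat n * s * poly (q x) (0 / (1 + 0 * s)) + e 1 x * 1 * (1 + 0 * s) ^ n) (at 0)"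
        by (rule DERIV_mult[rotated])
      moreover have "poly (q x) 0 = f x" using q[OF x, of 0] x by simp
      ultimately show ?thesis by (simp add: add.commute)
    qed
    have "((\<lambda>r. 1 + r * s) \<longlongrightarrow> 1 + 0 * s) (at 0)" by (intro tendsto_intros)
    then have "eventually (\<lambda>r. 1 + r * s \<noteq> 0) (at 0)"
      by (rule tendsto_imp_eventually_ne) simp
    then have "eventually (\<lambda>r. 1 + r * s \<noteq> 0) (nhds 0)"
      by (simp add: eventually_nhds_conv_at)
    then have ev: "eventually (\<lambda>r. ?rhs r = poly (q (act (upper s) x)) r) (nhds 0)"
      by eventually_elim (simp add: eq)
    from rhs show "(poly (q (act (upper s) x)) has_field_derivative e 1 x + of_nat n * s * f x) (at 0)"
      by (rule DERIV_cong_ev[OF refl ev refl, THEN iffD1])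
  qed
  then show ?thesis using that[of e d] e(1) q q1 by (simp add: q_def)
qed

section \<open>Tangent directions at a point of an orbit\<close>

lemma orbit_function:
  assumes "f \<in> R" "x \<in> P"
  obtains F where "F \<in> mpoly" "\<And>g. det g = 1 \<Longrightarrow> f (act g x) = F g"
proof -
  obtain h where h: "h \<in> tensor_functions R" "\<And>g x. det g = 1 \<Longrightarrow> x \<in> P \<Longrightarrow> f (act g x) = h g x"
    using rational[OF assms(1)] by blast
  from h(1) have "(\<lambda>g. h g x) \<in> mpoly"
  proof induction
    case (base F f)
    then show ?case by (intro mpoly.intros)
  next
    case (add h k)
    then show ?case by (intro mpoly.intros)
  qed
  then show ?thesis using that[of "\<lambda>g. h g x"] h(2) assms(2) by simp
qed

text \<open>The derivative at \<open>p\<close> in the direction of the matrix with rows \<open>(0, -k)\<close> and \<open>(1, 0)\<close>.\<close>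

definition point_derivative :: "'a \<Rightarrow> complex \<Rightarrow> ('a \<Rightarrow> complex) \<Rightarrow> complex \<Rightarrow> bool"
  where "point_derivative p k f d \<longleftrightarrow>
    ((\<lambda>z. f (act (upper (- k * z) ** lower z) p)) has_field_derivative d) (at 0)"

text \<open>On the orbit \<open>f\<close> is a polynomial in the matrix entries, so its derivative
  exists and depends only on the velocity of the curve. This permits replacing the curve of
  \<open>point_derivative\<close> by a one-parameter subgroup with the same velocity.\<close>

lemma point_derivative_curve:
  assumes "f \<in> R" "p \<in> P"
  obtains d where "point_derivative p k f d"
    "\<And>\<gamma>. \<gamma> 0 = mat 1 \<Longrightarrow> (\<And>z. det (\<gamma> z) = 1) \<Longrightarrow>
      (\<And>i j. ((\<lambda>z. \<gamma> z $ i $ j) has_field_derivative mat2 0 (- k) 1 0 $ i $ j) (at 0)) \<Longrightarrow>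
      ((\<lambda>z. f (act (\<gamma> z) p)) has_field_derivative d) (at 0)"
proof -
  obtain F where F: "F \<in> mpoly" "\<And>g. det g = 1 \<Longrightarrow> f (act g p) = F g" by (rule orbit_function[OF assms]) blast
  obtain D where D: "tangent_map F D" using mpoly_tangent[OF F(1)] by blast
  define d where "d = (\<Sum>i\<in>UNIV. \<Sum>j\<in>UNIV. D $ i $ j * mat2 0 (- k) 1 0 $ i $ j)"
  have *: "((\<lambda>z. f (act (\<gamma> z) p)) has_field_derivative d) (at 0)"
    if "\<gamma> 0 = mat 1" "\<And>z. det (\<gamma> z) = 1"
      "\<And>i j. ((\<lambda>z. \<gamma> z $ i $ j) has_field_derivative mat2 0 (- k) 1 0 $ i $ j) (at 0)" for \<gamma>
    using tangent_mapD[OF D that(1,3)] F(2)[OF that(2)] by (simp add: d_def)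
  have "point_derivative p k f d"
    unfolding point_derivative_def
  proof (rule *)
    fix i j :: 2
    show "((\<lambda>z. (upper (- k * z) ** lower z) $ i $ j) has_field_derivative mat2 0 (- k) 1 0 $ i $ j) (at 0)"
      using exhaust_2[of i] exhaust_2[of j] by (auto intro!: derivative_eq_intros)
  qed (auto simp: mat_1_eq_mat2)
  then show ?thesis using that * by blast
qed

context
  fixes p and k :: complex assumes p: "p \<in> P"
begin

lemma point_derivative_unique: "point_derivative p k f d \<Longrightarrow> point_derivative p k f d' \<Longrightarrow> d = d'"
  unfolding point_derivative_def by (rule DERIV_unique)

lemma point_derivative_cong:
  assumes "point_derivative p k f d" "\<And>x. x \<in> P \<Longrightarrow> h x = f x" shows "point_derivative p k h d"
proof -
  have "h (act (upper (- k * z) ** lower z) p) = f (act (upper (- k * z) ** lower z) p)" for z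
    by (rule assms(2)) (use p in \<open>auto intro!: act_closed\<close>)
  then show ?thesis using assms(1) unfolding point_derivative_def by simp
qed

lemma curve_at_0: "act (upper (- k * 0) ** lower 0) p = p"
  using p by simp

lemma point_derivative_mult:
  assumes "point_derivative p k f d" "point_derivative p k h d'"
  shows "point_derivative p k (\<lambda>x. f x * h x) (d * h p + d' * f p)"
  using DERIV_mult[OF assms[unfolded point_derivative_def]] curve_at_0
  unfolding point_derivative_def by simp

lemma point_derivative_power:
  assumes "point_derivative p k f 0" shows "point_derivative p k (\<lambda>x. f x ^ m) 0"
  using DERIV_power[OF assms[unfolded point_derivative_def], of m] unfolding point_derivative_def by simp

lemma point_derivative_cmult:
  "point_derivative p k f d \<Longrightarrow> point_derivative p k (\<lambda>x. c * f x) (c * d)"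
  unfolding point_derivative_def by (rule DERIV_cmult)

lemma point_derivative_add:
  "point_derivative p k f d \<Longrightarrow> point_derivative p k h d' \<Longrightarrow> point_derivative p k (\<lambda>x. f x + h x) (d + d')"
  unfolding point_derivative_def by (rule DERIV_add)

lemma point_derivative_sum:
  "(\<And>i. i \<in> I \<Longrightarrow> point_derivative p k (f i) 0) \<Longrightarrow> point_derivative p k (\<lambda>x. \<Sum>i\<in>I. f i x) 0"
proof (induction I rule: infinite_finite_induct)
  case (insert i I)
  then show ?case using point_derivative_add[of "f i" 0 "\<lambda>x. \<Sum>i\<in>I. f i x" 0] by simp
qed (simp_all add: point_derivative_def)

lemma point_derivative_vanishing: "vanishes f \<Longrightarrow> point_derivative p k f 0"
  by (rule point_derivative_cong[of "\<lambda>x. 0"]) (auto simp: vanishes_def point_derivative_def)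

end

text \<open>Unipotent invariants are sums of highest weight functions, each with a power
  proportional to a power of \<open>f\<close>, so they inherit the vanishing derivative. Other
  functions reduce to invariants by induction on the length of their expansion, because
  \<open>g\<close> serves as a coordinate along \<open>upper\<close> wherever \<open>f\<close> is
  nonzero.\<close>

lemma point_derivative_zero:
  assumes f: "highest_weight n f" "n > 0" "p \<in> P" "f p \<noteq> 0" "point_derivative p k f 0"
    and g: "g \<in> R" "g p = 0" "point_derivative p k g 0"
      "\<And>s x. x \<in> P \<Longrightarrow> g (act (upper s) x) = g x + of_nat n * s * f x"
  shows "a \<in> R \<Longrightarrow> upper_expansion a m b \<Longrightarrow> point_derivative p k a 0"
proof (induction m arbitrary: a b)
  case 0
  have inv: "upper_invariant a"
    using 0(2) upper_expansion_at_0[OF 0(2)] by (auto simp: upper_invariant_def upper_expansion_def)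
  obtain N d c where c: "\<And>i. c i \<in> R" "\<And>i. weight N i (c i)"
    "\<And>l x. l \<noteq> 0 \<Longrightarrow> x \<in> P \<Longrightarrow> l ^ N * a (act (diag2 l) x) = (\<Sum>i\<le>d. l ^ i * c i x)"
    "\<And>i x. i > d \<Longrightarrow> c i x = 0" "\<And>x. x \<in> P \<Longrightarrow> a x = (\<Sum>i\<le>d. c i x)"
    by (rule weight_decomposition[OF 0(1)]) blast
  have "point_derivative p k (c i) 0" for i
  proof (cases "vanishes (c i)")
    case True then show ?thesis by (rule point_derivative_vanishing[OF f(3)])
  next
    case False
    have "upper_invariant (c i)" by (rule weight_component_upper_invariant[OF inv c(4) c(3)])
    then have hw: "highest_weight (N - i) (c i)" using highest_weight_nonneg[OF c(1) _ c(2) False] by blast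
    have nz: "c i p \<noteq> 0" by (rule highest_weight_nonzero[OF f(1-4) hw False])
    have "\<not> vanishes f" using f by (auto simp: vanishes_def)
    then obtain e where e: "e \<noteq> 0" "\<And>x. x \<in> P \<Longrightarrow> c i x ^ n = e * f x ^ (N - i)"
      using highest_weight_proportional[OF f(1) _ hw False] by blast
    obtain d' where d': "point_derivative p k (c i) d'"
      by (rule point_derivative_curve[OF c(1)[of i] f(3), of k]) blast
    have "point_derivative p k (\<lambda>x. c i x ^ n) (of_nat n * (d' * c i p ^ (n - 1)))"
      using DERIV_power[OF d'[unfolded point_derivative_def], of n] curve_at_0[OF f(3)]
      unfolding point_derivative_def by simp
    moreover have "point_derivative p k (\<lambda>x. c i x ^ n) (e * 0)"
      by (rule point_derivative_cong[OF f(3) point_derivative_cmult[OF f(3) point_derivative_power[OF f(3) f(5)]]])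
        (rule e(2))
    ultimately have "of_nat n * (d' * c i p ^ (n - 1)) = e * 0" by (rule point_derivative_unique[OF f(3)])
    then have "d' = 0" using nz f(2) by simp
    then show ?thesis using d' by simp
  qed
  then have "point_derivative p k (\<lambda>x. \<Sum>i\<le>d. c i x) 0" by (intro point_derivative_sum[OF f(3)])
  then show ?case by (rule point_derivative_cong[OF f(3)]) (rule c(5))
next
  case (Suc m)
  let ?K = "Suc m"
  let ?e = "inverse (of_nat n ^ ?K) :: complex"
  have fR: "f \<in> R" and finv: "\<And>s x. x \<in> P \<Longrightarrow> f (act (upper s) x) = f x"
    using f(1) by (auto simp: highest_weight_def upper_invariant_def)
  have bR: "b i \<in> R" for i using Suc.prems(2) by (simp add: upper_expansion_def)
  have binv: "\<And>s x. x \<in> P \<Longrightarrow> b ?K (act (upper s) x) = b ?K x"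
    using leading_upper_invariant[OF Suc.prems(2)] by (auto simp: upper_invariant_def)
  \<comment> \<open>Along \<open>upper\<close> the power of \<open>g\<close> has leading coefficient
    \<open>(n f) ^ (m + 1)\<close>, so this combination cancels the top term of
    \<open>f ^ (m + 1) * a\<close> and its expansion is shorter by one.\<close>
  define c where "c = (\<lambda>x. f x ^ ?K * a x - ?e * (g x ^ ?K * b ?K x))"
  define b' where "b' = (\<lambda>i x. f x ^ ?K * b i x - ?e * (of_nat (?K choose i) * (of_nat n * f x) ^ i * g x ^ (?K - i) * b ?K x))"
  have cR: "c \<in> R" unfolding c_def by (intro R_intros fR g(1) bR Suc.prems(1))
  have b'R: "b' i \<in> R" for i unfolding b'_def by (intro R_intros fR g(1) bR)
  have exp: "c (act (upper s) x) = (\<Sum>i\<le>m. s ^ i * b' i x)" if x: "x \<in> P" for s x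
  proof -
    have a: "a (act (upper s) x) = (\<Sum>i\<le>?K. s ^ i * b i x)"
      using Suc.prems(2) x unfolding upper_expansion_def by blast
    have gK: "g (act (upper s) x) ^ ?K = (\<Sum>i\<le>?K. of_nat (?K choose i) * (s * (of_nat n * f x)) ^ i * g x ^ (?K - i))"
      unfolding g(4)[OF x] by (subst add.commute, subst binomial_ring) (simp add: mult_ac)
    have "c (act (upper s) x) = f x ^ ?K * (\<Sum>i\<le>?K. s ^ i * b i x)
      - ?e * ((\<Sum>i\<le>?K. of_nat (?K choose i) * (s * (of_nat n * f x)) ^ i * g x ^ (?K - i)) * b ?K x)"
      unfolding c_def finv[OF x] binv[OF x] a gK ..
    also have "\<dots> = (\<Sum>i\<le>?K. s ^ i * b' i x)"
      unfolding b'_def sum_distrib_left sum_distrib_right sum_subtractf[symmetric]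
      by (rule sum.cong[OF refl]) (simp only: power_mult_distrib right_diff_distrib mult_ac)
    also have "\<dots> = (\<Sum>i\<le>m. s ^ i * b' i x) + s ^ ?K * b' ?K x" by simp
    also have "b' ?K x = f x ^ ?K * b ?K x - (?e * of_nat n ^ ?K) * (f x ^ ?K * b ?K x)"
      unfolding b'_def by (simp only: power_mult_distrib binomial_n_n of_nat_1 diff_self_eq_0 power_0 mult_1 mult_1_right mult.assoc)
    also have "?e * of_nat n ^ ?K = 1" by (rule left_inverse) (use f(2) in simp)
    finally show ?thesis by simp
  qed
  have "upper_expansion c m b'" unfolding upper_expansion_def using b'R exp by blast
  from Suc.IH[OF cR this] have pc: "point_derivative p k c 0" .
  obtain d' where d': "point_derivative p k (b ?K) d'"
    by (rule point_derivative_curve[OF bR f(3), of k]) blast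
  have "point_derivative p k (\<lambda>x. g x ^ ?K * b ?K x) (0 * b ?K p + d' * g p ^ ?K)"
    by (rule point_derivative_mult[OF f(3) point_derivative_power[OF f(3) g(3)] d'])
  then have pg: "point_derivative p k (\<lambda>x. g x ^ ?K * b ?K x) 0" using g(2) by simp
  have 1: "point_derivative p k (\<lambda>x. f x ^ ?K * a x) (0 + ?e * 0)"
    by (rule point_derivative_cong[OF f(3) point_derivative_add[OF f(3) pc point_derivative_cmult[OF f(3) pg]]])
      (simp add: c_def)
  obtain d where d: "point_derivative p k a d"
    by (rule point_derivative_curve[OF Suc.prems(1) f(3), of k]) blast
  have "point_derivative p k (\<lambda>x. f x ^ ?K * a x) (0 * a p + d * f p ^ ?K)"
    by (rule point_derivative_mult[OF f(3) point_derivative_power[OF f(3) f(5)] d])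
  from point_derivative_unique[OF f(3) this 1] have "d = 0" using f(4) by simp
  then show ?case using d by simp
qed

text \<open>The derivative of \<open>a\<close> along the curve at parameter \<open>w\<close> is the
  derivative at 0 of the translate of \<open>a\<close> by \<open>\<gamma> w\<close>, which again
  lies in \<open>R\<close>. So it vanishes everywhere, every function is constant along the curve,
  and functions separate points.\<close>

lemma one_parameter_subgroup_fixes:
  assumes p: "p \<in> P" and 0: "\<And>a. a \<in> R \<Longrightarrow> point_derivative p k a 0"
    and \<gamma>: "\<And>z. det (\<gamma> z) = 1" "\<And>z w. \<gamma> (z + w) = \<gamma> z ** \<gamma> w" "\<gamma> 0 = mat 1"
      "\<And>i j. ((\<lambda>z. \<gamma> z $ i $ j) has_field_derivative mat2 0 (- k) 1 0 $ i $ j) (at 0)"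
  shows "act (\<gamma> z) p = p"
proof (rule separated)
  fix a assume a: "a \<in> R"
  have "((\<lambda>z. a (act (\<gamma> z) p)) has_field_derivative 0) (at w)" for w
  proof -
    have a': "(\<lambda>x. a (act (\<gamma> w) x)) \<in> R" by (rule R_act[OF a \<gamma>(1)])
    obtain d where d: "point_derivative p k (\<lambda>x. a (act (\<gamma> w) x)) d"
      "((\<lambda>z. a (act (\<gamma> w) (act (\<gamma> z) p))) has_field_derivative d) (at 0)"
      by (rule point_derivative_curve[OF a' p, of k]) (use \<gamma> in blast)
    have "d = 0" by (rule point_derivative_unique[OF p d(1) 0[OF a']])
    moreover have "act (\<gamma> w) (act (\<gamma> z) p) = act (\<gamma> (z + w)) p" for z
      using act_act[OF \<gamma>(1,1) p] \<gamma>(2) by (metis add.commute)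
    ultimately have "((\<lambda>z. a (act (\<gamma> (z + w)) p)) has_field_derivative 0) (at 0)" using d(2) by simp
    then show ?thesis using DERIV_shift[of "\<lambda>z. a (act (\<gamma> z) p)" 0 0 w] by simp
  qed
  then obtain c where "\<forall>w\<in>UNIV. a (act (\<gamma> w) p) = c"
    using has_field_derivative_zero_constant[of UNIV "\<lambda>z. a (act (\<gamma> z) p)"] by auto
  then have "a (act (\<gamma> z) p) = a (act (\<gamma> 0) p)" by simp
  then show "a (act (\<gamma> z) p) = a p" using p by (simp add: \<gamma>(3) act_1)
qed (use p \<gamma>(1) act_closed in auto)

text \<open>Two conditions on a three-dimensional Lie algebra leave a line. Normalizing
  \<open>p\<close> so that the lower derivative vanishes there puts this line into the form with
  rows \<open>(0, -k)\<close> and \<open>(1, 0)\<close>, which is nilpotent for \<open>k = 0\<close>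
  and semisimple otherwise.\<close>

lemma point_with_large_stabilizer:
  obtains p where "p \<in> P" "\<And>a. a \<in> R \<Longrightarrow> (\<And>g. det g = 1 \<Longrightarrow> a (act g p) = 0) \<Longrightarrow> vanishes a"
    "(\<forall>r. act (lower r) p = p) \<or> (\<forall>l. l \<noteq> 0 \<longrightarrow> act (diag2 l) p = p)"
proof -
  obtain f0 l0 x0 where "f0 \<in> R" "l0 \<noteq> 0" "x0 \<in> P" "f0 (act (diag2 l0) x0) \<noteq> f0 x0"
    using torus_nontrivial by blast
  then obtain n f where f: "n > 0" "highest_weight n f" "\<not> vanishes f"
    by (rule positive_highest_weight_exists)
  obtain p0 where p0: "p0 \<in> P" "f p0 \<noteq> 0" using f(3) by (auto simp: vanishes_def)
  have fR: "f \<in> R" and finv: "\<And>s x. x \<in> P \<Longrightarrow> f (act (upper s) x) = f x"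
    using f(2) by (auto simp: highest_weight_def upper_invariant_def)
  obtain d e where e: "\<And>i. e i \<in> R"
    "\<And>z x. x \<in> P \<Longrightarrow> f (act (lower z) x) = poly (\<Sum>i\<le>d. monom (e i x) i) z"
    "\<And>s x. x \<in> P \<Longrightarrow> e 1 (act (upper s) x) = e 1 x + of_nat n * s * f x"
    "\<And>x. coeff (\<Sum>i\<le>d. monom (e i x) i) 1 = e 1 x"
    by (rule lower_derivative[OF f(2)]) blast
  \<comment> \<open>The parameter solves \<open>e 1 p0 + n * s * f p0 = 0\<close>, so that the lower
    derivative of \<open>f\<close> vanishes at \<open>p\<close>.\<close>
  define p where "p = act (upper (- e 1 p0 / (of_nat n * f p0))) p0"
  have p: "p \<in> P" using p0 by (simp add: p_def)
  have fp: "f p \<noteq> 0" using p0 finv by (simp add: p_def)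
  have gp: "e 1 p = 0" using p0 f(1) unfolding p_def e(3)[OF p0(1)] by simp
  define q where "q = (\<Sum>i\<le>d. monom (e i p) i)"
  \<comment> \<open>Along the curve of \<open>point_derivative\<close>, \<open>e 1\<close> is the
    derivative of \<open>q\<close> at \<open>z\<close> minus \<open>n * k * z\<close> times the
    value of \<open>q\<close> there; \<open>k\<close> is chosen so that the derivative of this at 0
    is zero.\<close>
  define k where "k = poly (pderiv (pderiv q)) 0 / (of_nat n * f p)"
  have q: "f (act (lower z) p) = poly q z" for z using e(2)[OF p] by (simp add: q_def)
  have q1: "poly (pderiv q) 0 = 0" using e(4)[of p] gp by (simp add: q_def poly_0_coeff_0 coeff_pderiv)
  have gz: "e 1 (act (lower z) p) = poly (pderiv q) z" for z
  proof (rule DERIV_unique)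
    let ?r = "\<Sum>i\<le>d. monom (e i (act (lower z) p)) i"
    have "poly ?r r = poly q (r + z)" for r
      using e(2)[of "act (lower z) p" r] q[of "r + z"] p by (simp add: add.commute)
    then show "((\<lambda>r. poly q (r + z)) has_field_derivative e 1 (act (lower z) p)) (at 0)"
      using poly_DERIV[of ?r 0] e(4)[of "act (lower z) p"] by (simp add: poly_0_coeff_0 coeff_pderiv)
    show "((\<lambda>r. poly q (r + z)) has_field_derivative poly (pderiv q) z) (at 0)"
      using poly_DERIV[of q z] DERIV_shift[of "poly q" "poly (pderiv q) z" 0 z] by simp
  qed
  have curve: "act (upper (- k * z) ** lower z) p = act (upper (- k * z)) (act (lower z) p)" for z
    using p by simp
  have pf: "point_derivative p k f 0"
    unfolding point_derivative_def curve using finv[of "act (lower z) p" for z] p q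
    using DERIV_cong[OF poly_DERIV q1] by (simp del: act_mat2)
  have "((\<lambda>z. poly (pderiv q) z + of_nat n * (- k * z) * poly q z) has_field_derivative
     poly (pderiv (pderiv q)) 0 + of_nat n * (- k) * f p) (at 0)"
    using q[of 0] p by (auto intro!: derivative_eq_intros poly_DERIV)
  moreover have "poly (pderiv (pderiv q)) 0 + of_nat n * (- k) * f p = 0" using f(1) fp by (simp add: k_def)
  ultimately have pg: "point_derivative p k (e 1) 0"
    unfolding point_derivative_def curve using e(3)[of "act (lower z) p" for z] p q gz
    by (simp del: act_mat2)
  have 0: "point_derivative p k a 0" if a: "a \<in> R" for a
  proof -
    obtain m b where "upper_expansion a m b" by (rule upper_expansion_exists[OF a])
    then show ?thesis using point_derivative_zero[OF f(2,1) p fp pf e(1) gp pg e(3) a] by blast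
  qed
  have inj: "vanishes a" if "a \<in> R" "\<And>g. det g = 1 \<Longrightarrow> a (act g p) = 0" for a
    by (rule orbit_restriction_injective[OF f(2,1) p fp that])
  show ?thesis
  proof (cases "k = 0")
    case True
    have "act (lower r) p = p" for r
    proof (rule one_parameter_subgroup_fixes[where \<gamma> = lower, OF p 0])
      fix i j :: 2
      show "((\<lambda>z. lower z $ i $ j) has_field_derivative mat2 0 (- k) 1 0 $ i $ j) (at 0)"
        using exhaust_2[of i] exhaust_2[of j] True by auto
    qed (auto simp: mat_1_eq_mat2 add.commute)
    then show ?thesis using that[OF p inj] by blast
  next
    case False
    \<comment> \<open>\<open>\<nu>\<close> and \<open>- \<nu>\<close> are the eigenvalues of the
      matrix with rows \<open>(0, -k)\<close> and \<open>(1, 0)\<close>. The columns of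
      \<open>g\<close> are eigenvectors scaled to determinant 1, and \<open>g'\<close> is the
      inverse of \<open>g\<close>.\<close>
    define \<nu> where "\<nu> = csqrt (- k)"
    have \<nu>: "\<nu> * \<nu> = - k" "\<nu> \<noteq> 0" using False power2_csqrt[of "- k"] by (auto simp: \<nu>_def power2_eq_square)
    define g where "g = mat2 (1/2) (- \<nu>) (1 / (2 * \<nu>)) 1"
    define g' where "g' = mat2 1 \<nu> (- 1 / (2 * \<nu>)) (1/2)"
    have gg: "det g = 1" "det g' = 1" "g ** g' = mat 1" "g' ** g = mat 1"
      using \<nu>(2) by (auto simp: g_def g'_def mat_1_eq_mat2 field_simps)
    define \<gamma> where "\<gamma> z = g ** diag2 (exp (\<nu> * z)) ** g'" for z
    have \<gamma>: "\<gamma> z = mat2 ((exp (\<nu> * z) + exp (- (\<nu> * z))) / 2) (\<nu> * (exp (\<nu> * z) - exp (- (\<nu> * z))) / 2)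
      ((exp (\<nu> * z) - exp (- (\<nu> * z))) / (2 * \<nu>)) ((exp (\<nu> * z) + exp (- (\<nu> * z))) / 2)" for z
      using \<nu>(2) by (simp add: \<gamma>_def g_def g'_def exp_minus field_simps)
    have fixed: "act (\<gamma> z) p = p" for z
    proof (rule one_parameter_subgroup_fixes[where \<gamma> = \<gamma>, OF p 0])
      show "det (\<gamma> z) = 1" for z unfolding \<gamma>_def using gg by (simp add: det_mul)
      show "\<gamma> (z + w) = \<gamma> z ** \<gamma> w" for z w
      proof -
        have "\<gamma> z ** \<gamma> w = g ** diag2 (exp (\<nu> * z)) ** (g' ** g) ** diag2 (exp (\<nu> * w)) ** g'"
          by (simp only: \<gamma>_def matrix_mul_assoc)
        also have "\<dots> = g ** (diag2 (exp (\<nu> * z)) ** diag2 (exp (\<nu> * w))) ** g'"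
          by (simp only: gg matrix_mul_rid matrix_mul_assoc)
        also have "diag2 (exp (\<nu> * z)) ** diag2 (exp (\<nu> * w)) = diag2 (exp (\<nu> * (z + w)))"
          by (simp add: distrib_left exp_add)
        finally show ?thesis by (simp add: \<gamma>_def)
      qed
      show "\<gamma> 0 = mat 1" by (simp add: \<gamma> mat_1_eq_mat2)
      fix i j :: 2
      show "((\<lambda>z. \<gamma> z $ i $ j) has_field_derivative mat2 0 (- k) 1 0 $ i $ j) (at 0)"
        using exhaust_2[of i] exhaust_2[of j] \<nu> unfolding \<gamma>
        by (auto intro!: derivative_eq_intros simp: field_simps)
    qed
    define p' where "p' = act g' p"
    have p': "p' \<in> P" "act g p' = p" using p gg by (auto simp: p'_def act_closed act_act act_1)
    have "act (diag2 l) p' = p'" if l: "l \<noteq> 0" for l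
    proof -
      obtain z where "exp z = l" using l by (metis exp_Ln)
      then have z: "exp (\<nu> * (z / \<nu>)) = l" using \<nu> by simp
      have "act (g' ** \<gamma> (z / \<nu>)) p = p'"
        using act_act[of g' "\<gamma> (z / \<nu>)" p] fixed[of "z / \<nu>"] gg p by (simp add: p'_def \<gamma>_def det_mul)
      moreover have "g' ** \<gamma> (z / \<nu>) = diag2 l ** g'"
        unfolding \<gamma>_def z by (simp only: matrix_mul_assoc gg matrix_mul_lid)
      moreover have "act (diag2 l ** g') p = act (diag2 l) p'"
        unfolding p'_def by (rule act_act[symmetric]) (use l gg p in auto)
      ultimately show ?thesis by simp
    qed
    moreover have "vanishes a" if a: "a \<in> R" "\<And>h. det h = 1 \<Longrightarrow> a (act h p') = 0" for a
    proof (rule inj[OF a(1)])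
      fix h :: "complex^2^2" assume h: "det h = 1"
      have "act h p = act (h ** g) p'" using p' h gg by (metis act_act)
      then show "a (act h p) = 0" using a(2) h gg by (simp add: det_mul)
    qed
    ultimately show ?thesis using that[OF p'(1)] by blast
  qed
qed

end

section \<open>The case of a point fixed by a unipotent subgroup\<close>

text \<open>Matrices with nonzero lower right entry are dense: if this entry is 0, it becomes
  \<open>c * z\<close> after right multiplication by \<open>upper z\<close>, and a polynomial in
  \<open>z\<close> that vanishes for all nonzero \<open>z\<close> vanishes at 0.\<close>

lemma mpoly_dense_zero:
  assumes "F \<in> mpoly" and 0: "\<And>a b c d. a * d - b * c = 1 \<Longrightarrow> d \<noteq> 0 \<Longrightarrow> F (mat2 a b c d) = 0"
    and "det g = 1"
  shows "F g = 0"
proof -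
  obtain a b c d where g: "g = mat2 a b c d" by (rule mat2_cases)
  show ?thesis
  proof (cases "d = 0")
    case False then show ?thesis using 0 assms(3) by (simp add: g)
  next
    case True
    then have bc: "b * c = -1" using assms(3) by (simp add: g minus_equation_iff)
    then have c: "c \<noteq> 0" by auto
    obtain p where p: "\<And>z. F (g ** upper z) = poly p z"
      using mpoly_upper[OF mpoly_mult_left[OF assms(1), of g]] by auto
    have "poly p z = 0" if "z \<noteq> 0" for z
      unfolding p[symmetric] g using bc c that True by (simp, intro 0) (auto simp: algebra_simps)
    then have "infinite {z. poly p z = 0}"
      using infinite_super[of "UNIV - {0}" "{z. poly p z = 0}"] by (auto simp: infinite_UNIV_char_0)
    then have "p = 0" using poly_roots_finite by blast
    then show ?thesis using p[of 0] by (simp add: g)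
  qed
qed

text \<open>Every character of \<open>R\<close> is evaluation at a point. This is where affineness
  enters: maps of the variety can be built from endomorphisms of its ring.\<close>

locale complete_sl2_variety = multiplicity_free_sl2_variety +
  assumes hom_is_evaluation: "(\<And>c. ev (\<lambda>x. c) = c) \<Longrightarrow>
      (\<And>f f'. f \<in> R \<Longrightarrow> f' \<in> R \<Longrightarrow> ev (\<lambda>x. f x + f' x) = ev f + ev f') \<Longrightarrow>
      (\<And>f f'. f \<in> R \<Longrightarrow> f' \<in> R \<Longrightarrow> ev (\<lambda>x. f x * f' x) = ev f * ev f') \<Longrightarrow>
      (\<And>f f'. f \<in> R \<Longrightarrow> (\<And>x. x \<in> P \<Longrightarrow> f' x = f x) \<Longrightarrow> ev f' = ev f) \<Longrightarrow>
      \<exists>x\<in>P. \<forall>f\<in>R. ev f = f x"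
begin

context
  fixes p assumes p: "p \<in> P"
    and inj: "\<And>a. a \<in> R \<Longrightarrow> (\<And>g. det g = 1 \<Longrightarrow> a (act g p) = 0) \<Longrightarrow> vanishes a"
begin

lemma vanishesI_dense:
  assumes "a \<in> R" "\<And>x b c d. x * d - b * c = 1 \<Longrightarrow> d \<noteq> 0 \<Longrightarrow> a (act (mat2 x b c d) p) = 0"
  shows "vanishes a"
proof (rule inj[OF assms(1)])
  fix g :: "complex^2^2" assume g: "det g = 1"
  obtain F where F: "F \<in> mpoly" "\<And>g. det g = 1 \<Longrightarrow> a (act g p) = F g"
    by (rule orbit_function[OF assms(1) p]) blast
  have "F g = 0" by (rule mpoly_dense_zero[OF F(1) _ g]) (use F(2) assms(2) in \<open>metis det_mat2\<close>)
  then show "a (act g p) = 0" using F(2) g by simp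
qed

section \<open>Functions on a cone: the orbit of a point fixed by \<open>lower\<close>\<close>

context
  assumes fixed: "\<And>r. act (lower r) p = p"
begin

lemma orbit_decomposition:
  assumes "x * d - b * c = 1" "d \<noteq> 0"
  shows "act (mat2 x b c d) p = act (diag2 (inverse d)) (act (upper (b * d)) p)"
proof -
  have x: "x = (1 + b * c) / d" using assms by (simp add: field_simps)
  have "diag2 (inverse d) ** (upper (b * d) ** lower (c / d)) = mat2 x b c d"
    using assms(2) by (simp add: x field_simps)
  then have "act (mat2 x b c d) p = act (diag2 (inverse d)) (act (upper (b * d) ** lower (c / d)) p)"
    using act_act[of "diag2 (inverse d)" "upper (b * d) ** lower (c / d)" p] assms(2) p
    by (simp add: det_mul del: mat2_mult)
  also have "act (upper (b * d) ** lower (c / d)) p = act (upper (b * d)) p"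
    using act_act[of "upper (b * d)" "lower (c / d)" p] p fixed by simp
  finally show ?thesis .
qed

text \<open>Right multiplication by \<open>lower\<close> changes only the first column, so functions
  on the orbit depend only on the second column \<open>(b, d)\<close>. A weight function becomes
  \<open>d ^ (N - i)\<close> times a polynomial in \<open>b * d\<close>; the exponents stay on
  separate sides because \<open>N - i\<close> may be negative.\<close>

definition has_form :: "('a \<Rightarrow> complex) \<Rightarrow> nat \<Rightarrow> nat \<Rightarrow> complex poly \<Rightarrow> bool"
  where "has_form a N i q \<longleftrightarrow> (\<forall>x b c d. x * d - b * c = 1 \<longrightarrow> d \<noteq> 0 \<longrightarrow>
    d ^ i * a (act (mat2 x b c d) p) = d ^ N * poly q (b * d))"

lemma has_formD: "has_form a N i q \<Longrightarrow> x * d - b * c = 1 \<Longrightarrow> d \<noteq> 0 \<Longrightarrow>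
  d ^ i * a (act (mat2 x b c d) p) = d ^ N * poly q (b * d)"
  unfolding has_form_def by blast

lemma weight_has_form:
  assumes "weight N i a" "upper_expansion a n c"
  shows "has_form a N i (\<Sum>j\<le>n. monom (c j p) j)"
  unfolding has_form_def
proof (intro allI impI)
  fix x b c' d :: complex assume d: "x * d - b * c' = 1" "d \<noteq> 0"
  have "inverse d ^ N * a (act (diag2 (inverse d)) (act (upper (b * d)) p)) = inverse d ^ i * a (act (upper (b * d)) p)"
    using assms(1) d(2) p unfolding weight_def
    by (metis act_upper_lower_closed(1) nonzero_imp_inverse_nonzero)
  moreover have "a (act (upper (b * d)) p) = poly (\<Sum>j\<le>n. monom (c j p) j) (b * d)"
    using assms(2) p by (simp add: upper_expansion_def poly_sum poly_monom mult.commute)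
  ultimately have "inverse d ^ N * a (act (mat2 x b c' d) p) = inverse d ^ i * poly (\<Sum>j\<le>n. monom (c j p) j) (b * d)"
    unfolding orbit_decomposition[OF d] by simp
  then show "d ^ i * a (act (mat2 x b c' d) p) = d ^ N * poly (\<Sum>j\<le>n. monom (c j p) j) (b * d)"
    using d(2) by (simp add: field_simps)
qed

lemma has_form_weight:
  assumes "has_form a N i q" "a \<in> R" shows "weight N i a"
  unfolding weight_def
proof (intro allI impI ballI)
  fix l :: complex and y assume l: "l \<noteq> 0" and y: "y \<in> P"
  have "vanishes (\<lambda>y. l ^ N * a (act (diag2 l) y) - l ^ i * a y)"
  proof (rule vanishesI_dense)
    show "(\<lambda>y. l ^ N * a (act (diag2 l) y) - l ^ i * a y) \<in> R"
      by (intro R_intros R_act assms(2)) (use l in auto)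
    fix x b c d :: complex assume d: "x * d - b * c = 1" "d \<noteq> 0"
    let ?d = "inverse l * d"
    have 1: "?d ^ i * a (act (mat2 (l * x) (l * b) (inverse l * c) ?d) p) = ?d ^ N * poly q (l * b * ?d)"
      by (rule has_formD[OF assms(1)]) (use d l in \<open>auto simp: field_simps\<close>)
    have 2: "d ^ i * a (act (mat2 x b c d) p) = d ^ N * poly q (b * d)"
      by (rule has_formD[OF assms(1) d])
    have 3: "act (diag2 l) (act (mat2 x b c d) p) = act (mat2 (l * x) (l * b) (inverse l * c) ?d) p"
      using l d p by simp
    have "l * b * ?d = b * d" using l by simp
    then have "d ^ i * (l ^ N * a (act (diag2 l) (act (mat2 x b c d) p))) = d ^ i * (l ^ i * a (act (mat2 x b c d) p))"
      using 1 2 l unfolding 3 by (simp add: power_mult_distrib field_simps)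
    then show "l ^ N * a (act (diag2 l) (act (mat2 x b c d) p)) - l ^ i * a (act (mat2 x b c d) p) = 0"
      using d(2) by simp
  qed
  then show "l ^ N * a (act (diag2 l) y) = l ^ i * a y" using y by (simp add: vanishes_def)
qed

lemma highest_weight_on_orbit:
  assumes "highest_weight m h" "x * d - b * c = 1" "d \<noteq> 0"
  shows "h (act (mat2 x b c d) p) = d ^ m * h p"
proof -
  have "inverse d ^ m * h (act (diag2 (inverse d)) (act (upper (b * d)) p)) = h (act (upper (b * d)) p)"
    using assms p unfolding highest_weight_def weight_def
    by (metis act_upper_lower_closed(1) nonzero_imp_inverse_nonzero power_0 mult_1)
  moreover have "h (act (upper (b * d)) p) = h p"
    using assms(1) p by (simp add: highest_weight_def upper_invariant_def)
  ultimately show ?thesis unfolding orbit_decomposition[OF assms(2,3)] using assms(3) by (simp add: field_simps)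
qed

lemma highest_weight_nonzero_at:
  assumes "highest_weight m h" "\<not> vanishes h" shows "h p \<noteq> 0"
proof
  assume "h p = 0"
  have "vanishes h"
  proof (rule vanishesI_dense)
    show "h \<in> R" using assms(1) by (simp add: highest_weight_def)
    show "h (act (mat2 x b c d) p) = 0" if "x * d - b * c = 1" "d \<noteq> 0" for x b c d
      using highest_weight_on_orbit[OF assms(1) that] \<open>h p = 0\<close> by simp
  qed
  then show False using assms(2) by simp
qed

text \<open>Right multiplication by \<open>diag2 \<mu>\<close> gives a symmetry of the orbit that
  commutes with the group, the scaling of the cone. Pullback is phrased as a relation because it has
  to be proved that the pulled back function extends from the orbit to an element of
  \<open>R\<close>.\<close>

definition twist :: "complex \<Rightarrow> ('a \<Rightarrow> complex) \<Rightarrow> ('a \<Rightarrow> complex) \<Rightarrow> bool"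
  where "twist \<mu> a a' \<longleftrightarrow> a' \<in> R \<and> (\<forall>g. det g = 1 \<longrightarrow> a' (act g p) = a (act g (act (diag2 \<mu>) p)))"

lemma twist_add: "twist \<mu> a a' \<Longrightarrow> twist \<mu> b b' \<Longrightarrow> twist \<mu> (\<lambda>x. a x + b x) (\<lambda>x. a' x + b' x)"
  by (auto simp: twist_def intro: R_add)

lemma twist_vanishing: "\<mu> \<noteq> 0 \<Longrightarrow> vanishes a \<Longrightarrow> twist \<mu> a (\<lambda>x. 0)"
  using p by (auto simp: twist_def vanishes_def act_closed intro: R_const)

lemma twist_sum: "\<mu> \<noteq> 0 \<Longrightarrow> (\<And>i. i \<in> I \<Longrightarrow> \<exists>a'. twist \<mu> (a i) a') \<Longrightarrow> \<exists>a'. twist \<mu> (\<lambda>x. \<Sum>i\<in>I. a i x) a'"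
proof (induction I rule: infinite_finite_induct)
  case (insert i I)
  then obtain u v where "twist \<mu> (a i) u" "twist \<mu> (\<lambda>x. \<Sum>i\<in>I. a i x) v" by blast
  from twist_add[OF this] show ?case using insert by auto
qed (auto intro!: exI[of _ "\<lambda>x. 0"] twist_vanishing simp: vanishes_def)

lemma twist_cong:
  assumes "\<mu> \<noteq> 0" "twist \<mu> a a'" "\<And>x. x \<in> P \<Longrightarrow> b x = a x" shows "twist \<mu> b a'"
  using assms p by (auto simp: twist_def act_closed)

text \<open>Acting by \<open>lower z\<close> turns \<open>d\<close> into \<open>d + z * b\<close>,
  so the coefficient of \<open>z ^ k\<close> in \<open>h\<close> is a binomial multiple of
  \<open>b ^ k * d ^ (m - k)\<close>. These monomials are homogeneous of degree \<open>m\<close> in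
  the second column, which the scaling multiplies by \<open>inverse \<mu>\<close>.\<close>

lemma highest_weight_monomial:
  assumes h: "highest_weight m h" and k: "k \<le> m" and \<mu>: "\<mu> \<noteq> 0"
  obtains e where "e \<in> R" "\<And>x b c d. x * d - b * c = 1 \<Longrightarrow> d \<noteq> 0 \<Longrightarrow> e (act (mat2 x b c d) p) = b ^ k * d ^ (m - k) * h p"
    "\<exists>e'. twist \<mu> e e'"
proof -
  have "h \<in> R" using h by (simp add: highest_weight_def)
  obtain n c where c: "\<And>i. c i \<in> R" "\<And>i x. i > n \<Longrightarrow> c i x = 0"
    "\<And>z x. x \<in> P \<Longrightarrow> h (act (lower z) x) = (\<Sum>i\<le>n. z ^ i * c i x)"
  proof (rule act_curve[OF \<open>h \<in> R\<close>, of lower])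
    show "F \<in> mpoly \<Longrightarrow> \<exists>p. \<forall>z. F (lower z) = poly p z" for F by (metis mpoly_lower)
  qed auto
  have ck: "c k (act (mat2 x b c' d) p) = of_nat (m choose k) * (b ^ k * d ^ (m - k) * h p)"
    if d: "x * d - b * c' = 1" "d \<noteq> 0" for x b c' d
  proof -
    let ?y = "act (mat2 x b c' d) p"
    have y: "?y \<in> P" using d p by (simp add: act_closed)
    define q where "q = (\<Sum>i\<le>n. monom (c i ?y) i)"
    define r where "r = smult (h p) ([:d, b:] ^ m)"
    have "poly (q - r) z = 0" if z: "poly [:d, b:] z \<noteq> 0" for z
    proof -
      have "(\<Sum>i\<le>n. z ^ i * c i ?y) = h (act (lower z) ?y)" by (rule c(3)[OF y, symmetric])
      also have "act (lower z) ?y = act (mat2 x b (z * x + c') (d + z * b)) p" using d p by (simp add: add.commute)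
      also have "h \<dots> = (d + z * b) ^ m * h p"
        by (rule highest_weight_on_orbit[OF h]) (use d z in \<open>auto simp: algebra_simps\<close>)
      finally show ?thesis by (simp add: q_def r_def poly_sum poly_monom mult.commute)
    qed
    then have "UNIV - {z. poly [:d, b:] z = 0} \<subseteq> {z. poly (q - r) z = 0}" by blast
    moreover have "finite {z. poly [:d, b:] z = 0}" by (rule poly_roots_finite) (use d(2) in simp)
    ultimately have "infinite {z. poly (q - r) z = 0}"
      by (metis Diff_infinite_finite infinite_UNIV_char_0 infinite_super)
    then have "q = r" using poly_roots_finite by (metis right_minus_eq)
    then have "coeff q k = coeff r k" by simp
    moreover have "coeff q k = c k ?y" by (cases "k \<le> n") (auto simp: q_def coeff_sum c(2))
    moreover have "coeff r k = of_nat (m choose k) * (b ^ k * d ^ (m - k) * h p)"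
      using k by (simp add: r_def coeff_linear_poly_power)
    ultimately show ?thesis by simp
  qed
  define e where "e x = inverse (of_nat (m choose k)) * c k x" for x
  have nz: "of_nat (m choose k) \<noteq> (0::complex)" using k by simp
  have eR: "e \<in> R" unfolding e_def by (intro R_intros c)
  have e: "e (act (mat2 x b c' d) p) = b ^ k * d ^ (m - k) * h p" if "x * d - b * c' = 1" "d \<noteq> 0" for x b c' d
    using ck[OF that] nz by (simp add: e_def)
  have "twist \<mu> e (\<lambda>x. inverse \<mu> ^ m * e x)"
    unfolding twist_def
  proof (intro conjI allI impI)
    show "(\<lambda>x. inverse \<mu> ^ m * e x) \<in> R" by (intro R_intros eR)
    fix g :: "complex^2^2" assume g: "det g = 1"
    obtain F where F: "F \<in> mpoly" "\<And>g. det g = 1 \<Longrightarrow> e (act g p) = F g" by (rule orbit_function[OF eR p]) blast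
    have "inverse \<mu> ^ m * F g - F (g ** diag2 \<mu>) = 0"
    proof (rule mpoly_dense_zero[OF _ _ g])
      show "(\<lambda>g. inverse \<mu> ^ m * F g - F (g ** diag2 \<mu>)) \<in> mpoly"
        by (intro mpoly_intros mpoly_mult_right F)
      fix x b c' d :: complex assume d: "x * d - b * c' = 1" "d \<noteq> 0"
      have dd: "x * \<mu> * (d * inverse \<mu>) - b * inverse \<mu> * (c' * \<mu>) = 1" using d \<mu> by (simp add: field_simps)
      have "F (mat2 x b c' d ** diag2 \<mu>) = e (act (mat2 (x * \<mu>) (b * inverse \<mu>) (c' * \<mu>) (d * inverse \<mu>)) p)"
        using F(2)[of "mat2 x b c' d ** diag2 \<mu>"] dd by simp
      also have "\<dots> = (b * inverse \<mu>) ^ k * (d * inverse \<mu>) ^ (m - k) * h p"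
        by (rule e) (use d dd \<mu> in auto)
      also have "\<dots> = inverse \<mu> ^ (k + (m - k)) * (b ^ k * d ^ (m - k) * h p)"
        by (simp only: power_mult_distrib power_add mult_ac)
      also have "\<dots> = inverse \<mu> ^ m * F (mat2 x b c' d)" using k e[OF d] F(2)[of "mat2 x b c' d"] d(1) by simp
      finally show "inverse \<mu> ^ m * F (mat2 x b c' d) - F (mat2 x b c' d ** diag2 \<mu>) = 0" by simp
    qed
    moreover have "e (act g (act (diag2 \<mu>) p)) = F (g ** diag2 \<mu>)"
      using F(2)[of "g ** diag2 \<mu>"] g \<mu> p by (simp add: act_act det_mul)
    ultimately show "inverse \<mu> ^ m * e (act g p) = e (act g (act (diag2 \<mu>) p))" using F(2)[OF g] by simp
  qed
  then show ?thesis using that[OF eR e] by blast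
qed

text \<open>The leading coefficient of the unipotent expansion is a highest weight function, and its
  monomial of matching weight cancels the top term of \<open>q\<close>. Repeating this writes a
  weight function on the orbit as a combination of monomials whose twists are known.\<close>

lemma twist_has_form:
  assumes "\<mu> \<noteq> 0"
  shows "a \<in> R \<Longrightarrow> has_form a N i q \<Longrightarrow> \<exists>a'. twist \<mu> a a'"
\<comment> \<open>The measure places the zero polynomial strictly below the nonzero
  constants.\<close>
proof (induction "degree q + (if q = 0 then 0 else 1)" arbitrary: a q rule: less_induct)
  case less
  show ?case
  proof (cases "vanishes a")
    case True then show ?thesis using twist_vanishing assms by blast
  next
    case False
    obtain k c where c: "upper_expansion a k c" "\<not> vanishes (c k)" by (rule leading_upper_expansion[OF less.prems(1) False])
    have w: "weight N i a" by (rule has_form_weight[OF less.prems(2,1)])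
    have ckR: "c k \<in> R" using c(1) by (simp add: upper_expansion_def)
    have hw: "i \<le> N + 2 * k" "highest_weight (N + 2 * k - i) (c k)"
      using highest_weight_nonneg[OF ckR leading_upper_invariant[OF c(1)] weight_upper_expansion[OF c(1) w]] c(2) by blast+
    define q' where "q' = (\<Sum>j\<le>k. monom (c j p) j)"
    have f': "has_form a N i q'" unfolding q'_def by (rule weight_has_form[OF w c(1)])
    have "poly q s = poly q' s" for s
    proof -
      show ?thesis
        using has_formD[OF less.prems(2), of 1 1 s 0] has_formD[OF f', of 1 1 s 0] by simp
    qed
    then have "q = q'" by (simp add: poly_eq_poly_eq_iff[symmetric] fun_eq_iff)
    have lc: "coeff q k = c k p" by (simp add: \<open>q = q'\<close> q'_def coeff_sum)
    have nz: "c k p \<noteq> 0" by (rule highest_weight_nonzero_at[OF hw(2) c(2)])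
    have deg: "degree q = k"
    proof (rule antisym)
      show "degree q \<le> k" unfolding \<open>q = q'\<close> q'_def
        by (rule degree_sum_le) (auto intro: order_trans[OF degree_monom_le])
      show "k \<le> degree q" using lc nz by (intro le_degree) simp
    qed
    \<comment> \<open>The top term on the orbit is \<open>b ^ k * d ^ (N + k - i)\<close>. It must
      be free of poles at \<open>d = 0\<close>, a locus crossed by the curve
      \<open>mat2 0 (-1) 1 z\<close>.\<close>
    have "i \<le> N + k"
    proof (rule ccontr)
      assume *: "\<not> i \<le> N + k"
      obtain F where F: "F \<in> mpoly" "\<And>g. det g = 1 \<Longrightarrow> a (act g p) = F g" by (rule orbit_function[OF less.prems(1) p]) blast
      obtain r where r: "\<And>z. F (mat2 0 (-1) 1 z) = poly r z" by (rule mpoly_weyl_curve[OF F(1)]) blast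
      have "poly (monom 1 (i - N) * r - pcompose q [:0, -1:]) z = 0" if z: "z \<noteq> 0" for z
      proof -
        have "z ^ i * a (act (mat2 0 (-1) 1 z) p) = z ^ N * poly q (- 1 * z)"
          using has_formD[OF less.prems(2), of 0 z "-1" 1] z by simp
        then have "z ^ N * (z ^ (i - N) * poly r z) = z ^ N * poly q (- z)"
          using F(2)[of "mat2 0 (-1) 1 z"] r * by (simp add: mult.assoc[symmetric] power_add[symmetric])
        then show ?thesis using z by (simp add: poly_monom poly_pcompose)
      qed
      then have "infinite {z. poly (monom 1 (i - N) * r - pcompose q [:0, -1:]) z = 0}"
        using infinite_super[of "UNIV - {0}" "{z. poly (monom 1 (i - N) * r - pcompose q [:0, -1:]) z = 0}"]
        by (auto simp: infinite_UNIV_char_0)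
      then have eq: "monom 1 (i - N) * r = pcompose q [:0, -1:]" using poly_roots_finite by (metis right_minus_eq)
      have "coeff (pcompose q [:0, -1:]) k = lead_coeff (pcompose q [:0, -1:])"
        using deg by (simp add: degree_pcompose)
      also have "\<dots> \<noteq> 0" using lc nz deg by (auto simp: pcompose_eq_0_iff)
      finally have "coeff (monom 1 (i - N) * r) k \<noteq> 0" unfolding eq .
      moreover have "k < i - N" using * by linarith
      ultimately show False by (simp add: coeff_monom_mult)
    qed
    then have "k \<le> N + 2 * k - i" by simp
    from highest_weight_monomial[OF hw(2) this assms] obtain e where e: "e \<in> R"
      "\<And>x b c' d. x * d - b * c' = 1 \<Longrightarrow> d \<noteq> 0 \<Longrightarrow> e (act (mat2 x b c' d) p) = b ^ k * d ^ (N + 2 * k - i - k) * c k p"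
      "\<exists>e'. twist \<mu> e e'" by blast
    define q0 where "q0 = q - monom (c k p) k"
    have form: "has_form (\<lambda>x. a x - e x) N i q0"
      unfolding has_form_def
    proof (intro allI impI)
      fix x b c' d :: complex assume d: "x * d - b * c' = 1" "d \<noteq> 0"
      have "d ^ i * e (act (mat2 x b c' d) p) = (b * d) ^ k * (d ^ (i + (N + 2 * k - i - k) - k) * c k p)"
      proof -
        have "d ^ i * d ^ (N + 2 * k - i - k) = d ^ k * d ^ (i + (N + 2 * k - i - k) - k)"
          using \<open>i \<le> N + k\<close> by (simp add: power_add[symmetric])
        then show ?thesis using e(2)[OF d] by (simp add: power_mult_distrib mult_ac)
      qed
      also have "i + (N + 2 * k - i - k) - k = N" using \<open>i \<le> N + k\<close> by simp
      finally show "d ^ i * (a (act (mat2 x b c' d) p) - e (act (mat2 x b c' d) p)) = d ^ N * poly q0 (b * d)"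
        using has_formD[OF less.prems(2) d] unfolding q0_def
        by (simp add: right_diff_distrib poly_monom mult_ac)
    qed
    have "degree q0 + (if q0 = 0 then 0 else 1) < degree q + (if q = 0 then 0 else 1)"
    proof -
      have "q \<noteq> 0" using lc nz by auto
      have "degree q0 \<le> k" unfolding q0_def by (intro degree_diff_le) (auto simp: deg degree_monom_le)
      moreover have "coeff q0 k = 0" using lc by (simp add: q0_def)
      ultimately have "q0 = 0 \<or> degree q0 < k" by (metis le_neq_implies_less leading_coeff_0_iff)
      then show ?thesis using deg \<open>q \<noteq> 0\<close> by auto
    qed
    moreover have "(\<lambda>x. a x - e x) \<in> R" by (intro R_intros less.prems(1) e(1))
    ultimately obtain u v where "twist \<mu> (\<lambda>x. a x - e x) u" "twist \<mu> e v" using less.hyps form e(3) by blast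
    from twist_add[OF this] show ?thesis by auto
  qed
qed

lemma twist_exists:
  assumes "\<mu> \<noteq> 0" "a \<in> R" shows "\<exists>a'. twist \<mu> a a'"
proof -
  obtain N n b where b: "\<And>i. b i \<in> R" "\<And>i. weight N i (b i)"
    "\<And>l x. l \<noteq> 0 \<Longrightarrow> x \<in> P \<Longrightarrow> l ^ N * a (act (diag2 l) x) = (\<Sum>i\<le>n. l ^ i * b i x)"
    "\<And>i x. i > n \<Longrightarrow> b i x = 0" "\<And>x. x \<in> P \<Longrightarrow> a x = (\<Sum>i\<le>n. b i x)"
    by (rule weight_decomposition[OF assms(2)]) blast
  have "\<exists>b'. twist \<mu> (b i) b'" for i
  proof -
    obtain m c where "upper_expansion (b i) m c" by (rule upper_expansion_exists[OF b(1)])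
    from twist_has_form[OF assms(1) b(1) weight_has_form[OF b(2) this]] show ?thesis .
  qed
  then have "\<exists>a'. twist \<mu> (\<lambda>x. \<Sum>i\<le>n. b i x) a'" by (rule twist_sum[OF assms(1)])
  then obtain a' where "twist \<mu> (\<lambda>x. \<Sum>i\<le>n. b i x) a'" by blast
  then have "twist \<mu> a a'" by (rule twist_cong[OF assms(1)]) (rule b(5))
  then show ?thesis by blast
qed

lemma twist_unique:
  assumes "twist \<mu> a a'" "twist \<mu> b b'" "\<mu> \<noteq> 0" "\<And>x. x \<in> P \<Longrightarrow> a x = b x" "x \<in> P"
  shows "a' x = b' x"
proof -
  have "vanishes (\<lambda>x. a' x - b' x)"
    by (rule inj) (use assms p in \<open>auto simp: twist_def act_closed intro: R_diff\<close>)
  then show ?thesis using assms(5) by (simp add: vanishes_def)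
qed

text \<open>Since twists are unique, twisting is an endomorphism of the algebra \<open>R\<close>.
  Followed by evaluation at \<open>x\<close> it is a character, hence evaluation at some point
  \<open>\<sigma> x\<close>.\<close>

lemma scaling_map:
  assumes "\<mu> \<noteq> 0"
  obtains \<sigma> where "\<And>x. x \<in> P \<Longrightarrow> \<sigma> x \<in> P" "\<And>a a' x. twist \<mu> a a' \<Longrightarrow> a \<in> R \<Longrightarrow> x \<in> P \<Longrightarrow> a (\<sigma> x) = a' x"
proof -
  define t where "t a = (SOME a'. twist \<mu> a a')" for a
  have t: "twist \<mu> a (t a)" if "a \<in> R" for a
    unfolding t_def by (rule someI_ex[OF twist_exists[OF assms that]])
  have ex: "\<exists>y\<in>P. \<forall>a\<in>R. t a x = a y" if x: "x \<in> P" for x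
  proof (rule hom_is_evaluation)
    have c: "twist \<mu> (\<lambda>x. c) (\<lambda>x. c)" for c by (auto simp: twist_def R_const)
    show "t (\<lambda>x. c) x = c" for c by (rule twist_unique[OF t[OF R_const] c assms refl x])
    fix f f' assume f: "f \<in> R" 
    { assume f': "f' \<in> R"
      show "t (\<lambda>x. f x + f' x) x = t f x + t f' x"
        by (rule twist_unique[OF t[OF R_add[OF f f']] twist_add[OF t[OF f] t[OF f']] assms refl x])
      have "twist \<mu> (\<lambda>x. f x * f' x) (\<lambda>x. t f x * t f' x)"
        using t[OF f] t[OF f'] by (auto simp: twist_def intro: R_mult)
      then show "t (\<lambda>x. f x * f' x) x = t f x * t f' x"
        by (rule twist_unique[OF t[OF R_mult[OF f f']] _ assms refl x]) }
    { assume eq: "\<And>x. x \<in> P \<Longrightarrow> f' x = f x"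
      have "f' \<in> R" by (rule R_cong[OF f eq])
      then show "t f' x = t f x" using twist_unique[OF t t[OF f] assms eq x] by blast }
  qed
  define \<sigma> where "\<sigma> x = (SOME y. y \<in> P \<and> (\<forall>a\<in>R. t a x = a y))" for x
  have \<sigma>: "\<sigma> x \<in> P \<and> (\<forall>a\<in>R. t a x = a (\<sigma> x))" if "x \<in> P" for x
    unfolding \<sigma>_def by (rule someI_ex) (use ex[OF that] in blast)
  show ?thesis
  proof (rule that)
    show "x \<in> P \<Longrightarrow> \<sigma> x \<in> P" for x using \<sigma> by blast
    show "a (\<sigma> x) = a' x" if "twist \<mu> a a'" "a \<in> R" "x \<in> P" for a a' x
      using \<sigma>[OF that(3)] twist_unique[OF t[OF that(2)] that(1) assms refl that(3)] that(2) by simp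
  qed
qed

text \<open>The twists for 2 and for 1/2 are inverse to each other and commute with the group. The
  first multiplies a function of highest weight \<open>n\<close> by the \<open>n\<close>-th power of
  1/2, so its square moves \<open>p\<close>.\<close>

lemma scaling_automorphism:
  obtains \<sigma> \<rho> where "\<And>x. x \<in> P \<Longrightarrow> \<sigma> x \<in> P \<and> \<rho> x \<in> P \<and> \<sigma> (\<rho> x) = x \<and> \<rho> (\<sigma> x) = x"
    "\<And>a. a \<in> R \<Longrightarrow> (\<lambda>x. a (\<sigma> x)) \<in> R \<and> (\<lambda>x. a (\<rho> x)) \<in> R"
    "\<And>g x. det g = 1 \<Longrightarrow> x \<in> P \<Longrightarrow> \<sigma> (act g x) = act g (\<sigma> x)"
    "\<sigma> (\<sigma> p) \<noteq> p"
proof -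
  have *: "\<sigma> (\<rho> x) = x" if H: "\<mu> \<noteq> 0" "\<And>x. x \<in> P \<Longrightarrow> \<sigma> x \<in> P" "\<And>a a' x. twist \<mu> a a' \<Longrightarrow> a \<in> R \<Longrightarrow> x \<in> P \<Longrightarrow> a (\<sigma> x) = a' x"
     "\<And>x. x \<in> P \<Longrightarrow> \<rho> x \<in> P" "\<And>a a' x. twist (inverse \<mu>) a a' \<Longrightarrow> a \<in> R \<Longrightarrow> x \<in> P \<Longrightarrow> a (\<rho> x) = a' x" "x \<in> P"
    for \<mu> \<sigma> \<rho> x
  proof (rule separated)
    fix a assume a: "a \<in> R"
    obtain a' where a': "twist \<mu> a a'" using twist_exists[OF H(1) a] by blast
    then have a'R: "a' \<in> R" by (simp add: twist_def)
    obtain b where b: "twist (inverse \<mu>) a' b" using twist_exists[OF _ a'R] H(1) by (metis inverse_zero_imp_zero)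
    have "vanishes (\<lambda>x. b x - a x)"
    proof (rule inj)
      show "(\<lambda>x. b x - a x) \<in> R" using a b by (auto simp: twist_def intro: R_diff)
      fix g :: "complex^2^2" assume g: "det g = 1"
      have d: "det (diag2 (inverse \<mu>)) = 1" "det (diag2 \<mu>) = 1" using H(1) by auto
      have "b (act g p) = a' (act (g ** diag2 (inverse \<mu>)) p)"
        using b g p d by (simp only: twist_def act_act)
      also have "\<dots> = a (act (g ** diag2 (inverse \<mu>)) (act (diag2 \<mu>) p))"
        using a' g d by (simp only: twist_def det_mul mult_1)
      also have "act (g ** diag2 (inverse \<mu>)) (act (diag2 \<mu>) p) = act g p"
        using H(1) g p d act_act[of "g ** diag2 (inverse \<mu>)" "diag2 \<mu>" p]
        by (simp add: matrix_mul_assoc[symmetric] det_mul mat_1_eq_mat2[symmetric])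
      finally show "b (act g p) - a (act g p) = 0" by simp
    qed
    then show "a (\<sigma> (\<rho> x)) = a x"
      using H(3)[OF a' a H(4)[OF H(6)]] H(5)[OF b a'R H(6)] H(6) by (simp add: vanishes_def)
  qed (use H in auto)
  obtain \<sigma> where \<sigma>: "\<And>x. x \<in> P \<Longrightarrow> \<sigma> x \<in> P" "\<And>a a' x. twist 2 a a' \<Longrightarrow> a \<in> R \<Longrightarrow> x \<in> P \<Longrightarrow> a (\<sigma> x) = a' x"
    by (rule scaling_map[of 2]) auto
  obtain \<rho> where \<rho>: "\<And>x. x \<in> P \<Longrightarrow> \<rho> x \<in> P" "\<And>a a' x. twist (inverse 2) a a' \<Longrightarrow> a \<in> R \<Longrightarrow> x \<in> P \<Longrightarrow> a (\<rho> x) = a' x"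
    by (rule scaling_map[of "inverse 2"]) auto
  have 1: "\<sigma> x \<in> P \<and> \<rho> x \<in> P \<and> \<sigma> (\<rho> x) = x \<and> \<rho> (\<sigma> x) = x" if x: "x \<in> P" for x
  proof (intro conjI \<sigma>(1) \<rho>(1) x)
    show "\<sigma> (\<rho> x) = x" by (rule *[where \<mu> = 2 and \<sigma> = \<sigma> and \<rho> = \<rho> and x = x]; (fact \<sigma> \<rho> x | simp))
    have \<sigma>': "a (\<sigma> x) = a' x" if "twist (inverse (inverse 2)) a a'" "a \<in> R" "x \<in> P" for a a' x
      using \<sigma>(2) that by simp
    show "\<rho> (\<sigma> x) = x"
      by (rule *[where \<mu> = "inverse 2" and \<sigma> = \<rho> and \<rho> = \<sigma> and x = x]; (fact \<sigma>(1) \<rho> \<sigma>' x | simp))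
  qed
  have 2: "(\<lambda>x. a (\<sigma> x)) \<in> R \<and> (\<lambda>x. a (\<rho> x)) \<in> R" if a: "a \<in> R" for a
  proof -
    obtain u v where "twist 2 a u" "twist (inverse 2) a v"
      using twist_exists[of 2, OF _ a] twist_exists[of "inverse 2", OF _ a] by auto
    then show ?thesis using \<sigma>(2) \<rho>(2) a R_cong[of u "\<lambda>x. a (\<sigma> x)"] R_cong[of v "\<lambda>x. a (\<rho> x)"]
      by (simp add: twist_def)
  qed
  have 3: "\<sigma> (act g x) = act g (\<sigma> x)" if g: "det g = 1" and x: "x \<in> P" for g x
  proof (rule separated)
    show "\<sigma> (act g x) \<in> P" "act g (\<sigma> x) \<in> P" using g x \<sigma>(1) by (auto simp: act_closed)
    fix a assume a: "a \<in> R"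
    obtain a' where a': "twist 2 a a'" using twist_exists[of 2, OF _ a] by auto
    have "twist 2 (\<lambda>x. a (act g x)) (\<lambda>x. a' (act g x))"
      using a' g p by (auto simp: twist_def act_act act_closed det_mul matrix_mul_assoc intro!: R_act simp del: mat2_mult)
    from \<sigma>(2)[OF this R_act[OF a g] x] \<sigma>(2)[OF a' a, of "act g x"]
    show "a (\<sigma> (act g x)) = a (act g (\<sigma> x))" using g x by (simp add: act_closed)
  qed
  obtain f0 l0 x0 where "f0 \<in> R" "l0 \<noteq> 0" "x0 \<in> P" "f0 (act (diag2 l0) x0) \<noteq> f0 x0"
    using torus_nontrivial by blast
  then obtain n f where f: "n > 0" "highest_weight n f" "\<not> vanishes f"
    by (rule positive_highest_weight_exists)
  have fR: "f \<in> R" using f(2) by (simp add: highest_weight_def)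
  have fp: "f p \<noteq> 0" by (rule highest_weight_nonzero_at[OF f(2,3)])
  have fs: "f (\<sigma> x) = inverse 2 ^ n * f x" if x: "x \<in> P" for x
  proof -
    obtain f' where f': "twist 2 f f'" using twist_exists[of 2, OF _ fR] by auto
    have "vanishes (\<lambda>x. f' x - inverse 2 ^ n * f x)"
    proof (rule vanishesI_dense)
      show "(\<lambda>x. f' x - inverse 2 ^ n * f x) \<in> R" using f' fR by (auto simp: twist_def intro!: R_intros)
      fix y b c d :: complex assume d: "y * d - b * c = 1" "d \<noteq> 0"
      have "f' (act (mat2 y b c d) p) = f (act (mat2 (y * 2) (b * inverse 2) (c * 2) (d * inverse 2)) p)"
        using f' d p by (simp add: twist_def)
      also have "\<dots> = (d * inverse 2) ^ n * f p"
        by (rule highest_weight_on_orbit[OF f(2)]) (use d in \<open>auto simp: field_simps\<close>)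
      also have "\<dots> = inverse 2 ^ n * f (act (mat2 y b c d) p)"
        by (simp only: highest_weight_on_orbit[OF f(2) d] power_mult_distrib mult_ac)
      finally show "f' (act (mat2 y b c d) p) - inverse 2 ^ n * f (act (mat2 y b c d) p) = 0" by simp
    qed
    then show ?thesis using \<sigma>(2)[OF f' fR x] x by (simp add: vanishes_def)
  qed
  have 4: "\<sigma> (\<sigma> p) \<noteq> p"
  proof
    assume "\<sigma> (\<sigma> p) = p"
    then have "inverse 2 ^ n * (inverse 2 ^ n * f p) = f p" using fs[OF p] fs[OF \<sigma>(1)[OF p]] by simp
    then have "inverse 2 ^ (n + n) = (1::complex)" using fp by (simp add: power_add)
    then have "norm ((inverse 2 :: complex) ^ (n + n)) = 1" by (simp only: norm_one)
    then have "(1/2 :: real) ^ (n + n) = 1" by (simp add: norm_power norm_divide)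
    moreover have "(1/2 :: real) ^ (n + n) < 1" using f(1) by (simp add: power_Suc_less_one power_less_one_iff)
    ultimately show False by simp
  qed
  show ?thesis by (rule that[OF 1 2 3 4])
qed

end

end

end

section \<open>Functions on the group invariant under the torus and its normalizer\<close>

text \<open>Conjugating the diagonal matrix with entries 1/2 and -1/2 by \<open>g\<close> gives the
  matrix with rows \<open>(fun_z, - fun_w)\<close> and \<open>(fun_y, - fun_z)\<close>. Its
  determinant -1/4 is the equation \<open>yw_eq\<close> of a quadric, the quotient by the torus; the
  Weyl element negates the diagonal matrix and hence all three functions.\<close>

definition fun_y :: "complex^2^2 \<Rightarrow> complex" where "fun_y g = g$2$1 * g$2$2"
definition fun_z :: "complex^2^2 \<Rightarrow> complex" where "fun_z g = (g$1$1 * g$2$2 + g$1$2 * g$2$1) / 2"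
definition fun_w :: "complex^2^2 \<Rightarrow> complex" where "fun_w g = g$1$1 * g$1$2"

lemmas fun_yzw_defs = fun_y_def fun_z_def fun_w_def

lemma yw_eq: "det g = 1 \<Longrightarrow> fun_y g * fun_w g = (fun_z g)\<^sup>2 - 1/4"
proof -
  assume "det g = 1"
  then have *: "g$1$1 * g$2$2 = 1 + g$1$2 * g$2$1" by (simp add: det_2 diff_eq_eq)
  have "fun_y g * fun_w g = (g$1$1 * g$2$2) * (g$1$2 * g$2$1)" by (simp add: fun_yzw_defs)
  also have "\<dots> = (fun_z g)\<^sup>2 - 1/4" unfolding fun_z_def * by (simp add: power2_eq_square field_simps)
  finally show ?thesis .
qed

text \<open>The sign \<open>s\<close> records how the function changes under right translation by the Weyl element.\<close>

inductive signed :: "complex \<Rightarrow> (complex^2^2 \<Rightarrow> complex) \<Rightarrow> bool" where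
  const: "signed 1 (\<lambda>g. c)"
| y: "signed (-1) fun_y"
| z: "signed (-1) fun_z"
| w: "signed (-1) fun_w"
| add: "signed s F \<Longrightarrow> signed s G \<Longrightarrow> signed s (\<lambda>g. F g + G g)"
| mult: "signed s F \<Longrightarrow> signed t G \<Longrightarrow> signed (s * t) (\<lambda>g. F g * G g)"

lemma signed_sign: "signed s F \<Longrightarrow> s = 1 \<or> s = -1"
  by (induction rule: signed.induct) auto

lemma signed_cmult: "signed s F \<Longrightarrow> signed s (\<lambda>g. c * F g)"
  using signed.mult[OF signed.const[of c], of s F] by simp

lemma signed_power: "signed s F \<Longrightarrow> signed (s ^ n) (\<lambda>g. F g ^ n)"
  by (induction n) (auto intro: signed.intros)

lemma fun_yzw_mpoly: "fun_y \<in> mpoly" "fun_z \<in> mpoly" "fun_w \<in> mpoly"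
proof -
  note e = mpoly.mult[OF mpoly.entry mpoly.entry]
  have "fun_z = (\<lambda>g. (1/2) * (g$1$1 * g$2$2 + g$1$2 * g$2$1))" by (simp add: fun_z_def fun_eq_iff)
  then show "fun_z \<in> mpoly" using mpoly.mult[OF mpoly.const[of "1/2"] mpoly.add[OF e[of 1 1 2 2] e[of 1 2 2 1]]] by simp
  show "fun_y \<in> mpoly" using e[of 2 1 2 2] by (simp add: fun_y_def[abs_def])
  show "fun_w \<in> mpoly" using e[of 1 1 1 2] by (simp add: fun_w_def[abs_def])
qed

lemma signed_mpoly: "signed s F \<Longrightarrow> F \<in> mpoly"
proof (induction rule: signed.induct)
  case (add s F G) then show ?case using mpoly.add by blast
next
  case (mult s F t G) then show ?case using mpoly.mult by blast
qed (rule mpoly.const fun_yzw_mpoly)+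

lemma fun_weyl_right: "fun_y (g ** weyl) = - fun_y g" "fun_z (g ** weyl) = - fun_z g" "fun_w (g ** weyl) = - fun_w g"
  by (cases g rule: mat2_cases, simp add: fun_yzw_defs field_simps)+

lemma fun_diag_right: "l \<noteq> 0 \<Longrightarrow> fun_y (g ** diag2 l) = fun_y g" "l \<noteq> 0 \<Longrightarrow> fun_z (g ** diag2 l) = fun_z g"
  "l \<noteq> 0 \<Longrightarrow> fun_w (g ** diag2 l) = fun_w g"
  by (cases g rule: mat2_cases, simp add: fun_yzw_defs field_simps)+

lemma signed_weyl_right: "signed s F \<Longrightarrow> F (g ** weyl) = s * F g"
  by (induction rule: signed.induct) (simp_all add: fun_weyl_right distrib_left)

lemma signed_diag_right: "signed s F \<Longrightarrow> l \<noteq> 0 \<Longrightarrow> F (g ** diag2 l) = F g"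
  by (induction rule: signed.induct) (simp_all add: fun_diag_right)

lemma fun_lower: "fun_y (lower r ** g) = fun_y g + r * (2 * fun_z g) + r\<^sup>2 * fun_w g"
  "fun_z (lower r ** g) = fun_z g + r * fun_w g" "fun_w (lower r ** g) = fun_w g"
  by (cases g rule: mat2_cases, simp add: fun_yzw_defs power2_eq_square field_simps)+

lemma fun_weyl: "fun_y (weyl ** g) = fun_w g" "fun_z (weyl ** g) = - fun_z g" "fun_w (weyl ** g) = fun_y g"
  by (cases g rule: mat2_cases, simp add: fun_yzw_defs field_simps)+

lemma fun_upper: "fun_y (upper r ** g) = fun_y g" "fun_z (upper r ** g) = fun_z g + r * fun_y g"
  by (cases g rule: mat2_cases, simp add: fun_yzw_defs field_simps)+

lemma fun_diag_left: "l \<noteq> 0 \<Longrightarrow> l\<^sup>2 * fun_y (diag2 l ** g) = fun_y g" "l \<noteq> 0 \<Longrightarrow> fun_z (diag2 l ** g) = fun_z g"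
  by (cases g rule: mat2_cases, simp add: fun_yzw_defs power2_eq_square field_simps)+

text \<open>\<open>F'\<close> is the derivative of \<open>F (lower r ** g)\<close> at
  \<open>r = 0\<close>, read off as a coefficient so that the product rule becomes coefficient
  arithmetic.\<close>

definition lower_derivation :: "(complex^2^2 \<Rightarrow> complex) \<Rightarrow> (complex^2^2 \<Rightarrow> complex) \<Rightarrow> bool"
  where "lower_derivation F F' \<longleftrightarrow> (\<exists>Q. \<forall>g. (\<forall>r. F (lower r ** g) = poly (Q g) r) \<and> coeff (Q g) 0 = F g \<and> coeff (Q g) 1 = F' g)"

lemma lower_derivation_add:
  assumes "lower_derivation F F'" "lower_derivation G G'"
  shows "lower_derivation (\<lambda>g. F g + G g) (\<lambda>g. F' g + G' g)"
proof -
  obtain Q S where "\<forall>g. (\<forall>r. F (lower r ** g) = poly (Q g) r) \<and> coeff (Q g) 0 = F g \<and> coeff (Q g) 1 = F' g"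
    "\<forall>g. (\<forall>r. G (lower r ** g) = poly (S g) r) \<and> coeff (S g) 0 = G g \<and> coeff (S g) 1 = G' g"
    using assms unfolding lower_derivation_def by blast
  then show ?thesis unfolding lower_derivation_def by (intro exI[of _ "\<lambda>g. Q g + S g"]) simp
qed

lemma lower_derivation_mult:
  assumes "lower_derivation F F'" "lower_derivation G G'"
  shows "lower_derivation (\<lambda>g. F g * G g) (\<lambda>g. F' g * G g + F g * G' g)"
proof -
  obtain Q S where "\<forall>g. (\<forall>r. F (lower r ** g) = poly (Q g) r) \<and> coeff (Q g) 0 = F g \<and> coeff (Q g) 1 = F' g"
    "\<forall>g. (\<forall>r. G (lower r ** g) = poly (S g) r) \<and> coeff (S g) 0 = G g \<and> coeff (S g) 1 = G' g"
    using assms unfolding lower_derivation_def by blast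
  then show ?thesis unfolding lower_derivation_def
    by (intro exI[of _ "\<lambda>g. Q g * S g"]) (simp add: coeff_mult)
qed

lemma lower_derivation_const: "lower_derivation (\<lambda>g. c) (\<lambda>g. 0)"
  unfolding lower_derivation_def by (intro exI[of _ "\<lambda>g. [:c:]"]) simp

lemma lower_derivation_y: "lower_derivation fun_y (\<lambda>g. 2 * fun_z g)"
  unfolding lower_derivation_def
  by (intro exI[of _ "\<lambda>g. [:fun_y g, 2 * fun_z g, fun_w g:]"]) (simp add: fun_lower power2_eq_square algebra_simps)

lemma lower_derivation_z: "lower_derivation fun_z fun_w"
  unfolding lower_derivation_def by (intro exI[of _ "\<lambda>g. [:fun_z g, fun_w g:]"]) (simp add: fun_lower)

lemma lower_derivation_w: "lower_derivation fun_w (\<lambda>g. 0)"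
  unfolding lower_derivation_def by (intro exI[of _ "\<lambda>g. [:fun_w g:]"]) (simp add: fun_lower)

lemma lower_derivation_power:
  "lower_derivation F F' \<Longrightarrow> lower_derivation (\<lambda>g. F g ^ Suc n) (\<lambda>g. of_nat (Suc n) * F g ^ n * F' g)"
proof (induction n)
  case (Suc n)
  from lower_derivation_mult[OF Suc.prems Suc.IH[OF Suc.prems]]
  show ?case by (simp add: algebra_simps)
qed simp

text \<open>Left translation commutes with right translation by the Weyl element, so differentiating
  along \<open>lower\<close> keeps the sign.\<close>

lemma signed_lower_derivation: "signed s F \<Longrightarrow> \<exists>F'. signed s F' \<and> lower_derivation F F'"
proof (induction rule: signed.induct)
  case (const c)
  then show ?case using lower_derivation_const signed.const by blast
next
  case y
  then show ?case using lower_derivation_y signed_cmult[OF signed.z] by blast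
next
  case z
  then show ?case using lower_derivation_z signed.w by blast
next
  case w
  have "signed (-1) (\<lambda>g. 0 * fun_w g)" by (rule signed_cmult[OF signed.w])
  then show ?case using lower_derivation_w by auto
next
  case (add s F G)
  then show ?case using lower_derivation_add signed.add by blast
next
  case (mult s F t G)
  then obtain F' G' where *: "signed s F'" "lower_derivation F F'" "signed t G'" "lower_derivation G G'" by blast
  have "signed (s * t) (\<lambda>g. F' g * G g + F g * G' g)"
    by (intro signed.add signed.mult * mult)
  then show ?case using lower_derivation_mult[OF *(2,4)] by blast
qed

text \<open>Products of \<open>y\<close> and \<open>w\<close> can be eliminated by \<open>yw_eq\<close>.\<close>

inductive reduced :: "complex \<Rightarrow> (complex^2^2 \<Rightarrow> complex) \<Rightarrow> bool" where
  y: "(\<And>x. poly p (- x) = s * (-1) ^ i * poly p x) \<Longrightarrow> reduced s (\<lambda>g. fun_y g ^ i * poly p (fun_z g))"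
| w: "(\<And>x. poly p (- x) = s * (-1) ^ i * poly p x) \<Longrightarrow> reduced s (\<lambda>g. fun_w g ^ i * poly p (fun_z g))"
| add: "reduced s F \<Longrightarrow> reduced s G \<Longrightarrow> reduced s (\<lambda>g. F g + G g)"

lemma reduced_yw:
  assumes p: "\<And>x. poly p (- x) = s * (-1) ^ i * poly p x" and q: "\<And>x. poly q (- x) = t * (-1) ^ j * poly q x"
  shows "\<exists>F. reduced (s * t) F \<and> (\<forall>g. det g = 1 \<longrightarrow> F g = (fun_y g ^ i * poly p (fun_z g)) * (fun_w g ^ j * poly q (fun_z g)))"
proof -
  \<comment> \<open>\<open>[:-1/4, 0, 1:]\<close> is the polynomial in \<open>fun_z\<close> that
    replaces the product of \<open>fun_y\<close> and \<open>fun_w\<close>; \<open>m\<close> counts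
    the pairs that are replaced.\<close>
  define r where "r m = p * q * [:-1/4, 0, 1:] ^ m" for m
  have sgn: "poly (r m) (- x) = s * t * (-1) ^ (i + j) * poly (r m) x" for m x
    by (simp add: r_def p q power_add)
  have e: "(-1) ^ (i + j) = ((-1) ^ (i - j) :: complex)" if "j \<le> i"
    using that by (metis (no_types, lifting) le_add_diff_inverse2 minus_one_power_iff even_add even_diff_nat)
  have e': "(-1) ^ (i + j) = ((-1) ^ (j - i) :: complex)" if "i \<le> j"
    using that by (metis (no_types, lifting) le_add_diff_inverse2 minus_one_power_iff even_add even_diff_nat)
  have yw: "fun_y g ^ m * fun_w g ^ m = poly [:-1/4, 0, 1:] (fun_z g) ^ m" if "det g = 1" for g m
    using yw_eq[OF that] by (simp add: power_mult_distrib[symmetric] power2_eq_square)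
  show ?thesis
  proof (cases "j \<le> i")
    case True
    have "reduced (s * t) (\<lambda>g. fun_y g ^ (i - j) * poly (r j) (fun_z g))"
      by (rule reduced.y) (simp add: sgn e[OF True])
    moreover have "fun_y g ^ (i - j) * poly (r j) (fun_z g) = (fun_y g ^ i * poly p (fun_z g)) * (fun_w g ^ j * poly q (fun_z g))"
      if g: "det g = 1" for g
    proof -
      have "fun_y g ^ i = fun_y g ^ (i - j) * fun_y g ^ j" using True by (simp add: power_add[symmetric])
      then have "(fun_y g ^ i * poly p (fun_z g)) * (fun_w g ^ j * poly q (fun_z g))
        = fun_y g ^ (i - j) * (poly p (fun_z g) * poly q (fun_z g) * (fun_y g ^ j * fun_w g ^ j))" by (simp only: mult_ac)
      also have "\<dots> = fun_y g ^ (i - j) * poly (r j) (fun_z g)" unfolding yw[OF g] by (simp add: r_def)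
      finally show ?thesis by simp
    qed
    ultimately show ?thesis by blast
  next
    case False
    then have le: "i \<le> j" by simp
    have "reduced (s * t) (\<lambda>g. fun_w g ^ (j - i) * poly (r i) (fun_z g))"
      by (rule reduced.w) (simp add: sgn e'[OF le])
    moreover have "fun_w g ^ (j - i) * poly (r i) (fun_z g) = (fun_y g ^ i * poly p (fun_z g)) * (fun_w g ^ j * poly q (fun_z g))"
      if g: "det g = 1" for g
    proof -
      have "fun_w g ^ j = fun_w g ^ (j - i) * fun_w g ^ i" using le by (simp add: power_add[symmetric])
      then have "(fun_y g ^ i * poly p (fun_z g)) * (fun_w g ^ j * poly q (fun_z g))
        = fun_w g ^ (j - i) * (poly p (fun_z g) * poly q (fun_z g) * (fun_y g ^ i * fun_w g ^ i))" by (simp only: mult_ac)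
      also have "\<dots> = fun_w g ^ (j - i) * poly (r i) (fun_z g)" unfolding yw[OF g] by (simp add: r_def)
      finally show ?thesis by simp
    qed
    ultimately show ?thesis by blast
  qed
qed

lemma reduced_mult:
  assumes "reduced s F" "reduced t G"
  shows "\<exists>H. reduced (s * t) H \<and> (\<forall>g. det g = 1 \<longrightarrow> H g = F g * G g)"
  using assms
proof (induction rule: reduced.induct)
  case (y p s i)
  note p = y(1)
  from y(2) show ?case
  proof (induction rule: reduced.induct)
    case (y q t j)
    have "reduced (s * t) (\<lambda>g. fun_y g ^ (i + j) * poly (p * q) (fun_z g))"
      by (rule reduced.y) (simp add: p y power_add)
    then show ?case by (rule exI[where x = "\<lambda>g. fun_y g ^ (i + j) * poly (p * q) (fun_z g)", OF conjI]) (simp add: power_add)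
  next
    case (w q t j)
    then show ?case using reduced_yw[OF p w] by blast
  next
    case (add t G H)
    then obtain G' H' where "reduced (s * t) G'" "reduced (s * t) H'"
      "\<forall>g. det g = 1 \<longrightarrow> G' g = fun_y g ^ i * poly p (fun_z g) * G g"
      "\<forall>g. det g = 1 \<longrightarrow> H' g = fun_y g ^ i * poly p (fun_z g) * H g" by blast
    then show ?case by (intro exI[of _ "\<lambda>g. G' g + H' g"]) (auto intro: reduced.add simp: distrib_left)
  qed
next
  case (w p s i)
  note p = w(1)
  from w(2) show ?case
  proof (induction rule: reduced.induct)
    case (w q t j)
    have "reduced (s * t) (\<lambda>g. fun_w g ^ (i + j) * poly (p * q) (fun_z g))"
      by (rule reduced.w) (simp add: p w power_add)
    then show ?case by (rule exI[where x = "\<lambda>g. fun_w g ^ (i + j) * poly (p * q) (fun_z g)", OF conjI]) (simp add: power_add)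
  next
    case (y q t j)
    obtain F where "reduced (t * s) F"
      "\<forall>g. det g = 1 \<longrightarrow> F g = fun_y g ^ j * poly q (fun_z g) * (fun_w g ^ i * poly p (fun_z g))"
      using reduced_yw[OF y p] by blast
    then show ?case by (intro exI[of _ F]) (simp add: mult.commute)
  next
    case (add t G H)
    then obtain G' H' where "reduced (s * t) G'" "reduced (s * t) H'"
      "\<forall>g. det g = 1 \<longrightarrow> G' g = fun_w g ^ i * poly p (fun_z g) * G g"
      "\<forall>g. det g = 1 \<longrightarrow> H' g = fun_w g ^ i * poly p (fun_z g) * H g" by blast
    then show ?case by (intro exI[of _ "\<lambda>g. G' g + H' g"]) (auto intro: reduced.add simp: distrib_left)
  qed
next
  case (add s F F')
  then obtain G' H' where "reduced (s * t) G'" "reduced (s * t) H'"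
    "\<forall>g. det g = 1 \<longrightarrow> G' g = F g * G g" "\<forall>g. det g = 1 \<longrightarrow> H' g = F' g * G g" by blast
  then show ?case by (intro exI[of _ "\<lambda>g. G' g + H' g"]) (auto intro: reduced.add simp: distrib_right)
qed

lemma signed_reduced: "signed s F \<Longrightarrow> \<exists>F'. reduced s F' \<and> (\<forall>g. det g = 1 \<longrightarrow> F' g = F g)"
proof (induction rule: signed.induct)
  case (const c)
  then show ?case using reduced.y[of "[:c:]" 1 0] by auto
next
  case y
  then show ?case using reduced.y[of 1 "-1" 1] by (auto intro!: exI[of _ fun_y])
next
  case z
  then show ?case using reduced.y[of "[:0,1:]" "-1" 0] by (auto intro!: exI[of _ fun_z])
next
  case w
  then show ?case using reduced.w[of 1 "-1" 1] by (auto intro!: exI[of _ fun_w])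
next
  case (add s F G)
  then obtain F' G' where "reduced s F'" "reduced s G'" "\<forall>g. det g = 1 \<longrightarrow> F' g = F g" "\<forall>g. det g = 1 \<longrightarrow> G' g = G g" by blast
  then show ?case by (intro exI[of _ "\<lambda>g. F' g + G' g"]) (auto intro: reduced.add)
next
  case (mult s F t G)
  then obtain F' G' where FG: "reduced s F'" "reduced t G'" "\<forall>g. det g = 1 \<longrightarrow> F' g = F g" "\<forall>g. det g = 1 \<longrightarrow> G' g = G g" by blast
  obtain H where "reduced (s * t) H" "\<forall>g. det g = 1 \<longrightarrow> H g = F' g * G' g" using reduced_mult[OF FG(1,2)] by blast
  then show ?case using FG by (intro exI[of _ H]) auto
qed

section \<open>Invariants of the torus and of its normalizer among the polynomials on the
  group\<close>

definition torus_polynomial :: "(complex^2^2 \<Rightarrow> complex) \<Rightarrow> bool"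
  where "torus_polynomial F \<longleftrightarrow> (\<exists>F0 F1. signed 1 F0 \<and> signed (-1) F1 \<and> (\<forall>g. det g = 1 \<longrightarrow> F g = F0 g + F1 g))"

lemma signed_zero: "signed (-1) (\<lambda>g. 0)"
  using signed_cmult[OF signed.y, of 0] by simp

lemma torus_polynomial_const: "torus_polynomial (\<lambda>g. c)"
  unfolding torus_polynomial_def using signed.const[of c] signed_zero by (intro exI[of _ "\<lambda>g. c"] exI[of _ "\<lambda>g. 0"]) simp

lemma torus_polynomial_odd: "signed (-1) F \<Longrightarrow> torus_polynomial F"
  unfolding torus_polynomial_def using signed.const[of 0] by (intro exI[of _ "\<lambda>g. 0"] exI[of _ F]) simp

lemma torus_polynomial_add:
  assumes "torus_polynomial F" "torus_polynomial G" shows "torus_polynomial (\<lambda>g. F g + G g)"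
proof -
  obtain F0 F1 G0 G1 where "signed 1 F0" "signed (-1) F1" "\<forall>g. det g = 1 \<longrightarrow> F g = F0 g + F1 g"
    "signed 1 G0" "signed (-1) G1" "\<forall>g. det g = 1 \<longrightarrow> G g = G0 g + G1 g"
    using assms unfolding torus_polynomial_def by blast
  then show ?thesis unfolding torus_polynomial_def
    by (intro exI[of _ "\<lambda>g. F0 g + G0 g"] exI[of _ "\<lambda>g. F1 g + G1 g"]) (auto intro: signed.add)
qed

lemma torus_polynomial_mult:
  assumes "torus_polynomial F" "torus_polynomial G" shows "torus_polynomial (\<lambda>g. F g * G g)"
proof -
  obtain F0 F1 G0 G1 where *: "signed 1 F0" "signed (-1) F1" "\<forall>g. det g = 1 \<longrightarrow> F g = F0 g + F1 g"
    "signed 1 G0" "signed (-1) G1" "\<forall>g. det g = 1 \<longrightarrow> G g = G0 g + G1 g"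
    using assms unfolding torus_polynomial_def by blast
  have "signed 1 (\<lambda>g. F0 g * G0 g + F1 g * G1 g)"
    using signed.add[OF signed.mult[OF *(1,4)], of "\<lambda>g. F1 g * G1 g"] signed.mult[OF *(2,5)] by simp
  moreover have "signed (-1) (\<lambda>g. F0 g * G1 g + F1 g * G0 g)"
    using signed.add[of "-1" "\<lambda>g. F0 g * G1 g" "\<lambda>g. F1 g * G0 g"] signed.mult[OF *(1,5)] signed.mult[OF *(2,4)] by simp
  ultimately show ?thesis unfolding torus_polynomial_def
    by (intro exI[of _ "\<lambda>g. F0 g * G0 g + F1 g * G1 g"] exI[of _ "\<lambda>g. F0 g * G1 g + F1 g * G0 g"])
      (use * in \<open>simp add: algebra_simps\<close>)
qed

lemma torus_polynomial_cong:
  "torus_polynomial F \<Longrightarrow> (\<And>g. det g = 1 \<Longrightarrow> G g = F g) \<Longrightarrow> torus_polynomial G"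
  unfolding torus_polynomial_def by metis

inductive monomial_sum :: "(complex^2^2 \<Rightarrow> complex) \<Rightarrow> bool" where
  monomial: "monomial_sum (\<lambda>A. c * (A$1$1 ^ i * A$1$2 ^ j * A$2$1 ^ k * A$2$2 ^ l))"
| add: "monomial_sum F \<Longrightarrow> monomial_sum G \<Longrightarrow> monomial_sum (\<lambda>A. F A + G A)"

lemma monomial_sum_mult: "monomial_sum F \<Longrightarrow> monomial_sum G \<Longrightarrow> monomial_sum (\<lambda>A. F A * G A)"
proof (induction rule: monomial_sum.induct)
  case (monomial c i j k l)
  then show ?case
  proof (induction rule: monomial_sum.induct)
    case (monomial c' i' j' k' l')
    have "(\<lambda>A::complex^2^2. c * (A$1$1 ^ i * A$1$2 ^ j * A$2$1 ^ k * A$2$2 ^ l) * (c' * (A$1$1 ^ i' * A$1$2 ^ j' * A$2$1 ^ k' * A$2$2 ^ l')))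
      = (\<lambda>A. (c * c') * (A$1$1 ^ (i + i') * A$1$2 ^ (j + j') * A$2$1 ^ (k + k') * A$2$2 ^ (l + l')))"
      by (rule ext) (simp only: power_add mult_ac)
    then show ?case using monomial_sum.monomial[of "c * c'" "i + i'" "j + j'" "k + k'" "l + l'"] by (simp only:)
  next
    case (add F G)
    then show ?case using monomial_sum.add[OF add.IH] by (simp add: distrib_left)
  qed
next
  case (add F G)
  then show ?case using monomial_sum.add[OF add.IH(1)[OF add.prems] add.IH(2)[OF add.prems]] by (simp add: distrib_right)
qed

lemma mpoly_monomial_sum: "F \<in> mpoly \<Longrightarrow> monomial_sum F"
proof (induction rule: mpoly.induct)
  case (const c)
  then show ?case using monomial_sum.monomial[of c 0 0 0 0] by simp
next
  case (entry i j)
  then show ?case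
    using exhaust_2[of i] exhaust_2[of j] monomial_sum.monomial[of 1 1 0 0 0] monomial_sum.monomial[of 1 0 1 0 0]
      monomial_sum.monomial[of 1 0 0 1 0] monomial_sum.monomial[of 1 0 0 0 1] by auto
qed (auto intro: monomial_sum.add monomial_sum_mult)

lemma torus_polynomial_entries:
  "torus_polynomial (\<lambda>g. g$1$1 * g$1$2)" "torus_polynomial (\<lambda>g. g$1$1 * g$2$2)"
  "torus_polynomial (\<lambda>g. g$2$1 * g$1$2)" "torus_polynomial (\<lambda>g. g$2$1 * g$2$2)"
proof -
  show "torus_polynomial (\<lambda>g. g$1$1 * g$1$2)" "torus_polynomial (\<lambda>g. g$2$1 * g$2$2)"
    using torus_polynomial_odd[OF signed.w] torus_polynomial_odd[OF signed.y]
    by (simp_all add: fun_y_def[abs_def] fun_w_def[abs_def])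
  show "torus_polynomial (\<lambda>g. g$1$1 * g$2$2)"
    by (rule torus_polynomial_cong[OF torus_polynomial_add[OF torus_polynomial_odd[OF signed.z] torus_polynomial_const[of "1/2"]]])
      (simp add: fun_z_def det_2 field_simps)
  show "torus_polynomial (\<lambda>g. g$2$1 * g$1$2)"
    by (rule torus_polynomial_cong[OF torus_polynomial_add[OF torus_polynomial_odd[OF signed.z] torus_polynomial_const[of "-1/2"]]])
      (simp add: fun_z_def det_2 field_simps)
qed

text \<open>Equal degrees in the two columns allow each entry of the first column to be paired with
  one of the second. The four possible products are \<open>fun_w\<close>, \<open>fun_y\<close> and,
  by the determinant, \<open>fun_z\<close> shifted by 1/2 or by -1/2.\<close>

lemma balanced_monomial:
  "i + k = n \<Longrightarrow> j + l = n \<Longrightarrow> torus_polynomial (\<lambda>A. A$1$1 ^ i * A$1$2 ^ j * A$2$1 ^ k * A$2$2 ^ l)"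
proof (induction n arbitrary: i j k l)
  case 0
  then show ?case using torus_polynomial_const[of 1] by simp
next
  case (Suc n)
  show ?case
  proof (cases i; cases j)
    fix i' j' assume s: "i = Suc i'" "j = Suc j'"
    have "torus_polynomial (\<lambda>A. (A$1$1 * A$1$2) * (A$1$1 ^ i' * A$1$2 ^ j' * A$2$1 ^ k * A$2$2 ^ l))"
      by (intro torus_polynomial_mult torus_polynomial_entries Suc.IH) (use s Suc.prems in auto)
    then show ?thesis by (simp add: s mult_ac)
  next
    fix i' assume s: "i = Suc i'" "j = 0"
    then obtain l' where l: "l = Suc l'" using Suc.prems by auto
    have "torus_polynomial (\<lambda>A. (A$1$1 * A$2$2) * (A$1$1 ^ i' * A$1$2 ^ j * A$2$1 ^ k * A$2$2 ^ l'))"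
      by (intro torus_polynomial_mult torus_polynomial_entries Suc.IH) (use s l Suc.prems in auto)
    then show ?thesis by (simp add: s l mult_ac)
  next
    fix j' assume s: "i = 0" "j = Suc j'"
    then obtain k' where k: "k = Suc k'" using Suc.prems by auto
    have "torus_polynomial (\<lambda>A. (A$2$1 * A$1$2) * (A$1$1 ^ i * A$1$2 ^ j' * A$2$1 ^ k' * A$2$2 ^ l))"
      by (intro torus_polynomial_mult torus_polynomial_entries Suc.IH) (use s k Suc.prems in auto)
    then show ?thesis by (simp add: s k mult_ac)
  next
    assume s: "i = 0" "j = 0"
    then obtain k' l' where k: "k = Suc k'" "l = Suc l'" using Suc.prems by auto
    have "torus_polynomial (\<lambda>A. (A$2$1 * A$2$2) * (A$1$1 ^ i * A$1$2 ^ j * A$2$1 ^ k' * A$2$2 ^ l'))"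
      by (intro torus_polynomial_mult torus_polynomial_entries Suc.IH) (use s k Suc.prems in auto)
    then show ?thesis by (simp add: s k mult_ac)
  qed
qed

text \<open>The coefficient of \<open>l ^ N\<close> is the torus average of \<open>F\<close>, to
  which a monomial contributes only if its degrees in the two columns agree. The bound
  \<open>N0\<close> keeps exponents nonnegative and lets summands share one
  \<open>N\<close>.\<close>

lemma torus_average:
  assumes "monomial_sum F"
  shows "\<exists>N0. \<forall>N\<ge>N0. \<exists>n f. N \<le> n \<and> torus_polynomial (f N) \<and> (\<forall>i>n. f i = (\<lambda>A. 0)) \<and>
    (\<forall>A l. l \<noteq> 0 \<longrightarrow> l ^ N * F (A ** diag2 l) = (\<Sum>i\<le>n. l ^ i * f i A))"
  using assms
proof induction
  case (monomial c i j k l)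
  let ?F = "\<lambda>A::complex^2^2. c * (A$1$1 ^ i * A$1$2 ^ j * A$2$1 ^ k * A$2$2 ^ l)"
  show ?case
  proof (rule exI[of _ "j + l"], intro allI impI)
    fix N assume N: "j + l \<le> N"
    define e where "e = N - (j + l) + (i + k)"
    define f where "f m = (if m = e then ?F else (\<lambda>A. 0))" for m
    have 1: "torus_polynomial (f N)"
    proof (cases "N = e")
      case True
      then have "i + k = j + l" using N by (simp add: e_def)
      then have "torus_polynomial ?F" by (intro torus_polynomial_mult torus_polynomial_const balanced_monomial) auto
      then show ?thesis using True by (simp add: f_def)
    qed (simp add: f_def torus_polynomial_const)
    have 2: "x ^ N * ?F (A ** diag2 x) = (\<Sum>m\<le>max N e. x ^ m * f m A)" if x: "x \<noteq> 0" for A x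
    proof -
      obtain a b c' d where A: "A = mat2 a b c' d" by (rule mat2_cases)
      have "x ^ N * inverse x ^ (j + l) = x ^ (N - (j + l))" using x N
        by (simp add: power_diff field_simps)
      then have "x ^ N * ?F (A ** diag2 x) = x ^ (N - (j + l)) * x ^ (i + k) * ?F A"
        by (simp add: A power_mult_distrib power_add mult_ac)
      also have "\<dots> = x ^ e * f e A" by (simp add: e_def f_def power_add)
      also have "\<dots> = (\<Sum>m\<le>max N e. if m = e then x ^ e * f e A else 0)" by simp
      also have "\<dots> = (\<Sum>m\<le>max N e. x ^ m * f m A)" by (rule sum.cong) (auto simp: f_def)
      finally show ?thesis .
    qed
    show "\<exists>n f. N \<le> n \<and> torus_polynomial (f N) \<and> (\<forall>i>n. f i = (\<lambda>A. 0)) \<and>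
      (\<forall>A x. x \<noteq> 0 \<longrightarrow> x ^ N * ?F (A ** diag2 x) = (\<Sum>i\<le>n. x ^ i * f i A))"
      by (rule exI[of _ "max N e"], rule exI[of _ f]) (use 1 2 in \<open>auto simp: f_def\<close>)
  qed
next
  case (add F G)
  obtain N1 where N1: "\<forall>N\<ge>N1. \<exists>n f. N \<le> n \<and> torus_polynomial (f N) \<and> (\<forall>i>n. f i = (\<lambda>A. 0)) \<and>
    (\<forall>A l. l \<noteq> 0 \<longrightarrow> l ^ N * F (A ** diag2 l) = (\<Sum>i\<le>n. l ^ i * f i A))" using add.IH(1) by blast
  obtain N2 where N2: "\<forall>N\<ge>N2. \<exists>n f. N \<le> n \<and> torus_polynomial (f N) \<and> (\<forall>i>n. f i = (\<lambda>A. 0)) \<and>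
    (\<forall>A l. l \<noteq> 0 \<longrightarrow> l ^ N * G (A ** diag2 l) = (\<Sum>i\<le>n. l ^ i * f i A))" using add.IH(2) by blast
  show ?case
  proof (rule exI[of _ "max N1 N2"], intro allI impI)
    fix N assume N: "N \<ge> max N1 N2"
    then have "N \<ge> N1" "N \<ge> N2" by auto
    from N1[rule_format, OF this(1)] obtain n f where f: "N \<le> n" "torus_polynomial (f N)" "\<forall>i>n. f i = (\<lambda>A. 0)"
      "\<forall>A l. l \<noteq> 0 \<longrightarrow> l ^ N * F (A ** diag2 l) = (\<Sum>i\<le>n. l ^ i * f i A)" by blast
    from N2[rule_format, OF \<open>N \<ge> N2\<close>] obtain m h where h: "N \<le> m" "torus_polynomial (h N)" "\<forall>i>m. h i = (\<lambda>A. 0)"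
      "\<forall>A l. l \<noteq> 0 \<longrightarrow> l ^ N * G (A ** diag2 l) = (\<Sum>i\<le>m. l ^ i * h i A)" by blast
    have 1: "(\<Sum>i\<le>n. l ^ i * f i A) = (\<Sum>i\<le>max n m. l ^ i * f i A)" for l A
      by (rule sum.mono_neutral_left) (auto simp: f(3))
    have 2: "(\<Sum>i\<le>m. l ^ i * h i A) = (\<Sum>i\<le>max n m. l ^ i * h i A)" for l A
      by (rule sum.mono_neutral_left) (auto simp: h(3))
    show "\<exists>n f. N \<le> n \<and> torus_polynomial (f N) \<and> (\<forall>i>n. f i = (\<lambda>A. 0)) \<and>
      (\<forall>A l. l \<noteq> 0 \<longrightarrow> l ^ N * (F (A ** diag2 l) + G (A ** diag2 l)) = (\<Sum>i\<le>n. l ^ i * f i A))"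
      by (rule exI[of _ "max n m"], rule exI[of _ "\<lambda>i A. f i A + h i A"])
        (use f h 1 2 torus_polynomial_add[OF f(2) h(2)] in \<open>auto simp: distrib_left sum.distrib\<close>)
  qed
qed

lemma torus_invariant_polynomial:
  assumes "F \<in> mpoly" "\<And>g l. det g = 1 \<Longrightarrow> l \<noteq> 0 \<Longrightarrow> F (g ** diag2 l) = F g"
  shows "torus_polynomial F"
proof -
  obtain N n f where f: "N \<le> n" "torus_polynomial (f N)"
    "\<forall>A l. l \<noteq> 0 \<longrightarrow> l ^ N * F (A ** diag2 l) = (\<Sum>i\<le>n. l ^ i * f i A)"
    using torus_average[OF mpoly_monomial_sum[OF assms(1)]] by blast
  show ?thesis
  proof (rule torus_polynomial_cong[OF f(2)])
    fix g :: "complex^2^2" assume g: "det g = 1"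
    have "(\<Sum>i\<le>n. l ^ i * (if i = N then F g else 0)) = (\<Sum>i\<le>n. l ^ i * f i g)" if l: "l \<noteq> 0" for l
    proof -
      have "(\<Sum>i\<le>n. l ^ i * (if i = N then F g else 0)) = (\<Sum>i\<le>n. if i = N then l ^ N * F g else 0)"
        by (rule sum.cong) auto
      also have "\<dots> = l ^ N * F (g ** diag2 l)" using f(1) assms(2)[OF g l] by simp
      finally show ?thesis using f(3) l by simp
    qed
    from sum_powers_unique[OF this f(1)] show "F g = f N g" by simp
  qed
qed

lemma normalizer_invariant_polynomial:
  assumes "torus_polynomial F" "\<And>g. det g = 1 \<Longrightarrow> F (g ** weyl) = F g"
  shows "\<exists>F0. signed 1 F0 \<and> (\<forall>g. det g = 1 \<longrightarrow> F g = F0 g)"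
proof -
  obtain F0 F1 where F: "signed 1 F0" "signed (-1) F1" "\<And>g. det g = 1 \<Longrightarrow> F g = F0 g + F1 g"
    using assms(1) unfolding torus_polynomial_def by blast
  have "F g = F0 g" if g: "det g = 1" for g
  proof -
    have "F (g ** weyl) = F0 (g ** weyl) + F1 (g ** weyl)" by (rule F(3)) (simp add: det_mul g)
    then have "F0 g + F1 g = F0 g - F1 g"
      using assms(2)[OF g] F(3)[OF g] signed_weyl_right[OF F(1)] signed_weyl_right[OF F(2)] by simp
    then show ?thesis using F(3)[OF g] by simp
  qed
  then show ?thesis using F(1) by blast
qed

text \<open>The polynomial in \<open>fun_z\<close> that remains when \<open>fun_y ^ n\<close> is
  lowered \<open>k\<close> times. For \<open>k = n\<close> it is the Legendre polynomial of degree
  \<open>n\<close> in twice the argument.\<close>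

definition zonal :: "nat \<Rightarrow> nat \<Rightarrow> complex poly"
  where "zonal n k = (\<Sum>i\<le>k. smult (of_nat ((n choose i) * (n choose (k - i)))) ([:1/2, 1:] ^ i * [:-1/2, 1:] ^ (k - i)))"

text \<open>The quadratic polynomial factors as \<open>(c + a r) (d + b r)\<close>, so its power is
  a product of two binomial powers. In the resulting sum \<open>a d\<close> and \<open>b c\<close>
  are expressed through \<open>fun_z\<close> by the determinant.\<close>

lemma coeff_orbit_power:
  assumes "det g = 1" "k \<le> n"
  shows "coeff ([:fun_y g, 2 * fun_z g, fun_w g:] ^ n) k = fun_y g ^ (n - k) * poly (zonal n k) (fun_z g)"
proof -
  obtain a b c d where g: "g = mat2 a b c d" by (rule mat2_cases)
  have ad: "a * d = fun_z g + 1/2" "b * c = fun_z g - 1/2"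
    using assms(1) by (auto simp: g fun_z_def field_simps)
  have "[:fun_y g, 2 * fun_z g, fun_w g:] = [:c, a:] * [:d, b:]"
    by (simp add: g fun_yzw_defs)
  then have "coeff ([:fun_y g, 2 * fun_z g, fun_w g:] ^ n) k = (\<Sum>i\<le>k. coeff ([:c, a:] ^ n) i * coeff ([:d, b:] ^ n) (k - i))"
    by (simp only: power_mult_distrib coeff_mult)
  also have "\<dots> = (\<Sum>i\<le>k. fun_y g ^ (n - k) * (of_nat ((n choose i) * (n choose (k - i))) * ((fun_z g + 1/2) ^ i * (fun_z g - 1/2) ^ (k - i))))"
  proof (rule sum.cong[OF refl])
    fix i assume "i \<in> {..k}"
    then have i: "i \<le> k" by simp
    have "coeff ([:c, a:] ^ n) i * coeff ([:d, b:] ^ n) (k - i)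
      = of_nat (n choose i) * a ^ i * c ^ (n - i) * (of_nat (n choose (k - i)) * b ^ (k - i) * d ^ (n - (k - i)))"
      using i assms(2) by (simp add: coeff_linear_poly_power)
    also have "c ^ (n - i) = c ^ (n - k) * c ^ (k - i)" using i assms(2) by (simp add: power_add[symmetric])
    also have "d ^ (n - (k - i)) = d ^ (n - k) * d ^ i" using i assms(2) by (simp add: power_add[symmetric])
    finally have "coeff ([:c, a:] ^ n) i * coeff ([:d, b:] ^ n) (k - i)
      = (c * d) ^ (n - k) * (of_nat ((n choose i) * (n choose (k - i))) * ((a * d) ^ i * (b * c) ^ (k - i)))"
      by (simp add: power_mult_distrib mult_ac)
    also have "c * d = fun_y g" by (simp add: g fun_y_def)
    finally show "coeff ([:c, a:] ^ n) i * coeff ([:d, b:] ^ n) (k - i)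
      = fun_y g ^ (n - k) * (of_nat ((n choose i) * (n choose (k - i))) * ((fun_z g + 1/2) ^ i * (fun_z g - 1/2) ^ (k - i)))"
      unfolding ad .
  qed
  also have "\<dots> = fun_y g ^ (n - k) * poly (zonal n k) (fun_z g)"
    by (simp add: zonal_def poly_sum sum_distrib_left add.commute)
  finally show ?thesis .
qed

text \<open>Replacing \<open>i\<close> by \<open>k - i\<close> exchanges the two linear factors up
  to sign.\<close>

lemma zonal_parity: "poly (zonal n k) (- x) = (-1) ^ k * poly (zonal n k) x"
proof -
  have "poly (zonal n k) (- x) = (\<Sum>i\<le>k. of_nat ((n choose i) * (n choose (k - i))) * ((1/2 - x) ^ i * (- 1/2 - x) ^ (k - i)))"
    by (simp add: zonal_def poly_sum)
  also have "\<dots> = (\<Sum>i\<le>k. of_nat ((n choose (k - i)) * (n choose (k - (k - i)))) * ((1/2 - x) ^ (k - i) * (- 1/2 - x) ^ (k - (k - i))))"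
    by (rule sum.reindex_bij_witness[of _ "\<lambda>i. k - i" "\<lambda>i. k - i"]) auto
  also have "\<dots> = (\<Sum>i\<le>k. (-1) ^ k * (of_nat ((n choose i) * (n choose (k - i))) * ((1/2 + x) ^ i * (- 1/2 + x) ^ (k - i))))"
  proof (rule sum.cong[OF refl])
    fix i assume "i \<in> {..k}"
    then have i: "i \<le> k" by simp
    have "(1/2 - x) ^ (k - i) * (- 1/2 - x) ^ i = ((-1) * (- 1/2 + x)) ^ (k - i) * ((-1) * (1/2 + x)) ^ i" by simp
    also have "\<dots> = ((-1) ^ (k - i) * (-1) ^ i) * ((1/2 + x) ^ i * (- 1/2 + x) ^ (k - i))"
      by (simp only: power_mult_distrib mult_ac)
    also have "(-1) ^ (k - i) * (-1) ^ i = ((-1) ^ k :: complex)" using i by (simp add: power_add[symmetric])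
    finally show "of_nat ((n choose (k - i)) * (n choose (k - (k - i)))) * ((1/2 - x) ^ (k - i) * (- 1/2 - x) ^ (k - (k - i)))
      = (-1) ^ k * (of_nat ((n choose i) * (n choose (k - i))) * ((1/2 + x) ^ i * (- 1/2 + x) ^ (k - i)))"
      using i by (simp add: mult_ac)
  qed
  also have "\<dots> = (-1) ^ k * poly (zonal n k) x"
    by (simp add: zonal_def poly_sum sum_distrib_left)
  finally show ?thesis .
qed

lemma zonal_degree: "degree (zonal n k) \<le> k"
  unfolding zonal_def
proof (rule degree_sum_le)
  fix i assume i: "i \<in> {..k}"
  have "degree ([:1/2, 1::complex:] ^ i * [:-1/2, 1:] ^ (k - i)) \<le> k"
    using i by (intro order_trans[OF degree_mult_le]) (simp add: degree_power_eq)
  then show "degree (smult (of_nat ((n choose i) * (n choose (k - i)))) ([:1/2, 1::complex:] ^ i * [:-1/2, 1:] ^ (k - i))) \<le> k"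
    by (rule order_trans[OF degree_smult_le])
qed simp

text \<open>By Vandermonde's identity the leading coefficient is the binomial coefficient of
  \<open>2 n\<close> over \<open>k\<close>.\<close>

lemma zonal_lead: "k \<le> 2 * n \<Longrightarrow> coeff (zonal n k) k \<noteq> 0"
proof -
  assume k: "k \<le> 2 * n"
  have "coeff ([:1/2, 1::complex:] ^ i * [:-1/2, 1:] ^ (k - i)) k = 1" if "i \<le> k" for i
  proof -
    have "degree ([:1/2, 1::complex:] ^ i * [:-1/2, 1:] ^ (k - i)) = k"
      using that by (simp add: degree_mult_eq degree_power_eq)
    moreover have "lead_coeff ([:1/2, 1::complex:] ^ i * [:-1/2, 1:] ^ (k - i)) = 1"
      by (simp add: lead_coeff_mult lead_coeff_power)
    ultimately show ?thesis by simp
  qed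
  then have "coeff (zonal n k) k = (\<Sum>i\<le>k. of_nat ((n choose i) * (n choose (k - i))))"
    by (simp add: zonal_def coeff_sum)
  also have "\<dots> = of_nat ((n + n) choose k)" by (simp only: vandermonde[symmetric] of_nat_sum)
  finally show ?thesis using k by simp
qed

text \<open>Where \<open>z\<close> differs from -1/2 the upper left entry can be normalized to 1. On
  the rest of the quadric \<open>y * w = 0\<close>, and an explicit matrix exists for each of the
  two lines.\<close>

lemma exists_matrix_with_invariants:
  assumes "y * w = z\<^sup>2 - 1/4"
  obtains g where "det g = 1" "fun_y g = y" "fun_z g = z" "fun_w g = w"
proof (cases "z = -1/2")
  case False
  define d where "d = z + 1/2"
  have d: "d \<noteq> 0" using False by (simp add: d_def eq_neg_iff_add_eq_0[symmetric])
  have w: "w * y = (z - 1/2) * d" using assms by (simp add: d_def power2_eq_square field_simps)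
  have bc: "w * (y / d) = z - 1/2" using w d by (simp add: divide_eq_eq)
  show ?thesis
  proof (rule that[of "mat2 1 w (y / d) d"])
    show "det (mat2 1 w (y / d) d) = 1" "fun_z (mat2 1 w (y / d) d) = z"
      using bc by (simp_all add: fun_z_def d_def)
  qed (use d in \<open>simp_all add: fun_yzw_defs\<close>)
next
  case True
  then have "y = 0 \<or> w = 0" using assms by (simp add: power2_eq_square)
  then show ?thesis
  proof
    assume "y = 0"
    then show ?thesis by (intro that[of "mat2 w 1 (-1) 0"]) (auto simp: fun_yzw_defs True)
  next
    assume "w = 0"
    then show ?thesis by (intro that[of "mat2 0 1 (-1) (-y)"]) (auto simp: fun_yzw_defs True)
  qed
qed

section \<open>The case of a point fixed by the torus\<close>

text \<open>Closed forms of the first two zonal polynomials, which enter the second transvectant of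
  \<open>fun_y ^ l\<close> with itself in \<open>realized_y_step\<close>.\<close>

lemma lower_squared_transvectant:
  assumes "det g = 1" "l \<ge> 2"
  shows "poly (zonal l 1) x = 2 * of_nat l * x"
    and "poly (zonal l 2) x = of_nat l * (2 * of_nat l - 1) * x\<^sup>2 - of_nat l / 4"
proof -
  show "poly (zonal l 1) x = 2 * of_nat l * x"
    by (simp add: zonal_def algebra_simps)
  have "even (l * (l - 1))" by (cases l) auto
  then have "2 * (l choose 2) = l * (l - 1)" by (simp only: choose_two dvd_mult_div_cancel)
  then have "of_nat (2 * (l choose 2)) = (of_nat (l * (l - 1)) :: complex)" by (rule arg_cong)
  then have c: "2 * of_nat (l choose 2) = of_nat l * (of_nat l - 1 :: complex)" using assms(2) by (simp add: of_nat_diff)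
  have "poly (zonal l 2) x = of_nat (l choose 2) * (x - 1/2)\<^sup>2 + of_nat l * of_nat l * ((x + 1/2) * (x - 1/2))
     + of_nat (l choose 2) * (x + 1/2)\<^sup>2"
  proof -
    have s: "{..2::nat} = {0, 1, 2}" by auto
    have "poly (zonal l 2) x = (\<Sum>i\<in>{0, 1, 2}. of_nat ((l choose i) * (l choose (2 - i))) * ((1/2 + x) ^ i * (- 1/2 + x) ^ (2 - i)))"
      unfolding zonal_def s poly_sum by (rule sum.cong[OF refl]) simp
    also have "\<dots> = of_nat (l choose 2) * (- 1/2 + x)\<^sup>2 + (of_nat l * of_nat l * ((1/2 + x) * (- 1/2 + x)) + of_nat (l choose 2) * (1/2 + x)\<^sup>2)"
      by simp
    finally show ?thesis by (simp add: add.commute)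
  qed
  also have "\<dots> = (2 * of_nat (l choose 2)) * (x\<^sup>2 + 1/4) + of_nat l * of_nat l * (x\<^sup>2 - 1/4)"
    by (simp add: power2_eq_square algebra_simps)
  also have "\<dots> = of_nat l * (2 * of_nat l - 1) * x\<^sup>2 - of_nat l / 4"
    unfolding c by (simp add: power2_eq_square field_simps)
  finally show "poly (zonal l 2) x = of_nat l * (2 * of_nat l - 1) * x\<^sup>2 - of_nat l / 4" .
qed

lemma parity_coeff:
  fixes p :: "complex poly"
  assumes "\<And>x. poly p (- x) = s * poly p x" shows "(-1) ^ j * coeff p j = s * coeff p j"
proof -
  have "poly (pcompose p [:0, -1:]) = poly (smult s p)" using assms by (simp add: poly_pcompose fun_eq_iff)
  then have "pcompose p [:0, -1:] = smult s p" by (simp add: poly_eq_poly_eq_iff)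
  then have "coeff (pcompose p [:0, -1:]) j = s * coeff p j" by simp
  then show ?thesis by (simp add: coeff_pcompose_linear)
qed

context complete_sl2_variety
begin

context
  fixes p assumes p: "p \<in> P"
    and inj: "\<And>a. a \<in> R \<Longrightarrow> (\<And>g. det g = 1 \<Longrightarrow> a (act g p) = 0) \<Longrightarrow> vanishes a"
    and fixed: "\<And>l. l \<noteq> 0 \<Longrightarrow> act (diag2 l) p = p"
begin

text \<open>Restriction to the orbit of \<open>p\<close> embeds \<open>R\<close>, up to values
  outside \<open>P\<close>, into the torus invariants on the group. The aim is to show that the
  image consists of all of them or of the even ones.\<close>

definition realizes :: "('a \<Rightarrow> complex) \<Rightarrow> (complex^2^2 \<Rightarrow> complex) \<Rightarrow> bool"
  where "realizes a F \<longleftrightarrow> a \<in> R \<and> (\<forall>g. det g = 1 \<longrightarrow> a (act g p) = F g)"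

definition realized :: "(complex^2^2 \<Rightarrow> complex) \<Rightarrow> bool"
  where "realized F \<longleftrightarrow> (\<exists>a. realizes a F)"

lemma realized_const: "realized (\<lambda>g. c)"
  unfolding realized_def realizes_def by (intro exI[of _ "\<lambda>x. c"]) (simp add: R_const)

lemma realized_add: "realized F \<Longrightarrow> realized G \<Longrightarrow> realized (\<lambda>g. F g + G g)"
  unfolding realized_def realizes_def by (elim exE, rule_tac x = "\<lambda>x. a x + aa x" in exI) (simp add: R_add)

lemma realized_mult: "realized F \<Longrightarrow> realized G \<Longrightarrow> realized (\<lambda>g. F g * G g)"
  unfolding realized_def realizes_def by (elim exE, rule_tac x = "\<lambda>x. a x * aa x" in exI) (simp add: R_mult)

lemma realized_cmult: "realized F \<Longrightarrow> realized (\<lambda>g. c * F g)"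
  by (rule realized_mult[OF realized_const])

lemma realized_diff: "realized F \<Longrightarrow> realized G \<Longrightarrow> realized (\<lambda>g. F g - G g)"
  using realized_add[OF _ realized_cmult[of G "-1"], of F] by simp

lemma realized_power: "realized F \<Longrightarrow> realized (\<lambda>g. F g ^ n)"
  by (induction n) (auto intro: realized_const realized_mult)

lemma realized_sum: "(\<And>i. i \<in> I \<Longrightarrow> realized (F i)) \<Longrightarrow> realized (\<lambda>g. \<Sum>i\<in>I. F i g)"
  by (induction I rule: infinite_finite_induct) (auto intro: realized_const realized_add)

lemma realized_cong: "realized F \<Longrightarrow> (\<And>g. det g = 1 \<Longrightarrow> G g = F g) \<Longrightarrow> realized G"
  unfolding realized_def realizes_def by auto

lemma realized_left: assumes "realized F" "det h = 1" shows "realized (\<lambda>g. F (h ** g))"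
proof -
  obtain a where "a \<in> R" "\<And>g. det g = 1 \<Longrightarrow> a (act g p) = F g" using assms unfolding realized_def realizes_def by blast
  then show ?thesis unfolding realized_def realizes_def
    by (intro exI[of _ "\<lambda>x. a (act h x)"]) (use assms(2) p in \<open>auto simp: R_act act_act det_mul\<close>)
qed

lemma realized_coeff:
  assumes "realized F" "\<And>g z. det g = 1 \<Longrightarrow> F (lower z ** g) = poly (Q g) z"
  shows "realized (\<lambda>g. coeff (Q g) i)"
proof -
  obtain a where a: "a \<in> R" "\<And>g. det g = 1 \<Longrightarrow> a (act g p) = F g" using assms(1) unfolding realized_def realizes_def by blast
  obtain n e where e: "\<And>i. e i \<in> R" "\<And>i x. i > n \<Longrightarrow> e i x = 0"
    "\<And>z x. x \<in> P \<Longrightarrow> a (act (lower z) x) = (\<Sum>i\<le>n. z ^ i * e i x)"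
  proof (rule act_curve[OF a(1), of lower])
    show "F \<in> mpoly \<Longrightarrow> \<exists>p. \<forall>z. F (lower z) = poly p z" for F by (metis mpoly_lower)
  qed auto
  have "e i (act g p) = coeff (Q g) i" if g: "det g = 1" for g
  proof -
    define q where "q = (\<Sum>i\<le>n. monom (e i (act g p)) i)"
    have "poly q z = poly (Q g) z" for z
    proof -
      have "poly q z = a (act (lower z) (act g p))"
        using e(3)[of "act g p" z] p g by (simp add: q_def poly_sum poly_monom act_closed mult.commute)
      also have "act (lower z) (act g p) = act (lower z ** g) p" by (rule act_act) (use g p in auto)
      also have "a \<dots> = F (lower z ** g)" by (rule a(2)) (use g in \<open>simp add: det_mul\<close>)
      finally show ?thesis using assms(2)[OF g] by simp
    qed
    then have "q = Q g" by (simp add: poly_eq_poly_eq_iff[symmetric] fun_eq_iff)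
    moreover have "coeff q i = e i (act g p)" by (cases "i \<le> n") (auto simp: q_def coeff_sum e(2))
    ultimately show ?thesis by simp
  qed
  then show ?thesis unfolding realized_def realizes_def using e(1) by blast
qed

lemma realized_lower_derivation:
  assumes "realized F" "lower_derivation F F'" shows "realized F'"
proof -
  obtain Q where Q: "\<forall>g. (\<forall>r. F (lower r ** g) = poly (Q g) r) \<and> coeff (Q g) 0 = F g \<and> coeff (Q g) 1 = F' g"
    using assms(2) unfolding lower_derivation_def by blast
  have "realized (\<lambda>g. coeff (Q g) 1)" by (rule realized_coeff[OF assms(1)]) (use Q in simp)
  then show ?thesis using Q by simp
qed

lemma realized_y_lower:
  assumes "realized (\<lambda>g. fun_y g ^ n)" "k \<le> n"
  shows "realized (\<lambda>g. fun_y g ^ (n - k) * poly (zonal n k) (fun_z g))"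
proof -
  have "realized (\<lambda>g. coeff ([:fun_y g, 2 * fun_z g, fun_w g:] ^ n) k)"
    by (rule realized_coeff[OF assms(1)]) (simp add: fun_lower power2_eq_square algebra_simps)
  then show ?thesis by (rule realized_cong) (simp add: coeff_orbit_power assms(2))
qed

text \<open>Invariance under \<open>upper\<close> and the weight reduce the function to a polynomial
  \<open>q\<close> in \<open>c / d\<close>. The torus fixes \<open>p\<close>, and the single element
  \<open>diag2 2\<close> already forces \<open>q\<close> to be a monomial, because distinct powers
  of 2 differ.\<close>

lemma highest_weight_on_torus_orbit:
  assumes h: "highest_weight n h" "\<not> vanishes h"
  obtains l c where "n = 2 * l" "c \<noteq> 0" "\<And>g. det g = 1 \<Longrightarrow> h (act g p) = c * fun_y g ^ l"
proof -
  have hR: "h \<in> R" using h by (simp add: highest_weight_def)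
  obtain F where F: "F \<in> mpoly" "\<And>g. det g = 1 \<Longrightarrow> h (act g p) = F g" by (rule orbit_function[OF hR p]) blast
  obtain q where q: "\<And>r. F (lower r) = poly q r" by (rule mpoly_lower[OF F(1)]) blast
  have Fd: "F (mat2 x b c d) = d ^ n * poly q (c / d)" if d: "x * d - b * c = 1" "d \<noteq> 0" for x b c d
  proof -
    have x: "x = (1 + b * c) / d" using d by (simp add: field_simps)
    have "upper (b / d) ** (diag2 (inverse d) ** lower (c / d)) = mat2 x b c d"
      using d(2) by (simp add: x field_simps)
    then have "h (act (mat2 x b c d) p) = h (act (upper (b / d)) (act (diag2 (inverse d)) (act (lower (c / d)) p)))"
      using act_act[of "upper (b / d)" "diag2 (inverse d) ** lower (c / d)" p]
        act_act[of "diag2 (inverse d)" "lower (c / d)" p] d(2) p by (simp add: det_mul del: mat2_mult act_mat2)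
    also have "\<dots> = h (act (diag2 (inverse d)) (act (lower (c / d)) p))"
      using h(1) p d(2) unfolding highest_weight_def upper_invariant_def
      by (metis act_upper_lower_closed(2,3) nonzero_imp_inverse_nonzero)
    also have "inverse d ^ n * \<dots> = h (act (lower (c / d)) p)"
      using h(1) p d(2) unfolding highest_weight_def weight_def
      by (metis act_upper_lower_closed(2) nonzero_imp_inverse_nonzero power_0 mult_1)
    finally have "inverse d ^ n * h (act (mat2 x b c d) p) = F (lower (c / d))" using F(2) by simp
    then show ?thesis using F(2)[of "mat2 x b c d"] d q by (simp add: field_simps)
  qed
  have inv: "2 ^ n * poly q r = poly q (4 * r)" for r
  proof -
    have "F (mat2 2 0 (r * 2) (inverse 2)) = h (act (lower r ** diag2 2) p)" using F(2)[of "lower r ** diag2 2"] by simp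
    also have "\<dots> = h (act (lower r) (act (diag2 2) p))" using act_act[of "lower r" "diag2 2" p] p by simp
    also have "\<dots> = poly q r" using fixed[of 2] F(2)[of "lower r"] q by simp
    finally have "F (mat2 2 0 (r * 2) (inverse 2)) = poly q r" .
    moreover have "F (mat2 2 0 (r * 2) (inverse 2)) = inverse 2 ^ n * poly q (r * 2 / inverse 2)"
      by (rule Fd) auto
    ultimately show ?thesis by (simp add: field_simps)
  qed
  have co: "2 ^ n * coeff q i = 4 ^ i * coeff q i" for i
  proof -
    have "poly (smult (2 ^ n) q) = poly (pcompose q [:0, 4:])" using inv by (simp add: poly_pcompose fun_eq_iff mult.commute)
    then have "smult (2 ^ n) q = pcompose q [:0, 4:]" by (simp add: poly_eq_poly_eq_iff)
    then have "coeff (smult (2 ^ n) q) i = coeff (pcompose q [:0, 4:]) i" by simp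
    then show ?thesis by (simp add: coeff_pcompose_linear)
  qed
  have ni: "n = 2 * i" if "coeff q i \<noteq> 0" for i
  proof -
    have "(2::complex) ^ n = 2 ^ (2 * i)" using co[of i] that by (simp add: power_mult)
    then have "norm ((2::complex) ^ n) = norm ((2::complex) ^ (2 * i))" by simp
    then have "(2::real) ^ n = 2 ^ (2 * i)" by (simp only: norm_power norm_numeral)
    then show ?thesis by (simp add: power_inject_exp del: power_mult)
  qed
  have "q \<noteq> 0"
  proof
    assume "q = 0"
    have "vanishes h"
      by (rule vanishesI_dense[OF p inj hR]) (use Fd F(2) \<open>q = 0\<close> in \<open>auto\<close>)
    then show False using h(2) by simp
  qed
  then obtain l where l: "coeff q l \<noteq> 0" using leading_coeff_0_iff by blast
  have n: "n = 2 * l" by (rule ni[OF l])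
  have qm: "q = monom (coeff q l) l"
  proof (rule poly_eqI)
    show "coeff q i = coeff (monom (coeff q l) l) i" for i using ni[of i] n by (cases "coeff q i = 0") (auto simp: l)
  qed
  have "h (act g p) = coeff q l * fun_y g ^ l" if g: "det g = 1" for g
  proof -
    have "F g - coeff q l * fun_y g ^ l = 0"
    proof (rule mpoly_dense_zero[OF _ _ g])
      show "(\<lambda>g. F g - coeff q l * fun_y g ^ l) \<in> mpoly"
        using signed_mpoly[OF signed_cmult[OF signed_power[OF signed.y]]] by (intro mpoly_diff F(1)) blast
      fix x b c d :: complex assume d: "x * d - b * c = 1" "d \<noteq> 0"
      have "F (mat2 x b c d) = d ^ (2 * l) * (coeff q l * (c / d) ^ l)"
        unfolding Fd[OF d] n by (subst qm) (simp add: poly_monom)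
      also have "\<dots> = coeff q l * fun_y (mat2 x b c d) ^ l"
        using d(2) by (simp add: fun_y_def power_mult power2_eq_square power_divide power_mult_distrib)
      finally show "F (mat2 x b c d) - coeff q l * fun_y (mat2 x b c d) ^ l = 0" by simp
    qed
    then show ?thesis using F(2)[OF g] by simp
  qed
  then show ?thesis using that n l by blast
qed

lemma realized_y_exists: obtains l where "l \<ge> 1" "realized (\<lambda>g. fun_y g ^ l)"
proof -
  obtain f0 l0 x0 where "f0 \<in> R" "l0 \<noteq> 0" "x0 \<in> P" "f0 (act (diag2 l0) x0) \<noteq> f0 x0"
    using torus_nontrivial by blast
  then obtain n h where h: "n > 0" "highest_weight n h" "\<not> vanishes h"
    by (rule positive_highest_weight_exists)
  obtain l c where l: "n = 2 * l" "c \<noteq> 0" "\<And>g. det g = 1 \<Longrightarrow> h (act g p) = c * fun_y g ^ l"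
    by (rule highest_weight_on_torus_orbit[OF h(2,3)]) blast
  have "realized (\<lambda>g. c * fun_y g ^ l)"
    unfolding realized_def realizes_def using h(2) l(3) by (auto simp: highest_weight_def)
  from realized_cmult[OF this, of "inverse c"] have "realized (\<lambda>g. fun_y g ^ l)"
    using l(2) by (simp add: mult.assoc[symmetric])
  then show ?thesis by (rule that[rotated]) (use h(1) l(1) in simp)
qed

text \<open>This is the second transvectant of \<open>fun_y ^ l\<close> with itself: the constants
  make the terms with the square of \<open>fun_z\<close> cancel. Together with the exponent
  \<open>2 * l\<close> it provides two even exponents whose halves \<open>l - 1\<close> and
  \<open>l\<close> are coprime.\<close>

lemma realized_y_step:
  assumes "realized (\<lambda>g. fun_y g ^ l)" "l \<ge> 2" shows "realized (\<lambda>g. fun_y g ^ (2 * l - 2))"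
proof -
  let ?C1 = "\<lambda>g. fun_y g ^ (l - 1) * poly (zonal l 1) (fun_z g)"
  let ?C2 = "\<lambda>g. fun_y g ^ (l - 2) * poly (zonal l 2) (fun_z g)"
  let ?k = "of_nat l :: complex"
  have k: "?k \<noteq> 0" using assms(2) by simp
  have C: "realized ?C1" "realized ?C2" using realized_y_lower[OF assms(1)] assms(2) by auto
  have "realized (\<lambda>g. (4 / ?k) * (((2 * ?k - 1) / (4 * ?k)) * ?C1 g ^ 2 - fun_y g ^ l * ?C2 g))"
    by (rule realized_cmult[OF realized_diff[OF realized_cmult[OF realized_power[OF C(1)]] realized_mult[OF assms(1) C(2)]]])
  then show ?thesis
  proof (rule realized_cong)
    fix g :: "complex^2^2" assume g: "det g = 1"
    define Y where "Y = fun_y g ^ (2 * l - 2)"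
    have e: "2 * l - 2 = (l - 1) * 2" "l + (l - 2) = 2 * l - 2" using assms(2) by simp_all
    have y1: "Y = (fun_y g ^ (l - 1))\<^sup>2" unfolding Y_def e(1) by (rule power_mult)
    have y2: "fun_y g ^ l * fun_y g ^ (l - 2) = Y" unfolding Y_def e(2)[symmetric] by (rule power_add[symmetric])
    have c1: "?C1 g ^ 2 = Y * (2 * ?k * fun_z g)\<^sup>2"
      unfolding lower_squared_transvectant(1)[OF g assms(2)] y1 by (rule power_mult_distrib)
    have c2: "fun_y g ^ l * ?C2 g = Y * (?k * (2 * ?k - 1) * (fun_z g)\<^sup>2 - ?k / 4)"
      unfolding lower_squared_transvectant(2)[OF g assms(2)] y2[symmetric] by (rule mult.assoc[symmetric])
    have "(4 / ?k) * (((2 * ?k - 1) / (4 * ?k)) * ?C1 g ^ 2 - fun_y g ^ l * ?C2 g)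
      = Y * ((4 / ?k) * (((2 * ?k - 1) / (4 * ?k)) * (2 * ?k * fun_z g)\<^sup>2
        - (?k * (2 * ?k - 1) * (fun_z g)\<^sup>2 - ?k / 4)))"
      unfolding c1 c2 by (simp only: right_diff_distrib mult_ac)
    also have "(4 / ?k) * (((2 * ?k - 1) / (4 * ?k)) * (2 * ?k * fun_z g)\<^sup>2
        - (?k * (2 * ?k - 1) * (fun_z g)\<^sup>2 - ?k / 4)) = 1"
      using k by (simp add: field_simps power2_eq_square)
    finally show "fun_y g ^ (2 * l - 2) = (4 / ?k) * (((2 * ?k - 1) / (4 * ?k)) * ?C1 g ^ 2 - fun_y g ^ l * ?C2 g)" by (simp add: Y_def)
  qed
qed

text \<open>An odd power of \<open>fun_y\<close> separates the quotient by the torus from the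
  quotient by the normalizer, on which only even functions live.\<close>

definition full :: bool where "full \<longleftrightarrow> (\<exists>l. odd l \<and> realized (\<lambda>g. fun_y g ^ l))"

definition admissible :: "complex \<Rightarrow> bool" where "admissible s \<longleftrightarrow> s = 1 \<or> s = -1 \<and> full"

lemma realized_y_large: obtains N where "\<And>l. l \<ge> N \<Longrightarrow> even l \<or> full \<Longrightarrow> realized (\<lambda>g. fun_y g ^ l)"
proof -
  obtain l where l: "l \<ge> 1" "realized (\<lambda>g. fun_y g ^ l)" by (rule realized_y_exists)
  have mul: "realized (\<lambda>g. fun_y g ^ (i * j))" if "realized (\<lambda>g. fun_y g ^ j)" for i j
    using realized_power[OF that, of i] by (simp add: power_mult[symmetric] mult.commute)
  have plus: "realized (\<lambda>g. fun_y g ^ (i + j))" if "realized (\<lambda>g. fun_y g ^ i)" "realized (\<lambda>g. fun_y g ^ j)" for i j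
    using realized_mult[OF that] by (simp add: power_add)
  have ev: "realized (\<lambda>g. fun_y g ^ (2 * t))" if t: "t \<ge> l * l" for t
  proof (cases "l = 1")
    case True then show ?thesis using mul[OF l(2), of "2 * t"] by simp
  next
    case False
    then have l2: "l \<ge> 2" using l(1) by simp
    \<comment> \<open>The halved exponents \<open>l - 1\<close> and \<open>l\<close> generate every
      \<open>t\<close> from \<open>l * l\<close> on: divide \<open>t\<close> by \<open>l - 1\<close>
      and trade \<open>r\<close> of the summands \<open>l - 1\<close> for \<open>l\<close>, which is
      possible once \<open>r\<close> is at most \<open>q\<close>.\<close>
    define q r where "q = t div (l - 1)" and "r = t mod (l - 1)"
    have "r < l - 1" using l2 by (simp add: r_def)
    have "l * (l - 1) \<le> t" using t by (meson diff_le_self le_trans mult_le_mono2)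
    then have "l \<le> q" unfolding q_def using l2 by (simp add: less_eq_div_iff_mult_less_eq)
    then have "r \<le> q" using \<open>r < l - 1\<close> by simp
    have "t = q * (l - 1) + r" by (simp only: q_def r_def div_mult_mod_eq)
    also have "q = (q - r) + r" using \<open>r \<le> q\<close> by simp
    finally have "t = (q - r) * (l - 1) + r * (l - 1) + r" by (simp add: add_mult_distrib)
    moreover have "r * (l - 1) + r = r * l" using l2 by (cases l) auto
    ultimately have t': "t = (q - r) * (l - 1) + r * l" by linarith
    have e: "2 * l - 2 = 2 * (l - 1)" by simp
    have "2 * t = (q - r) * (2 * l - 2) + r * (2 * l)"
      unfolding t' e by (simp only: distrib_left mult.left_commute)
    moreover have "realized (\<lambda>g. fun_y g ^ ((q - r) * (2 * l - 2) + r * (2 * l)))"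
      by (intro plus mul realized_y_step l(2) l2)
    ultimately show ?thesis by simp
  qed
  show ?thesis
  proof (cases full)
    case True
    then obtain k where k: "odd k" "realized (\<lambda>g. fun_y g ^ k)" unfolding full_def by blast
    show ?thesis
    proof (rule that[of "2 * (l * l) + k"])
      fix m assume m: "m \<ge> 2 * (l * l) + k"
      show "realized (\<lambda>g. fun_y g ^ m)"
      proof (cases "even m")
        case True
        then obtain t where "m = 2 * t" by blast
        then show ?thesis using ev[of t] m by simp
      next
        case False
        then have "even (m - k)" using k(1) by simp
        then obtain t where t: "m - k = 2 * t" by blast
        then have "m = 2 * t + k" using m by linarith
        moreover have "t \<ge> l * l" using t m by linarith
        ultimately show ?thesis using plus[OF ev k(2)] by simp
      qed
    qed
  next
    case False
    show ?thesis
    proof (rule that[of "2 * (l * l)"])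
      fix m assume "m \<ge> 2 * (l * l)" "even m \<or> full"
      then show "realized (\<lambda>g. fun_y g ^ m)" using ev False by (metis dvdE mult_le_cancel1 zero_less_numeral)
    qed
  qed
qed

section \<open>The conductor of the ring of functions on the orbit\<close>

context
  fixes N assumes N: "\<And>l. l \<ge> N \<Longrightarrow> even l \<or> full \<Longrightarrow> realized (\<lambda>g. fun_y g ^ l)"
begin

text \<open>Lowering \<open>fun_y ^ (m + k)\<close> \<open>k\<close> times gives
  \<open>fun_y ^ m\<close> times a polynomial of exact degree \<open>k\<close> in
  \<open>fun_z\<close>. All its terms have the parity of \<open>k\<close>, so those below the top
  one are realized by induction.\<close>

lemma realized_yz:
  assumes "m \<ge> N" shows "even (m + k) \<or> full \<Longrightarrow> realized (\<lambda>g. fun_y g ^ m * fun_z g ^ k)"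
proof (induction k rule: less_induct)
  case (less k)
  let ?q = "zonal (m + k) k"
  have "realized (\<lambda>g. fun_y g ^ (m + k - k) * poly ?q (fun_z g))"
    by (rule realized_y_lower[OF N]) (use assms less.prems in auto)
  then have 1: "realized (\<lambda>g. fun_y g ^ m * poly ?q (fun_z g))" by simp
  have 2: "realized (\<lambda>g. \<Sum>j<k. coeff ?q j * (fun_y g ^ m * fun_z g ^ j))"
  proof (rule realized_sum)
    fix j assume j: "j \<in> {..<k}"
    show "realized (\<lambda>g. coeff ?q j * (fun_y g ^ m * fun_z g ^ j))"
    proof (cases "coeff ?q j = 0")
      case True then show ?thesis using realized_const[of 0] by simp
    next
      case False
      have "(-1) ^ j = ((-1) ^ k :: complex)" using parity_coeff[OF zonal_parity, of j "m + k" k] False by simp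
      then have "even j = even k" by (cases "even j"; cases "even k") auto
      then show ?thesis using less.IH j less.prems by (intro realized_cmult) auto
    qed
  qed
  have lead: "coeff ?q k \<noteq> 0" by (rule zonal_lead) simp
  have "realized (\<lambda>g. inverse (coeff ?q k) * (fun_y g ^ m * poly ?q (fun_z g) - (\<Sum>j<k. coeff ?q j * (fun_y g ^ m * fun_z g ^ j))))"
    by (intro realized_cmult realized_diff 1 2)
  then show ?case
  proof (rule realized_cong)
    fix g :: "complex^2^2"
    have "poly ?q (fun_z g) = (\<Sum>j\<le>k. coeff ?q j * fun_z g ^ j)"
      unfolding poly_altdef using zonal_degree[of "m + k" k]
      by (intro sum.mono_neutral_left) (auto simp: coeff_eq_0)
    also have "\<dots> = (\<Sum>j<k. coeff ?q j * fun_z g ^ j) + coeff ?q k * fun_z g ^ k"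
      by (simp add: lessThan_Suc_atMost[symmetric])
    finally have "fun_y g ^ m * poly ?q (fun_z g) - (\<Sum>j<k. coeff ?q j * (fun_y g ^ m * fun_z g ^ j))
      = coeff ?q k * (fun_y g ^ m * fun_z g ^ k)"
      by (simp add: sum_distrib_left distrib_left mult_ac)
    then show "fun_y g ^ m * fun_z g ^ k = inverse (coeff ?q k) *
      (fun_y g ^ m * poly ?q (fun_z g) - (\<Sum>j<k. coeff ?q j * (fun_y g ^ m * fun_z g ^ j)))"
      using lead by simp
  qed
qed

lemma realized_y_poly:
  assumes "m \<ge> N" "admissible s" "\<And>x. poly q (- x) = s * (-1) ^ m * poly q x"
  shows "realized (\<lambda>g. fun_y g ^ m * poly q (fun_z g))"
proof -
  have "realized (\<lambda>g. \<Sum>j\<le>degree q. coeff q j * (fun_y g ^ m * fun_z g ^ j))"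
  proof (rule realized_sum)
    fix j
    show "realized (\<lambda>g. coeff q j * (fun_y g ^ m * fun_z g ^ j))"
    proof (cases "coeff q j = 0")
      case True then show ?thesis using realized_const[of 0] by simp
    next
      case False
      have "(-1) ^ j = s * (-1) ^ m" using parity_coeff[OF assms(3), of j] False by simp
      then have "even (m + j) \<or> full" using assms(2) unfolding admissible_def
        by (cases "even j"; cases "even m") auto
      then show ?thesis by (intro realized_cmult realized_yz assms(1))
    qed
  qed
  then show ?thesis by (rule realized_cong) (simp add: poly_altdef sum_distrib_left mult_ac)
qed

text \<open>The Weyl element, acting from the left, exchanges \<open>fun_y\<close> with
  \<open>fun_w\<close> and negates \<open>fun_z\<close>.\<close>

lemma realized_w_poly:
  assumes "m \<ge> N" "admissible s" "\<And>x. poly q (- x) = s * (-1) ^ m * poly q x"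
  shows "realized (\<lambda>g. fun_w g ^ m * poly q (fun_z g))"
proof -
  let ?q = "pcompose q [:0, -1:]"
  have "poly ?q (- x) = s * (-1) ^ m * poly ?q x" for x using assms(3)[of "- x"] by (simp add: poly_pcompose)
  from realized_left[OF realized_y_poly[OF assms(1,2) this], of weyl]
  show ?thesis by (simp add: fun_weyl poly_pcompose)
qed

text \<open>A term with a power of \<open>fun_w\<close> beyond \<open>N\<close> is realized by
  itself. A smaller power is absorbed through \<open>yw_eq\<close> and leaves at least
  \<open>N\<close> factors \<open>fun_y\<close>; the exponent \<open>2 * N\<close> serves both
  cases.\<close>

lemma realized_conductor:
  assumes "reduced s F" "admissible s" shows "realized (\<lambda>g. fun_y g ^ (2 * N) * F g)"
  using assms
proof (induction rule: reduced.induct)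
  case (y q s i)
  have "realized (\<lambda>g. fun_y g ^ (2 * N + i) * poly q (fun_z g))"
    by (rule realized_y_poly[OF _ y(2)]) (simp_all add: y(1) power_add)
  then show ?case by (simp add: power_add mult.assoc)
next
  case (w q s i)
  show ?case
  proof (cases "i \<le> N")
    case True
    let ?q = "q * [:-1/4, 0, 1:] ^ i"
    have "even (2 * N - i) = even i" using True by simp
    then have e: "(-1) ^ (2 * N - i) = ((-1) ^ i :: complex)" by (simp add: minus_one_power_iff)
    have "realized (\<lambda>g. fun_y g ^ (2 * N - i) * poly ?q (fun_z g))"
      by (rule realized_y_poly[OF _ w(2)]) (use True in \<open>simp_all add: w(1) e\<close>)
    then show ?thesis
    proof (rule realized_cong)
      fix g :: "complex^2^2" assume g: "det g = 1"
      have "fun_y g ^ (2 * N) = fun_y g ^ (2 * N - i) * fun_y g ^ i" using True by (simp add: power_add[symmetric])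
      then have "fun_y g ^ (2 * N) * (fun_w g ^ i * poly q (fun_z g))
        = fun_y g ^ (2 * N - i) * (poly q (fun_z g) * (fun_y g * fun_w g) ^ i)" by (simp add: power_mult_distrib mult_ac)
      then show "fun_y g ^ (2 * N) * (fun_w g ^ i * poly q (fun_z g)) = fun_y g ^ (2 * N - i) * poly ?q (fun_z g)"
        by (simp add: yw_eq[OF g] power2_eq_square)
    qed
  next
    case False
    then show ?thesis by (intro realized_mult N realized_w_poly[OF _ w(2)]) (simp_all add: w(1))
  qed
next
  case (add s F G)
  then show ?case using realized_add by (simp add: distrib_left)
qed

text \<open>The conductor of the image of \<open>R\<close> in the admissible functions; these are
  all realized once it contains 1.\<close>

definition conductor :: "(complex^2^2 \<Rightarrow> complex) \<Rightarrow> bool"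
  where "conductor F \<longleftrightarrow> (\<forall>s G. signed s G \<longrightarrow> admissible s \<longrightarrow> realized (\<lambda>g. F g * G g))"

lemma conductor_cong: "conductor F \<Longrightarrow> (\<And>g. det g = 1 \<Longrightarrow> G g = F g) \<Longrightarrow> conductor G"
  unfolding conductor_def by (metis (no_types, lifting) realized_cong)

lemma conductor_diff: "conductor F \<Longrightarrow> conductor G \<Longrightarrow> conductor (\<lambda>g. F g - G g)"
  unfolding conductor_def using realized_diff by (simp add: left_diff_distrib)

lemma conductor_mult: assumes "conductor F" "signed 1 G" shows "conductor (\<lambda>g. F g * G g)"
  unfolding conductor_def
proof (intro allI impI)
  fix s H assume H: "signed s H" "admissible s"
  have "signed s (\<lambda>g. G g * H g)" using signed.mult[OF assms(2) H(1)] by simp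
  then show "realized (\<lambda>g. F g * G g * H g)" using assms(1) H(2) unfolding conductor_def by (simp add: mult.assoc)
qed

lemma conductor_cmult: "conductor F \<Longrightarrow> conductor (\<lambda>g. c * F g)"
  using conductor_mult[OF _ signed.const[of c], of F] by (simp add: mult.commute)

text \<open>By the product rule \<open>F' * H\<close> is the derivative of \<open>F * H\<close>
  minus \<open>F * H'\<close>, and both of these are realized.\<close>

lemma conductor_derivation: assumes "conductor F" "lower_derivation F F'" shows "conductor F'"
  unfolding conductor_def
proof (intro allI impI)
  fix s H assume H: "signed s H" "admissible s"
  obtain H' where H': "signed s H'" "lower_derivation H H'" using signed_lower_derivation[OF H(1)] by blast
  have "realized (\<lambda>g. F g * H g)" "realized (\<lambda>g. F g * H' g)"
    using assms(1) H H'(1) unfolding conductor_def by auto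
  from realized_diff[OF realized_lower_derivation[OF this(1) lower_derivation_mult[OF assms(2) H'(2)]] this(2)]
  show "realized (\<lambda>g. F' g * H g)" by simp
qed

text \<open>Write \<open>t\<close> for the square of \<open>fun_z\<close> and \<open>c\<close> for
  \<open>2 * j + 3\<close>. Differentiating twice, with constants divided out, gives
  \<open>fun_y ^ j * (c * t - 1/4)\<close>, while multiplication by even functions gives
  \<open>fun_y ^ j * (t - 1/4) / 4\<close>. Subtracting \<open>4 * c\<close> times the latter
  removes \<open>t\<close>.\<close>

lemma conductor_step: assumes "conductor (\<lambda>g. fun_y g ^ (j + 2))" shows "conductor (\<lambda>g. fun_y g ^ j)"
proof -
  have s: "signed 1 (\<lambda>g. fun_z g * fun_w g)" "signed 1 (\<lambda>g. fun_w g * fun_w g)"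
    using signed.mult[OF signed.z signed.w] signed.mult[OF signed.w signed.w] by simp_all
  have "conductor (\<lambda>g. of_nat (Suc (Suc j)) * fun_y g ^ Suc j * (2 * fun_z g))"
    using conductor_derivation[OF _ lower_derivation_power[OF lower_derivation_y, of "Suc j"]] assms by simp
  then have "conductor (\<lambda>g. inverse (2 * of_nat (Suc (Suc j))) * (of_nat (Suc (Suc j)) * fun_y g ^ Suc j * (2 * fun_z g)))"
    by (rule conductor_cmult)
  then have 1: "conductor (\<lambda>g. fun_y g ^ Suc j * fun_z g)"
    by (rule conductor_cong) (simp add: field_simps del: of_nat_Suc)
  have 2: "conductor (\<lambda>g. (of_nat (Suc j) * fun_y g ^ j * (2 * fun_z g)) * fun_z g + fun_y g ^ Suc j * fun_w g)"
    by (rule conductor_derivation[OF 1]) (intro lower_derivation_mult lower_derivation_power lower_derivation_y lower_derivation_z)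
  have 3: "conductor (\<lambda>g. fun_y g ^ Suc j * fun_z g * (fun_z g * fun_w g) - fun_y g ^ (j + 2) * (fun_w g * fun_w g))"
    by (intro conductor_diff conductor_mult 1 assms s)
  let ?c = "2 * of_nat (Suc j) + 1 :: complex"
  have "conductor (\<lambda>g. (4 / (?c - 1)) * (((of_nat (Suc j) * fun_y g ^ j * (2 * fun_z g)) * fun_z g + fun_y g ^ Suc j * fun_w g)
     - (4 * ?c) * (fun_y g ^ Suc j * fun_z g * (fun_z g * fun_w g) - fun_y g ^ (j + 2) * (fun_w g * fun_w g))))"
    by (intro conductor_cmult conductor_diff 2 3)
  then show ?thesis
  proof (rule conductor_cong)
    fix g :: "complex^2^2" assume g: "det g = 1"
    define Y t where "Y = fun_y g ^ j" and "t = (fun_z g)\<^sup>2"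
    have yw: "fun_y g * fun_w g = t - 1/4" using yw_eq[OF g] by (simp add: t_def)
    have a: "of_nat (Suc j) * fun_y g ^ j * (2 * fun_z g) * fun_z g + fun_y g ^ Suc j * fun_w g = Y * (?c * t - 1/4)"
    proof -
      have "of_nat (Suc j) * fun_y g ^ j * (2 * fun_z g) * fun_z g + fun_y g ^ Suc j * fun_w g
        = Y * (2 * of_nat (Suc j) * t + fun_y g * fun_w g)"
        by (simp add: Y_def t_def power2_eq_square algebra_simps)
      then show ?thesis by (simp only: yw) (simp add: algebra_simps)
    qed
    have b: "fun_y g ^ Suc j * fun_z g * (fun_z g * fun_w g) - fun_y g ^ (j + 2) * (fun_w g * fun_w g) = Y * ((t - 1/4) / 4)"
    proof -
      have "fun_y g ^ Suc j * fun_z g * (fun_z g * fun_w g) - fun_y g ^ (j + 2) * (fun_w g * fun_w g)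
        = Y * (t * (fun_y g * fun_w g) - (fun_y g * fun_w g) * (fun_y g * fun_w g))"
        by (simp add: Y_def t_def power2_eq_square power_add algebra_simps)
      then show ?thesis by (simp only: yw) (simp add: algebra_simps)
    qed
    have c: "?c - 1 \<noteq> 0" by (simp del: of_nat_Suc)
    have "Y * (c * t - 1/4) - (4 * c) * (Y * ((t - 1/4) / 4)) = Y * ((c - 1) / 4)" for c
      by (simp add: field_simps)
    then have "(4 / (?c - 1)) * (Y * (?c * t - 1/4) - (4 * ?c) * (Y * ((t - 1/4) / 4))) = (4 / (?c - 1)) * (Y * ((?c - 1) / 4))"
      by (simp only:)
    also have "\<dots> = Y"
    proof -
      have "(4 / d) * (Y * (d / 4)) = Y" if "d \<noteq> 0" for d using that by simp
      from this[OF c] show ?thesis .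
    qed
    finally show "fun_y g ^ j = (4 / (?c - 1)) * (((of_nat (Suc j) * fun_y g ^ j * (2 * fun_z g)) * fun_z g + fun_y g ^ Suc j * fun_w g)
     - (4 * ?c) * (fun_y g ^ Suc j * fun_z g * (fun_z g * fun_w g) - fun_y g ^ (j + 2) * (fun_w g * fun_w g)))"
      unfolding a b Y_def by simp
  qed
qed

lemma conductor_one: "conductor (\<lambda>g. fun_y g ^ 0)"
proof -
  have "conductor (\<lambda>g. fun_y g ^ (2 * N))"
    unfolding conductor_def
  proof (intro allI impI)
    fix s F assume "signed s F" "admissible s"
    then obtain F' where F': "reduced s F'" "\<forall>g. det g = 1 \<longrightarrow> F' g = F g" using signed_reduced by blast
    show "realized (\<lambda>g. fun_y g ^ (2 * N) * F g)"
      by (rule realized_cong[OF realized_conductor[OF F'(1) \<open>admissible s\<close>]]) (simp add: F'(2))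
  qed
  then have "conductor (\<lambda>g. fun_y g ^ (2 * (N - k)))" for k
  proof (induction k)
    case (Suc k)
    show ?case
    proof (cases "N \<le> k")
      case True then show ?thesis using Suc by simp
    next
      case False
      then have "2 * (N - k) = 2 * (N - Suc k) + 2" by simp
      then show ?thesis using conductor_step[of "2 * (N - Suc k)"] Suc by simp
    qed
  qed simp
  from this[of N] show ?thesis by simp
qed

lemma signed_realized_aux: "signed s F \<Longrightarrow> admissible s \<Longrightarrow> realized F"
  using conductor_one unfolding conductor_def by simp

end

lemma signed_realized: "signed s F \<Longrightarrow> admissible s \<Longrightarrow> realized F"
  by (rule realized_y_large) (rule signed_realized_aux)

lemma orbit_torus_polynomial:
  assumes "a \<in> R" obtains F0 F1 where "signed 1 F0" "signed (-1) F1" "\<And>g. det g = 1 \<Longrightarrow> a (act g p) = F0 g + F1 g"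
proof -
  obtain F where F: "F \<in> mpoly" "\<And>g. det g = 1 \<Longrightarrow> a (act g p) = F g" by (rule orbit_function[OF assms p]) blast
  have "torus_polynomial F"
  proof (rule torus_invariant_polynomial[OF F(1)])
    fix g :: "complex^2^2" and l :: complex assume g: "det g = 1" "l \<noteq> 0"
    have "F (g ** diag2 l) = a (act g (act (diag2 l) p))"
      using F(2)[of "g ** diag2 l"] g p by (simp add: det_mul act_act)
    then show "F (g ** diag2 l) = F g" using fixed g F(2) by simp
  qed
  then show ?thesis using that F(2) unfolding torus_polynomial_def by (metis (no_types, lifting))
qed

text \<open>The even part of \<open>a\<close> is always realized, hence so is the odd part. If the
  odd part were nonzero, there would be a highest weight function that is odd under right
  translation by \<open>weyl\<close>, and this is a multiple of an odd power of
  \<open>fun_y\<close>.\<close>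

lemma not_full_even:
  assumes "\<not> full" "a \<in> R" obtains F where "signed 1 F" "realizes a F"
proof -
  obtain F0 F1 where F: "signed 1 F0" "signed (-1) F1" "\<And>g. det g = 1 \<Longrightarrow> a (act g p) = F0 g + F1 g"
    by (rule orbit_torus_polynomial[OF assms(2)]) blast
  have "realized F0" by (rule signed_realized[OF F(1)]) (simp add: admissible_def)
  then obtain a0 where a0: "a0 \<in> R" "\<And>g. det g = 1 \<Longrightarrow> a0 (act g p) = F0 g" unfolding realized_def realizes_def by blast
  define b where "b x = a x - a0 x" for x
  have b: "b \<in> R" "\<And>g. det g = 1 \<Longrightarrow> b (act g p) = F1 g"
    using assms(2) a0 F(3) by (auto simp: b_def[abs_def] intro: R_diff)
  have "vanishes b"
  proof (rule ccontr)
    assume nv: "\<not> vanishes b"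
    let ?Z = "{(act (g ** weyl) p, act g p) |g. det g = 1}"
    obtain n h where h: "highest_weight n h" "\<not> vanishes h" "\<And>x y. (x, y) \<in> ?Z \<Longrightarrow> h x = - 1 * h y"
    proof (rule highest_weight_with_relation[OF b(1) nv, of ?Z "-1"])
      show "x \<in> P \<and> y \<in> P" if "(x, y) \<in> ?Z" for x y
        using that p by (auto intro!: act_closed simp: det_mul)
      show "(act h x, act h y) \<in> ?Z" if xy: "(x, y) \<in> ?Z" "det h = 1" for h x y
      proof -
        obtain g where g: "det g = 1" "x = act (g ** weyl) p" "y = act g p" using xy(1) by auto
        then have "act h x = act ((h ** g) ** weyl) p" "act h y = act (h ** g) p" "det (h ** g) = 1"
          using p xy(2) by (auto simp: act_act det_mul matrix_mul_assoc)
        then show ?thesis by blast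
      qed
      show "b x = - 1 * b y" if xy: "(x, y) \<in> ?Z" for x y
      proof -
        obtain g where g: "det g = 1" "x = act (g ** weyl) p" "y = act g p" using xy by auto
        then have "b x = F1 (g ** weyl)" using b(2)[of "g ** weyl"] by (simp add: det_mul)
        then show ?thesis using signed_weyl_right[OF F(2)] b(2) g by simp
      qed
    qed blast
    obtain l c where l: "n = 2 * l" "c \<noteq> 0" "\<And>g. det g = 1 \<Longrightarrow> h (act g p) = c * fun_y g ^ l"
      by (rule highest_weight_on_torus_orbit[OF h(1,2)]) blast
    have "(act (lower 1 ** weyl) p, act (lower 1) p) \<in> ?Z" by (rule CollectI, rule exI[of _ "lower 1"]) simp
    from h(3)[OF this] have "c * fun_y (lower 1 ** weyl) ^ l = - (c * fun_y (lower 1) ^ l)"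
      using l(3)[of "lower 1 ** weyl"] l(3)[of "lower 1"] by (simp add: det_mul)
    then have "c * (-1) ^ l = c * (-1 :: complex)" by (simp add: fun_y_def)
    then have "(-1) ^ l = (-1 :: complex)" by (rule mult_left_cancel[OF l(2), THEN iffD1])
    then have "odd l" by (cases "even l") auto
    moreover have "realized (\<lambda>g. c * fun_y g ^ l)"
      unfolding realized_def realizes_def using h(1) l(3) by (auto simp: highest_weight_def)
    from realized_cmult[OF this, of "inverse c"] have "realized (\<lambda>g. fun_y g ^ l)"
      using l(2) by (simp add: mult.assoc[symmetric])
    ultimately show False using assms(1) unfolding full_def by blast
  qed
  then have "a (act g p) = F0 g" if "det g = 1" for g
    using a0(2)[OF that] act_closed[OF that p] by (simp add: vanishes_def b_def)
  then show ?thesis using that[OF F(1)] assms(2) by (simp add: realizes_def)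
qed

text \<open>The point \<open>x\<close> is regarded as a character on realized functions; being a
  relation, it leaves all other functions without a value.\<close>

definition value_at :: "'a \<Rightarrow> (complex^2^2 \<Rightarrow> complex) \<Rightarrow> complex \<Rightarrow> bool"
  where "value_at x F v \<longleftrightarrow> (\<exists>a. realizes a F \<and> a x = v)"

lemma realizes_unique:
  assumes "realizes a F" "realizes b G" "\<And>g. det g = 1 \<Longrightarrow> F g = G g" "x \<in> P" shows "a x = b x"
proof -
  have "vanishes (\<lambda>x. a x - b x)"
    by (rule inj) (use assms in \<open>auto simp: realizes_def intro: R_diff\<close>)
  then show ?thesis using assms(4) by (simp add: vanishes_def)
qed

lemma value_at_unique: "value_at x F v \<Longrightarrow> value_at x F v' \<Longrightarrow> x \<in> P \<Longrightarrow> v = v'"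
  unfolding value_at_def using realizes_unique by blast

lemma value_at_const: "value_at x (\<lambda>g. c) c"
  unfolding value_at_def realizes_def by (intro exI[of _ "\<lambda>x. c"]) (simp add: R_const)

lemma value_at_add: "value_at x F v \<Longrightarrow> value_at x G v' \<Longrightarrow> value_at x (\<lambda>g. F g + G g) (v + v')"
  unfolding value_at_def realizes_def by (elim exE conjE, rule_tac x = "\<lambda>x. a x + aa x" in exI) (simp add: R_add)

lemma value_at_mult: "value_at x F v \<Longrightarrow> value_at x G v' \<Longrightarrow> value_at x (\<lambda>g. F g * G g) (v * v')"
  unfolding value_at_def realizes_def by (elim exE conjE, rule_tac x = "\<lambda>x. a x * aa x" in exI) (simp add: R_mult)

lemma value_at_cong: "value_at x F v \<Longrightarrow> (\<And>g. det g = 1 \<Longrightarrow> G g = F g) \<Longrightarrow> value_at x G v"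
  unfolding value_at_def realizes_def by auto

lemma realized_value_at: "realized F \<Longrightarrow> \<exists>v. value_at x F v"
  unfolding realized_def value_at_def by blast

text \<open>The values of \<open>fun_y\<close>, \<open>fun_z\<close> and \<open>fun_w\<close> at
  \<open>x\<close> satisfy the equation of the quadric and hence come from a matrix
  \<open>g\<close>. All torus invariants are polynomials in these three, so no function separates
  \<open>act g p\<close> from \<open>x\<close>.\<close>

lemma full_transitive:
  assumes full and x: "x \<in> P" obtains g where "det g = 1" "act g p = x"
proof -
  have adm: "admissible s" if "signed s F" for s F using signed_sign[OF that] assms(1) by (auto simp: admissible_def)
  obtain y z w where yzw: "value_at x fun_y y" "value_at x fun_z z" "value_at x fun_w w"
    using realized_value_at[OF signed_realized[OF signed.y adm[OF signed.y]]]
      realized_value_at[OF signed_realized[OF signed.z adm[OF signed.z]]]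
      realized_value_at[OF signed_realized[OF signed.w adm[OF signed.w]]] by metis
  have "value_at x (\<lambda>g. fun_z g * fun_z g + (- 1/4)) (y * w)"
    by (rule value_at_cong[OF value_at_mult[OF yzw(1,3)]]) (simp add: yw_eq power2_eq_square)
  from value_at_unique[OF this value_at_add[OF value_at_mult[OF yzw(2,2)] value_at_const] x]
  have "y * w = z\<^sup>2 - 1/4" by (simp add: power2_eq_square)
  then obtain g where g: "det g = 1" "fun_y g = y" "fun_z g = z" "fun_w g = w" by (rule exists_matrix_with_invariants)
  have val: "signed s F \<Longrightarrow> value_at x F (F g)" for s F
    by (induction rule: signed.induct) (auto simp: g yzw intro: value_at_const value_at_add value_at_mult)
  have "act g p = x"
  proof (rule separated)
    fix a assume a: "a \<in> R"
    obtain F0 F1 where F: "signed 1 F0" "signed (-1) F1" "\<And>g. det g = 1 \<Longrightarrow> a (act g p) = F0 g + F1 g"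
      by (rule orbit_torus_polynomial[OF a]) blast
    have "value_at x (\<lambda>g. F0 g + F1 g) (a x)" unfolding value_at_def realizes_def using a F(3) by blast
    from value_at_unique[OF this value_at_add[OF val[OF F(1)] val[OF F(2)]] x]
    show "a (act g p) = a x" using F(3)[OF g(1)] by simp
  qed (use x p g(1) act_closed in auto)
  then show ?thesis using that g(1) by blast
qed

text \<open>Only products of two of the three invariants have values at \<open>x\<close>. The
  symmetric array \<open>Q\<close> of these values has rank one, so a square root of a nonzero
  diagonal entry yields values for the invariants themselves; the choice of sign amounts to right
  translation by \<open>weyl\<close>.\<close>

lemma not_full_transitive:
  assumes nf: "\<not> full" and x: "x \<in> P" obtains g where "det g = 1" "act g p = x"
proof -
  define B where "B = {fun_y, fun_z, fun_w}"
  have sB: "signed (-1) u" if "u \<in> B" for u using that by (auto simp: B_def intro: signed.intros)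
  have "\<exists>v. value_at x (\<lambda>g. u g * v' g) v" if "u \<in> B" "v' \<in> B" for u v'
    using signed.mult[OF sB[OF that(1)] sB[OF that(2)]] by (intro realized_value_at signed_realized[of 1]) (auto simp: admissible_def)
  then obtain Q where Q: "\<And>u v. u \<in> B \<Longrightarrow> v \<in> B \<Longrightarrow> value_at x (\<lambda>g. u g * v g) (Q u v)" by metis
  have QQ: "Q u v * Q u' v' = Q u u' * Q v v'" if "u \<in> B" "v \<in> B" "u' \<in> B" "v' \<in> B" for u v u' v'
  proof (rule value_at_unique[OF value_at_mult[OF Q[OF that(1,2)] Q[OF that(3,4)]] _ x])
    show "value_at x (\<lambda>g. u g * v g * (u' g * v' g)) (Q u u' * Q v v')"
      by (rule value_at_cong[OF value_at_mult[OF Q[OF that(1,3)] Q[OF that(2,4)]]]) simp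
  qed
  have in_B: "fun_y \<in> B" "fun_z \<in> B" "fun_w \<in> B" by (auto simp: B_def)
  have "value_at x (\<lambda>g. fun_z g * fun_z g + (- 1/4)) (Q fun_y fun_w)"
    by (rule value_at_cong[OF Q[OF in_B(1,3)]]) (simp add: yw_eq power2_eq_square)
  from value_at_unique[OF this value_at_add[OF Q[OF in_B(2,2)] value_at_const] x]
  have yw: "Q fun_y fun_w = Q fun_z fun_z - 1/4" by simp
  \<comment> \<open>With a zero diagonal, rank one would make \<open>Q fun_y fun_w\<close> vanish,
    while the equation of the quadric makes it -1/4.\<close>
  have "\<exists>u\<in>B. Q u u \<noteq> 0"
  proof (rule ccontr)
    assume "\<not> ?thesis"
    then have "Q fun_z fun_z = 0" "Q fun_y fun_y = 0" using in_B by auto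
    moreover have "Q fun_y fun_w * Q fun_y fun_w = Q fun_y fun_y * Q fun_w fun_w" by (rule QQ) (use in_B in auto)
    ultimately show False using yw by simp
  qed
  then obtain u where u: "u \<in> B" "Q u u \<noteq> 0" by blast
  define r where "r = csqrt (Q u u)"
  have r: "r * r = Q u u" "r \<noteq> 0" using u(2) power2_csqrt[of "Q u u"] by (auto simp: r_def power2_eq_square)
  define val where "val v = Q u v / r" for v
  have val: "val v * val v' = Q v v'" if "v \<in> B" "v' \<in> B" for v v'
  proof -
    have "val v * val v' = Q u v * Q u v' / (r * r)" by (simp add: val_def)
    also have "Q u v * Q u v' = Q u u * Q v v'" by (rule QQ) (use u that in auto)
    finally show ?thesis using r u(2) by simp
  qed
  have "val fun_y * val fun_w = (val fun_z)\<^sup>2 - 1/4" using val in_B yw by (simp add: power2_eq_square)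
  then obtain g where g: "det g = 1" "fun_y g = val fun_y" "fun_z g = val fun_z" "fun_w g = val fun_w"
    by (rule exists_matrix_with_invariants)
  then have gB: "v g = val v" if "v \<in> B" for v using that by (auto simp: B_def)
  have base: "value_at x (\<lambda>g. v g * v' g) (v g * v' g)" if "v \<in> B" "v' \<in> B" for v v'
    using Q[OF that] val[OF that] gB[OF that(1)] gB[OF that(2)] by simp
  have u0: "u g \<noteq> 0" using val[OF u(1) u(1)] u(2) gB[OF u(1)] by auto
  \<comment> \<open>Odd functions are followed through their products with the three invariants. For
    a product of two odd functions the square of the nonzero number \<open>u g\<close> is
    cancelled.\<close>
  have *: "signed s F \<Longrightarrow> (s = 1 \<longrightarrow> value_at x F (F g)) \<and> (s = -1 \<longrightarrow> (\<forall>v\<in>B. value_at x (\<lambda>g. F g * v g) (F g * v g)))" for s F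
  proof (induction rule: signed.induct)
    case (add s F G)
    then show ?case by (auto intro: value_at_add simp: distrib_right)
  next
    case (mult s F t G)
    consider "s = 1" "t = 1" | "s = 1" "t = -1" | "s = -1" "t = 1" | "s = -1" "t = -1"
      using signed_sign[OF mult.hyps(1)] signed_sign[OF mult.hyps(2)] by blast
    then show ?case
    proof cases
      case 1
      then show ?thesis using mult.IH by (auto intro: value_at_mult)
    next
      case 2
      have "value_at x (\<lambda>g. F g * G g * v g) (F g * G g * v g)" if "v \<in> B" for v
        using value_at_mult[of x F "F g" "\<lambda>g. G g * v g" "G g * v g"] mult.IH 2 that by (simp add: mult.assoc)
      then show ?thesis using 2 by simp
    next
      case 3
      have "value_at x (\<lambda>g. F g * G g * v g) (F g * G g * v g)" if "v \<in> B" for v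
        using value_at_mult[of x G "G g" "\<lambda>g. F g * v g" "F g * v g"] mult.IH 3 that by (simp add: mult.left_commute mult.assoc)
      then show ?thesis using 3 by simp
    next
      case 4
      have "signed 1 (\<lambda>g. F g * G g)" using signed.mult[OF mult.hyps(1,2)] 4 by simp
      then obtain v where v: "value_at x (\<lambda>g. F g * G g) v"
        using realized_value_at[OF signed_realized[of 1]] by (auto simp: admissible_def)
      have "value_at x (\<lambda>g. F g * u g * (G g * u g)) (v * (u g * u g))"
        by (rule value_at_cong[OF value_at_mult[OF v base[OF u(1) u(1)]]]) simp
      moreover have "value_at x (\<lambda>g. F g * u g * (G g * u g)) (F g * u g * (G g * u g))"
        by (rule value_at_mult) (use mult.IH 4 u(1) in auto)
      ultimately have "v * (u g * u g) = F g * u g * (G g * u g)" using value_at_unique x by blast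
      then have "v = F g * G g" using u0 by (simp add: field_simps)
      then show ?thesis using v 4 by simp
    qed
  qed (use base in_B in \<open>auto intro: value_at_const\<close>)
  have "act g p = x"
  proof (rule separated)
    fix a assume a: "a \<in> R"
    obtain F where F: "signed 1 F" "realizes a F" by (rule not_full_even[OF nf a])
    have "value_at x F (a x)" unfolding value_at_def using F(2) by blast
    with *[OF F(1)] have "a x = F g" using value_at_unique x by blast
    then show "a (act g p) = a x" using F(2) g(1) by (simp add: realizes_def)
  qed (use x p g(1) act_closed in auto)
  then show ?thesis using that g(1) by blast
qed

text \<open>Without an odd power of \<open>fun_y\<close> every function is even, so none separates
  \<open>p\<close> from its image under \<open>weyl\<close>.\<close>

lemma torus_orbit_dichotomy:
  "(\<forall>x\<in>P. \<exists>g. det g = 1 \<and> act g p = x) \<and>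
   ((\<forall>F\<in>mpoly. (\<forall>g l. det g = 1 \<longrightarrow> l \<noteq> 0 \<longrightarrow> F (g ** diag2 l) = F g) \<longrightarrow>
       (\<exists>a\<in>R. \<forall>g. det g = 1 \<longrightarrow> a (act g p) = F g)) \<or>
    act weyl p = p \<and>
    (\<forall>F\<in>mpoly. (\<forall>g l. det g = 1 \<longrightarrow> l \<noteq> 0 \<longrightarrow> F (g ** diag2 l) = F g \<and> F (g ** weyl) = F g) \<longrightarrow>
       (\<exists>a\<in>R. \<forall>g. det g = 1 \<longrightarrow> a (act g p) = F g)))"
proof (cases full)
  case True
  have "\<exists>a\<in>R. \<forall>g. det g = 1 \<longrightarrow> a (act g p) = F g"
    if F: "F \<in> mpoly" "\<And>g l. det g = 1 \<Longrightarrow> l \<noteq> 0 \<Longrightarrow> F (g ** diag2 l) = F g" for F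
  proof -
    obtain F0 F1 where F': "signed 1 F0" "signed (-1) F1" "\<forall>g. det g = 1 \<longrightarrow> F g = F0 g + F1 g"
      using torus_invariant_polynomial[OF F] unfolding torus_polynomial_def by blast
    have "realized (\<lambda>g. F0 g + F1 g)"
      using F' True by (intro realized_add signed_realized[of 1] signed_realized[of "-1"]) (auto simp: admissible_def)
    then have "realized F" by (rule realized_cong) (simp add: F')
    then show ?thesis unfolding realized_def realizes_def by blast
  qed
  then show ?thesis using full_transitive[OF True] by blast
next
  case False
  have w: "act weyl p = p"
  proof (rule separated)
    fix a assume a: "a \<in> R"
    obtain F where F: "signed 1 F" "realizes a F" by (rule not_full_even[OF False a])
    have "a (act weyl p) = F (mat 1 ** weyl)" using F(2) by (simp add: realizes_def)
    also have "\<dots> = F (mat 1)" using signed_weyl_right[OF F(1), of "mat 1"] by (simp del: matrix_mul_lid)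
    also have "\<dots> = a (act (mat 1) p)" using F(2) by (simp add: realizes_def)
    finally show "a (act weyl p) = a p" using p by (simp add: act_1)
  qed (use p in auto)
  have "\<exists>a\<in>R. \<forall>g. det g = 1 \<longrightarrow> a (act g p) = F g"
    if F: "F \<in> mpoly" "\<And>g l. det g = 1 \<Longrightarrow> l \<noteq> 0 \<Longrightarrow> F (g ** diag2 l) = F g \<and> F (g ** weyl) = F g" for F
  proof -
    have T: "torus_polynomial F" by (rule torus_invariant_polynomial[OF F(1)]) (use F(2) in blast)
    have W: "F (g ** weyl) = F g" if "det g = 1" for g using F(2)[OF that, of 1] by simp
    obtain F0 where F0: "signed 1 F0" "\<forall>g. det g = 1 \<longrightarrow> F g = F0 g"
      using normalizer_invariant_polynomial[OF T W] by blast
    have "realized F" by (rule realized_cong[OF signed_realized[OF F0(1)]]) (simp_all add: admissible_def F0(2))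
    then show ?thesis unfolding realized_def realizes_def by blast
  qed
  then show ?thesis using w not_full_transitive[OF False] by blast
qed

end

end

section \<open>The homogeneous spaces\<close>

lemma poly_le_extensional: "poly_le A S k f \<Longrightarrow> f \<in> extensional A"
  by (induction rule: poly_le.induct) (auto simp: extensional_def)

lemma poly_le_mono:
  assumes "poly_le A S k f" "k \<le> n" shows "poly_le A S n f"
proof -
  have "poly_le A S (n - k + k) (\<lambda>x\<in>A. restrict (\<lambda>x. 1) A x * f x)"
    by (rule poly_le.mult[OF poly_le.const assms(1)])
  moreover have "(\<lambda>x\<in>A. restrict (\<lambda>x. 1) A x * f x) = f"
    by (rule extensionalityI[OF restrict_extensional poly_le_extensional[OF assms(1)]]) simp
  ultimately show ?thesis using assms(2) by simp
qed

lemma generated_algebra_const: "restrict (\<lambda>x. c) A \<in> generated_algebra A S"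
  unfolding generated_algebra_def polys_le_def using poly_le.const by blast

lemma generated_algebra_gen: "f \<in> S \<Longrightarrow> restrict f A \<in> generated_algebra A S"
  unfolding generated_algebra_def polys_le_def using poly_le.gen by blast

lemma generated_algebra_add:
  assumes "restrict f A \<in> generated_algebra A S" "restrict g A \<in> generated_algebra A S"
  shows "restrict (\<lambda>x. f x + g x) A \<in> generated_algebra A S"
proof -
  obtain j k where jk: "poly_le A S j (restrict f A)" "poly_le A S k (restrict g A)"
    using assms unfolding generated_algebra_def polys_le_def by blast
  have "poly_le A S (j + k) (\<lambda>x\<in>A. restrict f A x + restrict g A x)"
    by (intro poly_le.add poly_le_mono[OF jk(1)] poly_le_mono[OF jk(2)]) auto
  also have "(\<lambda>x\<in>A. restrict f A x + restrict g A x) = restrict (\<lambda>x. f x + g x) A" by (rule restrict_ext) simp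
  finally show ?thesis unfolding generated_algebra_def polys_le_def by blast
qed

lemma generated_algebra_mult:
  assumes "restrict f A \<in> generated_algebra A S" "restrict g A \<in> generated_algebra A S"
  shows "restrict (\<lambda>x. f x * g x) A \<in> generated_algebra A S"
proof -
  obtain j k where jk: "poly_le A S j (restrict f A)" "poly_le A S k (restrict g A)"
    using assms unfolding generated_algebra_def polys_le_def by blast
  have "poly_le A S (j + k) (\<lambda>x\<in>A. restrict f A x * restrict g A x)" by (rule poly_le.mult[OF jk])
  also have "(\<lambda>x\<in>A. restrict f A x * restrict g A x) = restrict (\<lambda>x. f x * g x) A" by (rule restrict_ext) simp
  finally show ?thesis unfolding generated_algebra_def polys_le_def by blast
qed

section \<open>The group, its torus and the normalizer as matrices\<close>

lemma carrier_SL2 [simp]: "A \<in> carrier SL2 \<longleftrightarrow> det A = 1"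
  by (simp add: SL2_def)

lemma mult_SL2 [simp]: "A \<otimes>\<^bsub>SL2\<^esub> B = A ** B"
  by (simp add: SL2_def)

lemma one_SL2 [simp]: "\<one>\<^bsub>SL2\<^esub> = mat 1"
  by (simp add: SL2_def)

lemma group_SL2: "group SL2"
proof (rule groupI)
  show "\<exists>y\<in>carrier SL2. y \<otimes>\<^bsub>SL2\<^esub> x = \<one>\<^bsub>SL2\<^esub>" if "x \<in> carrier SL2" for x
    using that by (intro bexI[of _ "adj2 x"]) (simp_all add: adj2_mult)
qed (simp_all add: det_mul matrix_mul_assoc)

interpretation SL2: group SL2 by (rule group_SL2)

lemma inv_SL2: "det g = 1 \<Longrightarrow> inv\<^bsub>SL2\<^esub> g = adj2 g"
  by (rule SL2.inv_equality) (simp_all add: adj2_mult)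

lemma torus_iff: "A \<in> torus \<longleftrightarrow> det A = 1 \<and> A$1$2 = 0 \<and> A$2$1 = 0"
proof -
  have "(\<forall>i j::2. i \<noteq> j \<longrightarrow> A $ i $ j = 0) \<longleftrightarrow> A$1$2 = 0 \<and> A$2$1 = 0"
    by (auto simp: forall_2)
  then show ?thesis by (simp add: torus_def)
qed

lemma torus_eq: "torus = {diag2 l |l. l \<noteq> 0}"
proof (intro equalityI subsetI)
  fix A assume A: "A \<in> torus"
  obtain a b c d where abcd: "A = mat2 a b c d" by (rule mat2_cases)
  then have "b = 0" "c = 0" "a * d = 1" using A by (auto simp: torus_iff)
  then have "a \<noteq> 0" "d = inverse a" by (auto simp: inverse_unique)
  then show "A \<in> {diag2 l |l. l \<noteq> 0}" using abcd \<open>b = 0\<close> \<open>c = 0\<close> by blast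
qed (auto simp: torus_iff)

text \<open>Conjugating the single element \<open>diag2 2\<close> already forces
  \<open>a * b = 0\<close> and \<open>c * d = 0\<close>, which for determinant 1 leaves the diagonal
  and the antidiagonal matrices.\<close>

lemma normalizer_torus_iff:
  "A \<in> normalizer SL2 torus \<longleftrightarrow> det A = 1 \<and> (A$1$2 = 0 \<and> A$2$1 = 0 \<or> A$1$1 = 0 \<and> A$2$2 = 0)"
proof -
  obtain a b c d where A: "A = mat2 a b c d" by (rule mat2_cases)
  have sub: "torus \<subseteq> carrier SL2" by (auto simp: torus_iff)
  have conj: "A <#\<^bsub>SL2\<^esub> torus #>\<^bsub>SL2\<^esub> inv\<^bsub>SL2\<^esub> A = {A ** t ** adj2 A |t. t \<in> torus}" if "det A = 1"
    using that by (auto simp: l_coset_def r_coset_def inv_SL2)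
  have "A \<in> normalizer SL2 torus \<longleftrightarrow> det A = 1 \<and> A <#\<^bsub>SL2\<^esub> torus #>\<^bsub>SL2\<^esub> inv\<^bsub>SL2\<^esub> A = torus"
    using sub by (auto simp: normalizer_def stabilizer_def)
  also have "\<dots> \<longleftrightarrow> det A = 1 \<and> {A ** t ** adj2 A |t. t \<in> torus} = torus" using conj by auto
  also have "\<dots> \<longleftrightarrow> det A = 1 \<and> (b = 0 \<and> c = 0 \<or> a = 0 \<and> d = 0)"
  proof (intro iffI conjI; (elim conjE)?)
    assume det: "det A = 1" and eq: "{A ** t ** adj2 A |t. t \<in> torus} = torus"
    have "diag2 2 \<in> torus" by (simp add: torus_iff)
    then have "A ** diag2 2 ** adj2 A \<in> torus" using eq by blast
    then have "a * b = 0" "c * d = 0" by (auto simp: A torus_iff field_simps)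
    then show "b = 0 \<and> c = 0 \<or> a = 0 \<and> d = 0" using det by (auto simp: A)
  next
    assume det: "det A = 1" and *: "b = 0 \<and> c = 0 \<or> a = 0 \<and> d = 0"
    have 1: "A ** t ** adj2 A \<in> torus" "adj2 A ** t ** A \<in> torus" if t: "t \<in> torus" for t
    proof -
      obtain l where l: "t = diag2 l" "l \<noteq> 0" using t by (auto simp: torus_eq)
      have d: "det (A ** t ** adj2 A) = 1" "det (adj2 A ** t ** A) = 1"
        using det t by (simp_all add: det_mul torus_iff)
      show "A ** t ** adj2 A \<in> torus" "adj2 A ** t ** A \<in> torus"
        using d * unfolding torus_iff by (auto simp: A l(1))
    qed
    have "t \<in> {A ** t ** adj2 A |t. t \<in> torus}" if t: "t \<in> torus" for t
    proof -
      have "A ** (adj2 A ** t ** A) ** adj2 A = (A ** adj2 A) ** t ** (A ** adj2 A)" by (simp only: matrix_mul_assoc)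
      also have "\<dots> = t" using adj2_mult[OF det] by simp
      finally show ?thesis using 1(2)[OF t] by (metis (mono_tags, lifting) mem_Collect_eq)
    qed
    then show "{A ** t ** adj2 A |t. t \<in> torus} = torus" using 1(1) by blast
  qed simp_all
  finally show ?thesis by (simp add: A)
qed

lemma torus_subset_normalizer: "torus \<subseteq> normalizer SL2 torus"
  by (auto simp: torus_iff normalizer_torus_iff)

lemma generated_algebra_SL2: "f \<in> regular SL2_variety \<longleftrightarrow> (\<exists>F\<in>mpoly. f = restrict F (carrier SL2))"
proof
  assume "f \<in> regular SL2_variety"
  then obtain k where "poly_le (carrier SL2) {(\<lambda>A. A $ i $ j) | i j. True} k f"
    by (auto simp: SL2_variety_def generated_algebra_def polys_le_def)
  then show "\<exists>F\<in>mpoly. f = restrict F (carrier SL2)"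
  proof induction
    case (const k c)
    then show ?case using mpoly.const by blast
  next
    case (gen f k)
    then show ?case using mpoly.entry by blast
  next
    case (add k f g)
    then obtain F G where "F \<in> mpoly" "f = restrict F (carrier SL2)" "G \<in> mpoly" "g = restrict G (carrier SL2)" by blast
    then show ?case by (intro bexI[OF _ mpoly.add[of F G]]) (auto intro!: restrict_ext)
  next
    case (mult j f k g)
    then obtain F G where "F \<in> mpoly" "f = restrict F (carrier SL2)" "G \<in> mpoly" "g = restrict G (carrier SL2)" by blast
    then show ?case by (intro bexI[OF _ mpoly.mult[of F G]]) (auto intro!: restrict_ext)
  qed
next
  assume "\<exists>F\<in>mpoly. f = restrict F (carrier SL2)"
  then obtain F where F: "F \<in> mpoly" "f = restrict F (carrier SL2)" by blast
  let ?S = "{(\<lambda>A::complex^2^2. A $ i $ j) | i j. True}"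
  from F(1) have "restrict F (carrier SL2) \<in> generated_algebra (carrier SL2) ?S"
  proof induction
    case (entry i j)
    show ?case by (rule generated_algebra_gen) blast
  qed (rule generated_algebra_const generated_algebra_add generated_algebra_mult; assumption?)+
  then show "f \<in> regular SL2_variety"
    using F(2) by (simp add: SL2_variety_def)
qed

text \<open>\<open>m\<close> is the index of the torus in \<open>H\<close>; the smallest positive
  power of \<open>fun_y\<close> that descends to the quotient has exponent \<open>m\<close>.\<close>

locale sl2_quotient =
  fixes H :: "(complex^2^2) set" and m :: nat
  assumes H: "H = torus \<and> m = 1 \<or> H = normalizer SL2 torus \<and> m = 2"
begin

lemma m_pos: "m \<ge> 1" using H by auto

lemma subgroup_H: "subgroup H SL2"
proof -
  have "subgroup torus SL2"
  proof
    fix x y assume "x \<in> torus" "y \<in> torus"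
    then show "x \<otimes>\<^bsub>SL2\<^esub> y \<in> torus" by (auto simp: torus_eq inverse_mult_distrib)
  next
    fix x assume x: "x \<in> torus"
    then have "adj2 x \<in> torus" by (auto simp: torus_iff adj2_def[of x] mult.commute det_2)
    then show "inv\<^bsub>SL2\<^esub> x \<in> torus" using x by (simp add: inv_SL2 torus_iff)
  qed (auto simp: torus_iff mat_1_eq_mat2)
  then show ?thesis
    using H SL2.normalizer_imp_subgroup[of torus] subgroup.subset by blast
qed

lemma diag_in_H: "l \<noteq> 0 \<Longrightarrow> diag2 l \<in> H"
  using H torus_subset_normalizer by (auto simp: torus_eq)

lemma H_cases:
  assumes "h \<in> H"
  obtains l where "l \<noteq> 0" "h = diag2 l" | l where "l \<noteq> 0" "h = diag2 l ** weyl" "m = 2"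
proof -
  obtain a b c d where h: "h = mat2 a b c d" by (rule mat2_cases)
  have 1: "\<exists>l. l \<noteq> 0 \<and> h = diag2 l" if "h \<in> torus" using that by (auto simp: torus_eq)
  show ?thesis
  proof (cases "h \<in> torus")
    case True then show ?thesis using 1 that(1) by blast
  next
    case False
    then have *: "m = 2" "det h = 1" "a = 0" "d = 0"
      using assms H by (auto simp: h normalizer_torus_iff torus_iff)
    then have "b * c = -1" by (simp add: h minus_equation_iff)
    then have "b \<noteq> 0" by auto
    moreover from this have "c = b * c / b" by simp
    ultimately have "b \<noteq> 0" "c = - inverse b" using \<open>b * c = -1\<close> by (simp_all add: inverse_eq_divide)
    then have "h = diag2 b ** weyl" using * by (simp add: h)
    then show ?thesis using that(2) \<open>b \<noteq> 0\<close> *(1) by blast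
  qed
qed

section \<open>Cosets, the action on them and their regular functions\<close>

definition coset :: "complex^2^2 \<Rightarrow> (complex^2^2) set" where "coset g = g <#\<^bsub>SL2\<^esub> H"

definition Q :: "(complex^2^2) set set" where "Q = lcosets\<^bsub>SL2\<^esub> H"

lemma Q_iff: "C \<in> Q \<longleftrightarrow> (\<exists>g. det g = 1 \<and> C = coset g)"
  by (auto simp: Q_def coset_def LCOSETS_def)

lemma coset_mem_iff: "c \<in> coset g \<longleftrightarrow> (\<exists>h\<in>H. c = g ** h)"
  by (auto simp: coset_def l_coset_def)

lemma coset_in_Q [simp]: "det g = 1 \<Longrightarrow> coset g \<in> Q"
  by (auto simp: Q_iff)

lemma coset_absorb: assumes "det g = 1" "h \<in> H" shows "coset (g ** h) = coset g"
proof -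
  have hd: "det h = 1" using subgroup.subset[OF subgroup_H] assms(2) by auto
  have "coset (g ** h) = g <#\<^bsub>SL2\<^esub> (h <#\<^bsub>SL2\<^esub> H)"
    using SL2.lcos_m_assoc[of H g h] subgroup.subset[OF subgroup_H] assms hd by (simp add: coset_def)
  also have "h <#\<^bsub>SL2\<^esub> H = H" using SL2.coset_join3[OF _ subgroup_H assms(2)] hd by simp
  finally show ?thesis by (simp add: coset_def)
qed

lemma coset_eqI: assumes "det g = 1" "det g' = 1" "adj2 g ** g' \<in> H" shows "coset g = coset g'"
proof -
  have "g' = g ** (adj2 g ** g')" using adj2_mult[OF assms(1)] by (simp add: matrix_mul_assoc)
  then show ?thesis using coset_absorb[OF assms(1,3)] by simp
qed

lemma coset_eqD: assumes "det g = 1" "det g' = 1" "coset g = coset g'" shows "adj2 g ** g' \<in> H"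
proof -
  have "mat 1 \<in> H" using subgroup.one_closed[OF subgroup_H] by simp
  then have "g' \<in> coset g'" by (auto simp: coset_mem_iff intro!: bexI[of _ "mat 1"])
  then have "g' \<in> coset g" by (simp only: assms(3))
  then obtain h where "h \<in> H" "g' = g ** h" by (auto simp: coset_mem_iff)
  then show ?thesis using adj2_mult[OF assms(1)] by (simp add: matrix_mul_assoc)
qed

definition qact :: "complex^2^2 \<Rightarrow> (complex^2^2) set \<Rightarrow> (complex^2^2) set" where "qact g C = (\<lambda>c. g ** c) ` C"

lemma qact_coset [simp]: "qact g (coset g') = coset (g ** g')"
proof -
  have "qact g (coset g') = (\<lambda>h. g ** (g' ** h)) ` H" by (auto simp: qact_def coset_def l_coset_def)
  moreover have "coset (g ** g') = (\<lambda>h. g ** g' ** h) ` H" by (auto simp: coset_def l_coset_def)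
  ultimately show ?thesis by (simp add: matrix_mul_assoc)
qed

definition RQ :: "((complex^2^2) set \<Rightarrow> complex) set"
  where "RQ = {f. \<exists>F\<in>mpoly. \<forall>g. det g = 1 \<longrightarrow> f (coset g) = F g}"

lemma RQ_iff: "f \<in> RQ \<longleftrightarrow> restrict f (points (SL2_quotient H)) \<in> regular (SL2_quotient H)"
proof -
  have "restrict f (lcosets\<^bsub>SL2\<^esub> H) (g <#\<^bsub>SL2\<^esub> H) = f (coset g)" if "det g = 1" for g
    using coset_in_Q[OF that] by (simp add: coset_def Q_def)
  then have "(\<lambda>g\<in>carrier SL2. restrict f (lcosets\<^bsub>SL2\<^esub> H) (g <#\<^bsub>SL2\<^esub> H)) = (\<lambda>g\<in>carrier SL2. f (coset g))"
    by (intro restrict_ext) simp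
  moreover have "(\<lambda>g\<in>carrier SL2. f (coset g)) \<in> regular SL2_variety \<longleftrightarrow> f \<in> RQ"
  proof -
    have "(\<lambda>g\<in>carrier SL2. f (coset g)) = restrict F (carrier SL2) \<longleftrightarrow> (\<forall>g. det g = 1 \<longrightarrow> f (coset g) = F g)" for F
      by (auto simp: restrict_def fun_eq_iff)
    then show ?thesis unfolding generated_algebra_SL2 RQ_def by simp
  qed
  ultimately show ?thesis by (simp add: SL2_quotient_def)
qed

lemma points_quotient: "points (SL2_quotient H) = Q"
  by (simp add: SL2_quotient_def Q_def)

lemma RQ_lift:
  assumes "F \<in> mpoly" "\<And>g h. det g = 1 \<Longrightarrow> h \<in> H \<Longrightarrow> F (g ** h) = F g"
  shows "\<exists>f\<in>RQ. \<forall>g. det g = 1 \<longrightarrow> f (coset g) = F g"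
proof -
  define f where "f C = F (SOME c. c \<in> C)" for C
  have "f (coset g) = F g" if g: "det g = 1" for g
  proof -
    have "mat 1 \<in> H" using subgroup.one_closed[OF subgroup_H] by simp
    then have "g \<in> coset g" by (auto simp: coset_mem_iff intro!: bexI[of _ "mat 1"])
    then have "(SOME c. c \<in> coset g) \<in> coset g" by (rule someI)
    then show ?thesis using assms(2)[OF g] by (auto simp: f_def coset_mem_iff)
  qed
  then show ?thesis using assms(1) by (intro bexI[of _ f]) (auto simp: RQ_def)
qed

lemma signed_H_invariant:
  assumes "signed s F" "s = 1 \<or> m = 1" "h \<in> H" shows "F (g ** h) = F g"
  using assms(3)
proof (cases rule: H_cases)
  case (1 l)
  then show ?thesis using signed_diag_right[OF assms(1)] by simp
next
  case (2 l)
  then have "F (g ** h) = s * F (g ** diag2 l)" using signed_weyl_right[OF assms(1), of "g ** diag2 l"] by (simp only: matrix_mul_assoc)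
  then show ?thesis using 2 assms(2) signed_diag_right[OF assms(1)] by simp
qed

lemma RQ_signed:
  assumes "signed s F" "s = 1 \<or> m = 1"
  shows "\<exists>f\<in>RQ. \<forall>g. det g = 1 \<longrightarrow> f (coset g) = F g"
  by (rule RQ_lift[OF signed_mpoly[OF assms(1)] signed_H_invariant[OF assms]])

lemma RQ_decompose:
  assumes "f \<in> RQ"
  shows "\<exists>F0 F1. signed 1 F0 \<and> signed (-1) F1 \<and> (m = 1 \<or> F1 = (\<lambda>g. 0)) \<and>
    (\<forall>g. det g = 1 \<longrightarrow> f (coset g) = F0 g + F1 g)"
proof -
  obtain F where F: "F \<in> mpoly" "\<And>g. det g = 1 \<Longrightarrow> f (coset g) = F g" using assms by (auto simp: RQ_def)
  have inv: "F (g ** h) = F g" if "det g = 1" "h \<in> H" for g h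
  proof -
    have "det h = 1" using subgroup.subset[OF subgroup_H] that(2) by auto
    then show ?thesis using F(2)[of "g ** h"] F(2)[OF that(1)] coset_absorb[OF that] that(1) by (simp add: det_mul)
  qed
  have T: "torus_polynomial F" by (rule torus_invariant_polynomial[OF F(1)]) (use inv diag_in_H in blast)
  show ?thesis
  proof (cases "m = 1")
    case True
    obtain F0 F1 where "signed 1 F0" "signed (-1) F1" "\<forall>g. det g = 1 \<longrightarrow> F g = F0 g + F1 g"
      using T unfolding torus_polynomial_def by blast
    then show ?thesis using True F(2) by (intro exI[of _ F0] exI[of _ F1]) simp
  next
    case False
    then have "weyl \<in> H" using H by (auto simp: normalizer_torus_iff)
    then have W: "F (g ** weyl) = F g" if "det g = 1" for g using inv that by blast
    obtain F0 where "signed 1 F0" "\<forall>g. det g = 1 \<longrightarrow> F g = F0 g"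
      using normalizer_invariant_polynomial[OF T W] by blast
    then show ?thesis using signed_zero F(2) by (intro exI[of _ F0] exI[of _ "\<lambda>g. 0"]) simp
  qed
qed

lemma tensor_signed_mult:
  assumes "h \<in> tensor_functions {F. signed s F}" "k \<in> tensor_functions {F. signed t F}"
  shows "(\<lambda>g x. h g x * k g x) \<in> tensor_functions {F. signed (s * t) F}"
  using assms
proof (induction rule: tensor_functions.induct)
  case (base F f)
  from base(3) show ?case
  proof (induction rule: tensor_functions.induct)
    case (base F' f')
    have "(\<lambda>g x. (F g * F' g) * (f x * f' x)) \<in> tensor_functions {F. signed (s * t) F}"
      using \<open>F \<in> mpoly\<close> \<open>f \<in> {F. signed s F}\<close> base by (intro tensor_functions.base) (auto intro: mpoly.mult signed.mult)
    then show ?case by (simp add: mult_ac)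
  next
    case (add h k)
    then show ?case using tensor_functions.add[OF add.IH] by (simp add: distrib_left)
  qed
next
  case (add h k')
  then show ?case using tensor_functions.add[OF add.IH(1)[OF add.prems] add.IH(2)[OF add.prems]] by (simp add: distrib_right)
qed

lemma tensor_three:
  assumes "F1 \<in> mpoly" "F2 \<in> mpoly" "F3 \<in> mpoly"
  shows "(\<lambda>g x. F1 g * fun_y x + F2 g * fun_z x + F3 g * fun_w x) \<in> tensor_functions {F. signed (-1) F}"
  using assms by (auto intro!: tensor_functions.intros intro: signed.intros)

lemmas entries = mpoly.mult[OF mpoly.entry mpoly.entry]

text \<open>The three invariants span the adjoint representation: each of them at
  \<open>g ** x\<close> is a combination of their values at \<open>x\<close> with coefficients
  quadratic in the entries of \<open>g\<close>. Sums and products preserve this shape and the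
  bookkeeping of signs.\<close>

lemma signed_tensor: "signed s F \<Longrightarrow> \<exists>h\<in>tensor_functions {F. signed s F}. \<forall>g x. F (g ** x) = h g x"
proof (induction rule: signed.induct)
  case (const c)
  have "(\<lambda>g x. 1 * c) \<in> tensor_functions {F. signed 1 F}"
    using tensor_functions.base[OF mpoly.const[of 1], of "\<lambda>x. c" "{F. signed 1 F}"] signed.const by simp
  then show ?case by (intro bexI) auto
next
  case y
  have e: "fun_y (g ** x) = g$2$2 * g$2$2 * fun_y x + 2 * (g$2$1 * g$2$2) * fun_z x + g$2$1 * g$2$1 * fun_w x" for g x
    by (cases g rule: mat2_cases; cases x rule: mat2_cases) (simp add: fun_yzw_defs field_simps)
  show ?case unfolding e
    by (rule bexI[OF _ tensor_three]) (rule allI refl entries mpoly.mult[OF mpoly.const entries] mpoly.add[OF entries entries])+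
next
  case z
  have e: "fun_z (g ** x) = g$1$2 * g$2$2 * fun_y x + (g$1$1 * g$2$2 + g$1$2 * g$2$1) * fun_z x + g$1$1 * g$2$1 * fun_w x" for g x
    by (cases g rule: mat2_cases; cases x rule: mat2_cases) (simp add: fun_yzw_defs field_simps)
  show ?case unfolding e
    by (rule bexI[OF _ tensor_three]) (rule allI refl entries mpoly.mult[OF mpoly.const entries] mpoly.add[OF entries entries])+
next
  case w
  have e: "fun_w (g ** x) = g$1$2 * g$1$2 * fun_y x + 2 * (g$1$1 * g$1$2) * fun_z x + g$1$1 * g$1$1 * fun_w x" for g x
    by (cases g rule: mat2_cases; cases x rule: mat2_cases) (simp add: fun_yzw_defs field_simps)
  show ?case unfolding e
    by (rule bexI[OF _ tensor_three]) (rule allI refl entries mpoly.mult[OF mpoly.const entries] mpoly.add[OF entries entries])+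
next
  case (add s F G)
  then obtain h k where "h \<in> tensor_functions {F. signed s F}" "\<forall>g x. F (g ** x) = h g x"
    "k \<in> tensor_functions {F. signed s F}" "\<forall>g x. G (g ** x) = k g x" by blast
  then show ?case by (intro bexI[OF _ tensor_functions.add[of h _ k]]) auto
next
  case (mult s F t G)
  then obtain h k where "h \<in> tensor_functions {F. signed s F}" "\<forall>g x. F (g ** x) = h g x"
    "k \<in> tensor_functions {F. signed t F}" "\<forall>g x. G (g ** x) = k g x" by blast
  then show ?case by (intro bexI[OF _ tensor_signed_mult[of h s k t]]) auto
qed

lemma tensor_descend:
  assumes "h \<in> tensor_functions {F. signed s F}" "s = 1 \<or> m = 1"
  shows "\<exists>k\<in>tensor_functions RQ. \<forall>g x. det x = 1 \<longrightarrow> k g (coset x) = h g x"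
  using assms(1)
proof induction
  case (base F f)
  obtain f' where f': "f' \<in> RQ" "\<forall>x. det x = 1 \<longrightarrow> f' (coset x) = f x"
    using RQ_signed[of s f] base assms(2) by auto
  then show ?case by (intro bexI[OF _ tensor_functions.base[OF base(1) f'(1)]]) simp
next
  case (add h k)
  then obtain h' k' where "h' \<in> tensor_functions RQ" "\<forall>g x. det x = 1 \<longrightarrow> h' g (coset x) = h g x"
    "k' \<in> tensor_functions RQ" "\<forall>g x. det x = 1 \<longrightarrow> k' g (coset x) = k g x" by blast
  then show ?case by (intro bexI[OF _ tensor_functions.add[of h' _ k']]) auto
qed

lemma RQ_left: assumes "f \<in> RQ" "det g = 1" shows "(\<lambda>C. f (qact g C)) \<in> RQ"
proof -
  obtain F where F: "F \<in> mpoly" "\<And>g. det g = 1 \<Longrightarrow> f (coset g) = F g" using assms(1) by (auto simp: RQ_def)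
  show ?thesis unfolding RQ_def using F(2) assms(2)
    by (auto intro!: bexI[OF _ mpoly_mult_left[OF F(1), of g]] simp: det_mul)
qed

text \<open>The squares of \<open>fun_y\<close> and \<open>fun_w\<close> are even and already cut
  out the normalizer. When \<open>H\<close> is the torus, \<open>fun_z\<close> is available and
  excludes the antidiagonal matrices.\<close>

lemma RQ_separates_base:
  assumes "det u = 1" "\<And>f. f \<in> RQ \<Longrightarrow> f (coset u) = f (coset (mat 1))" shows "u \<in> H"
proof -
  obtain a b c d where u: "u = mat2 a b c d" by (rule mat2_cases)
  have val: "F u = F (mat 1)" if F: "signed s F" "s = 1 \<or> m = 1" for s F
  proof -
    obtain f where f: "f \<in> RQ" "\<forall>g. det g = 1 \<longrightarrow> f (coset g) = F g" using RQ_signed[OF F] by blast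
    show ?thesis using assms(2)[OF f(1)] f(2) assms(1) by simp
  qed
  have "signed 1 (\<lambda>g. fun_y g * fun_y g)" "signed 1 (\<lambda>g. fun_w g * fun_w g)"
    using signed.mult[OF signed.y signed.y] signed.mult[OF signed.w signed.w] by simp_all
  from val[OF this(1)] val[OF this(2)] have 0: "c * d = 0" "a * b = 0"
    by (auto simp: u fun_yzw_defs mat_1_eq_mat2)
  have det: "a * d - b * c = 1" using assms(1) by (simp add: u)
  show ?thesis
  proof (cases "m = 1")
    case False
    then have "H = normalizer SL2 torus" using H by auto
    then show ?thesis using 0 det by (auto simp: u normalizer_torus_iff)
  next
    case True
    then have HT: "H = torus" using H by auto
    have "fun_z u = fun_z (mat 1)" by (rule val[OF signed.z]) (simp add: True)
    then have "2 * ((a * d + b * c) / 2) = 2 * ((1 * 1 + 0 * 0) / 2)" by (simp only: u fun_z_def mat_1_eq_mat2 mat2_nth)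
    then have "2 * (a * d) + 2 * (b * c) = 2" by (simp add: algebra_simps)
    then have "2 * (a * d + b * c) = 2 * 1" by (simp add: distrib_left)
    then have s: "a * d + b * c = 1" by (rule mult_left_cancel[THEN iffD1, rotated]) simp
    have "b * c = 0" using s det by algebra
    moreover from this have "a * d = 1" using det by auto
    ultimately have "a * d = 1" "b * c = 0" by simp_all
    then show ?thesis using 0 det unfolding HT by (auto simp: u torus_iff)
  qed
qed

sublocale sl2_variety Q RQ qact
proof
  fix f f' assume f: "f \<in> RQ"
  show "f' \<in> RQ" if "\<And>x. x \<in> Q \<Longrightarrow> f' x = f x" using f that by (auto simp: RQ_def)
  { assume f': "f' \<in> RQ"
    obtain F F' where FF: "F \<in> mpoly" "\<forall>g. det g = 1 \<longrightarrow> f (coset g) = F g" "F' \<in> mpoly" "\<forall>g. det g = 1 \<longrightarrow> f' (coset g) = F' g"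
      using f f' by (auto simp: RQ_def)
    show "(\<lambda>x. f x + f' x) \<in> RQ"
      unfolding RQ_def using FF by (intro CollectI bexI[OF _ mpoly.add[of F F']]) auto
    show "(\<lambda>x. f x * f' x) \<in> RQ"
      unfolding RQ_def using FF by (intro CollectI bexI[OF _ mpoly.mult[of F F']]) auto }
  obtain F0 F1 where F: "signed 1 F0" "signed (-1) F1" "m = 1 \<or> F1 = (\<lambda>g. 0)"
    "\<forall>g. det g = 1 \<longrightarrow> f (coset g) = F0 g + F1 g" using RQ_decompose[OF f] by blast
  have desc: "\<exists>h\<in>tensor_functions RQ. \<forall>g x. det x = 1 \<longrightarrow> h g (coset x) = F (g ** x)"
    if sF: "signed s F" "s = 1 \<or> m = 1" for s F
  proof -
    obtain h where h: "h \<in> tensor_functions {F. signed s F}" "\<forall>g x. F (g ** x) = h g x"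
      using signed_tensor[OF sF(1)] by blast
    show ?thesis using tensor_descend[OF h(1) sF(2)] h(2) by simp
  qed
  have "\<exists>h\<in>tensor_functions RQ. \<forall>g x. det x = 1 \<longrightarrow> h g (coset x) = F0 (g ** x)"
    by (rule desc[OF F(1)]) simp
  moreover have "\<exists>h\<in>tensor_functions RQ. \<forall>g x. det x = 1 \<longrightarrow> h g (coset x) = F1 (g ** x)"
  proof (cases "m = 1")
    case True then show ?thesis by (intro desc[OF F(2)]) simp
  next
    case False
    then have "F1 = (\<lambda>g. 0)" using F(3) by simp
    moreover have "(\<lambda>g x. 0 * f x) \<in> tensor_functions RQ" by (rule tensor_functions.base[OF mpoly.const f])
    ultimately show ?thesis by (intro bexI[of _ "\<lambda>g x. 0 * f x"]) auto
  qed
  ultimately obtain h k where "h \<in> tensor_functions RQ" "\<forall>g x. det x = 1 \<longrightarrow> h g (coset x) = F0 (g ** x)"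
    "k \<in> tensor_functions RQ" "\<forall>g x. det x = 1 \<longrightarrow> k g (coset x) = F1 (g ** x)" by blast
  then show "\<exists>h\<in>tensor_functions RQ. \<forall>g x. det g = 1 \<longrightarrow> x \<in> Q \<longrightarrow> f (qact g x) = h g x"
    by (intro bexI[OF _ tensor_functions.add[of h _ k]]) (auto simp: Q_iff F(4) det_mul)
next
  show "(\<lambda>x. c) \<in> RQ" for c by (auto simp: RQ_def intro!: bexI[OF _ mpoly.const])
  show "qact g x \<in> Q" if gx: "det g = 1" "x \<in> Q" for g x
  proof -
    obtain g' where "det g' = 1" "x = coset g'" using gx(2) by (auto simp: Q_iff)
    then show ?thesis using gx(1) by (simp add: det_mul)
  qed
  show "qact g (qact h x) = qact (g ** h) x" if "det g = 1" "det h = 1" "x \<in> Q" for g h x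
    using that by (auto simp: Q_iff matrix_mul_assoc)
  show "qact (mat 1) x = x" if "x \<in> Q" for x using that by (auto simp: Q_iff)
  fix x y assume "x \<in> Q" "y \<in> Q" and eq: "\<And>f. f \<in> RQ \<Longrightarrow> f x = f y"
  then obtain g g' where g: "det g = 1" "x = coset g" "det g' = 1" "y = coset g'" by (auto simp: Q_iff)
  have "adj2 g ** g' \<in> H"
  proof (rule RQ_separates_base)
    show "det (adj2 g ** g') = 1" using g by (simp add: det_mul)
    fix f assume f: "f \<in> RQ"
    have "f (qact (adj2 g) (coset g')) = f (qact (adj2 g) (coset g))"
      using eq[OF RQ_left[OF f, of "adj2 g"]] g by simp
    then show "f (coset (adj2 g ** g')) = f (coset (mat 1))" using adj2_mult[OF g(1)] by simp
  qed
  then show "x = y" using coset_eqI g by simp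
qed

end

section \<open>Automorphisms of the homogeneous spaces\<close>

lemma sum_lessThan_double: "(\<Sum>i<2 * n. f i) = (\<Sum>i<n. f (2 * i) + f (2 * i + 1))" for f :: "nat \<Rightarrow> complex"
  by (induction n) (simp_all add: add.assoc)

lemma even_poly_square:
  fixes q :: "complex poly"
  assumes "\<And>x. poly q (- x) = poly q x" shows "\<exists>r. \<forall>x. poly q x = poly r (x\<^sup>2)"
proof -
  define n where "n = Suc (degree q)"
  define r where "r = (\<Sum>i<n. monom (coeff q (2 * i)) i)"
  have odd: "coeff q (2 * i + 1) = 0" for i
    using parity_coeff[of q 1 "2 * i + 1"] assms by simp
  have "poly q x = poly r (x\<^sup>2)" for x
  proof -
    have "poly q x = (\<Sum>i<2 * n. coeff q i * x ^ i)"
      unfolding poly_altdef by (rule sum.mono_neutral_left) (auto simp: n_def coeff_eq_0)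
    also have "\<dots> = (\<Sum>i<n. coeff q (2 * i) * x ^ (2 * i))"
      unfolding sum_lessThan_double by (simp add: odd[simplified])
    also have "\<dots> = poly r (x\<^sup>2)" by (simp add: r_def poly_sum poly_monom power_mult)
    finally show ?thesis .
  qed
  then show ?thesis by blast
qed

context sl2_quotient
begin

text \<open>\<open>fun_F\<close> and \<open>fun_G\<close> are coordinates adapted to
  \<open>upper\<close>: the first generates the invariants, the second is translated by multiples of
  the first. The factor \<open>fun_y ^ (m - 1)\<close> in \<open>fun_G\<close> makes it even when
  \<open>H\<close> is the normalizer.\<close>

definition fun_F :: "(complex^2^2) set \<Rightarrow> complex"
  where "fun_F = (SOME f. f \<in> RQ \<and> (\<forall>g. det g = 1 \<longrightarrow> f (coset g) = fun_y g ^ m))"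

definition fun_G :: "(complex^2^2) set \<Rightarrow> complex"
  where "fun_G = (SOME f. f \<in> RQ \<and> (\<forall>g. det g = 1 \<longrightarrow> f (coset g) = fun_y g ^ (m - 1) * fun_z g))"

lemma fun_F: "fun_F \<in> RQ" "det g = 1 \<Longrightarrow> fun_F (coset g) = fun_y g ^ m"
proof -
  have "\<exists>f. f \<in> RQ \<and> (\<forall>g. det g = 1 \<longrightarrow> f (coset g) = fun_y g ^ m)"
    using RQ_signed[OF signed_power[OF signed.y, of m]] H by auto
  from someI_ex[OF this] show "fun_F \<in> RQ" "det g = 1 \<Longrightarrow> fun_F (coset g) = fun_y g ^ m"
    by (auto simp: fun_F_def)
qed

lemma fun_G: "fun_G \<in> RQ" "det g = 1 \<Longrightarrow> fun_G (coset g) = fun_y g ^ (m - 1) * fun_z g"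
proof -
  have "\<exists>f. f \<in> RQ \<and> (\<forall>g. det g = 1 \<longrightarrow> f (coset g) = fun_y g ^ (m - 1) * fun_z g)"
    using RQ_signed[OF signed.mult[OF signed_power[OF signed.y, of "m - 1"] signed.z]] H by auto
  from someI_ex[OF this] show "fun_G \<in> RQ" "det g = 1 \<Longrightarrow> fun_G (coset g) = fun_y g ^ (m - 1) * fun_z g"
    by (auto simp: fun_G_def)
qed

lemma fun_F_surj: "\<exists>q\<in>Q. fun_F q = v"
proof -
  have "\<exists>r. r ^ 1 = v" "\<exists>r. r ^ 2 = v" using power2_csqrt[of v] by (auto intro: exI[of _ "csqrt v"])
  then have "\<exists>r. r ^ m = v" using H by metis
  then obtain r where "r ^ m = v" by blast
  then show ?thesis using fun_F(2)[of "lower r"] by (intro bexI[of _ "coset (lower r)"]) (auto simp: fun_y_def)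
qed

lemma fun_F_upper: "q \<in> Q \<Longrightarrow> fun_F (qact (upper r) q) = fun_F q"
  by (auto simp: Q_iff fun_F(2) det_mul fun_upper)

lemma fun_G_upper: "q \<in> Q \<Longrightarrow> fun_G (qact (upper r) q) = fun_G q + r * fun_F q"
proof -
  assume "q \<in> Q"
  then obtain g where g: "det g = 1" "q = coset g" by (auto simp: Q_iff)
  have "fun_y g ^ (m - 1) * fun_y g = fun_y g ^ m" using m_pos by (simp add: power_Suc2[symmetric] del: power_Suc)
  then show ?thesis using g by (simp add: fun_F(2) fun_G(2) det_mul fun_upper distrib_left mult.left_commute)
qed

lemma fun_F_diag: "q \<in> Q \<Longrightarrow> l \<noteq> 0 \<Longrightarrow> l ^ (2 * m) * fun_F (qact (diag2 l) q) = fun_F q"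
proof -
  assume "q \<in> Q" and l: "l \<noteq> 0"
  then obtain g where g: "det g = 1" "q = coset g" by (auto simp: Q_iff)
  have "l ^ (2 * m) * fun_y (diag2 l ** g) ^ m = (l\<^sup>2 * fun_y (diag2 l ** g)) ^ m"
    by (simp only: power_mult power_mult_distrib)
  then show ?thesis using g l fun_diag_left(1)[OF l, of g] fun_F(2)[of "diag2 l ** g"] by (simp add: fun_F(2) det_mul)
qed

lemma fun_G_diag: "q \<in> Q \<Longrightarrow> l \<noteq> 0 \<Longrightarrow> l ^ (2 * m - 2) * fun_G (qact (diag2 l) q) = fun_G q"
proof -
  assume "q \<in> Q" and l: "l \<noteq> 0"
  then obtain g where g: "det g = 1" "q = coset g" by (auto simp: Q_iff)
  have e: "2 * m - 2 = 2 * (m - 1)" by simp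
  have "l ^ (2 * m - 2) * (fun_y (diag2 l ** g) ^ (m - 1) * fun_z (diag2 l ** g))
    = (l\<^sup>2 * fun_y (diag2 l ** g)) ^ (m - 1) * fun_z (diag2 l ** g)"
    unfolding e by (simp only: power_mult power_mult_distrib mult.assoc)
  then show ?thesis using g l fun_diag_left[OF l, of g] fun_G(2)[of "diag2 l ** g"] by (simp add: fun_G(2) det_mul)
qed

text \<open>The coset of a matrix with \<open>d\<close> nonzero lies in the unipotent orbit of the
  coset of \<open>lower (c * d)\<close>, so \<open>f\<close> is a polynomial in
  \<open>fun_y\<close>. For the normalizer, \<open>weyl\<close> changes the sign of
  \<open>fun_y\<close>, which makes this polynomial even.\<close>

lemma upper_invariant_poly:
  assumes f: "f \<in> RQ" "\<And>r q. q \<in> Q \<Longrightarrow> f (qact (upper r) q) = f q"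
  shows "\<exists>p. \<forall>q\<in>Q. f q = poly p (fun_F q)"
proof -
  obtain F where F: "F \<in> mpoly" "\<And>g. det g = 1 \<Longrightarrow> f (coset g) = F g" using f(1) by (auto simp: RQ_def)
  obtain p where p: "\<And>r. F (lower r) = poly p r" by (rule mpoly_lower[OF F(1)]) blast
  have py: "F g = poly p (fun_y g)" if g: "det g = 1" for g
  proof -
    have "F g - poly p (fun_y g) = 0"
    proof (rule mpoly_dense_zero[OF _ _ g])
      show "(\<lambda>g. F g - poly p (fun_y g)) \<in> mpoly" by (intro mpoly_diff mpoly_poly F(1) fun_yzw_mpoly)
      fix x b c d :: complex assume d: "x * d - b * c = 1" "d \<noteq> 0"
      have x: "x = (1 + b * c) / d" using d by (simp add: field_simps)
      have mm: "upper (b / d) ** (lower (c * d) ** diag2 (inverse d)) = mat2 x b c d"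
        using d(2) by (simp add: x field_simps)
      have "F (mat2 x b c d) = f (coset (upper (b / d) ** (lower (c * d) ** diag2 (inverse d))))"
        unfolding mm using F(2)[of "mat2 x b c d"] d(1) by simp
      also have "\<dots> = f (qact (upper (b / d)) (coset (lower (c * d) ** diag2 (inverse d))))" by (simp del: mat2_mult)
      also have "\<dots> = f (coset (lower (c * d) ** diag2 (inverse d)))"
        by (rule f(2)) (use d(2) in \<open>simp add: det_mul del: mat2_mult\<close>)
      also have "coset (lower (c * d) ** diag2 (inverse d)) = coset (lower (c * d))"
        by (rule coset_absorb[OF _ diag_in_H]) (use d(2) in auto)
      also have "f \<dots> = poly p (c * d)" using F(2)[of "lower (c * d)"] p by simp
      finally show "F (mat2 x b c d) - poly p (fun_y (mat2 x b c d)) = 0" by (simp add: fun_y_def)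
    qed
    then show ?thesis by simp
  qed
  show ?thesis
  proof (cases "m = 1")
    case True
    then have "f q = poly p (fun_F q)" if qQ: "q \<in> Q" for q
    proof -
      obtain g where g: "det g = 1" "q = coset g" using qQ by (auto simp: Q_iff)
      then show ?thesis using fun_F(2)[OF g(1)] F(2)[OF g(1)] py[OF g(1)] True by simp
    qed
    then show ?thesis by blast
  next
    case False
    then have m2: "m = 2" and w: "weyl \<in> H" using H by (auto simp: normalizer_torus_iff)
    have "poly p (- y) = poly p y" for y
    proof -
      have "F (lower y ** weyl) = F (lower y)"
        using F(2)[of "lower y ** weyl"] F(2)[of "lower y"] coset_absorb[OF _ w, of "lower y"] by (simp add: det_mul)
      then show ?thesis using py[of "lower y ** weyl"] py[of "lower y"] by (simp add: fun_y_def)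
    qed
    then obtain r where "\<forall>x. poly p x = poly r (x\<^sup>2)" using even_poly_square by blast
    then have "f q = poly r (fun_F q)" if qQ: "q \<in> Q" for q
    proof -
      obtain g where g: "det g = 1" "q = coset g" using qQ by (auto simp: Q_iff)
      have "fun_F q = (fun_y g)\<^sup>2" using fun_F(2)[OF g(1)] unfolding g(2) m2 .
      then show ?thesis using F(2)[OF g(1)] py[OF g(1)] g(2) \<open>\<forall>x. poly p x = poly r (x\<^sup>2)\<close> by simp
    qed
    then show ?thesis by blast
  qed
qed

lemma signed_transport:
  assumes "fun_y g' = e * fun_y g" "fun_z g' = e * fun_z g" "fun_w g' = e * fun_w g" "e = 1 \<or> e = -1"
  shows "signed s F \<Longrightarrow> F g' = (if e = 1 then F g else s * F g)"
  by (induction rule: signed.induct) (use assms in \<open>auto simp: distrib_left\<close>)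

text \<open>Where \<open>fun_F\<close> is nonzero, the two values determine the three invariants up
  to a common sign. The sign can be -1 only for \<open>m = 2\<close>, when all functions are
  even.\<close>

lemma fun_F_fun_G_determine:
  assumes "q \<in> Q" "q' \<in> Q" "fun_F q = fun_F q'" "fun_G q = fun_G q'" "fun_F q \<noteq> 0" shows "q = q'"
proof -
  obtain g g' where g: "det g = 1" "q = coset g" "det g' = 1" "q' = coset g'" using assms(1,2) by (auto simp: Q_iff)
  have "fun_y g ^ m \<noteq> 0" using assms(5) fun_F(2)[OF g(1)] g(2) by simp
  moreover have "0 < m" using m_pos by simp
  ultimately have "fun_y g \<noteq> 0" by (auto simp: zero_power)
  then have y: "fun_y g ^ m = fun_y g' ^ m" "fun_y g ^ (m - 1) * fun_z g = fun_y g' ^ (m - 1) * fun_z g'" "fun_y g \<noteq> 0"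
    using assms(3,4) g fun_F(2) fun_G(2) by auto
  have "\<exists>e. (e = 1 \<or> e = -1 \<and> m = 2) \<and> fun_y g' = e * fun_y g"
  proof (cases "m = 1")
    case True then show ?thesis using y(1) by (intro exI[of _ 1]) simp
  next
    case False
    then have "m = 2" using H by auto
    then have "(fun_y g')\<^sup>2 = (fun_y g)\<^sup>2" using y(1) by simp
    then have "fun_y g' = fun_y g \<or> fun_y g' = - fun_y g" by (simp only: power2_eq_iff)
    then show ?thesis using \<open>m = 2\<close> by (metis mult_1 mult_minus1)
  qed
  then obtain e where e: "e = 1 \<or> e = -1 \<and> m = 2" "fun_y g' = e * fun_y g" by blast
  have ee: "e * e = 1" using e(1) by auto
  have z: "fun_z g' = e * fun_z g"
  proof (cases "m = 1")
    case True then show ?thesis using y(2) e(1) by simp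
  next
    case False
    then have "m = 2" using H by auto
    then have "fun_y g * fun_z g = fun_y g * (e * fun_z g')" using y(2) e(2) by (simp add: mult_ac)
    then have "fun_z g = e * fun_z g'" using y(3) by simp
    then show ?thesis using ee by (simp add: mult.assoc[symmetric])
  qed
  have "fun_y g * (e * fun_w g') = fun_y g * fun_w g"
  proof -
    have "fun_y g * (e * fun_w g') = fun_y g' * fun_w g'" using e(2) by (simp add: mult_ac)
    also have "\<dots> = (e * e) * (fun_z g)\<^sup>2 - 1/4" using yw_eq[OF g(3)] z by (simp add: power2_eq_square mult_ac)
    also have "\<dots> = fun_y g * fun_w g" using yw_eq[OF g(1)] ee by simp
    finally show ?thesis .
  qed
  then have "e * fun_w g' = fun_w g" using y(3) by simp
  then have w: "fun_w g' = e * fun_w g" using ee by (metis mult.assoc mult_1)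
  show ?thesis
  proof (rule separated[OF assms(1,2)])
    fix f assume "f \<in> RQ"
    then obtain F0 F1 where F: "signed 1 F0" "signed (-1) F1" "m = 1 \<or> F1 = (\<lambda>g. 0)"
      "\<forall>g. det g = 1 \<longrightarrow> f (coset g) = F0 g + F1 g" using RQ_decompose by blast
    have "e = 1 \<or> e = -1" using e(1) by auto
    note tr = signed_transport[OF e(2) z w this]
    have "F0 g' = F0 g" using tr[OF F(1)] by simp
    moreover have "F1 g' = F1 g" using tr[OF F(2)] F(3) e(1) by auto
    ultimately show "f q = f q'" using F(4) g by simp
  qed
qed

text \<open>Along \<open>lower r ** g\<close> the function \<open>fun_y\<close> is a nonzero
  polynomial in \<open>r\<close>, since \<open>fun_y\<close> and \<open>fun_z\<close> have no common
  zero by \<open>yw_eq\<close>. So \<open>fun_F\<close> is nonzero for all but finitely many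
  \<open>r\<close>.\<close>

lemma RQ_zero_off_F:
  assumes "f \<in> RQ" "\<And>q. q \<in> Q \<Longrightarrow> fun_F q \<noteq> 0 \<Longrightarrow> f q = 0" "q \<in> Q" shows "f q = 0"
proof -
  obtain F where F: "F \<in> mpoly" "\<And>g. det g = 1 \<Longrightarrow> f (coset g) = F g" using assms(1) by (auto simp: RQ_def)
  obtain g where g: "det g = 1" "q = coset g" using assms(3) by (auto simp: Q_iff)
  obtain p where p: "\<And>r. F (lower r ** g) = poly p r"
  proof (rule mpoly_curve[OF F(1), of "\<lambda>r. lower r ** g"])
    fix i j :: 2
    obtain a b c d where "g = mat2 a b c d" by (rule mat2_cases)
    then show "\<exists>p. \<forall>z. (lower z ** g) $ i $ j = poly p z"
      by (intro mat2_curve[of _ "[:a:]" "[:b:]" "[:c, a:]" "[:d, b:]"]) (simp add: add.commute)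
  qed blast
  let ?Y = "[:fun_y g, 2 * fun_z g, fun_w g:]"
  have Y: "?Y \<noteq> 0"
  proof
    assume "?Y = 0"
    then have "fun_y g = 0" "fun_z g = 0" by auto
    then show False using yw_eq[OF g(1)] by simp
  qed
  have "poly p r = 0" if "poly ?Y r \<noteq> 0" for r
  proof -
    have d: "det (lower r ** g) = 1" using g by (simp add: det_mul)
    have "fun_y (lower r ** g) = poly ?Y r" by (simp add: fun_lower power2_eq_square algebra_simps)
    then have "fun_F (coset (lower r ** g)) \<noteq> 0" using fun_F(2)[OF d] that by simp
    then have "f (coset (lower r ** g)) = 0" using assms(2) d by simp
    then show ?thesis using F(2)[OF d] p by simp
  qed
  then have "UNIV - {r. poly ?Y r = 0} \<subseteq> {r. poly p r = 0}" by blast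
  moreover have "finite {r. poly ?Y r = 0}" by (rule poly_roots_finite[OF Y])
  ultimately have "infinite {r. poly p r = 0}"
    by (metis Diff_infinite_finite infinite_UNIV_char_0 infinite_super)
  then have "p = 0" using poly_roots_finite by blast
  moreover have "lower 0 ** g = g" by (simp add: mat_1_eq_mat2[symmetric])
  ultimately show ?thesis using p[of 0] F(2)[OF g(1)] g(2) by simp
qed

text \<open>A one-parameter group of automorphisms that commutes with the unipotent group fixes \<open>fun_F\<close> and
  translates \<open>fun_G\<close> by a polynomial in \<open>fun_F\<close>; a torus weight leaves only one monomial.\<close>

definition unipotent_family :: "nat \<Rightarrow> (complex \<Rightarrow> (complex^2^2) set \<Rightarrow> (complex^2^2) set) \<Rightarrow> bool"
  where "unipotent_family j h \<longleftrightarrow>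
    (\<forall>s. \<forall>q\<in>Q. h s q \<in> Q) \<and> (\<forall>s. \<forall>f\<in>RQ. (\<lambda>q. f (h s q)) \<in> RQ) \<and>
    (\<forall>s s'. \<forall>q\<in>Q. h (s + s') q = h s (h s' q)) \<and> (\<forall>q\<in>Q. h 0 q = q) \<and>
    (\<forall>s r. \<forall>q\<in>Q. h s (qact (upper r) q) = qact (upper r) (h s q)) \<and>
    (\<forall>s l. \<forall>q\<in>Q. l \<noteq> 0 \<longrightarrow> h (l ^ j * s) (qact (diag2 l) q) = qact (diag2 l) (h s q))"

lemma complex_nth_root: "n > 0 \<Longrightarrow> \<exists>l::complex. l ^ n = s"
proof -
  assume n: "n > 0"
  show ?thesis
  proof (cases "s = 0")
    case True then show ?thesis using n by (intro exI[of _ 0]) simp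
  next
    case False
    have "exp (Ln s / of_nat n) ^ n = exp (of_nat n * (Ln s / of_nat n))" by (rule exp_of_nat_mult[symmetric])
    also have "\<dots> = s" using n False by simp
    finally show ?thesis by blast
  qed
qed

text \<open>The dependence on \<open>s\<close> is only known to be additive. Every nonzero
  \<open>s\<close> is a power \<open>l ^ j\<close>, so additivity combined with the torus weight
  forces linear dependence on \<open>s\<close> and selects one monomial.\<close>

lemma unipotent_family_shape:
  assumes "unipotent_family j h" "j > 0"
  shows "\<exists>e. \<forall>s. \<forall>q\<in>Q. fun_F (h s q) = fun_F q \<and>
    fun_G (h s q) = fun_G q + s * e * fun_F q ^ ((j + 2 * m - 2) div (2 * m))"
proof -
  note u = assms(1)[unfolded unipotent_family_def]
  have hQ: "\<And>s q. q \<in> Q \<Longrightarrow> h s q \<in> Q" and hR: "\<And>s f. f \<in> RQ \<Longrightarrow> (\<lambda>q. f (h s q)) \<in> RQ"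
    and hadd: "\<And>s s' q. q \<in> Q \<Longrightarrow> h (s + s') q = h s (h s' q)" and h0: "\<And>q. q \<in> Q \<Longrightarrow> h 0 q = q"
    and hU: "\<And>s r q. q \<in> Q \<Longrightarrow> h s (qact (upper r) q) = qact (upper r) (h s q)"
    and hT: "\<And>s l q. q \<in> Q \<Longrightarrow> l \<noteq> 0 \<Longrightarrow> h (l ^ j * s) (qact (diag2 l) q) = qact (diag2 l) (h s q)"
    using u by simp_all
  have root: "\<exists>l. l \<noteq> 0 \<and> s = l ^ j" if "s \<noteq> 0" for s :: complex
    using complex_nth_root[OF assms(2), of s] that assms(2) by (metis power_0_left not_gr0)
  have "\<exists>P. \<forall>q\<in>Q. fun_F (h s q) = poly P (fun_F q)" for s
    by (rule upper_invariant_poly[OF hR[OF fun_F(1)]]) (simp add: hU fun_F_upper hQ)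
  then have "\<exists>P. \<forall>s. \<forall>q\<in>Q. fun_F (h s q) = poly (P s) (fun_F q)" by (intro choice allI)
  then obtain P where P: "\<And>s q. q \<in> Q \<Longrightarrow> fun_F (h s q) = poly (P s) (fun_F q)" by blast
  have polyI: "p = p'" if "\<And>q. q \<in> Q \<Longrightarrow> poly p (fun_F q) = poly p' (fun_F q)" for p p'
  proof -
    have "poly p v = poly p' v" for v using fun_F_surj[of v] that by blast
    then show ?thesis by (simp add: poly_eq_poly_eq_iff[symmetric] fun_eq_iff)
  qed
  have Padd: "P (s + s') = pcompose (P s) (P s')" for s s'
    by (rule polyI) (simp add: P[symmetric] hadd hQ poly_pcompose)
  have P0: "P 0 = [:0, 1:]" by (rule polyI) (simp add: P[symmetric] h0)
  \<comment> \<open>\<open>P s\<close> has the inverse \<open>P (- s)\<close> under composition, so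
    it is affine linear.\<close>
  have deg: "degree (P s) = 1" for s
  proof -
    have "pcompose (P s) (P (- s)) = [:0, 1:]" using Padd[of s "- s"] P0 by simp
    then have "degree (pcompose (P s) (P (- s))) = 1" by simp
    then have "degree (P s) * degree (P (- s)) = 1" by (simp only: degree_pcompose)
    then show ?thesis by (simp only: nat_mult_eq_1_iff)
  qed
  define a b where "a s = coeff (P s) 1" and "b s = coeff (P s) 0" for s
  have Pab: "P s = [:b s, a s:]" for s
  proof (rule poly_eqI)
    fix i show "coeff (P s) i = coeff [:b s, a s:] i"
      using deg[of s] by (cases i; cases "i - 1") (auto simp: a_def b_def coeff_eq_0 coeff_pCons split: nat.splits)
  qed
  have a_nz: "a s \<noteq> 0" for s using deg[of s] by (auto simp: Pab split: if_splits)
  have ab: "a (s + s') = a s * a s'" "b (s + s') = b s + a s * b s'" for s s'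
    using Padd[of s s'] by (simp_all add: Pab pcompose_pCons)
  have PT: "l ^ (2 * m) * poly (P (l ^ j * s)) v = poly (P s) (l ^ (2 * m) * v)" if l: "l \<noteq> 0" for l s v
  proof -
    obtain q where q: "q \<in> Q" "fun_F q = l ^ (2 * m) * v" using fun_F_surj by blast
    have tq: "qact (diag2 l) q \<in> Q" "fun_F (qact (diag2 l) q) = v" using fun_F_diag[OF q(1) l] q(2) l act_upper_lower_closed(3)[OF q(1) l] by auto
    have "l ^ (2 * m) * poly (P (l ^ j * s)) v = l ^ (2 * m) * fun_F (h (l ^ j * s) (qact (diag2 l) q))"
      using P[OF tq(1)] tq(2) by simp
    also have "\<dots> = fun_F (h s q)" unfolding hT[OF q(1) l] by (rule fun_F_diag[OF hQ[OF q(1)] l])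
    finally show ?thesis using P[OF q(1)] q(2) by simp
  qed
  have bT: "l ^ (2 * m) * b (l ^ j * s) = b s" if l: "l \<noteq> 0" for l s
    using PT[OF l, of s 0] by (simp add: Pab)
  have aT: "a (l ^ j * s) = a s" if l: "l \<noteq> 0" for l s
    using PT[OF l, of s 1] bT[OF l, of s] l by (simp add: Pab distrib_left)
  \<comment> \<open>The slope \<open>a\<close> takes a single value on all nonzero \<open>s\<close>
    and is multiplicative; comparing \<open>a 2\<close> with the square of \<open>a 1\<close> shows
    that this value is 1.\<close>
  have a1: "a s = 1" for s
  proof (cases "s = 0")
    case True then show ?thesis using P0 by (simp add: a_def)
  next
    case False
    have all: "a s = a 1" if s: "s \<noteq> 0" for s
    proof -
      obtain l where l: "l \<noteq> 0" "s = l ^ j" using root[OF s] by blast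
      show ?thesis using aT[OF l(1), of 1] l(2) by simp
    qed
    have as: "a s = a 1" by (rule all[OF False])
    have a2: "a 2 = a 1" by (rule all) simp
    have "a (1 + 1) = a 1 * a 1" by (rule ab(1))
    then have "a 1 * a 1 = a 1 * 1" using a2 by (simp only: one_add_one mult_1_right)
    then have "a 1 = 1" by (rule mult_left_cancel[OF a_nz, THEN iffD1])
    with as show ?thesis by (rule trans)
  qed
  have bn: "b (of_nat n * s) = of_nat n * b s" for n s
  proof (induction n)
    case 0 then show ?case using P0 by (simp add: b_def)
  next
    case (Suc n) then show ?case using ab(2)[of s "of_nat n * s"] by (simp add: a1 algebra_simps)
  qed
  have two: "2 ^ j = (of_nat (2 ^ j) :: complex)" by simp
  \<comment> \<open>Additivity gives \<open>b (2 ^ j) = 2 ^ j * b 1\<close>, and the weight gives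
    \<open>2 ^ (2 * m) * b (2 ^ j) = b 1\<close>; the combined factor exceeds 1.\<close>
  have b1: "b 1 = 0"
  proof -
    have "2 ^ (2 * m) * (2 ^ j * b 1) = b 1" using bT[of 2 1] bn[of "2 ^ j" 1] by simp
    then have "(2 ^ (2 * m + j) - 1) * b 1 = 0" by (simp add: power_add algebra_simps)
    moreover have "(2::complex) ^ (2 * m + j) \<noteq> 1"
    proof
      assume "(2::complex) ^ (2 * m + j) = 1"
      then have "norm ((2::complex) ^ (2 * m + j)) = 1" by simp
      then have "(2::real) ^ (2 * m + j) = 1" by (simp only: norm_power norm_numeral)
      then show False using one_less_power[of "2::real" "2 * m + j"] assms(2) by simp
    qed
    ultimately show ?thesis by simp
  qed
  have b0: "b s = 0" for s
  proof (cases "s = 0")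
    case True then show ?thesis using P0 by (simp add: b_def)
  next
    case False
    then obtain l where l: "l \<noteq> 0" "s = l ^ j" using root by blast
    then show ?thesis using bT[OF l(1), of 1] b1 by simp
  qed
  have F: "fun_F (h s q) = fun_F q" if "q \<in> Q" for s q using P[OF that] by (simp add: Pab a1 b0)
  have "\<exists>E. \<forall>q\<in>Q. fun_G (h s q) - fun_G q = poly E (fun_F q)" for s
  proof (rule upper_invariant_poly)
    show "(\<lambda>q. fun_G (h s q) - fun_G q) \<in> RQ" by (intro R_diff hR fun_G(1))
  qed (simp add: hU fun_G_upper hQ F)
  then have "\<exists>E. \<forall>s. \<forall>q\<in>Q. fun_G (h s q) - fun_G q = poly (E s) (fun_F q)" by (intro choice allI)
  then obtain E where E: "\<And>s q. q \<in> Q \<Longrightarrow> fun_G (h s q) - fun_G q = poly (E s) (fun_F q)" by blast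
  then have E': "\<And>s q. q \<in> Q \<Longrightarrow> fun_G (h s q) = fun_G q + poly (E s) (fun_F q)" by (simp add: algebra_simps)
  have Eadd: "E (s + s') = E s + E s'" for s s'
  proof (rule polyI)
    fix q assume q: "q \<in> Q"
    have "poly (E (s + s')) (fun_F q) = fun_G (h s (h s' q)) - fun_G q" using E[OF q, of "s + s'"] hadd[OF q] by simp
    also have "\<dots> = poly (E s + E s') (fun_F q)" using E'[OF hQ[OF q], of s] E'[OF q] F[OF q] by simp
    finally show "poly (E (s + s')) (fun_F q) = poly (E s + E s') (fun_F q)" .
  qed
  have E0: "E 0 = 0" using Eadd[of 0 0] by simp
  have En: "E (of_nat n * s) = smult (of_nat n) (E s)" for n s
    by (induction n) (simp_all add: E0 distrib_right Eadd smult_add_left)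
  have ET: "l ^ (2 * m - 2) * coeff (E (l ^ j * s)) k = l ^ (2 * m * k) * coeff (E s) k" if l: "l \<noteq> 0" for l s k
  proof -
    have "poly (smult (l ^ (2 * m - 2)) (E (l ^ j * s))) v = poly (pcompose (E s) [:0, l ^ (2 * m):]) v" for v
    proof -
      obtain q where q: "q \<in> Q" "fun_F q = l ^ (2 * m) * v" using fun_F_surj by blast
      have tq: "qact (diag2 l) q \<in> Q" "fun_F (qact (diag2 l) q) = v" using fun_F_diag[OF q(1) l] q(2) l act_upper_lower_closed(3)[OF q(1) l] by auto
      have "fun_G q + l ^ (2 * m - 2) * poly (E (l ^ j * s)) v
        = l ^ (2 * m - 2) * (fun_G (qact (diag2 l) q) + poly (E (l ^ j * s)) (fun_F (qact (diag2 l) q)))"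
        using fun_G_diag[OF q(1) l] tq(2) by (simp add: distrib_left)
      also have "\<dots> = l ^ (2 * m - 2) * fun_G (qact (diag2 l) (h s q))" by (simp only: E'[OF tq(1), symmetric] hT[OF q(1) l])
      also have "\<dots> = fun_G (h s q)" by (rule fun_G_diag[OF hQ[OF q(1)] l])
      also have "\<dots> = fun_G q + poly (E s) (l ^ (2 * m) * v)" using E'[OF q(1)] q(2) by simp
      finally show ?thesis by (simp add: poly_pcompose mult.commute)
    qed
    then have "smult (l ^ (2 * m - 2)) (E (l ^ j * s)) = pcompose (E s) [:0, l ^ (2 * m):]"
      by (simp add: poly_eq_poly_eq_iff[symmetric] fun_eq_iff)
    then have "coeff (smult (l ^ (2 * m - 2)) (E (l ^ j * s))) k = coeff (pcompose (E s) [:0, l ^ (2 * m):]) k" by simp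
    then show ?thesis by (simp add: coeff_pcompose_linear power_mult)
  qed
  \<comment> \<open>The torus scales \<open>fun_G\<close> with exponent \<open>2 m - 2\<close> and
    \<open>fun_F ^ k\<close> with exponent \<open>2 m k\<close>, so a family of weight
    \<open>j\<close> allows only the \<open>k\<close> with \<open>2 m k = j + 2 m - 2\<close>. If
    the division is not exact, all coefficients are zero.\<close>
  define k0 where "k0 = (j + 2 * m - 2) div (2 * m)"
  have k: "j + 2 * m - 2 = 2 * m * k" if nz: "coeff (E 1) k \<noteq> 0" for k
  proof -
    have "E (2 ^ j) = smult (2 ^ j) (E 1)" using En[of "2 ^ j" 1] by simp
    then have "2 ^ (2 * m - 2) * (2 ^ j * coeff (E 1) k) = 2 ^ (2 * m * k) * coeff (E 1) k" using ET[of 2 1 k] by simp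
    then have "(2::complex) ^ (2 * m - 2 + j) = 2 ^ (2 * m * k)" using nz by (simp add: power_add)
    then have "norm ((2::complex) ^ (2 * m - 2 + j)) = norm ((2::complex) ^ (2 * m * k))" by simp
    then have "(2::real) ^ (2 * m - 2 + j) = 2 ^ (2 * m * k)" by (simp only: norm_power norm_numeral)
    then have "2 * m - 2 + j = 2 * m * k" by (rule power_inject_exp[THEN iffD1, rotated]) simp
    then show ?thesis using m_pos by linarith
  qed
  have k0: "k = k0" if nz: "coeff (E 1) k \<noteq> 0" for k
    using k[OF nz] m_pos by (simp add: k0_def)
  have lin: "coeff (E s) i = s * coeff (E 1) i" for s i
  proof (cases "s = 0")
    case True then show ?thesis by (simp add: E0)
  next
    case False
    then obtain l where l: "l \<noteq> 0" "s = l ^ j" using root by blast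
    have *: "l ^ (2 * m - 2) * coeff (E s) i = l ^ (2 * m * i) * coeff (E 1) i" using ET[OF l(1), of 1 i] l(2) by simp
    show ?thesis
    proof (cases "coeff (E 1) i = 0")
      case True then show ?thesis using * l(1) by simp
    next
      case nz: False
      have "2 * m * i = 2 * m - 2 + j" using k[OF nz] m_pos by linarith
      then have "l ^ (2 * m - 2) * coeff (E s) i = l ^ (2 * m - 2) * (s * coeff (E 1) i)"
        using * l(2) by (simp add: power_add mult.assoc)
      then show ?thesis using l(1) by simp
    qed
  qed
  have Em: "E s = monom (s * coeff (E 1) k0) k0" for s
  proof (rule poly_eqI)
    fix i
    show "coeff (E s) i = coeff (monom (s * coeff (E 1) k0) k0) i"
    proof (cases "i = k0")
      case True
      then show ?thesis using lin[of s i] by simp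
    next
      case False
      then have "coeff (E 1) i = 0" using k0 by blast
      then show ?thesis using lin[of s i] False by simp
    qed
  qed
  have "fun_G (h s q) = fun_G q + s * coeff (E 1) k0 * fun_F q ^ k0" if qQ: "q \<in> Q" for s q
    by (simp only: E'[OF qQ, of s] Em[of s] poly_monom)
  then show ?thesis unfolding k0_def[symmetric]
    by (intro exI[of _ "coeff (E 1) k0"] allI ballI conjI F)
qed

text \<open>Each family is governed by one scalar, \<open>e\<close> or \<open>e'\<close>. With
  \<open>c * e = c' * e'\<close> the two automorphisms have the same \<open>fun_F\<close> and
  \<open>fun_G\<close>, so they agree where \<open>fun_F\<close> is nonzero and by density
  everywhere.\<close>

lemma unipotent_families_dependent:
  assumes "unipotent_family j h" "unipotent_family j h'" "j > 0"
  obtains c c' where "c \<noteq> 0 \<or> c' \<noteq> 0" "\<And>q. q \<in> Q \<Longrightarrow> h c q = h' c' q"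
proof -
  let ?k = "(j + 2 * m - 2) div (2 * m)"
  obtain e where e: "\<forall>s. \<forall>q\<in>Q. fun_F (h s q) = fun_F q \<and> fun_G (h s q) = fun_G q + s * e * fun_F q ^ ?k"
    using unipotent_family_shape[OF assms(1,3)] by blast
  obtain e' where e': "\<forall>s. \<forall>q\<in>Q. fun_F (h' s q) = fun_F q \<and> fun_G (h' s q) = fun_G q + s * e' * fun_F q ^ ?k"
    using unipotent_family_shape[OF assms(2,3)] by blast
  have "\<exists>c c'. (c \<noteq> 0 \<or> c' \<noteq> 0) \<and> c * e = c' * e'"
  proof (cases "e = 0")
    case True then show ?thesis by (intro exI[of _ 1] exI[of _ 0]) simp
  next
    case False then show ?thesis by (intro exI[of _ e'] exI[of _ e]) simp
  qed
  then obtain c c' where c: "c \<noteq> 0 \<or> c' \<noteq> 0" "c * e = c' * e'" by blast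
  have hQ: "h c q \<in> Q" "h' c' q \<in> Q" if "q \<in> Q" for q
    using assms(1,2) that unfolding unipotent_family_def by simp_all
  have hR: "(\<lambda>q. f (h c q)) \<in> RQ" "(\<lambda>q. f (h' c' q)) \<in> RQ" if "f \<in> RQ" for f
    using assms(1,2) that unfolding unipotent_family_def by simp_all
  have off: "h c q = h' c' q" if q: "q \<in> Q" "fun_F q \<noteq> 0" for q
    by (rule fun_F_fun_G_determine) (use hQ[OF q(1)] e e' q c(2) in auto)
  have "h c q = h' c' q" if q: "q \<in> Q" for q
  proof (rule separated[OF hQ[OF q]])
    fix f assume f: "f \<in> RQ"
    have "f (h c q) - f (h' c' q) = 0"
      by (rule RQ_zero_off_F[OF R_diff[OF hR[OF f]] _ q]) (simp add: off)
    then show "f (h c q) = f (h' c' q)" by simp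
  qed
  then show ?thesis using that c(1) by blast
qed

text \<open>An antidiagonal conjugate would have both diagonal entries zero, but their sum is 5/2
  times the determinant. So the conjugate is diagonal, which gives \<open>b * d = 0\<close> and
  \<open>a * c = 0\<close>.\<close>

lemma normalizes_torus_element:
  assumes "det x = 1" "adj2 x ** diag2 2 ** x \<in> H" shows "x$1$2 = 0 \<and> x$2$1 = 0 \<or> x$1$1 = 0 \<and> x$2$2 = 0"
proof -
  obtain a b c d where x: "x = mat2 a b c d" by (rule mat2_cases)
  have det: "a * d - b * c = 1" using assms(1) by (simp add: x)
  let ?M = "adj2 x ** diag2 2 ** x"
  have M: "?M = mat2 (2 * a * d - b * c / 2) (3/2 * (b * d)) (- 3/2 * (a * c)) (a * d / 2 - 2 * b * c)"
    by (simp add: x field_simps)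
  have "?M \<in> normalizer SL2 torus" using assms(2) H torus_subset_normalizer by auto
  then consider "b * d = 0" "a * c = 0" | "2 * a * d - b * c / 2 = 0" "a * d / 2 - 2 * b * c = 0"
    unfolding normalizer_torus_iff M by auto
  then show ?thesis
  proof cases
    case 1
    then show ?thesis using det by (auto simp: x)
  next
    case 2
    have "5 * (a * d - b * c) = 2 * ((2 * a * d - b * c / 2) + (a * d / 2 - 2 * b * c))" by (simp add: field_simps)
    then have "5 * (a * d - b * c) = 0" unfolding 2 by simp
    then show ?thesis using det by simp
  qed
qed

text \<open>An equivariant map is right translation by an \<open>x\<close> representing the image of
  the base point, and that image is fixed by \<open>diag2 2\<close> because the base point is. So
  \<open>x\<close> is diagonal or antidiagonal: its square lies in the torus, and \<open>x\<close>
  itself lies in the normalizer.\<close>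

lemma centralizer:
  assumes \<phi>: "\<And>q. q \<in> Q \<Longrightarrow> \<phi> q \<in> Q" "\<And>g q. det g = 1 \<Longrightarrow> q \<in> Q \<Longrightarrow> \<phi> (qact g q) = qact g (\<phi> q)" and q: "q \<in> Q"
  shows "\<phi> (\<phi> q) = q" and "m = 2 \<Longrightarrow> \<phi> q = q"
proof -
  have "\<phi> (coset (mat 1)) \<in> Q" by (rule \<phi>(1)) simp
  then obtain x where x: "det x = 1" "\<phi> (coset (mat 1)) = coset x" unfolding Q_iff by blast
  have orb: "\<phi> (coset g) = coset (g ** x)" if "det g = 1" for g
    using \<phi>(2)[OF that, of "coset (mat 1)"] x by simp
  have two: "det (diag2 2) = 1" by simp
  have "coset (diag2 2 ** mat 1) = coset (mat 1)"
    using coset_absorb[of "mat 1" "diag2 2"] diag_in_H[of 2] by simp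
  then have "coset x = coset (diag2 2 ** x)" using orb[OF two] x(2) by simp
  then have "adj2 x ** (diag2 2 ** x) \<in> H" by (intro coset_eqD) (use x(1) in \<open>simp_all add: det_mul\<close>)
  then have mono: "x$1$2 = 0 \<and> x$2$1 = 0 \<or> x$1$1 = 0 \<and> x$2$2 = 0"
    using normalizes_torus_element[OF x(1)] by (simp add: matrix_mul_assoc)
  obtain a b c d where abcd: "x = mat2 a b c d" by (rule mat2_cases)
  have "x ** x \<in> torus"
    unfolding torus_iff
  proof (intro conjI)
    show "det (x ** x) = 1" using x(1) by (simp add: det_mul)
  qed (use mono in \<open>auto simp: abcd\<close>)
  then have xx: "x ** x \<in> H" using H torus_subset_normalizer by auto
  obtain g where g: "det g = 1" "q = coset g" using q by (auto simp: Q_iff)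
  have "\<phi> (\<phi> q) = coset (g ** (x ** x))" using orb[OF g(1)] orb[of "g ** x"] g x(1) by (simp add: det_mul matrix_mul_assoc)
  then show "\<phi> (\<phi> q) = q" using coset_absorb[OF g(1) xx] g(2) by simp
  show "\<phi> q = q" if "m = 2"
  proof -
    have "x \<in> H" using H that mono x(1) by (auto simp: normalizer_torus_iff)
    then show ?thesis using orb[OF g(1)] coset_absorb[OF g(1)] g(2) by simp
  qed
qed

text \<open>Right translation by \<open>weyl\<close> is well defined on cosets because
  \<open>weyl\<close> normalizes the torus, and its square is translation by -1, an element of the
  torus.\<close>

lemma involution:
  assumes "m = 1"
  obtains \<tau> where "\<And>q. q \<in> Q \<Longrightarrow> \<tau> q \<in> Q" "\<And>q. q \<in> Q \<Longrightarrow> \<tau> (\<tau> q) = q" "\<And>f. f \<in> RQ \<Longrightarrow> (\<lambda>q. f (\<tau> q)) \<in> RQ"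
    "\<And>g q. det g = 1 \<Longrightarrow> q \<in> Q \<Longrightarrow> \<tau> (qact g q) = qact g (\<tau> q)" "\<exists>q\<in>Q. \<tau> q \<noteq> q"
proof -
  have HT: "H = torus" using H assms by auto
  define \<tau> where "\<tau> C = (\<lambda>c. c ** weyl) ` C" for C :: "(complex^2^2) set"
  have \<tau>: "\<tau> (coset g) = coset (g ** weyl)" for g
  proof -
    have w: "(\<lambda>h. h ** weyl) ` H = (\<lambda>h. weyl ** h) ` H"
      unfolding HT
    proof (intro equalityI subsetI)
      fix A assume "A \<in> (\<lambda>h. h ** weyl) ` torus"
      then obtain l where "l \<noteq> 0" "A = diag2 l ** weyl" by (auto simp: torus_eq)
      then have "A = weyl ** diag2 (inverse l)" by simp
      then show "A \<in> (\<lambda>h. weyl ** h) ` torus" using \<open>l \<noteq> 0\<close> by (auto simp: torus_iff intro!: image_eqI[of _ _ "diag2 (inverse l)"])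
    next
      fix A assume "A \<in> (\<lambda>h. weyl ** h) ` torus"
      then obtain l where "l \<noteq> 0" "A = weyl ** diag2 l" by (auto simp: torus_eq)
      then have "A = diag2 (inverse l) ** weyl" by simp
      then show "A \<in> (\<lambda>h. h ** weyl) ` torus" using \<open>l \<noteq> 0\<close> by (auto simp: torus_iff intro!: image_eqI[of _ _ "diag2 (inverse l)"])
    qed
    have c: "coset g = (\<lambda>h. g ** h) ` H" for g by (auto simp: coset_def l_coset_def)
    have "\<tau> (coset g) = (\<lambda>h. g ** h) ` (\<lambda>h. h ** weyl) ` H"
      by (simp add: \<tau>_def c image_image matrix_mul_assoc)
    also have "\<dots> = coset (g ** weyl)" unfolding w by (simp add: c image_image matrix_mul_assoc)
    finally show ?thesis .
  qed
  have ww: "coset (g ** weyl ** weyl) = coset g" if "det g = 1" for g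
    using coset_absorb[OF that, of "weyl ** weyl"] diag_in_H[of "-1"] by (simp only: matrix_mul_assoc) simp
  show ?thesis
  proof (rule that[of \<tau>])
    show "\<tau> q \<in> Q" if q: "q \<in> Q" for q
    proof -
      obtain g where "det g = 1" "q = coset g" using q by (auto simp: Q_iff)
      then show ?thesis by (simp add: \<tau> det_mul)
    qed
    show "\<tau> (\<tau> q) = q" if "q \<in> Q" for q using that by (auto simp: Q_iff \<tau> ww)
    show "(\<lambda>q. f (\<tau> q)) \<in> RQ" if f: "f \<in> RQ" for f
    proof -
      obtain F where F: "F \<in> mpoly" "\<And>g. det g = 1 \<Longrightarrow> f (coset g) = F g" using f by (auto simp: RQ_def)
      show ?thesis unfolding RQ_def using F(2)
        by (auto intro!: bexI[OF _ mpoly_mult_right[OF F(1), of weyl]] simp: \<tau> det_mul)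
    qed
    show "\<tau> (qact g q) = qact g (\<tau> q)" if "det g = 1" "q \<in> Q" for g q
      using that by (auto simp: Q_iff \<tau> matrix_mul_assoc)
    have "\<tau> (coset (mat 1)) \<noteq> coset (mat 1)"
    proof
      assume "\<tau> (coset (mat 1)) = coset (mat 1)"
      then have "coset (mat 1) = coset weyl" by (simp add: \<tau>)
      from coset_eqD[OF _ _ this] have "adj2 (mat 1) ** weyl \<in> H" by simp
      then show False by (simp add: HT torus_iff mat_1_eq_mat2)
    qed
    then show "\<exists>q\<in>Q. \<tau> q \<noteq> q" by (intro bexI[of _ "coset (mat 1)"]) auto
  qed
qed

lemma torus_acts_nontrivially: "\<exists>q\<in>Q. qact (diag2 2) q \<noteq> q"
proof (intro bexI notI)
  show q: "coset (lower 1) \<in> Q" by simp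
  assume "qact (diag2 2) (coset (lower 1)) = coset (lower 1)"
  then have "2 ^ (2 * m) * fun_F (coset (lower 1)) = fun_F (coset (lower 1))"
    using fun_F_diag[OF q, of 2] by (simp del: qact_coset)
  then have "(2::complex) ^ (2 * m) = 1" by (simp add: fun_F(2) fun_y_def)
  then have "norm ((2::complex) ^ (2 * m)) = 1" by simp
  then have "(2::real) ^ (2 * m) = 1" by (simp only: norm_power norm_numeral)
  then show False using one_less_power[of "2::real" "2 * m"] m_pos by simp
qed

lemma upper_acts_nontrivially: "\<exists>q\<in>Q. qact (upper 1) q \<noteq> q"
proof (intro bexI notI)
  show q: "coset (lower 1) \<in> Q" by simp
  assume "qact (upper 1) (coset (lower 1)) = coset (lower 1)"
  then have "fun_F (coset (lower 1)) = 0" using fun_G_upper[OF q, of 1] by (simp del: qact_coset)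
  then show False by (simp add: fun_F(2) fun_y_def)
qed

end

section \<open>Affine varieties and their automorphisms\<close>

lemma variety_isoI:
  assumes "\<And>x. x \<in> points X \<Longrightarrow> \<sigma> x \<in> points Y \<and> \<rho> (\<sigma> x) = x"
    and "\<And>y. y \<in> points Y \<Longrightarrow> \<rho> y \<in> points X \<and> \<sigma> (\<rho> y) = y"
    and "\<And>f. f \<in> regular Y \<Longrightarrow> restrict (\<lambda>x. f (\<sigma> x)) (points X) \<in> regular X"
    and "\<And>f. f \<in> regular X \<Longrightarrow> restrict (\<lambda>y. f (\<rho> y)) (points Y) \<in> regular Y"
  shows "variety_iso \<sigma> X Y"
proof -
  have b: "bij_betw \<sigma> (points X) (points Y)"
    by (rule bij_betw_byWitness[where f' = \<rho>]) (use assms in auto)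
  have inv: "inv_into (points X) \<sigma> y = \<rho> y" if "y \<in> points Y" for y
    by (rule inv_into_f_eq) (use b assms that in \<open>auto simp: bij_betw_def\<close>)
  have "compose (points Y) f (inv_into (points X) \<sigma>) = restrict (\<lambda>y. f (\<rho> y)) (points Y)" for f :: "'a \<Rightarrow> complex"
    unfolding compose_def by (rule restrict_ext) (simp add: inv)
  then show ?thesis
    unfolding variety_iso_def variety_morphism_def using b assms inv by (auto simp: compose_def)
qed

lemma automorphismI:
  assumes "\<And>x. x \<in> points X \<Longrightarrow> \<sigma> x \<in> points X \<and> \<rho> (\<sigma> x) = x"
    and "\<And>y. y \<in> points X \<Longrightarrow> \<rho> y \<in> points X \<and> \<sigma> (\<rho> y) = y"
    and "\<And>f. f \<in> regular X \<Longrightarrow> restrict (\<lambda>x. f (\<sigma> x)) (points X) \<in> regular X"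
    and "\<And>f. f \<in> regular X \<Longrightarrow> restrict (\<lambda>y. f (\<rho> y)) (points X) \<in> regular X"
  shows "restrict \<sigma> (points X) \<in> automorphisms X"
proof -
  have eq: "restrict (\<lambda>x. f (restrict \<sigma> (points X) x)) (points X) = restrict (\<lambda>x. f (\<sigma> x)) (points X)" for f :: "'a \<Rightarrow> complex"
    by (rule restrict_ext) simp
  have i: "variety_iso (restrict \<sigma> (points X)) X X"
  proof (rule variety_isoI[where \<rho> = \<rho>])
    fix f assume "f \<in> regular X"
    then show "restrict (\<lambda>x. f (restrict \<sigma> (points X) x)) (points X) \<in> regular X"
      "restrict (\<lambda>x. f (\<rho> x)) (points X) \<in> regular X" unfolding eq by (rule assms(3,4))+
  qed (use assms in auto)
  then show ?thesis by (auto simp: automorphisms_def Bij_def variety_iso_def)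
qed

lemma automorphismD:
  assumes "\<phi> \<in> automorphisms X"
  shows "x \<in> points X \<Longrightarrow> \<phi> x \<in> points X" "x \<in> points X \<Longrightarrow> inv_into (points X) \<phi> x \<in> points X"
    "x \<in> points X \<Longrightarrow> \<phi> (inv_into (points X) \<phi> x) = x" "x \<in> points X \<Longrightarrow> inv_into (points X) \<phi> (\<phi> x) = x"
    "f \<in> regular X \<Longrightarrow> restrict (\<lambda>x. f (\<phi> x)) (points X) \<in> regular X"
    "f \<in> regular X \<Longrightarrow> restrict (\<lambda>x. f (inv_into (points X) \<phi> x)) (points X) \<in> regular X"
    "\<phi> \<in> extensional (points X)" "inj_on \<phi> (points X)"
  using assms
  by (auto simp: automorphisms_def Bij_def variety_iso_def variety_morphism_def compose_def bij_betw_def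
      f_inv_into_f inv_into_into)

lemma carrier_aut [simp]: "carrier (aut_ind_group X S) = automorphisms X"
  by (simp add: aut_ind_group_def)

lemma level_aut [simp]: "level (aut_ind_group X S) = aut_level X S"
  by (simp add: aut_ind_group_def)

lemma mult_aut:
  assumes "\<phi> \<in> automorphisms X" "\<psi> \<in> automorphisms X"
  shows "\<phi> \<otimes>\<^bsub>aut_ind_group X S\<^esub> \<psi> = compose (points X) \<phi> \<psi>"
  using assms by (simp add: aut_ind_group_def BijGroup_def automorphisms_def)

lemma compose_automorphisms:
  assumes "\<phi> \<in> automorphisms X" "\<psi> \<in> automorphisms X"
  shows "compose (points X) \<phi> \<psi> \<in> automorphisms X"
proof -
  note D = automorphismD[OF assms(1)] automorphismD[OF assms(2)]
  have "restrict (\<lambda>x. f (\<phi> (\<psi> x))) (points X) \<in> regular X" if "f \<in> regular X" for f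
  proof -
    have "restrict (\<lambda>x. restrict (\<lambda>x. f (\<phi> x)) (points X) (\<psi> x)) (points X) \<in> regular X"
      by (intro D that)
    also have "restrict (\<lambda>x. restrict (\<lambda>x. f (\<phi> x)) (points X) (\<psi> x)) (points X) = restrict (\<lambda>x. f (\<phi> (\<psi> x))) (points X)"
      by (rule restrict_ext) (simp add: D)
    finally show ?thesis .
  qed
  moreover have "restrict (\<lambda>x. f (inv_into (points X) \<psi> (inv_into (points X) \<phi> x))) (points X) \<in> regular X" if "f \<in> regular X" for f
  proof -
    have "restrict (\<lambda>x. restrict (\<lambda>x. f (inv_into (points X) \<psi> x)) (points X) (inv_into (points X) \<phi> x)) (points X) \<in> regular X"
      by (intro D that)
    also have "restrict (\<lambda>x. restrict (\<lambda>x. f (inv_into (points X) \<psi> x)) (points X) (inv_into (points X) \<phi> x)) (points X) =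
        restrict (\<lambda>x. f (inv_into (points X) \<psi> (inv_into (points X) \<phi> x))) (points X)"
      by (rule restrict_ext) (simp add: D)
    finally show ?thesis .
  qed
  ultimately show ?thesis unfolding compose_def
    by (intro automorphismI[where \<rho> = "\<lambda>x. inv_into (points X) \<psi> (inv_into (points X) \<phi> x)"]) (simp_all add: D)
qed

section \<open>Functions of bounded degree and interpolation\<close>

inductive_set lin_span :: "('a \<Rightarrow> complex) set \<Rightarrow> ('a \<Rightarrow> complex) set" for G where
  zero: "(\<lambda>x. 0) \<in> lin_span G"
| step: "g \<in> G \<Longrightarrow> f \<in> lin_span G \<Longrightarrow> (\<lambda>x. c * g x + f x) \<in> lin_span G"

lemma lin_span_add: assumes "f \<in> lin_span G" "g \<in> lin_span G" shows "(\<lambda>x. f x + g x) \<in> lin_span G"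
  using assms(1)
proof induction
  case zero then show ?case using assms(2) by simp
next
  case (step h f c)
  show ?case using lin_span.step[OF step.hyps(1) step.IH, of c] by (simp add: add.assoc)
qed

lemma lin_span_base: "g \<in> G \<Longrightarrow> (\<lambda>x. c * g x) \<in> lin_span G"
  using lin_span.step[OF _ lin_span.zero, of g G c] by simp

lemma lin_span_insert: "f \<in> lin_span (insert g G) \<Longrightarrow> \<exists>c. \<exists>f0\<in>lin_span G. \<forall>x. f x = c * g x + f0 x"
proof (induction rule: lin_span.induct)
  case zero
  show ?case by (intro exI[of _ 0] bexI[OF _ lin_span.zero]) simp
next
  case (step h f c)
  then obtain d f0 where d: "f0 \<in> lin_span G" "\<forall>x. f x = d * g x + f0 x" by blast
  show ?case
  proof (cases "h = g")
    case True
    then show ?thesis using d by (intro exI[of _ "c + d"] bexI[OF _ d(1)]) (simp add: distrib_right add.assoc)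
  next
    case False
    then have "h \<in> G" using step by blast
    then show ?thesis using d by (intro exI[of _ d] bexI[OF _ lin_span.step[OF _ d(1), of h c]]) simp_all
  qed
qed

definition monomials :: "('a \<Rightarrow> complex) set \<Rightarrow> nat \<Rightarrow> ('a \<Rightarrow> complex) set"
  where "monomials S k = (\<lambda>fs x. \<Prod>f\<leftarrow>fs. f x) ` {fs. set fs \<subseteq> S \<and> length fs \<le> k}"

lemma finite_monomials: "finite S \<Longrightarrow> finite (monomials S k)"
  unfolding monomials_def by (intro finite_imageI finite_lists_length_le)

lemma monomials_mult: assumes "f \<in> monomials S j" "g \<in> monomials S k" shows "(\<lambda>x. f x * g x) \<in> monomials S (j + k)"
proof -
  obtain fs gs where "f = (\<lambda>x. \<Prod>f\<leftarrow>fs. f x)" "set fs \<subseteq> S" "length fs \<le> j"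
    "g = (\<lambda>x. \<Prod>f\<leftarrow>gs. f x)" "set gs \<subseteq> S" "length gs \<le> k" using assms unfolding monomials_def by blast
  then show ?thesis unfolding monomials_def by (intro image_eqI[of _ _ "fs @ gs"]) auto
qed

lemma lin_span_mult:
  assumes "f \<in> lin_span (monomials S j)" "g \<in> lin_span (monomials S k)"
  shows "(\<lambda>x. f x * g x) \<in> lin_span (monomials S (j + k))"
  using assms(1)
proof induction
  case zero then show ?case using lin_span.zero by simp
next
  case (step h f c)
  from assms(2) have "(\<lambda>x. c * h x * g x) \<in> lin_span (monomials S (j + k))"
  proof induction
    case zero then show ?case using lin_span.zero by simp
  next
    case (step h' g c')
    have "(\<lambda>x. c * c' * (h x * h' x) + c * h x * g x) \<in> lin_span (monomials S (j + k))"
      by (intro lin_span.step monomials_mult step \<open>h \<in> monomials S j\<close>)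
    then show ?case by (simp add: distrib_left mult_ac)
  qed
  then show ?case using lin_span_add[OF _ step.IH] by (simp add: distrib_right)
qed

lemma polys_le_span:
  assumes "poly_le A S k f" shows "\<exists>f'\<in>lin_span (monomials S k). \<forall>x\<in>A. f x = f' x"
  using assms
proof induction
  case (const k c)
  have "(\<lambda>x. 1) \<in> monomials S k" unfolding monomials_def by (intro image_eqI[of _ _ "[]"]) auto
  from lin_span_base[OF this, of c] show ?case by (intro bexI) auto
next
  case (gen f k)
  then have "f \<in> monomials S (Suc k)" unfolding monomials_def by (intro image_eqI[of _ _ "[f]"]) auto
  from lin_span_base[OF this, of 1] show ?case by (intro bexI) auto
next
  case (add k f g)
  then obtain f' g' where "f' \<in> lin_span (monomials S k)" "\<forall>x\<in>A. f x = f' x"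
    "g' \<in> lin_span (monomials S k)" "\<forall>x\<in>A. g x = g' x" by blast
  then show ?case by (intro bexI[OF _ lin_span_add[of f' _ g']]) auto
next
  case (mult j f k g)
  then obtain f' g' where "f' \<in> lin_span (monomials S j)" "\<forall>x\<in>A. f x = f' x"
    "g' \<in> lin_span (monomials S k)" "\<forall>x\<in>A. g x = g' x" by blast
  then show ?case by (intro bexI[OF _ lin_span_mult[of f' _ _ g']]) auto
qed

locale generated_variety =
  fixes X :: "'a variety" and S :: "('a \<Rightarrow> complex) set"
  assumes gen: "generating_set X S"
begin

definition reg :: "('a \<Rightarrow> complex) set" where "reg = {f. restrict f (points X) \<in> regular X}"

lemma regular_eq: "regular X = generated_algebra (points X) S" and finite_S: "finite S" and S_regular: "S \<subseteq> regular X"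
  using gen by (auto simp: generating_set_def)

lemma regular_extensional: assumes "f \<in> regular X" shows "restrict f (points X) = f"
proof -
  have "f \<in> extensional (points X)"
    using assms poly_le_extensional unfolding regular_eq generated_algebra_def polys_le_def by blast
  then show ?thesis by (simp add: extensional_restrict)
qed

lemma regular_reg: "f \<in> regular X \<Longrightarrow> f \<in> reg"
  by (simp add: reg_def regular_extensional)

lemma reg_const: "(\<lambda>x. c) \<in> reg" and reg_add: "f \<in> reg \<Longrightarrow> f' \<in> reg \<Longrightarrow> (\<lambda>x. f x + f' x) \<in> reg"
  and reg_mult: "f \<in> reg \<Longrightarrow> f' \<in> reg \<Longrightarrow> (\<lambda>x. f x * f' x) \<in> reg"
  by (simp_all add: reg_def regular_eq generated_algebra_const generated_algebra_add generated_algebra_mult)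

lemma reg_cong: assumes "f \<in> reg" "\<And>x. x \<in> points X \<Longrightarrow> f' x = f x" shows "f' \<in> reg"
proof -
  have "restrict f' (points X) = restrict f (points X)" by (rule restrict_ext) (rule assms(2))
  then show ?thesis using assms(1) by (simp add: reg_def)
qed

lemma reg_diff: assumes "f \<in> reg" "f' \<in> reg" shows "(\<lambda>x. f x - f' x) \<in> reg"
  using reg_add[OF assms(1) reg_mult[OF reg_const[of "-1"] assms(2)]] by simp

lemma reg_sum: "(\<And>i. i \<in> I \<Longrightarrow> f i \<in> reg) \<Longrightarrow> (\<lambda>x. \<Sum>i\<in>I. f i x) \<in> reg"
  by (induction I rule: infinite_finite_induct) (auto intro: reg_const reg_add)

lemma reg_compose:
  assumes "f \<in> reg" "\<And>x. x \<in> points X \<Longrightarrow> \<sigma> x \<in> points X"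
    "\<And>f. f \<in> regular X \<Longrightarrow> restrict (\<lambda>x. f (\<sigma> x)) (points X) \<in> regular X"
  shows "(\<lambda>x. f (\<sigma> x)) \<in> reg"
proof -
  have "restrict (\<lambda>x. restrict f (points X) (\<sigma> x)) (points X) = restrict (\<lambda>x. f (\<sigma> x)) (points X)"
    by (rule restrict_ext) (simp add: assms(2))
  then show ?thesis using assms(3)[of "restrict f (points X)"] assms(1) by (simp add: reg_def)
qed

lemma reg_automorphism: assumes "\<phi> \<in> automorphisms X" "f \<in> reg"
  shows "(\<lambda>x. f (\<phi> x)) \<in> reg" "(\<lambda>x. f (inv_into (points X) \<phi> x)) \<in> reg"
  by (rule reg_compose[OF assms(2)]; rule automorphismD[OF assms(1)]; assumption)+

lemma automorphism_regI:
  assumes "\<And>x. x \<in> points X \<Longrightarrow> \<sigma> x \<in> points X \<and> \<rho> (\<sigma> x) = x"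
    and "\<And>x. x \<in> points X \<Longrightarrow> \<rho> x \<in> points X \<and> \<sigma> (\<rho> x) = x"
    and "\<And>f. f \<in> reg \<Longrightarrow> (\<lambda>x. f (\<sigma> x)) \<in> reg" "\<And>f. f \<in> reg \<Longrightarrow> (\<lambda>x. f (\<rho> x)) \<in> reg"
  shows "restrict \<sigma> (points X) \<in> automorphisms X"
proof (rule automorphismI[where \<rho> = \<rho>])
  fix f assume "f \<in> regular X"
  then show "restrict (\<lambda>x. f (\<sigma> x)) (points X) \<in> regular X" "restrict (\<lambda>x. f (\<rho> x)) (points X) \<in> regular X"
    using assms(3,4) regular_reg by (auto simp: reg_def)
qed (use assms in auto)

lemma monomials_reg: "monomials S k \<subseteq> reg"
proof -
  have "(\<lambda>x. \<Prod>f\<leftarrow>fs. f x) \<in> reg" if "set fs \<subseteq> S" for fs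
    using that
  proof (induction fs)
    case (Cons f fs)
    then have "f \<in> reg" "(\<lambda>x. \<Prod>f\<leftarrow>fs. f x) \<in> reg" using S_regular regular_reg by auto
    then show ?case using reg_mult by simp
  qed (simp add: reg_const)
  then show ?thesis by (auto simp: monomials_def)
qed

text \<open>A linear projection onto the span of \<open>G\<close> of the form \<open>f \<mapsto> \<Sum>i<N. f (x i) * e i\<close> is built
  by adding one generator at a time, together with a point where its residual does not vanish.\<close>

lemma interpolation:
  assumes "finite G" "G \<subseteq> reg"
  shows "\<exists>N x e. (\<forall>i<N. x i \<in> points X \<and> e i \<in> reg) \<and>
    (\<forall>f\<in>lin_span G. \<forall>y\<in>points X. f y = (\<Sum>i<N::nat. f (x i) * e i y))"
  using assms
proof (induction G rule: finite_induct)
  case empty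
  have "f = (\<lambda>x. 0)" if "f \<in> lin_span {}" for f :: "'a \<Rightarrow> complex" using that by induction auto
  then show ?case by (intro exI[of _ 0]) auto
next
  case (insert g G)
  then obtain N x e where xe: "\<And>i. i < N \<Longrightarrow> x i \<in> points X" "\<And>i. i < N \<Longrightarrow> e i \<in> reg"
    and *: "\<And>f y. f \<in> lin_span G \<Longrightarrow> y \<in> points X \<Longrightarrow> f y = (\<Sum>i<N::nat. f (x i) * e i y)" by blast
  define r where "r y = g y - (\<Sum>i<N. g (x i) * e i y)" for y
  have r: "r \<in> reg" unfolding r_def using insert.prems xe
    by (intro reg_diff reg_sum reg_mult reg_const) auto
  show ?case
  proof (cases "\<forall>y\<in>points X. r y = 0")
    case True
    have "f y = (\<Sum>i<N. f (x i) * e i y)" if fG: "f \<in> lin_span (insert g G)" and y: "y \<in> points X" for f y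
    proof -
      obtain c f0 where f0: "f0 \<in> lin_span G" "\<And>x. f x = c * g x + f0 x" using lin_span_insert[OF fG] by blast
      have "g y = (\<Sum>i<N. g (x i) * e i y)" using True y by (simp add: r_def)
      then show ?thesis using *[OF f0(1) y] by (simp add: f0(2) distrib_right sum.distrib mult.assoc sum_distrib_left[symmetric])
    qed
    then show ?thesis using xe by blast
  next
    case False
    then obtain z where z: "z \<in> points X" "r z \<noteq> 0" by blast
    define x' where "x' i = (if i = N then z else x i)" for i
    \<comment> \<open>If \<open>L\<close> is the old projection, the new one sends \<open>f\<close>
      to \<open>L f\<close> plus the value of \<open>f - L f\<close> at \<open>z\<close> times the
      residual normalized to 1 at \<open>z\<close>.\<close>
    define e' where "e' i y = (if i = N then 1 / r z * r y else e i y - e i z / r z * r y)" for i y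
    have reg: "x' i \<in> points X \<and> e' i \<in> reg" if "i < Suc N" for i
    proof (cases "i = N")
      case True
      then have "e' i = (\<lambda>y. 1 / r z * r y)" by (simp add: e'_def fun_eq_iff)
      then have "e' i \<in> reg" by (simp only: reg_mult[OF reg_const r])
      then show ?thesis using True z by (simp add: x'_def)
    next
      case False
      then have "e' i = (\<lambda>y. e i y - e i z / r z * r y)" by (simp add: e'_def fun_eq_iff)
      moreover have iN: "i < N" using False that by simp
      ultimately have "e' i \<in> reg" by (simp only: reg_diff[OF xe(2)[OF iN] reg_mult[OF reg_const r]])
      then show ?thesis using False xe(1)[OF iN] by (simp add: x'_def)
    qed
    have "f y = (\<Sum>i<Suc N. f (x' i) * e' i y)" if fG: "f \<in> lin_span (insert g G)" and y: "y \<in> points X" for f y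
    proof -
      obtain c f0 where f0: "f0 \<in> lin_span G" "\<And>x. f x = c * g x + f0 x" using lin_span_insert[OF fG] by blast
      have L: "(\<Sum>i<N. f (x i) * e i y) = f y - c * r y" if "y \<in> points X" for y
        using *[OF f0(1) that] by (simp add: f0(2) distrib_right sum.distrib mult.assoc sum_distrib_left[symmetric] r_def right_diff_distrib)
      have "(\<Sum>i<Suc N. f (x' i) * e' i y) = (\<Sum>i<N. f (x i) * (e i y - e i z / r z * r y)) + f z * (1 / r z * r y)"
        by (simp add: x'_def e'_def)
      also have "(\<Sum>i<N. f (x i) * (e i y - e i z / r z * r y)) = (\<Sum>i<N. f (x i) * e i y) - (\<Sum>i<N. f (x i) * e i z) * (r y / r z)"
        by (simp add: right_diff_distrib sum_subtractf sum_distrib_right mult.assoc sum_divide_distrib)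
      also have "\<dots> + f z * (1 / r z * r y) = f y"
        unfolding L[OF y] L[OF z(1)] using z(2) by (simp add: field_simps)
      finally show ?thesis by simp
    qed
    then show ?thesis using reg by blast
  qed
qed

lemma polys_le_interpolation:
  obtains N x e where "\<And>i. i < N \<Longrightarrow> x i \<in> points X" "\<And>i. i < N \<Longrightarrow> e i \<in> reg"
    "\<And>f y. f \<in> polys_le (points X) S k \<Longrightarrow> y \<in> points X \<Longrightarrow> f y = (\<Sum>i<N::nat. f (x i) * e i y)"
proof -
  obtain N x e where xe: "\<And>i. i < N \<Longrightarrow> x i \<in> points X" "\<And>i. i < N \<Longrightarrow> e i \<in> reg"
    and *: "\<And>f y. f \<in> lin_span (monomials S k) \<Longrightarrow> y \<in> points X \<Longrightarrow> f y = (\<Sum>i<N::nat. f (x i) * e i y)"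
    using interpolation[OF finite_monomials[OF finite_S] monomials_reg, of k] by blast
  have "f y = (\<Sum>i<N::nat. f (x i) * e i y)" if f: "f \<in> polys_le (points X) S k" and y: "y \<in> points X" for f y
  proof -
    obtain f' where f': "f' \<in> lin_span (monomials S k)" "\<And>x. x \<in> points X \<Longrightarrow> f x = f' x"
      using polys_le_span f unfolding polys_le_def by blast
    have "f y = (\<Sum>i<N. f' (x i) * e i y)" using *[OF f'(1) y] f'(2)[OF y] by simp
    also have "\<dots> = (\<Sum>i<N. f (x i) * e i y)" by (rule sum.cong) (simp_all add: f'(2) xe)
    finally show ?thesis .
  qed
  then show ?thesis using that xe by blast
qed

text \<open>A tensor has finitely many terms, so its slices \<open>h g\<close> lie in one space of
  bounded degree, and linear functionals see only the polynomial factors in \<open>g\<close>.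
  Stating this for all large \<open>K\<close> lets finitely many generators share one level.\<close>

lemma tensor_polys_le:
  assumes "h \<in> tensor_functions reg"
  shows "\<exists>k0. \<forall>K\<ge>k0. (\<forall>g. restrict (h g) (points X) \<in> polys_le (points X) S K) \<and>
    (\<forall>l. linear_functional (points X) (polys_le (points X) S K) l \<longrightarrow>
      (\<exists>F\<in>mpoly. \<forall>g. l (restrict (h g) (points X)) = F g))"
  using assms
proof induction
  case (base F f)
  then obtain k0 where k0: "poly_le (points X) S k0 (restrict f (points X))"
    by (auto simp: reg_def regular_eq generated_algebra_def polys_le_def)
  show ?case
  proof (intro exI[of _ k0] allI impI conjI)
    fix K assume "k0 \<le> K"
    then have K: "poly_le (points X) S K (restrict f (points X))" by (rule poly_le_mono[OF k0])
    have eq: "restrict (\<lambda>x. F g * f x) (points X) = (\<lambda>x\<in>points X. F g * restrict f (points X) x)" for g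
      by (rule restrict_ext) simp
    show "restrict (\<lambda>x. F g * f x) (points X) \<in> polys_le (points X) S K" for g
    proof -
      have "poly_le (points X) S (0 + K) (\<lambda>x\<in>points X. restrict (\<lambda>x. F g) (points X) x * restrict f (points X) x)"
        by (intro poly_le.mult poly_le.const K)
      also have "(\<lambda>x\<in>points X. restrict (\<lambda>x. F g) (points X) x * restrict f (points X) x) = restrict (\<lambda>x. F g * f x) (points X)"
        by (rule restrict_ext) simp
      finally show ?thesis by (simp only: polys_le_def mem_Collect_eq add_0)
    qed
    fix l assume "linear_functional (points X) (polys_le (points X) S K) l"
    then have scale: "\<forall>f\<in>polys_le (points X) S K. \<forall>c. l (\<lambda>x\<in>points X. c * f x) = c * l f"
      unfolding linear_functional_def by (rule conjunct2)
    have "l (restrict (\<lambda>x. F g * f x) (points X)) = F g * l (restrict f (points X))" for g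
      unfolding eq by (rule scale[rule_format]) (simp only: polys_le_def mem_Collect_eq K)
    then show "\<exists>F'\<in>mpoly. \<forall>g. l (restrict (\<lambda>x. F g * f x) (points X)) = F' g"
      by (intro bexI[OF _ mpoly.mult[OF base(1) mpoly.const[of "l (restrict f (points X))"]]]) simp
  qed
next
  case (add h k)
  from add.IH(1) obtain h0 where h0: "\<And>K. K \<ge> h0 \<Longrightarrow> (\<forall>g. restrict (h g) (points X) \<in> polys_le (points X) S K) \<and>
    (\<forall>l. linear_functional (points X) (polys_le (points X) S K) l \<longrightarrow> (\<exists>F\<in>mpoly. \<forall>g. l (restrict (h g) (points X)) = F g))" by blast
  from add.IH(2) obtain k0 where k0: "\<And>K. K \<ge> k0 \<Longrightarrow> (\<forall>g. restrict (k g) (points X) \<in> polys_le (points X) S K) \<and>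
    (\<forall>l. linear_functional (points X) (polys_le (points X) S K) l \<longrightarrow> (\<exists>F\<in>mpoly. \<forall>g. l (restrict (k g) (points X)) = F g))" by blast
  have eq: "restrict (\<lambda>x. h g x + k g x) (points X) = (\<lambda>x\<in>points X. restrict (h g) (points X) x + restrict (k g) (points X) x)" for g
    by (rule restrict_ext) simp
  show ?case
  proof (intro exI[of _ "max h0 k0"] allI impI conjI)
    fix K assume "max h0 k0 \<le> K"
    then have hK: "\<forall>g. restrict (h g) (points X) \<in> polys_le (points X) S K"
      "\<forall>l. linear_functional (points X) (polys_le (points X) S K) l \<longrightarrow> (\<exists>F\<in>mpoly. \<forall>g. l (restrict (h g) (points X)) = F g)"
      and kK: "\<forall>g. restrict (k g) (points X) \<in> polys_le (points X) S K"
      "\<forall>l. linear_functional (points X) (polys_le (points X) S K) l \<longrightarrow> (\<exists>F\<in>mpoly. \<forall>g. l (restrict (k g) (points X)) = F g)"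
      using h0[of K] k0[of K] by auto
    show "restrict (\<lambda>x. h g x + k g x) (points X) \<in> polys_le (points X) S K" for g
    proof -
      have "poly_le (points X) S K (restrict (h g) (points X))" "poly_le (points X) S K (restrict (k g) (points X))"
        using hK(1) kK(1) unfolding polys_le_def by blast+
      from poly_le.add[OF this] show ?thesis unfolding eq polys_le_def by (simp only: mem_Collect_eq)
    qed
    fix l assume l: "linear_functional (points X) (polys_le (points X) S K) l"
    obtain F where F: "F \<in> mpoly" "\<forall>g. l (restrict (h g) (points X)) = F g" using hK(2) l by blast
    obtain F' where F': "F' \<in> mpoly" "\<forall>g. l (restrict (k g) (points X)) = F' g" using kK(2) l by blast
    have sum_rule: "\<forall>f\<in>polys_le (points X) S K. \<forall>g\<in>polys_le (points X) S K. l (\<lambda>x\<in>points X. f x + g x) = l f + l g"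
      using l unfolding linear_functional_def by (rule conjunct1)
    have "l (restrict (\<lambda>x. h g x + k g x) (points X)) = F g + F' g" for g
    proof -
      have "l (restrict (\<lambda>x. h g x + k g x) (points X)) = l (restrict (h g) (points X)) + l (restrict (k g) (points X))"
        unfolding eq by (rule sum_rule[rule_format, OF hK(1)[rule_format] kK(1)[rule_format]])
      then show ?thesis using F(2) F'(2) by simp
    qed
    then show "\<exists>F\<in>mpoly. \<forall>g. l (restrict (\<lambda>x. h g x + k g x) (points X)) = F g"
      by (intro bexI[OF _ mpoly.add[OF F(1) F'(1)]]) simp
  qed
qed

section \<open>Families of automorphisms inside one level of the filtration\<close>

lemma level_points_iff: "\<phi> \<in> points (aut_level X S k) \<longleftrightarrow> \<phi> \<in> automorphisms X \<and>
  (\<forall>f\<in>S. restrict (\<lambda>x. f (\<phi> x)) (points X) \<in> polys_le (points X) S k \<and>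
    restrict (\<lambda>x. f (inv_into (points X) \<phi> x)) (points X) \<in> polys_le (points X) S k)"
  by (auto simp: aut_level_def embedded_variety_def Let_def aut_coords_def compose_def PiE_iff split: if_splits)

text \<open>Regular functions on a level are polynomials in linear functionals of the coordinates.
  Once those functionals depend polynomially on \<open>g\<close>, the family is a morphism from the
  group to the level.\<close>

lemma level_regular_family:
  assumes \<phi>: "\<And>g. det g = 1 \<Longrightarrow> \<phi> g \<in> points (aut_level X S k)"
    and F: "\<And>f l. f \<in> S \<Longrightarrow> linear_functional (points X) (polys_le (points X) S k) l \<Longrightarrow>
      (\<exists>F\<in>mpoly. \<forall>g. det g = 1 \<longrightarrow> l (restrict (\<lambda>x. f (\<phi> g x)) (points X)) = F g) \<and>
      (\<exists>F\<in>mpoly. \<forall>g. det g = 1 \<longrightarrow> l (restrict (\<lambda>x. f (inv_into (points X) (\<phi> g) x)) (points X)) = F g)"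
    and r: "r \<in> regular (aut_level X S k)"
  shows "\<exists>F\<in>mpoly. \<forall>g. det g = 1 \<longrightarrow> r (\<phi> g) = F g"
proof -
  let ?V = "polys_le (points X) S k" and ?I = "UNIV \<times> S :: (bool \<times> ('a \<Rightarrow> complex)) set"
  let ?C = "{(\<lambda>v. l (v i)) | i l. i \<in> ?I \<and> linear_functional (points X) ?V l}"
  obtain p where p: "p \<in> generated_algebra (?I \<rightarrow>\<^sub>E ?V) ?C"
    "r = compose (points (aut_level X S k)) p (aut_coords X S)"
    using r by (auto simp: aut_level_def embedded_variety_def Let_def tuple_variety_def)
  have co: "aut_coords X S (\<phi> g) \<in> ?I \<rightarrow>\<^sub>E ?V" if "det g = 1" for g
    using \<phi>[OF that] by (simp add: aut_level_def embedded_variety_def Let_def)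
  obtain j where "poly_le (?I \<rightarrow>\<^sub>E ?V) ?C j p" using p(1) by (auto simp: generated_algebra_def polys_le_def)
  then have "\<exists>F\<in>mpoly. \<forall>g. det g = 1 \<longrightarrow> p (aut_coords X S (\<phi> g)) = F g"
  proof induction
    case (const k c)
    then show ?case using co by (intro bexI[OF _ mpoly.const[of c]]) simp
  next
    case (gen f k)
    then obtain b a l where f: "f = (\<lambda>v. l (v (b, a)))" "a \<in> S" "linear_functional (points X) ?V l" by auto
    then obtain F where "F \<in> mpoly" "\<forall>g. det g = 1 \<longrightarrow> l (restrict (\<lambda>x. a ((if b then \<phi> g else inv_into (points X) (\<phi> g)) x)) (points X)) = F g"
      using F[of a l] by (cases b) auto
    moreover have "restrict f (?I \<rightarrow>\<^sub>E ?V) (aut_coords X S (\<phi> g)) =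
        l (restrict (\<lambda>x. a ((if b then \<phi> g else inv_into (points X) (\<phi> g)) x)) (points X))" if "det g = 1" for g
      by (simp only: restrict_apply'[OF co[OF that]] f(1)) (simp add: aut_coords_def compose_def f(2))
    ultimately show ?case by (intro bexI[of _ F]) auto
  next
    case (add k f g)
    then obtain F G where "F \<in> mpoly" "G \<in> mpoly" "\<forall>h. det h = 1 \<longrightarrow> f (aut_coords X S (\<phi> h)) = F h"
      "\<forall>h. det h = 1 \<longrightarrow> g (aut_coords X S (\<phi> h)) = G h" by blast
    then show ?case using co by (intro bexI[OF _ mpoly.add[of F G]]) simp_all
  next
    case (mult j f k g)
    then obtain F G where "F \<in> mpoly" "G \<in> mpoly" "\<forall>h. det h = 1 \<longrightarrow> f (aut_coords X S (\<phi> h)) = F h"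
      "\<forall>h. det h = 1 \<longrightarrow> g (aut_coords X S (\<phi> h)) = G h" by blast
    then show ?case using co by (intro bexI[OF _ mpoly.mult[of F G]]) simp_all
  qed
  then show ?thesis using \<phi> by (auto simp: p(2) compose_def)
qed

text \<open>Evaluation at \<open>x\<close> is a linear functional, applied here to the coordinate
  with index \<open>(True, a)\<close>.\<close>

lemma evaluation_regular:
  assumes "a \<in> S" "x \<in> points X"
  shows "restrict (\<lambda>\<phi>. a (\<phi> x)) (points (aut_level X S k)) \<in> regular (aut_level X S k)"
proof -
  let ?V = "polys_le (points X) S k" and ?I = "UNIV \<times> S :: (bool \<times> ('a \<Rightarrow> complex)) set"
  let ?C = "{(\<lambda>v. l (v i)) | i l. i \<in> ?I \<and> linear_functional (points X) ?V l}"
  let ?l = "\<lambda>f::'a \<Rightarrow> complex. f x"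
  have l: "linear_functional (points X) ?V ?l" using assms(2) by (simp add: linear_functional_def)
  have "(\<lambda>v. ?l (v (True, a))) \<in> ?C"
    by (intro CollectI exI[of _ "(True, a)"] exI[of _ ?l] conjI) (use l assms(1) in auto)
  then have "restrict (\<lambda>v. v (True, a) x) (?I \<rightarrow>\<^sub>E ?V) \<in> generated_algebra (?I \<rightarrow>\<^sub>E ?V) ?C"
    by (rule generated_algebra_gen)
  then have "compose (points (aut_level X S k)) (restrict (\<lambda>v. v (True, a) x) (?I \<rightarrow>\<^sub>E ?V)) (aut_coords X S) \<in> regular (aut_level X S k)"
    by (simp add: aut_level_def embedded_variety_def Let_def tuple_variety_def)
  also have "compose (points (aut_level X S k)) (restrict (\<lambda>v. v (True, a) x) (?I \<rightarrow>\<^sub>E ?V)) (aut_coords X S) =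
      restrict (\<lambda>\<phi>. a (\<phi> x)) (points (aut_level X S k))"
    unfolding compose_def
  proof (rule restrict_ext)
    fix \<phi> assume "\<phi> \<in> points (aut_level X S k)"
    then have "aut_coords X S \<phi> \<in> ?I \<rightarrow>\<^sub>E ?V" by (simp add: aut_level_def embedded_variety_def Let_def)
    then show "restrict (\<lambda>v. v (True, a) x) (?I \<rightarrow>\<^sub>E ?V) (aut_coords X S \<phi>) = a (\<phi> x)"
      using assms by (simp add: aut_coords_def compose_def)
  qed
  finally show ?thesis .
qed

lemma tensor_mult:
  assumes "h \<in> tensor_functions reg" "k \<in> tensor_functions reg"
  shows "(\<lambda>g x. h g x * k g x) \<in> tensor_functions reg"
  using assms(1)
proof induction
  case (base F f)
  from assms(2) show ?case
  proof induction
    case (base F' f')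
    have "(\<lambda>g x. (F g * F' g) * (f x * f' x)) \<in> tensor_functions reg"
      by (intro tensor_functions.base mpoly.mult reg_mult base \<open>F \<in> mpoly\<close> \<open>f \<in> reg\<close>)
    then show ?case by (simp add: mult_ac)
  next
    case (add h k)
    then show ?case using tensor_functions.add[OF add.IH] by (simp add: distrib_left)
  qed
next
  case (add h k')
  then show ?case using tensor_functions.add[OF add.IH] by (simp add: distrib_right)
qed

lemma tensor_sum: "(\<And>i. i < N \<Longrightarrow> h i \<in> tensor_functions reg) \<Longrightarrow> (\<lambda>g x. \<Sum>i<N::nat. h i g x) \<in> tensor_functions reg"
proof (induction N)
  case 0
  show ?case using tensor_functions.base[OF mpoly.const[of 0] reg_const[of 0]] by simp
next
  case (Suc N)
  have "(\<lambda>g x. \<Sum>i<N. h i g x) \<in> tensor_functions reg" by (rule Suc.IH, rule Suc.prems) simp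
  from tensor_functions.add[OF this Suc.prems[OF lessI]] show ?case by (simp only: sum.lessThan_Suc)
qed

text \<open>A family of automorphisms through one level of the filtration, depending polynomially on its
  parameter at every point, acts rationally: interpolation turns the pointwise polynomials into
  finitely many.\<close>

lemma rational_family:
  assumes \<phi>: "\<And>g. det g = 1 \<Longrightarrow> \<phi> g \<in> points (aut_level X S k)"
    and F: "\<And>a x. a \<in> S \<Longrightarrow> x \<in> points X \<Longrightarrow> \<exists>F\<in>mpoly. \<forall>g. det g = 1 \<longrightarrow> a (\<phi> g x) = F g"
    and f: "f \<in> reg"
  shows "\<exists>h\<in>tensor_functions reg. \<forall>g x. det g = 1 \<longrightarrow> x \<in> points X \<longrightarrow> f (\<phi> g x) = h g x"
proof -
  have \<phi>P: "\<phi> g x \<in> points X" if "det g = 1" "x \<in> points X" for g x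
    by (rule automorphismD(1)[OF _ that(2)]) (use \<phi>[OF that(1)] in \<open>simp add: level_points_iff\<close>)
  obtain j where "poly_le (points X) S j (restrict f (points X))"
    using f by (auto simp: reg_def regular_eq generated_algebra_def polys_le_def)
  then have "\<exists>h\<in>tensor_functions reg. \<forall>g x. det g = 1 \<longrightarrow> x \<in> points X \<longrightarrow> restrict f (points X) (\<phi> g x) = h g x"
  proof induction
    case (const j c)
    have "(\<lambda>g x. c * 1) \<in> tensor_functions reg" by (intro tensor_functions.base mpoly.const reg_const)
    then show ?case using \<phi>P by (intro bexI) auto
  next
    case (gen a j)
    obtain N x e where xe: "\<And>i. i < N \<Longrightarrow> x i \<in> points X" "\<And>i. i < N \<Longrightarrow> e i \<in> reg"
      and *: "\<And>f y. f \<in> polys_le (points X) S k \<Longrightarrow> y \<in> points X \<Longrightarrow> f y = (\<Sum>i<N::nat. f (x i) * e i y)"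
      by (rule polys_le_interpolation) blast
    have "\<forall>i. \<exists>F. i < N \<longrightarrow> F \<in> mpoly \<and> (\<forall>g. det g = 1 \<longrightarrow> a (\<phi> g (x i)) = F g)" using F[OF gen xe(1)] by blast
    then obtain Fs where Fs: "\<And>i. i < N \<Longrightarrow> Fs i \<in> mpoly" "\<And>i g. i < N \<Longrightarrow> det g = 1 \<Longrightarrow> a (\<phi> g (x i)) = Fs i g" by metis
    have "a (\<phi> g y) = (\<Sum>i<N. Fs i g * e i y)" if g: "det g = 1" and y: "y \<in> points X" for g y
    proof -
      have "restrict (\<lambda>y. a (\<phi> g y)) (points X) \<in> polys_le (points X) S k"
        using \<phi>[OF g] gen unfolding level_points_iff by simp
      from *[OF this y] have "a (\<phi> g y) = (\<Sum>i<N. restrict (\<lambda>y. a (\<phi> g y)) (points X) (x i) * e i y)" using y by simp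
      also have "\<dots> = (\<Sum>i<N. Fs i g * e i y)" by (rule sum.cong) (simp_all add: Fs(2) g xe)
      finally show ?thesis .
    qed
    moreover have "(\<lambda>g y. \<Sum>i<N. Fs i g * e i y) \<in> tensor_functions reg"
      by (intro tensor_sum tensor_functions.base Fs xe)
    ultimately show ?case using \<phi>P by (intro bexI[of _ "\<lambda>g y. \<Sum>i<N. Fs i g * e i y"]) auto
  next
    case (add j f f')
    then obtain h h' where "h \<in> tensor_functions reg" "h' \<in> tensor_functions reg"
      "\<forall>g x. det g = 1 \<longrightarrow> x \<in> points X \<longrightarrow> f (\<phi> g x) = h g x" "\<forall>g x. det g = 1 \<longrightarrow> x \<in> points X \<longrightarrow> f' (\<phi> g x) = h' g x" by blast
    then show ?case using \<phi>P by (intro bexI[OF _ tensor_functions.add[of h _ h']]) auto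
  next
    case (mult j f k f')
    then obtain h h' where "h \<in> tensor_functions reg" "h' \<in> tensor_functions reg"
      "\<forall>g x. det g = 1 \<longrightarrow> x \<in> points X \<longrightarrow> f (\<phi> g x) = h g x" "\<forall>g x. det g = 1 \<longrightarrow> x \<in> points X \<longrightarrow> f' (\<phi> g x) = h' g x" by blast
    then show ?case using \<phi>P by (intro bexI[OF _ tensor_mult[of h h']]) auto
  qed
  then obtain h where "h \<in> tensor_functions reg" "\<forall>g x. det g = 1 \<longrightarrow> x \<in> points X \<longrightarrow> restrict f (points X) (\<phi> g x) = h g x" by blast
  then show ?thesis using \<phi>P by (intro bexI[of _ h]) auto
qed

lemma irreducible_domain:
  assumes "irreducible_variety X" "f \<in> reg" "f' \<in> reg" "\<And>x. x \<in> points X \<Longrightarrow> f x * f' x = 0"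
  shows "(\<forall>x\<in>points X. f x = 0) \<or> (\<forall>x\<in>points X. f' x = 0)"
proof -
  have c: "zariski_closed X {x \<in> points X. f x = 0}" if "f \<in> reg" for f
    unfolding zariski_closed_def using that by (intro exI[of _ "{restrict f (points X)}"]) (auto simp: reg_def)
  have "{x \<in> points X. f x = 0} \<union> {x \<in> points X. f' x = 0} = points X" using assms(4) by auto
  then show ?thesis using assms(1) c[OF assms(2)] c[OF assms(3)] unfolding irreducible_variety_def by blast
qed

end

locale affine_generated_variety = generated_variety X S for X :: "'a variety" and S +
  assumes affine: "affine_variety X"
begin

lemma affine_coordinates:
  obtains n e where "inj_on e (points X)" "e ` points X \<subseteq> {..<n} \<rightarrow>\<^sub>E UNIV"
    "\<exists>F. F \<subseteq> generated_algebra ({..<n} \<rightarrow>\<^sub>E UNIV) ((\<lambda>i x. x i) ` {..<n::nat}) \<and>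
       e ` points X = {x \<in> {..<n} \<rightarrow>\<^sub>E UNIV. \<forall>f\<in>F. f x = 0}"
    "\<And>f. f \<in> reg \<longleftrightarrow> (\<exists>p\<in>generated_algebra ({..<n} \<rightarrow>\<^sub>E UNIV) ((\<lambda>i x. x i) ` {..<n}). \<forall>x\<in>points X. f x = p (e x))"
proof -
  obtain n e where e: "inj_on e (points X)" "zariski_closed (affine_space n) (e ` points X)"
    "X = embedded_variety (points X) e (affine_space n)" using affine unfolding affine_variety_def by blast
  have eq: "restrict f (points X) = compose (points X) p e \<longleftrightarrow> (\<forall>x\<in>points X. f x = p (e x))" for f p
    by (auto simp: compose_def fun_eq_iff restrict_def)
  have "regular X = (\<lambda>p. compose (points X) p e) ` regular (affine_space n)"
    by (subst e(3)) (simp add: embedded_variety_def)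
  then have "f \<in> reg \<longleftrightarrow> (\<exists>p\<in>regular (affine_space n). restrict f (points X) = compose (points X) p e)" for f
    unfolding reg_def by auto
  then have "f \<in> reg \<longleftrightarrow> (\<exists>p\<in>regular (affine_space n). \<forall>x\<in>points X. f x = p (e x))" for f
    by (simp only: eq)
  then show ?thesis using e(1,2)
    by (intro that[of e n]) (auto simp: affine_space_def zariski_closed_def)
qed

lemma reg_separated:
  assumes "x \<in> points X" "y \<in> points X" "\<And>f. f \<in> reg \<Longrightarrow> f x = f y" shows "x = y"
proof (rule affine_coordinates)
  fix n e assume e: "inj_on e (points X)" "e ` points X \<subseteq> {..<n} \<rightarrow>\<^sub>E UNIV"
    and reg: "\<And>f. f \<in> reg \<longleftrightarrow> (\<exists>p\<in>generated_algebra ({..<n} \<rightarrow>\<^sub>E UNIV) ((\<lambda>i x. x i) ` {..<n::nat}). \<forall>x\<in>points X. f x = p (e x))"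
  have eP: "e x \<in> {..<n} \<rightarrow>\<^sub>E UNIV" if "x \<in> points X" for x using e(2) that by blast
  have "e x i = e y i" if "i < n" for i
  proof -
    have "restrict (\<lambda>x. x i) ({..<n} \<rightarrow>\<^sub>E UNIV) \<in> generated_algebra ({..<n} \<rightarrow>\<^sub>E UNIV) ((\<lambda>i x. x i) ` {..<n})"
      by (rule generated_algebra_gen) (use that in auto)
    then have "(\<lambda>x. e x i) \<in> reg" unfolding reg by (rule rev_bexI) (use eP in auto)
    then show ?thesis by (rule assms(3))
  qed
  then have "e x = e y" by (intro PiE_ext[OF eP[OF assms(1)] eP[OF assms(2)]]) auto
  then show ?thesis using e(1) assms(1,2) by (auto dest: inj_onD)
qed

text \<open>The values of \<open>ev\<close> on the coordinate functions are the coordinates of the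
  desired point. It satisfies the equations of the variety because each equation becomes the zero
  function there, which \<open>ev\<close> sends to 0.\<close>

lemma reg_hom_is_evaluation:
  assumes c: "\<And>c. ev (\<lambda>x. c) = c"
    and a: "\<And>f f'. f \<in> reg \<Longrightarrow> f' \<in> reg \<Longrightarrow> ev (\<lambda>x. f x + f' x) = ev f + ev f'"
    and m: "\<And>f f'. f \<in> reg \<Longrightarrow> f' \<in> reg \<Longrightarrow> ev (\<lambda>x. f x * f' x) = ev f * ev f'"
    and cong: "\<And>f f'. f \<in> reg \<Longrightarrow> (\<And>x. x \<in> points X \<Longrightarrow> f' x = f x) \<Longrightarrow> ev f' = ev f"
  shows "\<exists>x\<in>points X. \<forall>f\<in>reg. ev f = f x"
proof (rule affine_coordinates)
  fix n e
  let ?A = "{..<n::nat} \<rightarrow>\<^sub>E (UNIV :: complex set)" and ?C = "(\<lambda>i x. x i) ` {..<n}"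
  assume e: "inj_on e (points X)" "e ` points X \<subseteq> ?A"
    and cl: "\<exists>F. F \<subseteq> generated_algebra ?A ?C \<and> e ` points X = {x \<in> ?A. \<forall>f\<in>F. f x = 0}"
    and reg: "\<And>f. f \<in> reg \<longleftrightarrow> (\<exists>p\<in>generated_algebra ?A ?C. \<forall>x\<in>points X. f x = p (e x))"
  have eP: "e x \<in> ?A" if "x \<in> points X" for x using e(2) that by blast
  define v where "v = (\<lambda>i\<in>{..<n}. ev (\<lambda>x. e x i))"
  have v: "v \<in> ?A" by (simp add: v_def)
  have regp: "(\<lambda>x. p (e x)) \<in> reg" if "p \<in> generated_algebra ?A ?C" for p unfolding reg using that by blast
  have ev: "ev (\<lambda>x. p (e x)) = p v" if "p \<in> generated_algebra ?A ?C" for p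
  proof -
    from that obtain k where "poly_le ?A ?C k p" by (auto simp: generated_algebra_def polys_le_def)
    then show ?thesis
    proof induction
      case (const k c')
      show ?case by (subst cong[OF reg_const[of c']]) (use eP v c in auto)
    next
      case (gen f k)
      then obtain i where i: "i < n" "f = (\<lambda>x. x i)" by auto
      have r: "(\<lambda>x. e x i) \<in> reg"
      proof -
        have "restrict f ?A \<in> generated_algebra ?A ?C" by (rule generated_algebra_gen) (rule gen)
        then show ?thesis unfolding reg by (rule rev_bexI) (use eP i in auto)
      qed
      have "ev (\<lambda>x. restrict f ?A (e x)) = ev (\<lambda>x. e x i)"
        by (rule cong[OF r]) (use eP i in auto)
      also have "\<dots> = v i" by (simp add: v_def i)
      also have "\<dots> = restrict f ?A v" by (simp only: restrict_apply'[OF v] i(2))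
      finally show ?case .
    next
      case (add k f g)
      have r: "(\<lambda>x. f (e x)) \<in> reg" "(\<lambda>x. g (e x)) \<in> reg"
        using add.hyps regp by (auto simp: generated_algebra_def polys_le_def)
      have "ev (\<lambda>x. restrict (\<lambda>x. f x + g x) ?A (e x)) = ev (\<lambda>x. f (e x) + g (e x))"
        by (rule cong[OF reg_add[OF r]]) (use eP in auto)
      then show ?case using v a[OF r] add.IH by simp
    next
      case (mult j f k g)
      have r: "(\<lambda>x. f (e x)) \<in> reg" "(\<lambda>x. g (e x)) \<in> reg"
        using mult.hyps regp by (auto simp: generated_algebra_def polys_le_def)
      have "ev (\<lambda>x. restrict (\<lambda>x. f x * g x) ?A (e x)) = ev (\<lambda>x. f (e x) * g (e x))"
        by (rule cong[OF reg_mult[OF r]]) (use eP in auto)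
      then show ?case using v m[OF r] mult.IH by simp
    qed
  qed
  obtain F where F: "F \<subseteq> generated_algebra ?A ?C" "e ` points X = {x \<in> ?A. \<forall>f\<in>F. f x = 0}" using cl by blast
  have "f v = 0" if f: "f \<in> F" for f
  proof -
    have "f v = ev (\<lambda>x. f (e x))" using ev F(1) f by auto
    also have "\<dots> = ev (\<lambda>x. 0)" by (rule cong[OF reg_const]) (use F(2) f in blast)
    finally show ?thesis by (simp add: c)
  qed
  then have "v \<in> e ` points X" using F(2) v by blast
  then obtain x where x: "x \<in> points X" "v = e x" by blast
  have "ev f = f x" if "f \<in> reg" for f
  proof -
    obtain p where p: "p \<in> generated_algebra ?A ?C" "\<And>x. x \<in> points X \<Longrightarrow> f x = p (e x)" using \<open>f \<in> reg\<close> reg by blast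
    have "ev f = ev (\<lambda>x. p (e x))" by (rule cong[OF regp[OF p(1)] p(2)])
    then show ?thesis using ev[OF p(1)] x p(2) by simp
  qed
  then show ?thesis using x(1) by blast
qed

end

section \<open>Transfer along an isomorphism of automorphism groups\<close>

lemma restrict_eq_iff: "restrict f A = restrict g A \<longleftrightarrow> (\<forall>x\<in>A. f x = g x)"
  by (auto simp: fun_eq_iff restrict_def)

lemma compose_eq_iff: "compose A f g = compose A f' g' \<longleftrightarrow> (\<forall>x\<in>A. f (g x) = f' (g' x))"
  by (simp only: compose_def restrict_eq_iff)

locale automorphism_transfer = sl2_quotient H m + V: affine_generated_variety X S +
  W: generated_variety "SL2_quotient H" S'
  for H m and X :: "'a variety" and S S' +
  fixes \<Phi> :: "('a \<Rightarrow> 'a) \<Rightarrow> (complex^2^2) set \<Rightarrow> (complex^2^2) set"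
  assumes irreducible: "irreducible_variety X"
    and iso: "\<Phi> \<in> iso (aut_ind_group X S) (aut_ind_group (SL2_quotient H) S')"
    and ind: "ind_iso \<Phi> (level (aut_ind_group X S)) (level (aut_ind_group (SL2_quotient H) S'))"
begin

section \<open>Relations between automorphisms on both sides\<close>

lemma W_reg: "W.reg = RQ"
  unfolding W.reg_def RQ_iff[symmetric] by (rule Collect_mem_eq)

lemma Phi_bij: "bij_betw \<Phi> (automorphisms X) (automorphisms (SL2_quotient H))"
  using iso unfolding iso_def carrier_aut by blast

lemma Phi_aut: "\<alpha> \<in> automorphisms X \<Longrightarrow> \<Phi> \<alpha> \<in> automorphisms (SL2_quotient H)"
  by (rule bij_betw_apply[OF Phi_bij])

lemma Phi_inj: "\<alpha> \<in> automorphisms X \<Longrightarrow> \<beta> \<in> automorphisms X \<Longrightarrow> \<Phi> \<alpha> = \<Phi> \<beta> \<Longrightarrow> \<alpha> = \<beta>"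
  using bij_betw_imp_inj_on[OF Phi_bij] by (rule inj_onD)

lemma Phi_surj: "\<gamma> \<in> automorphisms (SL2_quotient H) \<Longrightarrow> \<exists>\<alpha>\<in>automorphisms X. \<Phi> \<alpha> = \<gamma>"
  by (simp only: bij_betw_imp_surj_on[OF Phi_bij, symmetric] image_iff) blast

lemma Phi_compose:
  assumes "\<alpha> \<in> automorphisms X" "\<beta> \<in> automorphisms X"
  shows "\<Phi> (compose (points X) \<alpha> \<beta>) = compose Q (\<Phi> \<alpha>) (\<Phi> \<beta>)"
proof -
  have "\<Phi> (\<alpha> \<otimes>\<^bsub>aut_ind_group X S\<^esub> \<beta>) = \<Phi> \<alpha> \<otimes>\<^bsub>aut_ind_group (SL2_quotient H) S'\<^esub> \<Phi> \<beta>"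
    using iso assms unfolding iso_def hom_def by auto
  then show ?thesis using assms by (simp only: mult_aut Phi_aut points_quotient)
qed

text \<open>Relations are compared as equalities of products of two automorphisms. Commutation is of
  this form, and shorter relations are brought into it by inserting the automorphism of the identity
  matrix.\<close>

lemma transfer_iff:
  assumes "\<alpha> \<in> automorphisms X" "\<beta> \<in> automorphisms X" "\<gamma> \<in> automorphisms X" "\<delta> \<in> automorphisms X"
  shows "(\<forall>x\<in>points X. \<alpha> (\<beta> x) = \<gamma> (\<delta> x)) \<longleftrightarrow> (\<forall>q\<in>Q. \<Phi> \<alpha> (\<Phi> \<beta> q) = \<Phi> \<gamma> (\<Phi> \<delta> q))"
proof -
  have "compose (points X) \<alpha> \<beta> = compose (points X) \<gamma> \<delta> \<longleftrightarrow>
      \<Phi> (compose (points X) \<alpha> \<beta>) = \<Phi> (compose (points X) \<gamma> \<delta>)"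
    using Phi_inj[OF compose_automorphisms[OF assms(1,2)] compose_automorphisms[OF assms(3,4)]] by auto
  then show ?thesis by (simp only: Phi_compose assms compose_eq_iff)
qed

section \<open>The action of the group carried over to \<open>X\<close>\<close>

definition aq :: "complex^2^2 \<Rightarrow> (complex^2^2) set \<Rightarrow> (complex^2^2) set"
  where "aq g = restrict (qact g) Q"

lemma aq_apply [simp]: "q \<in> Q \<Longrightarrow> aq g q = qact g q"
  by (simp add: aq_def)

lemma qact_adj2:
  assumes "det g = 1" "q \<in> Q" shows "qact (adj2 g) (qact g q) = q" "qact g (qact (adj2 g) q) = q"
proof -
  have d: "det (adj2 g) = 1" using assms(1) by simp
  show "qact (adj2 g) (qact g q) = q" "qact g (qact (adj2 g) q) = q"
    by (simp_all only: act_act[OF d assms] act_act[OF assms(1) d assms(2)] adj2_mult[OF assms(1)] act_1[OF assms(2)])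
qed

lemma aq_aut: assumes "det g = 1" shows "aq g \<in> automorphisms (SL2_quotient H)"
proof -
  have d: "det (adj2 g) = 1" using assms by simp
  have "restrict (qact g) (points (SL2_quotient H)) \<in> automorphisms (SL2_quotient H)"
  proof (rule W.automorphism_regI[where \<rho> = "qact (adj2 g)"]; unfold W_reg points_quotient)
    fix x assume "x \<in> Q"
    then show "qact g x \<in> Q \<and> qact (adj2 g) (qact g x) = x" "qact (adj2 g) x \<in> Q \<and> qact g (qact (adj2 g) x) = x"
      using qact_adj2[OF assms] act_closed[OF assms] act_closed[OF d] by auto
  next
    fix f assume "f \<in> RQ"
    then show "(\<lambda>x. f (qact g x)) \<in> RQ" "(\<lambda>x. f (qact (adj2 g) x)) \<in> RQ" using R_act assms d by auto
  qed
  then show ?thesis by (simp only: aq_def points_quotient)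
qed

lemma inv_aq: assumes "det g = 1" "q \<in> Q" shows "inv_into Q (aq g) q = qact (adj2 g) q"
proof (rule inv_into_f_eq)
  have d: "det (adj2 g) = 1" using assms(1) by simp
  show "inj_on (aq g) Q" using automorphismD(8)[OF aq_aut[OF assms(1)]] by (simp only: points_quotient)
  show *: "qact (adj2 g) q \<in> Q" by (rule act_closed[OF d assms(2)])
  show "aq g (qact (adj2 g) q) = q" using * qact_adj2(2)[OF assms] by simp
qed

lemma aq_mult: assumes "det g = 1" "det h = 1" shows "compose Q (aq g) (aq h) = aq (g ** h)"
  unfolding compose_def aq_def[of "g ** h"]
proof (rule restrict_ext)
  fix q assume "q \<in> Q"
  then show "aq g (aq h q) = qact (g ** h) q" using act_closed[OF assms(2)] act_act[OF assms] by simp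
qed

lemma aq_coordinate:
  assumes "f \<in> S'"
  shows "\<exists>k0. \<forall>K\<ge>k0. (\<forall>g. det g = 1 \<longrightarrow> restrict (\<lambda>q. f (qact g q)) Q \<in> polys_le Q S' K) \<and>
    (\<forall>l. linear_functional Q (polys_le Q S' K) l \<longrightarrow>
      (\<exists>F\<in>mpoly. \<forall>g. det g = 1 \<longrightarrow> l (restrict (\<lambda>q. f (qact g q)) Q) = F g))"
proof -
  have "f \<in> RQ" using W.S_regular W.regular_reg assms W_reg by blast
  then obtain h where h: "h \<in> tensor_functions RQ" "\<And>g x. det g = 1 \<Longrightarrow> x \<in> Q \<Longrightarrow> f (qact g x) = h g x"
    using rational by blast
  have eq: "restrict (\<lambda>q. f (qact g q)) Q = restrict (h g) Q" if "det g = 1" for g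
    by (rule restrict_ext) (rule h(2)[OF that])
  obtain k0 where k0: "\<And>K. K \<ge> k0 \<Longrightarrow> (\<forall>g. restrict (h g) Q \<in> polys_le Q S' K) \<and>
    (\<forall>l. linear_functional Q (polys_le Q S' K) l \<longrightarrow> (\<exists>F\<in>mpoly. \<forall>g. l (restrict (h g) Q) = F g))"
    using W.tensor_polys_le[unfolded W_reg points_quotient, OF h(1)] by blast
  show ?thesis
  proof (intro exI[of _ k0] allI impI conjI)
    fix K and g :: "complex^2^2" assume "K \<ge> k0" "det g = 1"
    then show "restrict (\<lambda>q. f (qact g q)) Q \<in> polys_le Q S' K" using k0[of K] by (simp only: eq)
  next
    fix K l assume K: "K \<ge> k0" and l: "linear_functional Q (polys_le Q S' K) l"
    obtain F where F: "F \<in> mpoly" "\<forall>g. l (restrict (h g) Q) = F g" using k0[OF K] l by blast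
    show "\<exists>F\<in>mpoly. \<forall>g. det g = 1 \<longrightarrow> l (restrict (\<lambda>q. f (qact g q)) Q) = F g"
      by (intro bexI[OF _ F(1)] allI impI) (simp only: eq F(2))
  qed
qed

text \<open>The finitely many generators in \<open>S'\<close> admit a common degree bound, so the
  whole group acts through one level \<open>K\<close>. Inverses are covered because
  \<open>adj2\<close> is polynomial in the entries.\<close>

lemma aq_level:
  obtains K where "\<And>g. det g = 1 \<Longrightarrow> aq g \<in> points (aut_level (SL2_quotient H) S' K)"
    "\<And>r. r \<in> regular (aut_level (SL2_quotient H) S' K) \<Longrightarrow> \<exists>F\<in>mpoly. \<forall>g. det g = 1 \<longrightarrow> r (aq g) = F g"
proof -
  have "\<forall>f\<in>S'. \<exists>k0. \<forall>K\<ge>k0. (\<forall>g. det g = 1 \<longrightarrow> restrict (\<lambda>q. f (qact g q)) Q \<in> polys_le Q S' K) \<and>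
    (\<forall>l. linear_functional Q (polys_le Q S' K) l \<longrightarrow>
      (\<exists>F\<in>mpoly. \<forall>g. det g = 1 \<longrightarrow> l (restrict (\<lambda>q. f (qact g q)) Q) = F g))"
    using aq_coordinate by blast
  from bchoice[OF this] obtain k0 where k0: "\<forall>f\<in>S'. \<forall>K\<ge>k0 f. (\<forall>g. det g = 1 \<longrightarrow> restrict (\<lambda>q. f (qact g q)) Q \<in> polys_le Q S' K) \<and>
    (\<forall>l. linear_functional Q (polys_le Q S' K) l \<longrightarrow>
      (\<exists>F\<in>mpoly. \<forall>g. det g = 1 \<longrightarrow> l (restrict (\<lambda>q. f (qact g q)) Q) = F g))" ..
  define K where "K = (\<Sum>f\<in>S'. k0 f)"
  have K: "k0 f \<le> K" if "f \<in> S'" for f unfolding K_def by (rule member_le_sum[OF that _ W.finite_S]) simp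
  have P: "restrict (\<lambda>q. f (qact g q)) Q \<in> polys_le Q S' K" if "f \<in> S'" "det g = 1" for f g
    using k0[rule_format, OF that(1) K[OF that(1)]] that(2) by simp
  have L: "\<exists>F\<in>mpoly. \<forall>g. det g = 1 \<longrightarrow> l (restrict (\<lambda>q. f (qact g q)) Q) = F g"
    if "f \<in> S'" "linear_functional Q (polys_le Q S' K) l" for f l
    using k0[rule_format, OF that(1) K[OF that(1)]] that(2) by simp
  have e1: "restrict (\<lambda>q. f (aq g q)) Q = restrict (\<lambda>q. f (qact g q)) Q" for f :: "(complex^2^2) set \<Rightarrow> complex" and g
    by (rule restrict_ext) simp
  have e2: "restrict (\<lambda>q. f (inv_into Q (aq g) q)) Q = restrict (\<lambda>q. f (qact (adj2 g) q)) Q" if "det g = 1"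
    for f :: "(complex^2^2) set \<Rightarrow> complex" and g
    by (rule restrict_ext) (simp only: inv_aq[OF that])
  have d: "det (adj2 g) = 1" if "det g = 1" for g using that by simp
  have lev: "aq g \<in> points (aut_level (SL2_quotient H) S' K)" if g: "det g = 1" for g
    unfolding W.level_points_iff points_quotient e1 e2[OF g] using aq_aut[OF g] P[OF _ g] P[OF _ d[OF g]] by blast
  show ?thesis
  proof (rule that[OF lev])
    fix r assume r: "r \<in> regular (aut_level (SL2_quotient H) S' K)"
    show "\<exists>F\<in>mpoly. \<forall>g. det g = 1 \<longrightarrow> r (aq g) = F g"
    proof (rule W.level_regular_family[where \<phi> = aq and k = K and r = r])
      fix f l assume f: "f \<in> S'" and l0: "linear_functional (points (SL2_quotient H)) (polys_le (points (SL2_quotient H)) S' K) l"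
      have l: "linear_functional Q (polys_le Q S' K) l" using l0 by (simp only: points_quotient)
      obtain F where F: "F \<in> mpoly" "\<And>g. det g = 1 \<Longrightarrow> l (restrict (\<lambda>q. f (qact g q)) Q) = F g" using L[OF f l] by blast
      have "\<forall>g. det g = 1 \<longrightarrow> l (restrict (\<lambda>q. f (inv_into Q (aq g) q)) Q) = F (adj2 g)"
        by (intro allI impI) (simp only: e2 F(2)[OF d])
      then have "\<exists>F\<in>mpoly. \<forall>g. det g = 1 \<longrightarrow> l (restrict (\<lambda>q. f (inv_into Q (aq g) q)) Q) = F g"
        using mpoly_adj2[OF F(1)] by (rule bexI)
      from conjI[OF L[OF f l] this]
      show "(\<exists>F\<in>mpoly. \<forall>g. det g = 1 \<longrightarrow> l (restrict (\<lambda>q. f (aq g q)) (points (SL2_quotient H))) = F g) \<and>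
        (\<exists>F\<in>mpoly. \<forall>g. det g = 1 \<longrightarrow>
          l (restrict (\<lambda>q. f (inv_into (points (SL2_quotient H)) (aq g) q)) (points (SL2_quotient H))) = F g)"
        unfolding points_quotient e1 .
    qed (fact lev r)+
  qed
qed

text \<open>The inverse is taken on \<open>ind_points\<close> because this is exactly the map that
  \<open>ind_iso\<close> declares to be a morphism.\<close>

definition xact :: "complex^2^2 \<Rightarrow> 'a \<Rightarrow> 'a"
  where "xact g = inv_into (ind_points (aut_level X S)) \<Phi> (aq g)"

lemma xact_level:
  obtains k where "\<And>g. det g = 1 \<Longrightarrow> xact g \<in> points (aut_level X S k)"
    "\<And>r. r \<in> regular (aut_level X S k) \<Longrightarrow> \<exists>F\<in>mpoly. \<forall>g. det g = 1 \<longrightarrow> r (xact g) = F g"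
proof (rule aq_level)
  fix K
  assume K: "\<And>g. det g = 1 \<Longrightarrow> aq g \<in> points (aut_level (SL2_quotient H) S' K)"
    "\<And>r. r \<in> regular (aut_level (SL2_quotient H) S' K) \<Longrightarrow> \<exists>F\<in>mpoly. \<forall>g. det g = 1 \<longrightarrow> r (aq g) = F g"
  let ?\<psi> = "inv_into (ind_points (aut_level X S)) \<Phi>"
  obtain k where k: "?\<psi> \<in> points (aut_level (SL2_quotient H) S' K) \<rightarrow> points (aut_level X S k)"
    "\<forall>r\<in>regular (aut_level X S k). compose (points (aut_level (SL2_quotient H) S' K)) r ?\<psi> \<in> regular (aut_level (SL2_quotient H) S' K)"
    using ind unfolding ind_iso_def ind_morphism_def variety_morphism_def level_aut by blast
  show ?thesis
  proof (rule that)
    show "xact g \<in> points (aut_level X S k)" if "det g = 1" for g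
      unfolding xact_def by (rule funcset_mem[OF k(1) K(1)[OF that]])
    fix r assume "r \<in> regular (aut_level X S k)"
    then obtain F where F: "F \<in> mpoly" "\<forall>g. det g = 1 \<longrightarrow> compose (points (aut_level (SL2_quotient H) S' K)) r ?\<psi> (aq g) = F g"
      using K(2) k(2) by blast
    have "r (xact g) = F g" if g: "det g = 1" for g
      using F(2)[rule_format, OF g] K(1)[OF g] by (simp add: compose_def xact_def)
    then show "\<exists>F\<in>mpoly. \<forall>g. det g = 1 \<longrightarrow> r (xact g) = F g" using F(1) by blast
  qed
qed

lemma xact_aut: assumes "det g = 1" shows "xact g \<in> automorphisms X"
proof (rule xact_level)
  fix k assume "\<And>g. det g = 1 \<Longrightarrow> xact g \<in> points (aut_level X S k)"
  from this[OF assms] show ?thesis by (simp only: V.level_points_iff)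
qed

lemma Phi_xact: assumes "det g = 1" shows "\<Phi> (xact g) = aq g"
proof (rule aq_level)
  fix K assume "\<And>g. det g = 1 \<Longrightarrow> aq g \<in> points (aut_level (SL2_quotient H) S' K)"
  from this[OF assms] have "aq g \<in> ind_points (aut_level (SL2_quotient H) S')" unfolding ind_points_def by blast
  then have "aq g \<in> \<Phi> ` ind_points (aut_level X S)" using ind unfolding ind_iso_def bij_betw_def level_aut by blast
  then show ?thesis unfolding xact_def by (rule f_inv_into_f)
qed

lemma Phi_xact_apply: "det g = 1 \<Longrightarrow> q \<in> Q \<Longrightarrow> \<Phi> (xact g) q = qact g q"
  by (simp only: Phi_xact aq_apply)

lemma Phi_closed: assumes "\<alpha> \<in> automorphisms X" "q \<in> Q" shows "\<Phi> \<alpha> q \<in> Q"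
  using automorphismD(1)[OF Phi_aut[OF assms(1)]] assms(2) by (simp only: points_quotient)

lemma xact_xact: assumes "det g = 1" "det h = 1" "x \<in> points X" shows "xact g (xact h x) = xact (g ** h) x"
proof -
  have d: "det (g ** h) = 1" using assms by (simp add: det_mul)
  have "\<Phi> (compose (points X) (xact g) (xact h)) = \<Phi> (xact (g ** h))"
    by (simp only: Phi_compose xact_aut assms Phi_xact aq_mult d)
  then have "compose (points X) (xact g) (xact h) = xact (g ** h)"
    by (rule Phi_inj[OF compose_automorphisms[OF xact_aut[OF assms(1)] xact_aut[OF assms(2)]] xact_aut[OF d]])
  then have "compose (points X) (xact g) (xact h) x = xact (g ** h) x" by (rule fun_cong)
  then show ?thesis using assms(3) by (simp add: compose_def)
qed

lemma xact_closed: "det g = 1 \<Longrightarrow> x \<in> points X \<Longrightarrow> xact g x \<in> points X"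
  by (rule automorphismD(1)[OF xact_aut])

lemma xact_1: assumes x: "x \<in> points X" shows "xact (mat 1) x = x"
proof -
  have d: "det (mat 1 :: complex^2^2) = 1" by simp
  have c: "xact (mat 1) x \<in> points X" by (rule xact_closed[OF d x])
  have "xact (mat 1) (xact (mat 1) x) = xact (mat 1) x" using xact_xact[OF d d x] by simp
  then show ?thesis using automorphismD(8)[OF xact_aut[OF d]] c x by (auto dest: inj_onD)
qed

text \<open>Evaluating a generator at a point is a regular function on the level containing the
  group, hence a polynomial in the matrix. By \<open>rational_family\<close> this pointwise
  information yields rationality of the action.\<close>

sublocale A: sl2_variety "points X" V.reg xact
proof
  fix f assume f: "f \<in> V.reg"
  show "\<exists>h\<in>tensor_functions V.reg. \<forall>g x. det g = 1 \<longrightarrow> x \<in> points X \<longrightarrow> f (xact g x) = h g x"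
  proof (rule xact_level)
    fix k
    assume k: "\<And>g. det g = 1 \<Longrightarrow> xact g \<in> points (aut_level X S k)"
      "\<And>r. r \<in> regular (aut_level X S k) \<Longrightarrow> \<exists>F\<in>mpoly. \<forall>g. det g = 1 \<longrightarrow> r (xact g) = F g"
    show ?thesis
    proof (rule V.rational_family[OF k(1) _ f])
      fix a x assume ax: "a \<in> S" "x \<in> points X"
      obtain F where F: "F \<in> mpoly" "\<forall>g. det g = 1 \<longrightarrow> restrict (\<lambda>\<phi>. a (\<phi> x)) (points (aut_level X S k)) (xact g) = F g"
        using k(2)[OF V.evaluation_regular[OF ax]] by blast
      then have "\<forall>g. det g = 1 \<longrightarrow> a (xact g x) = F g" using k(1) by simp
      then show "\<exists>F\<in>mpoly. \<forall>g. det g = 1 \<longrightarrow> a (xact g x) = F g" using F(1) by blast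
    qed
  qed
qed (fact V.reg_const V.reg_add V.reg_mult V.reg_cong V.reg_separated xact_closed xact_xact xact_1)+

lemma det_unipotent: "det (upper s) = 1" "det (mat 1 :: complex^2^2) = 1" and det_diag2: "l \<noteq> 0 \<Longrightarrow> det (diag2 l) = 1"
  by simp_all

lemma transfer_commute:
  assumes "\<alpha> \<in> automorphisms X" "\<beta> \<in> automorphisms X" "det g = 1"
  shows "(\<forall>x\<in>points X. \<alpha> (xact g x) = xact g (\<beta> x)) \<longleftrightarrow> (\<forall>q\<in>Q. \<Phi> \<alpha> (qact g q) = qact g (\<Phi> \<beta> q))"
  unfolding transfer_iff[OF assms(1) xact_aut[OF assms(3)] xact_aut[OF assms(3)] assms(2)]
  by (rule ball_cong[OF refl]) (simp only: Phi_xact_apply[OF assms(3)] Phi_closed[OF assms(2)])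

lemma transfer_eq:
  assumes "\<alpha> \<in> automorphisms X" "\<gamma> \<in> automorphisms X" "\<delta> \<in> automorphisms X"
  shows "(\<forall>x\<in>points X. \<alpha> x = \<gamma> (\<delta> x)) \<longleftrightarrow> (\<forall>q\<in>Q. \<Phi> \<alpha> q = \<Phi> \<gamma> (\<Phi> \<delta> q))"
proof -
  have "(\<forall>x\<in>points X. \<alpha> (xact (mat 1) x) = \<gamma> (\<delta> x)) \<longleftrightarrow> (\<forall>q\<in>Q. \<Phi> \<alpha> (\<Phi> (xact (mat 1)) q) = \<Phi> \<gamma> (\<Phi> \<delta> q))"
    by (rule transfer_iff[OF assms(1) xact_aut[OF det_unipotent(2)] assms(2,3)])
  moreover have "(\<forall>x\<in>points X. \<alpha> (xact (mat 1) x) = \<gamma> (\<delta> x)) \<longleftrightarrow> (\<forall>x\<in>points X. \<alpha> x = \<gamma> (\<delta> x))"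
    by (rule ball_cong[OF refl]) (simp only: xact_1)
  moreover have "(\<forall>q\<in>Q. \<Phi> \<alpha> (\<Phi> (xact (mat 1)) q) = \<Phi> \<gamma> (\<Phi> \<delta> q)) \<longleftrightarrow> (\<forall>q\<in>Q. \<Phi> \<alpha> q = \<Phi> \<gamma> (\<Phi> \<delta> q))"
    by (rule ball_cong[OF refl]) (simp only: Phi_xact_apply[OF det_unipotent(2)] act_1)
  ultimately show ?thesis by (simp only:)
qed

lemma transfer_id:
  assumes "\<gamma> \<in> automorphisms X" "\<delta> \<in> automorphisms X"
  shows "(\<forall>x\<in>points X. \<gamma> (\<delta> x) = x) \<longleftrightarrow> (\<forall>q\<in>Q. \<Phi> \<gamma> (\<Phi> \<delta> q) = q)"
proof -
  have "(\<forall>x\<in>points X. xact (mat 1) x = \<gamma> (\<delta> x)) \<longleftrightarrow> (\<forall>q\<in>Q. \<Phi> (xact (mat 1)) q = \<Phi> \<gamma> (\<Phi> \<delta> q))"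
    by (rule transfer_eq[OF xact_aut[OF det_unipotent(2)] assms])
  moreover have "(\<forall>x\<in>points X. xact (mat 1) x = \<gamma> (\<delta> x)) \<longleftrightarrow> (\<forall>x\<in>points X. \<gamma> (\<delta> x) = x)"
    by (rule ball_cong[OF refl]) (simp only: xact_1 eq_commute)
  moreover have "(\<forall>q\<in>Q. \<Phi> (xact (mat 1)) q = \<Phi> \<gamma> (\<Phi> \<delta> q)) \<longleftrightarrow> (\<forall>q\<in>Q. \<Phi> \<gamma> (\<Phi> \<delta> q) = q)"
    by (rule ball_cong[OF refl]) (simp only: Phi_xact_apply[OF det_unipotent(2)] act_1 eq_commute)
  ultimately show ?thesis by (simp only:)
qed

lemma transfer_single_id:
  assumes "\<gamma> \<in> automorphisms X"
  shows "(\<forall>x\<in>points X. \<gamma> x = x) \<longleftrightarrow> (\<forall>q\<in>Q. \<Phi> \<gamma> q = q)"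
proof -
  have "(\<forall>x\<in>points X. \<gamma> (xact (mat 1) x) = x) \<longleftrightarrow> (\<forall>q\<in>Q. \<Phi> \<gamma> (\<Phi> (xact (mat 1)) q) = q)"
    by (rule transfer_id[OF assms xact_aut[OF det_unipotent(2)]])
  moreover have "(\<forall>x\<in>points X. \<gamma> (xact (mat 1) x) = x) \<longleftrightarrow> (\<forall>x\<in>points X. \<gamma> x = x)"
    by (rule ball_cong[OF refl]) (simp only: xact_1)
  moreover have "(\<forall>q\<in>Q. \<Phi> \<gamma> (\<Phi> (xact (mat 1)) q) = q) \<longleftrightarrow> (\<forall>q\<in>Q. \<Phi> \<gamma> q = q)"
    by (rule ball_cong[OF refl]) (simp only: Phi_xact_apply[OF det_unipotent(2)] act_1)
  ultimately show ?thesis by (simp only:)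
qed

lemma acts_nontrivially:
  assumes "det g = 1" "\<exists>q\<in>Q. qact g q \<noteq> q" shows "\<exists>x\<in>points X. xact g x \<noteq> x"
proof (rule ccontr)
  assume "\<not> ?thesis"
  then have "\<forall>x\<in>points X. xact g x = x" by blast
  then have "\<forall>q\<in>Q. \<Phi> (xact g) q = q" by (simp only: transfer_single_id[OF xact_aut[OF assms(1)]])
  then show False using assms Phi_xact_apply by metis
qed

text \<open>A unipotent root subgroup \<open>upper\<close> can be reparametrized by an invariant function \<open>f\<close>; these replicas
  are what distinguishes functions on \<open>X\<close> inside the automorphism group.\<close>

definition replica :: "('a \<Rightarrow> complex) \<Rightarrow> complex \<Rightarrow> 'a \<Rightarrow> 'a"
  where "replica f s = restrict (\<lambda>x. xact (upper (s * f x)) x) (points X)"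

lemma upper_add: "x \<in> points X \<Longrightarrow> xact (upper s) (xact (upper t) x) = xact (upper (s + t)) x"
  by (subst xact_xact[OF det_unipotent(1) det_unipotent(1)]) (simp_all add: add.commute)

text \<open>Substituting the regular function \<open>s * f x\<close> for the parameter of the finite
  unipotent expansion of \<open>a\<close> gives a regular function again.\<close>

lemma replica_reg:
  assumes "f \<in> V.reg" "a \<in> V.reg" shows "(\<lambda>x. a (xact (upper (s * f x)) x)) \<in> V.reg"
proof -
  obtain n b where b: "A.upper_expansion a n b" using A.upper_expansion_exists[OF assms(2)] by blast
  have "(\<lambda>x. \<Sum>i\<le>n. (s * f x) ^ i * b i x) \<in> V.reg"
    using b assms(1) unfolding A.upper_expansion_def by (intro A.R_intros) auto
  then show ?thesis by (rule V.reg_cong) (use b in \<open>simp only: A.upper_expansion_def\<close>)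
qed

lemma replica_aut:
  assumes "f \<in> V.reg" "A.upper_invariant f" shows "replica f s \<in> automorphisms X"
proof -
  have c: "xact (upper t) x \<in> points X" if "x \<in> points X" for x t by (rule xact_closed[OF det_unipotent(1) that])
  have inv: "f (xact (upper t) x) = f x" if "x \<in> points X" for x t
    using assms(2) that unfolding A.upper_invariant_def by blast
  have z: "xact (upper 0) x = x" if "x \<in> points X" for x using xact_1[OF that] by (simp only: mat_1_eq_mat2)
  show ?thesis unfolding replica_def
  proof (rule V.automorphism_regI[where \<rho> = "\<lambda>x. xact (upper (- s * f x)) x"])
    fix x assume x: "x \<in> points X"
    have e: "- s * f x + s * f x = 0" "s * f x + - s * f x = 0" by simp_all
    show "xact (upper (s * f x)) x \<in> points X \<and> xact (upper (- s * f (xact (upper (s * f x)) x))) (xact (upper (s * f x)) x) = x"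
      by (simp only: inv[OF x] upper_add[OF x] e z[OF x] c[OF x] simp_thms)
    show "xact (upper (- s * f x)) x \<in> points X \<and> xact (upper (s * f (xact (upper (- s * f x)) x))) (xact (upper (- s * f x)) x) = x"
      by (simp only: inv[OF x] upper_add[OF x] e z[OF x] c[OF x] simp_thms)
  qed (rule replica_reg[OF assms(1)]; assumption)+
qed

text \<open>The weight has two sources: conjugation by the torus scales \<open>upper\<close> by the
  square of \<open>l\<close>, and \<open>f\<close> contributes \<open>l ^ n\<close>.\<close>

lemma replica_family:
  assumes "A.highest_weight n f" shows "unipotent_family (n + 2) (\<lambda>s. \<Phi> (replica f s))"
proof -
  have f: "f \<in> V.reg" "A.upper_invariant f" and "A.weight n 0 f" using assms unfolding A.highest_weight_def by auto
  then have wt: "l ^ n * f (xact (diag2 l) x) = f x" if "l \<noteq> 0" "x \<in> points X" for l x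
    using that unfolding A.weight_def by simp
  have inv: "f (xact (upper t) x) = f x" if "x \<in> points X" for x t
    using f(2) that unfolding A.upper_invariant_def by blast
  note aut = replica_aut[OF f]
  have cu: "xact (upper t) x \<in> points X" if "x \<in> points X" for x t by (rule xact_closed[OF det_unipotent(1) that])
  have ap: "replica f s x = xact (upper (s * f x)) x" if "x \<in> points X" for s x using that by (simp add: replica_def)
  have ru: "\<forall>x\<in>points X. replica f s (xact (upper r) x) = xact (upper r) (replica f s x)" for s r
    by (simp add: ap cu inv upper_add add.commute del: A.act_mat2)
  have rd: "\<forall>x\<in>points X. replica f (l ^ (n + 2) * s) (xact (diag2 l) x) = xact (diag2 l) (replica f s x)" if l: "l \<noteq> 0" for s l
  proof
    fix x assume x: "x \<in> points X"
    have dx: "xact (diag2 l) x \<in> points X" by (rule xact_closed[OF det_diag2[OF l] x])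
    have "l ^ (n + 2) * s * f (xact (diag2 l) x) = l\<^sup>2 * (s * (l ^ n * f (xact (diag2 l) x)))"
      by (simp add: power_add power2_eq_square mult_ac)
    also have "\<dots> = l\<^sup>2 * (s * f x)" by (simp only: wt[OF l x])
    finally show "replica f (l ^ (n + 2) * s) (xact (diag2 l) x) = xact (diag2 l) (replica f s x)"
      by (simp only: ap[OF x] ap[OF dx] A.act_diag_upper[OF x l])
  qed
  have ra: "\<forall>x\<in>points X. replica f (s + s') x = replica f s (replica f s' x)" for s s'
    by (simp add: ap cu inv upper_add distrib_right del: A.act_mat2)
  have r0: "\<forall>x\<in>points X. replica f 0 x = x"
    using xact_1 by (simp add: ap mat_1_eq_mat2)
  show ?thesis unfolding unipotent_family_def
  proof (intro conjI allI ballI impI)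
    show "\<Phi> (replica f s) q \<in> Q" if "q \<in> Q" for s q by (rule Phi_closed[OF aut that])
    show "(\<lambda>q. a (\<Phi> (replica f s) q)) \<in> RQ" if "a \<in> RQ" for s a
      using W.reg_automorphism(1)[OF Phi_aut[OF aut]] that unfolding W_reg by blast
    show "\<Phi> (replica f (s + s')) q = \<Phi> (replica f s) (\<Phi> (replica f s') q)" if "q \<in> Q" for s s' q
      using ra[of s s'] that unfolding transfer_eq[OF aut aut aut] by (rule bspec)
    show "\<Phi> (replica f 0) q = q" if "q \<in> Q" for q
      using r0 that unfolding transfer_single_id[OF aut] by (rule bspec)
    show "\<Phi> (replica f s) (qact (upper r) q) = qact (upper r) (\<Phi> (replica f s) q)" if "q \<in> Q" for s r q
      using ru[of s r] that unfolding transfer_commute[OF aut aut det_unipotent(1)] by (rule bspec)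
    show "\<Phi> (replica f (l ^ (n + 2) * s)) (qact (diag2 l) q) = qact (diag2 l) (\<Phi> (replica f s) q)" if "q \<in> Q" "l \<noteq> 0" for s l q
      using rd[OF that(2), of s] that(1) unfolding transfer_commute[OF aut aut det_diag2[OF that(2)]] by (rule bspec)
  qed
qed

text \<open>All natural multiples of \<open>u\<close> fix \<open>x\<close> too, so the polynomial
  measuring the change of a function along \<open>upper\<close> has infinitely many zeros.\<close>

lemma fixed_by_unipotent:
  assumes x: "x \<in> points X" and u: "u \<noteq> 0" "xact (upper u) x = x" shows "xact (upper t) x = x"
proof (rule V.reg_separated)
  show "xact (upper t) x \<in> points X" by (rule xact_closed[OF det_unipotent(1) x])
  fix a assume "a \<in> V.reg"
  then obtain n b where b: "A.upper_expansion a n b" by (rule A.upper_expansion_exists)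
  have mult: "xact (upper (of_nat j * u)) x = x" for j
  proof (induction j)
    case 0 show ?case using xact_1[OF x] by (simp only: mat_1_eq_mat2 of_nat_0 mult_zero_left)
  next
    case (Suc j)
    have "xact (upper (u + of_nat j * u)) x = x" by (simp only: upper_add[OF x, symmetric] Suc u(2))
    then show ?case by (simp add: distrib_right)
  qed
  define p where "p = (\<Sum>i\<le>n. monom (b i x) i) - [:a x:]"
  have p: "poly p s = a (xact (upper s) x) - a x" for s
    using b x unfolding A.upper_expansion_def by (simp add: p_def poly_sum poly_monom mult.commute)
  have "range (\<lambda>j. of_nat j * u) \<subseteq> {s. poly p s = 0}" by (auto simp: p mult)
  moreover have "infinite (range (\<lambda>j. of_nat j * u))" using u(1) by (intro range_inj_infinite injI) simp
  ultimately have "p = 0" using poly_roots_finite finite_subset by blast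
  then show "a (xact (upper t) x) = a x" using p[of t] by simp
qed (rule x)

text \<open>Coinciding replicas show that \<open>upper (k x)\<close> fixes \<open>x\<close> for
  \<open>k = c f - c' f'\<close>. Where \<open>k x\<close> is nonzero, the whole unipotent group
  fixes \<open>x\<close>; by irreducibility a nonzero \<open>k\<close> would make that group act
  trivially on \<open>X\<close>.\<close>

lemma highest_weight_unique:
  assumes f: "A.highest_weight n f" and f': "A.highest_weight n f'" and nv: "\<not> A.vanishes f"
  shows "\<exists>c. \<forall>x\<in>points X. f' x = c * f x"
proof -
  have R: "f \<in> V.reg" "f' \<in> V.reg" and i: "A.upper_invariant f" "A.upper_invariant f'"
    using f f' unfolding A.highest_weight_def by auto
  have pos: "n + 2 > 0" by simp
  obtain c c' where c: "c \<noteq> 0 \<or> c' \<noteq> 0" "\<And>q. q \<in> Q \<Longrightarrow> \<Phi> (replica f c) q = \<Phi> (replica f' c') q"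
    by (rule unipotent_families_dependent[OF replica_family[OF f] replica_family[OF f'] pos]) blast
  have "\<forall>q\<in>Q. \<Phi> (replica f c) q = \<Phi> (replica f' c') q" using c(2) by blast
  then have e: "replica f c = replica f' c'"
    using Phi_inj[OF replica_aut[OF R(1) i(1)] replica_aut[OF R(2) i(2)]]
      automorphismD(7)[OF Phi_aut[OF replica_aut[OF R(1) i(1)]]] automorphismD(7)[OF Phi_aut[OF replica_aut[OF R(2) i(2)]]]
    unfolding points_quotient by (meson extensionalityI)
  define k where "k x = c * f x - c' * f' x" for x
  have kR: "k \<in> V.reg" unfolding k_def[abs_def] by (intro A.R_intros R)
  have fixed: "xact (upper (k x)) x = x" if x: "x \<in> points X" for x
  proof -
    have "xact (upper (c * f x)) x = xact (upper (c' * f' x)) x"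
      using fun_cong[OF e, of x] x by (simp add: replica_def)
    then have "xact (upper (- (c' * f' x) + c * f x)) x = xact (upper (- (c' * f' x) + c' * f' x)) x"
      by (simp only: upper_add[OF x, symmetric])
    also have "\<dots> = x" using xact_1[OF x] by (simp only: mat_1_eq_mat2 add.left_inverse)
    finally show ?thesis by (simp add: k_def)
  qed
  have k0: "\<forall>x\<in>points X. k x = 0"
  proof (rule ccontr)
    assume nk: "\<not> ?thesis"
    have "xact (upper 1) x = x" if x: "x \<in> points X" for x
    proof (rule V.reg_separated)
      show "xact (upper 1) x \<in> points X" by (rule xact_closed[OF det_unipotent(1) x])
      fix a assume a: "a \<in> V.reg"
      have aR: "(\<lambda>x. a (xact (upper 1) x) - a x) \<in> V.reg" by (intro A.R_diff A.R_act a det_unipotent)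
      have "k y * (a (xact (upper 1) y) - a y) = 0" if y: "y \<in> points X" for y
      proof (cases "k y = 0")
        case False
        then show ?thesis by (simp only: fixed_by_unipotent[OF y False fixed[OF y]]) simp
      qed simp
      from V.irreducible_domain[OF irreducible kR aR this] nk x show "a (xact (upper 1) x) = a x" by auto
    qed (rule x)
    then show False using acts_nontrivially[OF det_unipotent(1) upper_acts_nontrivially] by blast
  qed
  have "c' \<noteq> 0"
  proof
    assume "c' = 0"
    then have "\<forall>x\<in>points X. f x = 0" using k0 c(1) by (simp add: k_def)
    then show False using nv by (simp add: A.vanishes_def)
  qed
  then have "f' x = c / c' * f x" if "x \<in> points X" for x
    using k0 that by (simp add: k_def field_simps)
  then show ?thesis by blast
qed

sublocale A: complete_sl2_variety "points X" V.reg xact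
proof
  show "A.vanishes f \<or> A.vanishes f'" if "f \<in> V.reg" "f' \<in> V.reg" "\<And>x. x \<in> points X \<Longrightarrow> f x * f' x = 0" for f f'
    using V.irreducible_domain[OF irreducible that] by (simp only: A.vanishes_def)
  show "\<exists>c. \<forall>x\<in>points X. f' x = c * f x" if "A.highest_weight n f" "A.highest_weight n f'" "\<not> A.vanishes f" for n f f'
    by (rule highest_weight_unique[OF that])
  have two: "(2::complex) \<noteq> 0" by simp
  obtain x where x: "x \<in> points X" "xact (diag2 2) x \<noteq> x"
    using acts_nontrivially[OF det_diag2[OF two] torus_acts_nontrivially] by blast
  then obtain f where "f \<in> V.reg" "f (xact (diag2 2) x) \<noteq> f x"
    using V.reg_separated[OF xact_closed[OF det_diag2[OF two] x(1)] x(1)] by blast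
  then show "\<exists>f\<in>V.reg. \<exists>l x. l \<noteq> 0 \<and> x \<in> points X \<and> f (xact (diag2 l) x) \<noteq> f x" using two x(1) by blast
next
  fix ev
  assume ev: "\<And>c. ev (\<lambda>x. c) = c"
    "\<And>f f'. f \<in> V.reg \<Longrightarrow> f' \<in> V.reg \<Longrightarrow> ev (\<lambda>x. f x + f' x) = ev f + ev f'"
    "\<And>f f'. f \<in> V.reg \<Longrightarrow> f' \<in> V.reg \<Longrightarrow> ev (\<lambda>x. f x * f' x) = ev f * ev f'"
    "\<And>f f'. f \<in> V.reg \<Longrightarrow> (\<And>x. x \<in> points X \<Longrightarrow> f' x = f x) \<Longrightarrow> ev f' = ev f"
  show "\<exists>x\<in>points X. \<forall>f\<in>V.reg. ev f = f x" by (rule V.reg_hom_is_evaluation) (fact ev)+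
qed

section \<open>Recognizing the homogeneous space\<close>

lemma commuting_automorphism:
  assumes \<alpha>: "\<alpha> \<in> automorphisms X" and c: "\<And>g x. det g = 1 \<Longrightarrow> x \<in> points X \<Longrightarrow> \<alpha> (xact g x) = xact g (\<alpha> x)"
  shows "\<forall>x\<in>points X. \<alpha> (\<alpha> x) = x" "m = 2 \<Longrightarrow> \<forall>x\<in>points X. \<alpha> x = x"
proof -
  have cq: "\<Phi> \<alpha> (qact g q) = qact g (\<Phi> \<alpha> q)" if g: "det g = 1" and q: "q \<in> Q" for g q
  proof -
    have "\<forall>x\<in>points X. \<alpha> (xact g x) = xact g (\<alpha> x)" using c[OF g] by blast
    then show ?thesis using q unfolding transfer_commute[OF \<alpha> \<alpha> g] by blast
  qed
  note C = centralizer[where \<phi> = "\<Phi> \<alpha>"]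
  have "\<Phi> \<alpha> (\<Phi> \<alpha> q) = q" and "m = 2 \<Longrightarrow> \<Phi> \<alpha> q = q" if q: "q \<in> Q" for q
    using C(1)[OF Phi_closed[OF \<alpha>] cq q] C(2)[OF Phi_closed[OF \<alpha>] cq q] by simp_all
  then show "\<forall>x\<in>points X. \<alpha> (\<alpha> x) = x" "m = 2 \<Longrightarrow> \<forall>x\<in>points X. \<alpha> x = x"
    unfolding transfer_id[OF \<alpha> \<alpha>] transfer_single_id[OF \<alpha>] by simp_all
qed

lemma tensor_mpoly: "h \<in> tensor_functions R \<Longrightarrow> (\<lambda>g. h g p) \<in> mpoly"
  by (induction rule: tensor_functions.induct) (auto intro: mpoly.intros)

text \<open>Sending \<open>coset g\<close> to \<open>xact g p\<close> is an isomorphism because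
  \<open>lift\<close> supplies enough functions both to separate cosets and to make the inverse
  regular. The other two claims transport automorphisms commuting with the group: only the identity
  for the normalizer, an involution besides it for the torus.\<close>

lemma orbit_model:
  assumes K: "sl2_quotient H' m'" and p: "p \<in> points X"
    and trans: "\<And>x. x \<in> points X \<Longrightarrow> \<exists>g. det g = 1 \<and> xact g p = x"
    and stab: "\<And>h. h \<in> H' \<Longrightarrow> xact h p = p"
    and lift: "\<And>F. F \<in> mpoly \<Longrightarrow> (\<And>g h. det g = 1 \<Longrightarrow> h \<in> H' \<Longrightarrow> F (g ** h) = F g) \<Longrightarrow>
      \<exists>a\<in>V.reg. \<forall>g. det g = 1 \<longrightarrow> a (xact g p) = F g"
  shows "variety_isomorphic X (SL2_quotient H')"
    and "m' = 2 \<Longrightarrow> \<alpha> \<in> automorphisms X \<Longrightarrow>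
      (\<And>g x. det g = 1 \<Longrightarrow> x \<in> points X \<Longrightarrow> \<alpha> (xact g x) = xact g (\<alpha> x)) \<Longrightarrow> x \<in> points X \<Longrightarrow> \<alpha> x = x"
    and "m' = 1 \<Longrightarrow> \<exists>\<alpha>\<in>automorphisms X.
      (\<forall>g x. det g = 1 \<longrightarrow> x \<in> points X \<longrightarrow> \<alpha> (xact g x) = xact g (\<alpha> x)) \<and> (\<exists>x\<in>points X. \<alpha> x \<noteq> x)"
proof -
  interpret K: sl2_quotient H' m' by (rule K)
  have Hdet: "det h = 1" if "h \<in> H'" for h using subgroup.subset[OF K.subgroup_H] that by auto
  have liftR: "\<exists>a\<in>V.reg. \<forall>g. det g = 1 \<longrightarrow> a (xact g p) = f (K.coset g)" if f: "f \<in> K.RQ" for f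
  proof -
    obtain F where F: "F \<in> mpoly" "\<And>g. det g = 1 \<Longrightarrow> f (K.coset g) = F g" using f unfolding K.RQ_def by blast
    have "F (g ** h) = F g" if g: "det g = 1" and h: "h \<in> H'" for g h
    proof -
      have "det (g ** h) = 1" using g Hdet[OF h] by (simp add: det_mul)
      then show ?thesis by (simp only: F(2)[symmetric] g K.coset_absorb[OF g h])
    qed
    from lift[OF F(1) this] show ?thesis using F(2) by simp
  qed
  have coset: "K.coset g = K.coset g'" if g: "det g = 1" "det g' = 1" and e: "xact g p = xact g' p" for g g'
  proof (rule K.separated)
    fix f assume "f \<in> K.RQ"
    then obtain a where "\<forall>g. det g = 1 \<longrightarrow> a (xact g p) = f (K.coset g)" using liftR by blast
    then show "f (K.coset g) = f (K.coset g')" using g e by metis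
  qed (use g in simp_all)
  have orbit: "xact g p = xact g' p" if g: "det g = 1" "det g' = 1" and e: "K.coset g = K.coset g'" for g g'
  proof -
    have h: "adj2 g ** g' \<in> H'" by (rule K.coset_eqD[OF g e])
    have "g ** (adj2 g ** g') = g'" by (simp add: matrix_mul_assoc adj2_mult[OF g(1)])
    then have "xact g' p = xact g (xact (adj2 g ** g') p)" by (simp only: xact_xact[OF g(1) Hdet[OF h] p])
    then show ?thesis by (simp only: stab[OF h])
  qed
  define \<eta> where "\<eta> C = xact (SOME g. det g = 1 \<and> C = K.coset g) p" for C
  define \<theta> where "\<theta> x = K.coset (SOME g. det g = 1 \<and> xact g p = x)" for x
  have \<eta>: "\<eta> (K.coset g) = xact g p" if g: "det g = 1" for g
  proof -
    have "det (SOME g'. det g' = 1 \<and> K.coset g = K.coset g') = 1 \<and> K.coset g = K.coset (SOME g'. det g' = 1 \<and> K.coset g = K.coset g')"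
      by (rule someI[of _ g]) (simp add: g)
    then show ?thesis unfolding \<eta>_def using orbit[OF _ g] by metis
  qed
  have \<theta>: "\<theta> (xact g p) = K.coset g" if g: "det g = 1" for g
  proof -
    have "det (SOME g'. det g' = 1 \<and> xact g' p = xact g p) = 1 \<and> xact (SOME g'. det g' = 1 \<and> xact g' p = xact g p) p = xact g p"
      by (rule someI[of _ g]) (simp add: g)
    then show ?thesis unfolding \<theta>_def using coset[OF _ g] by blast
  qed
  have \<theta>\<eta>: "\<theta> x \<in> K.Q \<and> \<eta> (\<theta> x) = x" if x: "x \<in> points X" for x
  proof -
    obtain g where g: "det g = 1" "xact g p = x" using trans[OF x] by blast
    then have "\<theta> x = K.coset g" using \<theta> by blast
    then show ?thesis using g \<eta> by simp
  qed
  have \<eta>\<theta>: "\<eta> C \<in> points X \<and> \<theta> (\<eta> C) = C" if C: "C \<in> K.Q" for C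
  proof -
    obtain g where g: "det g = 1" "C = K.coset g" using C unfolding K.Q_iff by blast
    show ?thesis unfolding g(2) \<eta>[OF g(1)] \<theta>[OF g(1)] using xact_closed[OF g(1) p] by simp
  qed
  have \<eta>act: "\<eta> (K.qact g C) = xact g (\<eta> C)" if g: "det g = 1" and C: "C \<in> K.Q" for g C
  proof -
    obtain g' where g': "det g' = 1" "C = K.coset g'" using C unfolding K.Q_iff by blast
    have "det (g ** g') = 1" using g g'(1) by (simp add: det_mul)
    then show ?thesis by (simp only: g'(2) K.qact_coset \<eta> g'(1) xact_xact[OF g g'(1) p])
  qed
  have \<theta>act: "\<theta> (xact g x) = K.qact g (\<theta> x)" if g: "det g = 1" and x: "x \<in> points X" for g x
  proof -
    have q: "K.qact g (\<theta> x) \<in> K.Q" using K.act_closed[OF g] \<theta>\<eta>[OF x] by blast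
    have "xact g x = \<eta> (K.qact g (\<theta> x))" using \<eta>act[OF g, of "\<theta> x"] \<theta>\<eta>[OF x] by simp
    then show ?thesis using \<eta>\<theta>[OF q] by simp
  qed
  have \<eta>reg: "(\<lambda>C. a (\<eta> C)) \<in> K.RQ" if a: "a \<in> V.reg" for a
  proof -
    obtain h where h: "h \<in> tensor_functions V.reg" "\<And>g x. det g = 1 \<Longrightarrow> x \<in> points X \<Longrightarrow> a (xact g x) = h g x"
      using A.rational[OF a] by blast
    have "\<forall>g. det g = 1 \<longrightarrow> a (\<eta> (K.coset g)) = h g p" using \<eta> h(2) p by simp
    then show ?thesis unfolding K.RQ_def using tensor_mpoly[OF h(1), of p] by (intro CollectI bexI[of _ "\<lambda>g. h g p"])
  qed
  have \<theta>reg: "(\<lambda>x. f (\<theta> x)) \<in> V.reg" if f: "f \<in> K.RQ" for f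
  proof -
    obtain a where a: "a \<in> V.reg" "\<And>g. det g = 1 \<Longrightarrow> a (xact g p) = f (K.coset g)" using liftR[OF f] by blast
    show ?thesis
    proof (rule V.reg_cong[OF a(1)])
      fix x assume "x \<in> points X"
      then obtain g where g: "det g = 1" "x = xact g p" using trans by blast
      show "f (\<theta> x) = a x" unfolding g(2) by (simp only: \<theta> a(2) g(1))
    qed
  qed
  have "variety_iso \<theta> X (SL2_quotient H')"
  proof (rule variety_isoI[where \<rho> = \<eta>]; (unfold K.points_quotient)?)
    fix f assume "f \<in> regular (SL2_quotient H')"
    moreover from this have "restrict f K.Q = f"
      unfolding K.points_quotient[symmetric] by (simp add: SL2_quotient_def extensional_restrict)
    ultimately have "f \<in> K.RQ" by (simp only: K.RQ_iff K.points_quotient)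
    then show "restrict (\<lambda>x. f (\<theta> x)) (points X) \<in> regular X" using \<theta>reg by (simp only: V.reg_def mem_Collect_eq)
  next
    fix f assume "f \<in> regular X"
    then have "(\<lambda>C. f (\<eta> C)) \<in> K.RQ" by (intro \<eta>reg V.regular_reg)
    then show "restrict (\<lambda>C. f (\<eta> C)) K.Q \<in> regular (SL2_quotient H')" by (simp only: K.RQ_iff K.points_quotient)
  qed (fact \<theta>\<eta> \<eta>\<theta>)+
  then show "variety_isomorphic X (SL2_quotient H')" unfolding variety_isomorphic_def by blast
  {
    assume m': "m' = 2" and \<alpha>: "\<alpha> \<in> automorphisms X" and x: "x \<in> points X"
      and c: "\<And>g x. det g = 1 \<Longrightarrow> x \<in> points X \<Longrightarrow> \<alpha> (xact g x) = xact g (\<alpha> x)"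
    have "\<theta> (\<alpha> (\<eta> C)) = C" if C: "C \<in> K.Q" for C
    proof (rule K.centralizer(2)[where \<phi> = "\<lambda>C. \<theta> (\<alpha> (\<eta> C))"])
      fix q and g :: "complex^2^2" assume q: "q \<in> K.Q"
      have aq: "\<alpha> (\<eta> q) \<in> points X" using \<eta>\<theta>[OF q] automorphismD(1)[OF \<alpha>] by blast
      then show "\<theta> (\<alpha> (\<eta> q)) \<in> K.Q" using \<theta>\<eta> by blast
      assume g: "det g = 1"
      have "\<alpha> (\<eta> (K.qact g q)) = xact g (\<alpha> (\<eta> q))" unfolding \<eta>act[OF g q] using c[OF g] \<eta>\<theta>[OF q] by blast
      then show "\<theta> (\<alpha> (\<eta> (K.qact g q))) = K.qact g (\<theta> (\<alpha> (\<eta> q)))" by (simp only: \<theta>act[OF g aq])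
    qed (rule C m')+
    from this[of "\<theta> x"] have "\<theta> (\<alpha> x) = \<theta> x" using \<theta>\<eta>[OF x] by simp
    then show "\<alpha> x = x" using \<theta>\<eta>[OF x] \<theta>\<eta>[OF automorphismD(1)[OF \<alpha> x]] by metis
  }
  assume m': "m' = 1"
  show "\<exists>\<alpha>\<in>automorphisms X. (\<forall>g x. det g = 1 \<longrightarrow> x \<in> points X \<longrightarrow> \<alpha> (xact g x) = xact g (\<alpha> x)) \<and> (\<exists>x\<in>points X. \<alpha> x \<noteq> x)"
  proof (rule K.involution[OF m'])
    fix \<tau>
    assume \<tau>: "\<And>q. q \<in> K.Q \<Longrightarrow> \<tau> q \<in> K.Q" "\<And>q. q \<in> K.Q \<Longrightarrow> \<tau> (\<tau> q) = q" "\<And>f. f \<in> K.RQ \<Longrightarrow> (\<lambda>q. f (\<tau> q)) \<in> K.RQ"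
      "\<And>g q. det g = 1 \<Longrightarrow> q \<in> K.Q \<Longrightarrow> \<tau> (K.qact g q) = K.qact g (\<tau> q)" and nt: "\<exists>q\<in>K.Q. \<tau> q \<noteq> q"
    define \<alpha> where "\<alpha> x = \<eta> (\<tau> (\<theta> x))" for x
    have t: "\<tau> (\<theta> x) \<in> K.Q" if "x \<in> points X" for x using \<tau>(1) \<theta>\<eta>[OF that] by blast
    have c: "\<alpha> x \<in> points X" if "x \<in> points X" for x unfolding \<alpha>_def using \<eta>\<theta>[OF t[OF that]] by blast
    have i: "\<alpha> (\<alpha> x) = x" if x: "x \<in> points X" for x
      unfolding \<alpha>_def using \<eta>\<theta>[OF t[OF x]] \<tau>(2) \<theta>\<eta>[OF x] by simp
    have r: "(\<lambda>x. a (\<alpha> x)) \<in> V.reg" if "a \<in> V.reg" for a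
      unfolding \<alpha>_def by (rule \<theta>reg[OF \<tau>(3)[OF \<eta>reg[OF that]]])
    have "restrict \<alpha> (points X) \<in> automorphisms X"
      by (rule V.automorphism_regI[where \<rho> = \<alpha>]) (use c i r in auto)
    moreover have "\<alpha> (xact g x) = xact g (\<alpha> x)" if g: "det g = 1" and x: "x \<in> points X" for g x
    proof -
      have "\<theta> x \<in> K.Q" using \<theta>\<eta>[OF x] by blast
      then show ?thesis unfolding \<alpha>_def by (simp only: \<theta>act[OF g x] \<tau>(4)[OF g] \<eta>act[OF g t[OF x]])
    qed
    moreover have "\<exists>x\<in>points X. \<alpha> x \<noteq> x"
    proof -
      obtain q where q: "q \<in> K.Q" "\<tau> q \<noteq> q" using nt by blast
      have "\<alpha> (\<eta> q) \<noteq> \<eta> q"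
      proof
        assume "\<alpha> (\<eta> q) = \<eta> q"
        then have "\<theta> (\<eta> (\<tau> q)) = \<theta> (\<eta> q)" using \<eta>\<theta>[OF q(1)] by (simp add: \<alpha>_def)
        then show False using \<eta>\<theta>[OF q(1)] \<eta>\<theta>[OF \<tau>(1)[OF q(1)]] q(2) by simp
      qed
      then show ?thesis using \<eta>\<theta>[OF q(1)] by blast
    qed
    ultimately show ?thesis using xact_closed by (intro bexI[of _ "restrict \<alpha> (points X)"]) auto
  qed
qed

lemma isomorphic: "variety_isomorphic X (SL2_quotient H)"
proof (rule A.point_with_large_stabilizer)
  fix p
  assume p: "p \<in> points X"
    and inj: "\<And>a. a \<in> V.reg \<Longrightarrow> (\<And>g. det g = 1 \<Longrightarrow> a (xact g p) = 0) \<Longrightarrow> A.vanishes a"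
    and "(\<forall>r. xact (lower r) p = p) \<or> (\<forall>l. l \<noteq> 0 \<longrightarrow> xact (diag2 l) p = p)"
  then consider (U) "\<And>r. xact (lower r) p = p" | (T) "\<And>l. l \<noteq> 0 \<Longrightarrow> xact (diag2 l) p = p" by blast
  then show ?thesis
  proof cases
    case U
    show ?thesis
    proof (rule A.scaling_automorphism[where p = p])
      fix \<sigma> \<rho>
      assume \<sigma>: "\<And>x. x \<in> points X \<Longrightarrow> \<sigma> x \<in> points X \<and> \<rho> x \<in> points X \<and> \<sigma> (\<rho> x) = x \<and> \<rho> (\<sigma> x) = x"
        "\<And>a. a \<in> V.reg \<Longrightarrow> (\<lambda>x. a (\<sigma> x)) \<in> V.reg \<and> (\<lambda>x. a (\<rho> x)) \<in> V.reg"
        "\<And>g x. det g = 1 \<Longrightarrow> x \<in> points X \<Longrightarrow> \<sigma> (xact g x) = xact g (\<sigma> x)" and ne: "\<sigma> (\<sigma> p) \<noteq> p"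
      have "restrict \<sigma> (points X) \<in> automorphisms X"
        by (rule V.automorphism_regI[where \<rho> = \<rho>]) (use \<sigma>(1,2) in auto)
      then have "\<forall>x\<in>points X. restrict \<sigma> (points X) (restrict \<sigma> (points X) x) = x"
        by (rule commuting_automorphism(1)) (use \<sigma>(1,3) xact_closed in auto)
      then show ?thesis using p \<sigma>(1)[OF p] ne by auto
    qed (fact p inj U)+
  next
    case T
    have dich: "(\<forall>x\<in>points X. \<exists>g. det g = 1 \<and> xact g p = x) \<and>
      ((\<forall>F\<in>mpoly. (\<forall>g l. det g = 1 \<longrightarrow> l \<noteq> 0 \<longrightarrow> F (g ** diag2 l) = F g) \<longrightarrow> (\<exists>a\<in>V.reg. \<forall>g. det g = 1 \<longrightarrow> a (xact g p) = F g)) \<or>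
       xact weyl p = p \<and> (\<forall>F\<in>mpoly. (\<forall>g l. det g = 1 \<longrightarrow> l \<noteq> 0 \<longrightarrow> F (g ** diag2 l) = F g \<and> F (g ** weyl) = F g) \<longrightarrow>
         (\<exists>a\<in>V.reg. \<forall>g. det g = 1 \<longrightarrow> a (xact g p) = F g)))"
      by (rule A.torus_orbit_dichotomy[where p = p]) (fact p inj T)+
    have tr: "\<exists>g. det g = 1 \<and> xact g p = x" if "x \<in> points X" for x using dich that by blast
    from conjunct2[OF dich] show ?thesis
    proof
      assume lift0: "\<forall>F\<in>mpoly. (\<forall>g l. det g = 1 \<longrightarrow> l \<noteq> 0 \<longrightarrow> F (g ** diag2 l) = F g) \<longrightarrow> (\<exists>a\<in>V.reg. \<forall>g. det g = 1 \<longrightarrow> a (xact g p) = F g)"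
      have K: "sl2_quotient torus 1" by (simp add: sl2_quotient_def)
      have st: "xact h p = p" if "h \<in> torus" for h using that T by (auto simp: torus_eq)
      have lift: "\<exists>a\<in>V.reg. \<forall>g. det g = 1 \<longrightarrow> a (xact g p) = F g"
        if F: "F \<in> mpoly" and i: "\<And>g h. det g = 1 \<Longrightarrow> h \<in> torus \<Longrightarrow> F (g ** h) = F g" for F
      proof -
        have "\<forall>g l. det g = 1 \<longrightarrow> l \<noteq> 0 \<longrightarrow> F (g ** diag2 l) = F g"
          by (intro allI impI i) (auto simp: torus_eq)
        then show ?thesis using lift0 F by blast
      qed
      show ?thesis
      proof (cases "m = 1")
        case True
        have "H = torus" using True H by (elim disjE conjE) simp_all
        show ?thesis unfolding \<open>H = torus\<close>
          by (rule orbit_model(1)[where H' = torus and m' = 1 and p = p]) (fact K p tr st lift)+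
      next
        case False
        then have "m = 2" using H by auto
        have "\<exists>\<alpha>\<in>automorphisms X. (\<forall>g x. det g = 1 \<longrightarrow> x \<in> points X \<longrightarrow> \<alpha> (xact g x) = xact g (\<alpha> x)) \<and>
            (\<exists>x\<in>points X. \<alpha> x \<noteq> x)"
          by (rule orbit_model(3)[where H' = torus and m' = 1 and p = p]) (fact K p tr st lift refl)+
        then obtain \<alpha> where \<alpha>: "\<alpha> \<in> automorphisms X"
          "\<And>g x. det g = 1 \<Longrightarrow> x \<in> points X \<Longrightarrow> \<alpha> (xact g x) = xact g (\<alpha> x)" "\<exists>x\<in>points X. \<alpha> x \<noteq> x" by blast
        from commuting_automorphism(2)[OF \<alpha>(1,2) \<open>m = 2\<close>] \<alpha>(3) show ?thesis by blast
      qed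
    next
      let ?N = "normalizer SL2 torus"
      assume w: "xact weyl p = p \<and> (\<forall>F\<in>mpoly. (\<forall>g l. det g = 1 \<longrightarrow> l \<noteq> 0 \<longrightarrow> F (g ** diag2 l) = F g \<and> F (g ** weyl) = F g) \<longrightarrow>
         (\<exists>a\<in>V.reg. \<forall>g. det g = 1 \<longrightarrow> a (xact g p) = F g))"
      have K: "sl2_quotient ?N 2" by (simp add: sl2_quotient_def)
      interpret K: sl2_quotient ?N 2 by (rule K)
      have st: "xact h p = p" if h: "h \<in> ?N" for h
      proof (rule K.H_cases[OF h])
        fix l :: complex assume l: "l \<noteq> 0"
        show "xact h p = p" if "h = diag2 l" using T[OF l] that by simp
        have dw: "det weyl = 1" by simp
        show "xact h p = p" if hl: "h = diag2 l ** weyl"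
          unfolding hl by (simp only: xact_xact[OF det_diag2[OF l] dw p, symmetric] conjunct1[OF w] T[OF l])
      qed
      have lift: "\<exists>a\<in>V.reg. \<forall>g. det g = 1 \<longrightarrow> a (xact g p) = F g"
        if F: "F \<in> mpoly" and i: "\<And>g h. det g = 1 \<Longrightarrow> h \<in> ?N \<Longrightarrow> F (g ** h) = F g" for F
      proof -
        have "weyl \<in> ?N" by (simp add: normalizer_torus_iff)
        then have "\<forall>g l. det g = 1 \<longrightarrow> l \<noteq> 0 \<longrightarrow> F (g ** diag2 l) = F g \<and> F (g ** weyl) = F g"
          by (intro allI impI conjI i K.diag_in_H)
        then show ?thesis using w F by blast
      qed
      show ?thesis
      proof (cases "m = 1")
        case False
        have "H = ?N" using False H by (elim disjE conjE) simp_all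
        show ?thesis unfolding \<open>H = ?N\<close>
          by (rule orbit_model(1)[where H' = ?N and m' = 2 and p = p]) (fact K p tr st lift)+
      next
        \<comment> \<open>The comparison runs through \<open>\<Phi>\<close>: the involution of the
          quotient by the torus comes from an automorphism of \<open>X\<close>, where commuting with
          the group leaves only the identity.\<close>
        case True
        show ?thesis
        proof (rule involution[OF True])
          fix \<tau>
          assume \<tau>: "\<And>q. q \<in> Q \<Longrightarrow> \<tau> q \<in> Q" "\<And>q. q \<in> Q \<Longrightarrow> \<tau> (\<tau> q) = q" "\<And>f. f \<in> RQ \<Longrightarrow> (\<lambda>q. f (\<tau> q)) \<in> RQ"
            "\<And>g q. det g = 1 \<Longrightarrow> q \<in> Q \<Longrightarrow> \<tau> (qact g q) = qact g (\<tau> q)" and nt: "\<exists>q\<in>Q. \<tau> q \<noteq> q"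
          have "restrict \<tau> (points (SL2_quotient H)) \<in> automorphisms (SL2_quotient H)"
            by (rule W.automorphism_regI[where \<rho> = \<tau>]; unfold W_reg points_quotient) (use \<tau>(1,2,3) in auto)
          then obtain \<alpha> where \<alpha>: "\<alpha> \<in> automorphisms X" "\<Phi> \<alpha> = restrict \<tau> Q"
            using Phi_surj unfolding points_quotient by blast
          have comm: "\<alpha> (xact g x) = xact g (\<alpha> x)" if g: "det g = 1" and x: "x \<in> points X" for g x
          proof -
            have "\<forall>q\<in>Q. \<Phi> \<alpha> (qact g q) = qact g (\<Phi> \<alpha> q)"
              unfolding \<alpha>(2) using \<tau>(4)[OF g] act_closed[OF g] by simp
            then show ?thesis using x unfolding transfer_commute[OF \<alpha>(1) \<alpha>(1) g, symmetric] by blast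
          qed
          have "\<alpha> x = x" if "x \<in> points X" for x
            by (rule orbit_model(2)[where H' = ?N and m' = 2 and p = p and \<alpha> = \<alpha>])
              (fact K p tr st lift refl \<alpha>(1) comm that)+
          then have "\<forall>x\<in>points X. \<alpha> x = x" by blast
          then have "\<forall>q\<in>Q. \<tau> q = q" unfolding transfer_single_id[OF \<alpha>(1)] \<alpha>(2) by simp
          then show ?thesis using nt by blast
        qed
      qed
    qed
  qed
qed

end

lemma variety_isomorphic_quotient:
  assumes "sl2_quotient H m" "affine_variety X" "irreducible_variety X"
    and "generating_set X S" "generating_set (SL2_quotient H) S'"
    and "ind_group_isomorphic (aut_ind_group X S) (aut_ind_group (SL2_quotient H) S')"
  shows "variety_isomorphic X (SL2_quotient H)"
proof -
  obtain \<Phi> where "\<Phi> \<in> iso (aut_ind_group X S) (aut_ind_group (SL2_quotient H) S')"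
    "ind_iso \<Phi> (level (aut_ind_group X S)) (level (aut_ind_group (SL2_quotient H) S'))"
    using assms(6) unfolding ind_group_isomorphic_def by blast
  then have "automorphism_transfer H m X S S' \<Phi>"
    by (intro automorphism_transfer.intro affine_generated_variety.intro generated_variety.intro
        affine_generated_variety_axioms.intro automorphism_transfer_axioms.intro assms)
  then show ?thesis by (rule automorphism_transfer.isomorphic)
qed

theorem theorem3:
  fixes X :: "'a variety"
  assumes "affine_variety X" and "irreducible_variety X"
  shows "(\<forall>S S'. generating_set X S \<longrightarrow> generating_set SL2_mod_T S' \<longrightarrow>
            ind_group_isomorphic (aut_ind_group X S) (aut_ind_group SL2_mod_T S') \<longrightarrow>
            variety_isomorphic X SL2_mod_T) \<and>
         (\<forall>S S'. generating_set X S \<longrightarrow> generating_set SL2_mod_N S' \<longrightarrow>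
            ind_group_isomorphic (aut_ind_group X S) (aut_ind_group SL2_mod_N S') \<longrightarrow>
            variety_isomorphic X SL2_mod_N)"
proof -
  have "sl2_quotient torus 1" "sl2_quotient (normalizer SL2 torus) 2" by (simp_all add: sl2_quotient_def)
  then show ?thesis using variety_isomorphic_quotient[OF _ assms] by blast
qed

end
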